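(* The following square of 2-categories and 2-functors commutes serially. Its horizontal sides are the pairs of mutually inverse 2-functors $$F:\mathbf{UArr}(Cat)\rightleftarrows\mathbf{Adj}_{R}(Cat):G,\qquad H:\mathbf{EMnd}(Cat)\rightleftarrows\mathbf{Mnd}_{E}(Cat):K,$$ and its vertical sides are the pairs $$\Phi:\mathbf{UArr}(Cat)\rightleftarrows\mathbf{EMnd}(Cat):\Psi,\qquad \Phi_{E}:\mathbf{Adj}_{R}(Cat)\rightleftarrows\mathbf{Mnd}_{E}(Cat):\Psi_{E},$$ with $\Phi\dashv\Psi$ and $\Phi_{E}\dashv\Psi_{E}$ (these are 2-adjunctions once the 1-cells of $\mathbf{UArr}(Cat)$ and $\mathbf{Adj}_R(Cat)$ are required to have $\rho$ an identity, i.e. the squares of right adjoints commute). That is, the following equalities of 2-functors hold: $$H\Phi=\Phi_{E}F,\qquad \Phi G=K\Phi_{E},\qquad F\Psi=\Psi_{E}H,\qquad \Psi K=G\Psi_{E}.$$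
   Context: **$\mathbf{UArr}(Cat)$.** $Cat$ is the 2-category of categories. A 0-cell, a universal arrow $(\mathcal{C},R,\eta^{RL},\zeta^{R}(\sim))$, consists of a functor $R:\mathcal{X}\to\mathcal{C}$, a function $L:\mathrm{Obj}(\mathcal{C})\to\mathrm{Obj}(\mathcal{X})$, and morphisms $\eta^{RL}A:A\to RLA$ such that for each $v:A\to RX$ there is a unique $w=:\zeta^{RX}(v):LA\to X$ with $Rw\cdot\eta^{RL}A=v$. A 1-cell $(J,V,\rho^{JV}):(\mathcal{C},R)\to(\mathcal{D},R^{\dagger})$, where $R:\mathcal{X}\to\mathcal{C}$ and $R^{\dagger}:\mathcal{Y}\to\mathcal{D}$, consists of functors $J:\mathcal{C}\to\mathcal{D}$, $V:\mathcal{X}\to\mathcal{Y}$ and a natural isomorphism $\rho^{JV}:JR\to R^{\dagger}V$ with inverse $\varrho^{JV}$. A 2-cell $(\alpha,\beta):(J,V,\rho^{JV})\to(K,W,\rho^{KW})$ consists of natural transformations $\alpha:J\to K$, $\beta:V\to W$ with $R^{\dagger}\beta\circ\rho^{JV}=\rho^{KW}\circ\alpha R$. Composition of 1-cells: $(F',G',\rho^{F'G'})(J,V,\rho^{JV})=(F'J,G'V,\rho^{F'G'}V\circ F'\rho^{JV})$; 2-cells compose componentwise as in $Cat$. **$\mathbf{Adj}_{R}(Cat)$.** 0-cells: adjunctions $(L\dashv R,\eta^{RL},\varepsilon^{LR})$ with $L:\mathcal{C}\to\mathcal{X}$. 1-cells $(J,V,\rho^{JV},\lambda^{JV})$: functors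 $J,V$ and a natural isomorphism $\rho^{JV}:JR\to R^{\dagger}V$ as before, with $\lambda^{JV}:L^{\dagger}J\to VL$ its adjoint dual (mate), i.e. $R^{\dagger}\lambda^{JV}\circ\eta^{RL\dagger}J=\rho^{JV}L\circ J\eta^{RL}$. 2-cells: pairs $(\alpha,\beta)$ with $R^{\dagger}\beta\circ\rho^{JV}=\rho^{KW}\circ\alpha R$ and $\lambda^{KW}\circ L^{\dagger}\alpha=\beta L\circ\lambda^{JV}$. Composition as in $\mathbf{UArr}(Cat)$, with mates composed by pasting. **$\mathbf{EMnd}(Cat)$.** An extensive monad $(\mathcal{C},S,\eta^{S},(\sim)^{S})$ is a function $S$ on objects of $\mathcal{C}$, morphisms $\eta^{S}A:A\to SA$ and functions $(\sim)^{SB}:\mathrm{Hom}_{\mathcal{C}}(A,SB)\to\mathrm{Hom}_{\mathcal{C}}(SA,SB)$ with $(\eta^{S}A)^{SA}=1_{SA}$, $h^{SB}\cdot\eta^{S}A=h$, $(k^{SC}\cdot h)^{SC}=k^{SC}\cdot h^{SB}$ for $h:A\to SB$, $k:B\to SC$. An $S$-algebra $(N,(\sim)^{N})$ is an object $N$ with functions $(\sim)^{N}:\mathrm{Hom}_{\mathcal{C}}(A,N)\to\mathrm{Hom}_{\mathcal{C}}(SA,N)$ with $a^{N}\cdot\eta^{S}A=a$, $(b^{N}\cdot h)^{N}=b^{N}\cdot h^{SB}$ for $a:A\to N$, $b:B\to N$, $h:A\to SB$; a morphism $q:(M,(\sim)^M)\to(N,(\sim)^N)$ satisfies $(q\cdot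 a)^{N}=q\cdot a^{M}$ for all $a:A\to M$. They form the category $\mathcal{C}^{S}$, with forgetful functor $U^{S}:\mathcal{C}^{S}\to\mathcal{C}$ and function on objects $F^{S}A=(SA,(\sim)^{SA})$. 1-cells $(P,(\sim)^{PS}):(\mathcal{C},S)\to(\mathcal{D},T)$: a functor $P:\mathcal{C}\to\mathcal{D}$ with functions $(\sim)^{PSA}:\mathrm{Hom}_{\mathcal{D}}(D,PSA)\to\mathrm{Hom}_{\mathcal{D}}(TD,PSA)$ such that $(PSA,(\sim)^{PSA})$ is a $T$-algebra and $P(h^{SB})$ is a $T$-algebra morphism $PSA\to PSB$ for each $h:A\to SB$. 2-cells: natural transformations $\theta:P\to Q$ with each $\theta SA$ a $T$-algebra morphism. Composition: $WP$ with $w^{WPSA}:=W((1_{PSA})^{PSA})\cdot[W\eta^{T}PSA\cdot w]^{WTPSA}$; identity $(1_{\mathcal{C}},(\sim)^{S})$. **$\mathbf{Mnd}_{E}(Cat)$.** 0-cells: classical monads $(\mathcal{C},S,\eta^{S},\mu^{S})$. 1-cells $(P,\varphi^{P}):(\mathcal{C},S)\to(\mathcal{D},T)$: a functor $P$ and a natural transformation $\varphi^{P}:TP\to PS$ with $\varphi^{P}\circ\eta^{T}P=P\eta^{S}$, $\varphi^{P}\circ\mu^{T}P=P\mu^{S}\circ\varphi^{P}S\circ T\varphi^{P}$. 2-cells $\theta:(P,\varphi^{P})\to(Q,\psi^{Q})$: natural transformations with $\psi^{Q}\circ T\theta=\theta S\circ\varphi^{P}$. The composite of $(P,\varphi^P)$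 followed by $(W,\psi^W)$ is $(WP,W\varphi^{P}\circ\psi^{W}P)$. **$\Phi$:** $(\mathcal{C},R,\eta^{RL},\zeta^{R})\mapsto(\mathcal{C},RL,\eta^{RL},(\sim)^{RL})$, $h^{RLB}=R\zeta^{RLB}(h)$ where $\zeta^{RLB}(h):LA\to LB$ for $h:A\to RLB$; $(J,V,\rho^{JV})\mapsto(J,(\sim)^{JRL})$ with $p^{JRLA}=\varrho^{JV}LA\cdot R^{\dagger}\zeta^{R\dagger VLA}(\rho^{JV}LA\cdot p)$ for $p:D\to JRLA$; $(\alpha,\beta)\mapsto\alpha$. **$\Psi$:** $(\mathcal{C},S,\eta^S,(\sim)^S)\mapsto(\mathcal{C},U^{S},\eta^{S},\zeta^{US})$, with object function $F^S$ and $\zeta^{USN}(v)=v^{N}$; $(P,(\sim)^{PS})\mapsto(P,\widehat{P},1)$ with $\widehat{P}(N,(\sim)^{N})=(PN,(\sim)^{PN})$, $q^{PN}=P((1_{N})^{N})\cdot(P\eta^{S}N\cdot q)^{PSN}$ for $q:D\to PN$, $\widehat{P}m=Pm$; $\theta\mapsto(\theta,\widehat{\theta})$, $\widehat{\theta}(N,(\sim)^{N})=\theta N$. **$F$:** $(\mathcal{C},R,\eta^{RL},\zeta^{R})\mapsto(L\dashv R,\eta^{RL},\varepsilon^{LR})$ with $Lf=\zeta^{RLB}(\eta^{RL}B\cdot f)$ for $f:A\to B$, $\varepsilon^{LR}X=\zeta^{RX}(1_{RX})$; $(J,V,\rho^{JV})\mapsto(J,V,\rho^{JV},\lambda^{JV})$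 with $\lambda^{JV}A=\zeta^{R\dagger VLA}(\rho^{JV}LA\cdot J\eta^{RL}A)$; identity on 2-cells. **$G$:** $(L\dashv R,\eta^{RL},\varepsilon^{LR})\mapsto(\mathcal{C},R,\eta^{RL},\zeta^{R})$ with $\zeta^{RX}(v)=\varepsilon^{LR}X\cdot Lv$; forgets $\lambda^{JV}$; identity on 2-cells. **$H$:** $(\mathcal{C},S,\eta^{S},(\sim)^{S})\mapsto(\mathcal{C},S,\eta^{S},\mu^{S})$ with $Sf=(\eta^{S}B\cdot f)^{SB}$ for $f:A\to B$, $\mu^{S}A=(1_{SA})^{SA}$; $(P,(\sim)^{PS})\mapsto(P,\varphi^{P})$, $\varphi^{P}A=(P\eta^{S}A)^{PSA}$; $\theta\mapsto\theta$. **$K$:** $(\mathcal{C},S,\eta^S,\mu^S)\mapsto(\mathcal{C},S,\eta^S,(\sim)^S)$ with $h^{SB}=\mu^{S}B\cdot Sh$ for $h:A\to SB$; $(P,\varphi^P)\mapsto(P,(\sim)^{PS})$ with $r^{PSA}=P\mu^{S}A\cdot\varphi^{P}SA\cdot Tr$ for $r:D\to PSA$; $\theta\mapsto\theta$. **$\Phi_{E}$, $\Psi_{E}$:** the 2-functors of the known 2-adjunction between adjunctions and classical monads. $\Phi_{E}$: $(L\dashv R,\eta^{RL},\varepsilon^{LR})\mapsto(\mathcal{C},RL,\eta^{RL},R\varepsilon^{LR}L)$; $(J,V,\rho^{JV},\lambda^{JV})\mapsto(J,\varrho^{JV}L\circ R^{\dagger}\lambda^{JV})$; $(\alpha,\beta)\mapsto\alpha$.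 $\Psi_{E}$: a monad goes to its Eilenberg–Moore (free–forgetful) adjunction; $(P,\varphi^{P})$ goes to $(P,\overline{P},1,\lambda)$ with $\overline{P}(N,n)=(PN,Pn\cdot\varphi^{P}N)$, $\overline{P}m=Pm$, and $\lambda$ the mate of the identity; $\theta\mapsto(\theta,\overline{\theta})$ with $\overline{\theta}_{(N,n)}=\theta N$.
   Formalization: FΨ=Ψ_E H and ΨK=GΨ_E are shown as equalities once each algebra (N,(~)^N) is identified with (N,(1_N)^N), and in general as canonical 2-natural isomorphisms; literally the two categories of algebras differ. Algebras are renamed injectively so that Ψ, Ψ_E land in fixed 2-categories. *)

theory Defs
  imports "HOL-Library.FuncSet"
begin

section \<open>Categories, functors, natural transformations\<close>

text \<open>
  Maps are required to be undefined outside their domain (here and for all families of functions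
  below), so that equality in HOL of categories, functors and transformations is the
  mathematical equality.
\<close>

record ('o, 'm) category =
  Obj :: "'o set"
  Arr :: "'m set"
  Dom :: "'m \<Rightarrow> 'o"
  Cod :: "'m \<Rightarrow> 'o"
  Ide :: "'o \<Rightarrow> 'm"
  Cmp :: "'m \<Rightarrow> 'm \<Rightarrow> 'm"  (infixr "\<cdot>\<index>" 70)

definition Hom :: "('o, 'm) category \<Rightarrow> 'o \<Rightarrow> 'o \<Rightarrow> 'm set" where
  "Hom C A B = {f \<in> Arr C. Dom C f = A \<and> Cod C f = B}"

definition Into :: "('o, 'm) category \<Rightarrow> 'o \<Rightarrow> 'm set" where
  "Into C B = {f \<in> Arr C. Cod C f = B}"

locale category =
  fixes C :: "('o, 'm) category" (structure)
  assumes Dom_closed: "Dom C \<in> Arr C \<rightarrow>\<^sub>E Obj C"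
    and Cod_closed: "Cod C \<in> Arr C \<rightarrow>\<^sub>E Obj C"
    and Ide_ext: "Ide C \<in> extensional (Obj C)"
    and Ide_Hom: "A \<in> Obj C \<Longrightarrow> Ide C A \<in> Hom C A A"
    and Cmp_Hom: "\<lbrakk>f \<in> Hom C A B; g \<in> Hom C B D\<rbrakk> \<Longrightarrow> g \<cdot> f \<in> Hom C A D"
    and Cmp_ext: "\<not> (f \<in> Arr C \<and> g \<in> Arr C \<and> Dom C g = Cod C f) \<Longrightarrow> g \<cdot> f = undefined"
    and Ide_left: "f \<in> Hom C A B \<Longrightarrow> Ide C B \<cdot> f = f"
    and Ide_right: "f \<in> Hom C A B \<Longrightarrow> f \<cdot> Ide C A = f"
    and Cmp_assoc: "\<lbrakk>f \<in> Hom C A B; g \<in> Hom C B D; h \<in> Hom C D E\<rbrakk>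
      \<Longrightarrow> h \<cdot> (g \<cdot> f) = (h \<cdot> g) \<cdot> f"

text \<open>The category record with given data, cut down to the domains required above.\<close>

definition mk_category ::
  "'o set \<Rightarrow> 'm set \<Rightarrow> ('m \<Rightarrow> 'o) \<Rightarrow> ('m \<Rightarrow> 'o) \<Rightarrow> ('o \<Rightarrow> 'm) \<Rightarrow> ('m \<Rightarrow> 'm \<Rightarrow> 'm) \<Rightarrow> ('o, 'm) category"
where
  "mk_category Ob Ar d c i m =
    \<lparr>Obj = Ob, Arr = Ar, Dom = restrict d Ar, Cod = restrict c Ar, Ide = restrict i Ob,
     Cmp = (\<lambda>g f. if f \<in> Ar \<and> g \<in> Ar \<and> d g = c f then m g f else undefined)\<rparr>"

record ('a, 'b, 'c, 'd) fctr =
  FDom :: "('a, 'b) category"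
  FCod :: "('c, 'd) category"
  FObj :: "'a \<Rightarrow> 'c"
  FArr :: "'b \<Rightarrow> 'd"

definition cat_functor :: "('a, 'b, 'c, 'd) fctr \<Rightarrow> bool" where
  "cat_functor F \<longleftrightarrow>
    category (FDom F) \<and> category (FCod F) \<and>
    FObj F \<in> Obj (FDom F) \<rightarrow>\<^sub>E Obj (FCod F) \<and>
    FArr F \<in> extensional (Arr (FDom F)) \<and>
    (\<forall>f \<in> Arr (FDom F).
      FArr F f \<in> Hom (FCod F) (FObj F (Dom (FDom F) f)) (FObj F (Cod (FDom F) f))) \<and>
    (\<forall>A \<in> Obj (FDom F). FArr F (Ide (FDom F) A) = Ide (FCod F) (FObj F A)) \<and>
    (\<forall>f \<in> Arr (FDom F). \<forall>g \<in> Arr (FDom F). Dom (FDom F) g = Cod (FDom F) f \<longrightarrow>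
      FArr F (g \<cdot>\<^bsub>FDom F\<^esub> f) = FArr F g \<cdot>\<^bsub>FCod F\<^esub> FArr F f)"

definition functor_from_to ::
  "('a, 'b, 'c, 'd) fctr \<Rightarrow> ('a, 'b) category \<Rightarrow> ('c, 'd) category \<Rightarrow> bool" where
  "functor_from_to F C D \<longleftrightarrow> cat_functor F \<and> FDom F = C \<and> FCod F = D"

definition id_functor :: "('a, 'b) category \<Rightarrow> ('a, 'b, 'a, 'b) fctr" where
  "id_functor C = \<lparr>FDom = C, FCod = C, FObj = (\<lambda>A\<in>Obj C. A), FArr = (\<lambda>f\<in>Arr C. f)\<rparr>"

definition comp_functor ::
  "('c, 'd, 'e, 'f) fctr \<Rightarrow> ('a, 'b, 'c, 'd) fctr \<Rightarrow> ('a, 'b, 'e, 'f) fctr"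
  (infixr "\<circ>\<^sub>F" 75) where
  "G \<circ>\<^sub>F F = \<lparr>FDom = FDom F, FCod = FCod G,
    FObj = compose (Obj (FDom F)) (FObj G) (FObj F),
    FArr = compose (Arr (FDom F)) (FArr G) (FArr F)\<rparr>"

record ('a, 'b, 'c, 'd) ntrans =
  NSrc :: "('a, 'b, 'c, 'd) fctr"
  NTrg :: "('a, 'b, 'c, 'd) fctr"
  NCmp :: "'a \<Rightarrow> 'd"

definition nat_trans :: "('a, 'b, 'c, 'd) ntrans \<Rightarrow> bool" where
  "nat_trans \<alpha> \<longleftrightarrow>
    cat_functor (NSrc \<alpha>) \<and> cat_functor (NTrg \<alpha>) \<and>
    FDom (NTrg \<alpha>) = FDom (NSrc \<alpha>) \<and> FCod (NTrg \<alpha>) = FCod (NSrc \<alpha>) \<and>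
    NCmp \<alpha> \<in> extensional (Obj (FDom (NSrc \<alpha>))) \<and>
    (\<forall>A \<in> Obj (FDom (NSrc \<alpha>)).
      NCmp \<alpha> A \<in> Hom (FCod (NSrc \<alpha>)) (FObj (NSrc \<alpha>) A) (FObj (NTrg \<alpha>) A)) \<and>
    (\<forall>f \<in> Arr (FDom (NSrc \<alpha>)).
      NCmp \<alpha> (Cod (FDom (NSrc \<alpha>)) f) \<cdot>\<^bsub>FCod (NSrc \<alpha>)\<^esub> FArr (NSrc \<alpha>) f =
      FArr (NTrg \<alpha>) f \<cdot>\<^bsub>FCod (NSrc \<alpha>)\<^esub> NCmp \<alpha> (Dom (FDom (NSrc \<alpha>)) f))"

definition nat_from_to ::
  "('a, 'b, 'c, 'd) ntrans \<Rightarrow> ('a, 'b, 'c, 'd) fctr \<Rightarrow> ('a, 'b, 'c, 'd) fctr \<Rightarrow> bool" where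
  "nat_from_to \<alpha> F G \<longleftrightarrow> nat_trans \<alpha> \<and> NSrc \<alpha> = F \<and> NTrg \<alpha> = G"

definition id_nat :: "('a, 'b, 'c, 'd) fctr \<Rightarrow> ('a, 'b, 'c, 'd) ntrans" where
  "id_nat F = \<lparr>NSrc = F, NTrg = F, NCmp = (\<lambda>A\<in>Obj (FDom F). Ide (FCod F) (FObj F A))\<rparr>"

definition vcomp ::
  "('a, 'b, 'c, 'd) ntrans \<Rightarrow> ('a, 'b, 'c, 'd) ntrans \<Rightarrow> ('a, 'b, 'c, 'd) ntrans"
  (infixr "\<circ>\<^sub>V" 65) where
  "\<beta> \<circ>\<^sub>V \<alpha> = \<lparr>NSrc = NSrc \<alpha>, NTrg = NTrg \<beta>,
    NCmp = (\<lambda>A\<in>Obj (FDom (NSrc \<alpha>)). NCmp \<beta> A \<cdot>\<^bsub>FCod (NSrc \<alpha>)\<^esub> NCmp \<alpha> A)\<rparr>"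

definition whisker_left ::
  "('c, 'd, 'e, 'f) fctr \<Rightarrow> ('a, 'b, 'c, 'd) ntrans \<Rightarrow> ('a, 'b, 'e, 'f) ntrans"
  (infixr "\<star>\<^sub>l" 70) where
  "H \<star>\<^sub>l \<alpha> = \<lparr>NSrc = H \<circ>\<^sub>F NSrc \<alpha>, NTrg = H \<circ>\<^sub>F NTrg \<alpha>,
    NCmp = (\<lambda>A\<in>Obj (FDom (NSrc \<alpha>)). FArr H (NCmp \<alpha> A))\<rparr>"

definition whisker_right ::
  "('c, 'd, 'e, 'f) ntrans \<Rightarrow> ('a, 'b, 'c, 'd) fctr \<Rightarrow> ('a, 'b, 'e, 'f) ntrans"
  (infixl "\<star>\<^sub>r" 71) where
  "\<alpha> \<star>\<^sub>r H = \<lparr>NSrc = NSrc \<alpha> \<circ>\<^sub>F H, NTrg = NTrg \<alpha> \<circ>\<^sub>F H,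
    NCmp = (\<lambda>A\<in>Obj (FDom H). NCmp \<alpha> (FObj H A))\<rparr>"

definition hcomp ::
  "('c, 'd, 'e, 'f) ntrans \<Rightarrow> ('a, 'b, 'c, 'd) ntrans \<Rightarrow> ('a, 'b, 'e, 'f) ntrans"
  (infixr "\<star>\<^sub>h" 70) where
  "\<beta> \<star>\<^sub>h \<alpha> = (\<beta> \<star>\<^sub>r NTrg \<alpha>) \<circ>\<^sub>V (NSrc \<beta> \<star>\<^sub>l \<alpha>)"

definition inverse_nat ::
  "('a, 'b, 'c, 'd) ntrans \<Rightarrow> ('a, 'b, 'c, 'd) ntrans \<Rightarrow> bool" where
  "inverse_nat \<rho> \<sigma> \<longleftrightarrow> nat_trans \<rho> \<and> nat_trans \<sigma> \<and>
    \<sigma> \<circ>\<^sub>V \<rho> = id_nat (NSrc \<rho>) \<and> \<rho> \<circ>\<^sub>V \<sigma> = id_nat (NTrg \<rho>)"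

definition nat_iso_from_to ::
  "('a, 'b, 'c, 'd) ntrans \<Rightarrow> ('a, 'b, 'c, 'd) fctr \<Rightarrow> ('a, 'b, 'c, 'd) fctr \<Rightarrow> bool" where
  "nat_iso_from_to \<rho> F G \<longleftrightarrow> nat_from_to \<rho> F G \<and> (\<exists>\<sigma>. inverse_nat \<rho> \<sigma>)"

definition nat_inv :: "('a, 'b, 'c, 'd) ntrans \<Rightarrow> ('a, 'b, 'c, 'd) ntrans" where
  "nat_inv \<rho> = (THE \<sigma>. inverse_nat \<rho> \<sigma>)"


section \<open>Strict 2-categories, 2-functors, 2-adjunctions\<close>

text \<open>
  The 1-cells and 2-cells (with vertical composition) form the category \<open>Vert\<close>;
  \<open>\<odot>\<close> and \<open>\<diamondop>\<close> are composition along 0-cells.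
\<close>

record ('p, 'q, 'r) two_category =
  Cell0 :: "'p set"
  Vert :: "('q, 'r) category"
  src :: "'q \<Rightarrow> 'p"
  trg :: "'q \<Rightarrow> 'p"
  one :: "'p \<Rightarrow> 'q"
  comp1 :: "'q \<Rightarrow> 'q \<Rightarrow> 'q"  (infixr "\<odot>\<index>" 70)
  comp2 :: "'r \<Rightarrow> 'r \<Rightarrow> 'r"  (infixr "\<diamondop>\<index>" 70)

abbreviation Cell1 :: "('p, 'q, 'r) two_category \<Rightarrow> 'q set" where
  "Cell1 K \<equiv> Obj (Vert K)"

abbreviation Cell2 :: "('p, 'q, 'r) two_category \<Rightarrow> 'r set" where
  "Cell2 K \<equiv> Arr (Vert K)"

abbreviation src2 :: "('p, 'q, 'r) two_category \<Rightarrow> 'r \<Rightarrow> 'p" where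
  "src2 K \<theta> \<equiv> src K (Dom (Vert K) \<theta>)"

abbreviation trg2 :: "('p, 'q, 'r) two_category \<Rightarrow> 'r \<Rightarrow> 'p" where
  "trg2 K \<theta> \<equiv> trg K (Dom (Vert K) \<theta>)"

locale two_category =
  fixes K :: "('p, 'q, 'r) two_category" (structure)
  assumes Vert_category: "category (Vert K)"
    and src_closed: "f \<in> Cell1 K \<Longrightarrow> src K f \<in> Cell0 K"
    and trg_closed: "f \<in> Cell1 K \<Longrightarrow> trg K f \<in> Cell0 K"
    and src_Cod: "\<theta> \<in> Cell2 K \<Longrightarrow> src K (Cod (Vert K) \<theta>) = src2 K \<theta>"
    and trg_Cod: "\<theta> \<in> Cell2 K \<Longrightarrow> trg K (Cod (Vert K) \<theta>) = trg2 K \<theta>"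
    and one_closed: "A \<in> Cell0 K \<Longrightarrow> one K A \<in> Cell1 K \<and> src K (one K A) = A \<and> trg K (one K A) = A"
    and comp1_closed: "\<lbrakk>f \<in> Cell1 K; g \<in> Cell1 K; src K g = trg K f\<rbrakk>
      \<Longrightarrow> g \<odot> f \<in> Cell1 K \<and> src K (g \<odot> f) = src K f \<and> trg K (g \<odot> f) = trg K g"
    and comp2_closed: "\<lbrakk>\<theta> \<in> Hom (Vert K) f f'; \<kappa> \<in> Hom (Vert K) g g'; src K g = trg K f\<rbrakk>
      \<Longrightarrow> \<kappa> \<diamondop> \<theta> \<in> Hom (Vert K) (g \<odot> f) (g' \<odot> f')"
    and comp1_one_right: "f \<in> Cell1 K \<Longrightarrow> f \<odot> one K (src K f) = f"
    and comp1_one_left: "f \<in> Cell1 K \<Longrightarrow> one K (trg K f) \<odot> f = f"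
    and comp1_assoc: "\<lbrakk>f \<in> Cell1 K; g \<in> Cell1 K; h \<in> Cell1 K; src K g = trg K f; src K h = trg K g\<rbrakk>
      \<Longrightarrow> h \<odot> (g \<odot> f) = (h \<odot> g) \<odot> f"
    and comp2_one_right: "\<theta> \<in> Cell2 K \<Longrightarrow> \<theta> \<diamondop> Ide (Vert K) (one K (src2 K \<theta>)) = \<theta>"
    and comp2_one_left: "\<theta> \<in> Cell2 K \<Longrightarrow> Ide (Vert K) (one K (trg2 K \<theta>)) \<diamondop> \<theta> = \<theta>"
    and comp2_assoc: "\<lbrakk>\<theta> \<in> Cell2 K; \<kappa> \<in> Cell2 K; \<xi> \<in> Cell2 K; src2 K \<kappa> = trg2 K \<theta>; src2 K \<xi> = trg2 K \<kappa>\<rbrakk>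
      \<Longrightarrow> \<xi> \<diamondop> (\<kappa> \<diamondop> \<theta>) = (\<xi> \<diamondop> \<kappa>) \<diamondop> \<theta>"
    and comp2_Ide: "\<lbrakk>f \<in> Cell1 K; g \<in> Cell1 K; src K g = trg K f\<rbrakk>
      \<Longrightarrow> Ide (Vert K) g \<diamondop> Ide (Vert K) f = Ide (Vert K) (g \<odot> f)"
    and interchange: "\<lbrakk>\<theta> \<in> Hom (Vert K) f f'; \<theta>' \<in> Hom (Vert K) f' f'';
        \<kappa> \<in> Hom (Vert K) g g'; \<kappa>' \<in> Hom (Vert K) g' g''; src K g = trg K f\<rbrakk>
      \<Longrightarrow> (\<kappa>' \<cdot>\<^bsub>Vert K\<^esub> \<kappa>) \<diamondop> (\<theta>' \<cdot>\<^bsub>Vert K\<^esub> \<theta>) = (\<kappa>' \<diamondop> \<theta>') \<cdot>\<^bsub>Vert K\<^esub> (\<kappa> \<diamondop> \<theta>)"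

record ('p, 'q, 'r, 's, 't, 'u) two_fctr =
  F0 :: "'p \<Rightarrow> 's"
  F1 :: "'q \<Rightarrow> 't"
  F2 :: "'r \<Rightarrow> 'u"

definition two_functor ::
  "('p, 'q, 'r) two_category \<Rightarrow> ('s, 't, 'u) two_category \<Rightarrow> ('p, 'q, 'r, 's, 't, 'u) two_fctr \<Rightarrow> bool"
where
  "two_functor K M F \<longleftrightarrow>
    two_category K \<and> two_category M \<and>
    (\<forall>A \<in> Cell0 K. F0 F A \<in> Cell0 M) \<and>
    (\<forall>f \<in> Cell1 K. F1 F f \<in> Cell1 M \<and>
      src M (F1 F f) = F0 F (src K f) \<and> trg M (F1 F f) = F0 F (trg K f)) \<and>
    (\<forall>\<theta> \<in> Cell2 K. F2 F \<theta> \<in> Hom (Vert M) (F1 F (Dom (Vert K) \<theta>)) (F1 F (Cod (Vert K) \<theta>))) \<and>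
    (\<forall>f \<in> Cell1 K. F2 F (Ide (Vert K) f) = Ide (Vert M) (F1 F f)) \<and>
    (\<forall>\<theta> \<in> Cell2 K. \<forall>\<kappa> \<in> Cell2 K. Dom (Vert K) \<kappa> = Cod (Vert K) \<theta> \<longrightarrow>
      F2 F (\<kappa> \<cdot>\<^bsub>Vert K\<^esub> \<theta>) = F2 F \<kappa> \<cdot>\<^bsub>Vert M\<^esub> F2 F \<theta>) \<and>
    (\<forall>A \<in> Cell0 K. F1 F (one K A) = one M (F0 F A)) \<and>
    (\<forall>f \<in> Cell1 K. \<forall>g \<in> Cell1 K. src K g = trg K f \<longrightarrow>
      F1 F (g \<odot>\<^bsub>K\<^esub> f) = F1 F g \<odot>\<^bsub>M\<^esub> F1 F f) \<and>
    (\<forall>\<theta> \<in> Cell2 K. \<forall>\<kappa> \<in> Cell2 K. src2 K \<kappa> = trg2 K \<theta> \<longrightarrow>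
      F2 F (\<kappa> \<diamondop>\<^bsub>K\<^esub> \<theta>) = F2 F \<kappa> \<diamondop>\<^bsub>M\<^esub> F2 F \<theta>)"

definition two_id :: "('p, 'q, 'r, 'p, 'q, 'r) two_fctr" where
  "two_id = \<lparr>F0 = id, F1 = id, F2 = id\<rparr>"

definition two_comp ::
  "('s, 't, 'u, 'v, 'w, 'x) two_fctr \<Rightarrow> ('p, 'q, 'r, 's, 't, 'u) two_fctr
    \<Rightarrow> ('p, 'q, 'r, 'v, 'w, 'x) two_fctr"  (infixr "\<circ>\<^sub>2" 75) where
  "G \<circ>\<^sub>2 F = \<lparr>F0 = F0 G \<circ> F0 F, F1 = F1 G \<circ> F1 F, F2 = F2 G \<circ> F2 F\<rparr>"

text \<open>Equality of 2-functors with source \<open>K\<close>.\<close>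

definition two_functor_eq ::
  "('p, 'q, 'r) two_category \<Rightarrow> ('p, 'q, 'r, 's, 't, 'u) two_fctr
    \<Rightarrow> ('p, 'q, 'r, 's, 't, 'u) two_fctr \<Rightarrow> bool" where
  "two_functor_eq K F G \<longleftrightarrow>
    (\<forall>A \<in> Cell0 K. F0 F A = F0 G A) \<and> (\<forall>f \<in> Cell1 K. F1 F f = F1 G f) \<and>
    (\<forall>\<theta> \<in> Cell2 K. F2 F \<theta> = F2 G \<theta>)"

definition mutually_inverse ::
  "('p, 'q, 'r) two_category \<Rightarrow> ('s, 't, 'u) two_category
    \<Rightarrow> ('p, 'q, 'r, 's, 't, 'u) two_fctr \<Rightarrow> ('s, 't, 'u, 'p, 'q, 'r) two_fctr \<Rightarrow> bool" where
  "mutually_inverse K M F G \<longleftrightarrow>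
    two_functor K M F \<and> two_functor M K G \<and>
    two_functor_eq K (G \<circ>\<^sub>2 F) two_id \<and> two_functor_eq M (F \<circ>\<^sub>2 G) two_id"

definition two_natural ::
  "('p, 'q, 'r) two_category \<Rightarrow> ('s, 't, 'u) two_category
    \<Rightarrow> ('p, 'q, 'r, 's, 't, 'u) two_fctr \<Rightarrow> ('p, 'q, 'r, 's, 't, 'u) two_fctr
    \<Rightarrow> ('p \<Rightarrow> 't) \<Rightarrow> bool" where
  "two_natural K M F G \<tau> \<longleftrightarrow>
    two_functor K M F \<and> two_functor K M G \<and>
    (\<forall>A \<in> Cell0 K. \<tau> A \<in> Cell1 M \<and> src M (\<tau> A) = F0 F A \<and> trg M (\<tau> A) = F0 G A) \<and>
    (\<forall>f \<in> Cell1 K. F1 G f \<odot>\<^bsub>M\<^esub> \<tau> (src K f) = \<tau> (trg K f) \<odot>\<^bsub>M\<^esub> F1 F f) \<and>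
    (\<forall>\<theta> \<in> Cell2 K. F2 G \<theta> \<diamondop>\<^bsub>M\<^esub> Ide (Vert M) (\<tau> (src2 K \<theta>)) =
      Ide (Vert M) (\<tau> (trg2 K \<theta>)) \<diamondop>\<^bsub>M\<^esub> F2 F \<theta>)"

definition invertible1 :: "('p, 'q, 'r) two_category \<Rightarrow> 'q \<Rightarrow> bool" where
  "invertible1 K f \<longleftrightarrow> f \<in> Cell1 K \<and>
    (\<exists>g \<in> Cell1 K. src K g = trg K f \<and> trg K g = src K f \<and>
      g \<odot>\<^bsub>K\<^esub> f = one K (src K f) \<and> f \<odot>\<^bsub>K\<^esub> g = one K (trg K f))"

definition two_natural_iso ::
  "('p, 'q, 'r) two_category \<Rightarrow> ('s, 't, 'u) two_category
    \<Rightarrow> ('p, 'q, 'r, 's, 't, 'u) two_fctr \<Rightarrow> ('p, 'q, 'r, 's, 't, 'u) two_fctr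
    \<Rightarrow> ('p \<Rightarrow> 't) \<Rightarrow> bool" where
  "two_natural_iso K M F G \<tau> \<longleftrightarrow>
    two_natural K M F G \<tau> \<and> (\<forall>A \<in> Cell0 K. invertible1 M (\<tau> A))"

definition two_adjunction ::
  "('p, 'q, 'r) two_category \<Rightarrow> ('s, 't, 'u) two_category
    \<Rightarrow> ('p, 'q, 'r, 's, 't, 'u) two_fctr \<Rightarrow> ('s, 't, 'u, 'p, 'q, 'r) two_fctr \<Rightarrow> bool" where
  "two_adjunction K M F G \<longleftrightarrow>
    two_functor K M F \<and> two_functor M K G \<and>
    (\<exists>\<eta> \<epsilon>. two_natural K K two_id (G \<circ>\<^sub>2 F) \<eta> \<and> two_natural M M (F \<circ>\<^sub>2 G) two_id \<epsilon> \<and>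
      (\<forall>A \<in> Cell0 K. \<epsilon> (F0 F A) \<odot>\<^bsub>M\<^esub> F1 F (\<eta> A) = one M (F0 F A)) \<and>
      (\<forall>B \<in> Cell0 M. F1 G (\<epsilon> B) \<odot>\<^bsub>K\<^esub> \<eta> (F0 G B) = one K (F0 G B)))"

definition restrict_1cells ::
  "('p, 'q, 'r) two_category \<Rightarrow> ('q \<Rightarrow> bool) \<Rightarrow> ('p, 'q, 'r) two_category" where
  "restrict_1cells K P = K\<lparr>Vert := mk_category
    {f \<in> Cell1 K. P f} {\<theta> \<in> Cell2 K. P (Dom (Vert K) \<theta>) \<and> P (Cod (Vert K) \<theta>)}
    (Dom (Vert K)) (Cod (Vert K)) (Ide (Vert K)) (Cmp (Vert K))\<rparr>"


section \<open>Universal arrows\<close>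

record ('o, 'm, 'x, 'y) uarr =
  uR :: "('x, 'y, 'o, 'm) fctr"
  uL :: "'o \<Rightarrow> 'x"
  uEta :: "'o \<Rightarrow> 'm"
  uZeta :: "'x \<Rightarrow> 'm \<Rightarrow> 'y"

abbreviation uC :: "('o, 'm, 'x, 'y) uarr \<Rightarrow> ('o, 'm) category" where "uC A \<equiv> FCod (uR A)"
abbreviation uX :: "('o, 'm, 'x, 'y) uarr \<Rightarrow> ('x, 'y) category" where "uX A \<equiv> FDom (uR A)"

definition universal_arrow :: "('o, 'm, 'x, 'y) uarr \<Rightarrow> bool" where
  "universal_arrow U \<longleftrightarrow>
    cat_functor (uR U) \<and>
    uL U \<in> Obj (uC U) \<rightarrow>\<^sub>E Obj (uX U) \<and>
    uEta U \<in> extensional (Obj (uC U)) \<and>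
    (\<forall>A \<in> Obj (uC U). uEta U A \<in> Hom (uC U) A (FObj (uR U) (uL U A))) \<and>
    uZeta U \<in> (\<Pi>\<^sub>E X\<in>Obj (uX U). Into (uC U) (FObj (uR U) X) \<rightarrow>\<^sub>E Arr (uX U)) \<and>
    (\<forall>A \<in> Obj (uC U). \<forall>X \<in> Obj (uX U). \<forall>v \<in> Hom (uC U) A (FObj (uR U) X).
      uZeta U X v \<in> Hom (uX U) (uL U A) X \<and>
      FArr (uR U) (uZeta U X v) \<cdot>\<^bsub>uC U\<^esub> uEta U A = v \<and>
      (\<forall>w \<in> Hom (uX U) (uL U A) X. FArr (uR U) w \<cdot>\<^bsub>uC U\<^esub> uEta U A = v \<longrightarrow> w = uZeta U X v))"

record ('o, 'm, 'x, 'y) uarr1 =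
  u1s :: "('o, 'm, 'x, 'y) uarr"
  u1t :: "('o, 'm, 'x, 'y) uarr"
  u1J :: "('o, 'm, 'o, 'm) fctr"
  u1V :: "('x, 'y, 'x, 'y) fctr"
  u1rho :: "('x, 'y, 'o, 'm) ntrans"

definition uarr_1cell :: "('o, 'm, 'x, 'y) uarr1 \<Rightarrow> bool" where
  "uarr_1cell f \<longleftrightarrow>
    universal_arrow (u1s f) \<and> universal_arrow (u1t f) \<and>
    functor_from_to (u1J f) (uC (u1s f)) (uC (u1t f)) \<and>
    functor_from_to (u1V f) (uX (u1s f)) (uX (u1t f)) \<and>
    nat_iso_from_to (u1rho f) (u1J f \<circ>\<^sub>F uR (u1s f)) (uR (u1t f) \<circ>\<^sub>F u1V f)"

record ('o, 'm, 'x, 'y) uarr2 =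
  u2s :: "('o, 'm, 'x, 'y) uarr1"
  u2t :: "('o, 'm, 'x, 'y) uarr1"
  u2a :: "('o, 'm, 'o, 'm) ntrans"
  u2b :: "('x, 'y, 'x, 'y) ntrans"

definition uarr_2cell :: "('o, 'm, 'x, 'y) uarr2 \<Rightarrow> bool" where
  "uarr_2cell \<theta> \<longleftrightarrow>
    uarr_1cell (u2s \<theta>) \<and> uarr_1cell (u2t \<theta>) \<and>
    u1s (u2t \<theta>) = u1s (u2s \<theta>) \<and> u1t (u2t \<theta>) = u1t (u2s \<theta>) \<and>
    nat_from_to (u2a \<theta>) (u1J (u2s \<theta>)) (u1J (u2t \<theta>)) \<and>
    nat_from_to (u2b \<theta>) (u1V (u2s \<theta>)) (u1V (u2t \<theta>)) \<and>
    (uR (u1t (u2s \<theta>)) \<star>\<^sub>l u2b \<theta>) \<circ>\<^sub>V u1rho (u2s \<theta>) =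
      u1rho (u2t \<theta>) \<circ>\<^sub>V (u2a \<theta> \<star>\<^sub>r uR (u1s (u2s \<theta>)))"

definition uarr_one :: "('o, 'm, 'x, 'y) uarr \<Rightarrow> ('o, 'm, 'x, 'y) uarr1" where
  "uarr_one U = \<lparr>u1s = U, u1t = U, u1J = id_functor (uC U), u1V = id_functor (uX U),
    u1rho = id_nat (uR U)\<rparr>"

definition uarr_comp1 ::
  "('o, 'm, 'x, 'y) uarr1 \<Rightarrow> ('o, 'm, 'x, 'y) uarr1 \<Rightarrow> ('o, 'm, 'x, 'y) uarr1" where
  "uarr_comp1 g f = \<lparr>u1s = u1s f, u1t = u1t g, u1J = u1J g \<circ>\<^sub>F u1J f, u1V = u1V g \<circ>\<^sub>F u1V f,
    u1rho = (u1rho g \<star>\<^sub>r u1V f) \<circ>\<^sub>V (u1J g \<star>\<^sub>l u1rho f)\<rparr>"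

definition UArr :: "(('o, 'm, 'x, 'y) uarr, ('o, 'm, 'x, 'y) uarr1, ('o, 'm, 'x, 'y) uarr2) two_category"
where
  "UArr = \<lparr>Cell0 = {U. universal_arrow U},
    Vert = mk_category {f. uarr_1cell f} {\<theta>. uarr_2cell \<theta>} u2s u2t
      (\<lambda>f. \<lparr>u2s = f, u2t = f, u2a = id_nat (u1J f), u2b = id_nat (u1V f)\<rparr>)
      (\<lambda>\<kappa> \<theta>. \<lparr>u2s = u2s \<theta>, u2t = u2t \<kappa>, u2a = u2a \<kappa> \<circ>\<^sub>V u2a \<theta>, u2b = u2b \<kappa> \<circ>\<^sub>V u2b \<theta>\<rparr>),
    src = u1s, trg = u1t, one = uarr_one, comp1 = uarr_comp1,
    comp2 = (\<lambda>\<kappa> \<theta>. \<lparr>u2s = uarr_comp1 (u2s \<kappa>) (u2s \<theta>), u2t = uarr_comp1 (u2t \<kappa>) (u2t \<theta>),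
      u2a = u2a \<kappa> \<star>\<^sub>h u2a \<theta>, u2b = u2b \<kappa> \<star>\<^sub>h u2b \<theta>\<rparr>)\<rparr>"

definition UArr_id :: "(('o, 'm, 'x, 'y) uarr, ('o, 'm, 'x, 'y) uarr1, ('o, 'm, 'x, 'y) uarr2) two_category"
where
  "UArr_id = restrict_1cells UArr (\<lambda>f. u1rho f = id_nat (u1J f \<circ>\<^sub>F uR (u1s f)))"


section \<open>Adjunctions\<close>

record ('o, 'm, 'x, 'y) adjn =
  aL :: "('o, 'm, 'x, 'y) fctr"
  aR :: "('x, 'y, 'o, 'm) fctr"
  aEta :: "('o, 'm, 'o, 'm) ntrans"
  aEps :: "('x, 'y, 'x, 'y) ntrans"

abbreviation aC :: "('o, 'm, 'x, 'y) adjn \<Rightarrow> ('o, 'm) category" where "aC A \<equiv> FCod (aR A)"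
abbreviation aX :: "('o, 'm, 'x, 'y) adjn \<Rightarrow> ('x, 'y) category" where "aX A \<equiv> FDom (aR A)"

definition adjunction :: "('o, 'm, 'x, 'y) adjn \<Rightarrow> bool" where
  "adjunction A \<longleftrightarrow>
    cat_functor (aR A) \<and> functor_from_to (aL A) (aC A) (aX A) \<and>
    nat_from_to (aEta A) (id_functor (aC A)) (aR A \<circ>\<^sub>F aL A) \<and>
    nat_from_to (aEps A) (aL A \<circ>\<^sub>F aR A) (id_functor (aX A)) \<and>
    (aEps A \<star>\<^sub>r aL A) \<circ>\<^sub>V (aL A \<star>\<^sub>l aEta A) = id_nat (aL A) \<and>
    (aR A \<star>\<^sub>l aEps A) \<circ>\<^sub>V (aEta A \<star>\<^sub>r aR A) = id_nat (aR A)"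

record ('o, 'm, 'x, 'y) adjn1 =
  a1s :: "('o, 'm, 'x, 'y) adjn"
  a1t :: "('o, 'm, 'x, 'y) adjn"
  a1J :: "('o, 'm, 'o, 'm) fctr"
  a1V :: "('x, 'y, 'x, 'y) fctr"
  a1rho :: "('x, 'y, 'o, 'm) ntrans"
  a1lam :: "('o, 'm, 'x, 'y) ntrans"

definition adjn_1cell :: "('o, 'm, 'x, 'y) adjn1 \<Rightarrow> bool" where
  "adjn_1cell f \<longleftrightarrow>
    adjunction (a1s f) \<and> adjunction (a1t f) \<and>
    functor_from_to (a1J f) (aC (a1s f)) (aC (a1t f)) \<and>
    functor_from_to (a1V f) (aX (a1s f)) (aX (a1t f)) \<and>
    nat_iso_from_to (a1rho f) (a1J f \<circ>\<^sub>F aR (a1s f)) (aR (a1t f) \<circ>\<^sub>F a1V f) \<and>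
    nat_from_to (a1lam f) (aL (a1t f) \<circ>\<^sub>F a1J f) (a1V f \<circ>\<^sub>F aL (a1s f)) \<and>
    (aR (a1t f) \<star>\<^sub>l a1lam f) \<circ>\<^sub>V (aEta (a1t f) \<star>\<^sub>r a1J f) =
      (a1rho f \<star>\<^sub>r aL (a1s f)) \<circ>\<^sub>V (a1J f \<star>\<^sub>l aEta (a1s f))"

record ('o, 'm, 'x, 'y) adjn2 =
  a2s :: "('o, 'm, 'x, 'y) adjn1"
  a2t :: "('o, 'm, 'x, 'y) adjn1"
  a2a :: "('o, 'm, 'o, 'm) ntrans"
  a2b :: "('x, 'y, 'x, 'y) ntrans"

definition adjn_2cell :: "('o, 'm, 'x, 'y) adjn2 \<Rightarrow> bool" where
  "adjn_2cell \<theta> \<longleftrightarrow>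
    adjn_1cell (a2s \<theta>) \<and> adjn_1cell (a2t \<theta>) \<and>
    a1s (a2t \<theta>) = a1s (a2s \<theta>) \<and> a1t (a2t \<theta>) = a1t (a2s \<theta>) \<and>
    nat_from_to (a2a \<theta>) (a1J (a2s \<theta>)) (a1J (a2t \<theta>)) \<and>
    nat_from_to (a2b \<theta>) (a1V (a2s \<theta>)) (a1V (a2t \<theta>)) \<and>
    (aR (a1t (a2s \<theta>)) \<star>\<^sub>l a2b \<theta>) \<circ>\<^sub>V a1rho (a2s \<theta>) =
      a1rho (a2t \<theta>) \<circ>\<^sub>V (a2a \<theta> \<star>\<^sub>r aR (a1s (a2s \<theta>))) \<and>
    a1lam (a2t \<theta>) \<circ>\<^sub>V (aL (a1t (a2s \<theta>)) \<star>\<^sub>l a2a \<theta>) =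
      (a2b \<theta> \<star>\<^sub>r aL (a1s (a2s \<theta>))) \<circ>\<^sub>V a1lam (a2s \<theta>)"

definition adjn_one :: "('o, 'm, 'x, 'y) adjn \<Rightarrow> ('o, 'm, 'x, 'y) adjn1" where
  "adjn_one A = \<lparr>a1s = A, a1t = A, a1J = id_functor (aC A), a1V = id_functor (aX A),
    a1rho = id_nat (aR A), a1lam = id_nat (aL A)\<rparr>"

definition adjn_comp1 ::
  "('o, 'm, 'x, 'y) adjn1 \<Rightarrow> ('o, 'm, 'x, 'y) adjn1 \<Rightarrow> ('o, 'm, 'x, 'y) adjn1" where
  "adjn_comp1 g f = \<lparr>a1s = a1s f, a1t = a1t g, a1J = a1J g \<circ>\<^sub>F a1J f, a1V = a1V g \<circ>\<^sub>F a1V f,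
    a1rho = (a1rho g \<star>\<^sub>r a1V f) \<circ>\<^sub>V (a1J g \<star>\<^sub>l a1rho f),
    a1lam = (a1V g \<star>\<^sub>l a1lam f) \<circ>\<^sub>V (a1lam g \<star>\<^sub>r a1J f)\<rparr>"

definition AdjR :: "(('o, 'm, 'x, 'y) adjn, ('o, 'm, 'x, 'y) adjn1, ('o, 'm, 'x, 'y) adjn2) two_category"
where
  "AdjR = \<lparr>Cell0 = {A. adjunction A},
    Vert = mk_category {f. adjn_1cell f} {\<theta>. adjn_2cell \<theta>} a2s a2t
      (\<lambda>f. \<lparr>a2s = f, a2t = f, a2a = id_nat (a1J f), a2b = id_nat (a1V f)\<rparr>)
      (\<lambda>\<kappa> \<theta>. \<lparr>a2s = a2s \<theta>, a2t = a2t \<kappa>, a2a = a2a \<kappa> \<circ>\<^sub>V a2a \<theta>, a2b = a2b \<kappa> \<circ>\<^sub>V a2b \<theta>\<rparr>),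
    src = a1s, trg = a1t, one = adjn_one, comp1 = adjn_comp1,
    comp2 = (\<lambda>\<kappa> \<theta>. \<lparr>a2s = adjn_comp1 (a2s \<kappa>) (a2s \<theta>), a2t = adjn_comp1 (a2t \<kappa>) (a2t \<theta>),
      a2a = a2a \<kappa> \<star>\<^sub>h a2a \<theta>, a2b = a2b \<kappa> \<star>\<^sub>h a2b \<theta>\<rparr>)\<rparr>"

definition AdjR_id :: "(('o, 'm, 'x, 'y) adjn, ('o, 'm, 'x, 'y) adjn1, ('o, 'm, 'x, 'y) adjn2) two_category"
where
  "AdjR_id = restrict_1cells AdjR (\<lambda>f. a1rho f = id_nat (a1J f \<circ>\<^sub>F aR (a1s f)))"

definition mate ::
  "('o, 'm, 'x, 'y) adjn \<Rightarrow> ('o, 'm, 'x, 'y) adjn \<Rightarrow> ('o, 'm, 'o, 'm) fctr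
    \<Rightarrow> ('x, 'y, 'x, 'y) fctr \<Rightarrow> ('x, 'y, 'o, 'm) ntrans \<Rightarrow> ('o, 'm, 'x, 'y) ntrans" where
  "mate A B J V \<rho> =
    (aEps B \<star>\<^sub>r (V \<circ>\<^sub>F aL A)) \<circ>\<^sub>V (aL B \<star>\<^sub>l (\<rho> \<star>\<^sub>r aL A)) \<circ>\<^sub>V (aL B \<star>\<^sub>l (J \<star>\<^sub>l aEta A))"


section \<open>Extensive monads\<close>

record ('o, 'm) emonad =
  eC :: "('o, 'm) category"
  eS :: "'o \<Rightarrow> 'o"
  eEta :: "'o \<Rightarrow> 'm"
  eExt :: "'o \<Rightarrow> 'm \<Rightarrow> 'm"

definition extensive_monad :: "('o, 'm) emonad \<Rightarrow> bool" where
  "extensive_monad S \<longleftrightarrow>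
    category (eC S) \<and>
    eS S \<in> Obj (eC S) \<rightarrow>\<^sub>E Obj (eC S) \<and>
    eEta S \<in> extensional (Obj (eC S)) \<and>
    (\<forall>A \<in> Obj (eC S). eEta S A \<in> Hom (eC S) A (eS S A)) \<and>
    eExt S \<in> (\<Pi>\<^sub>E B\<in>Obj (eC S). Into (eC S) (eS S B) \<rightarrow>\<^sub>E Arr (eC S)) \<and>
    (\<forall>A \<in> Obj (eC S). \<forall>B \<in> Obj (eC S). \<forall>h \<in> Hom (eC S) A (eS S B).
      eExt S B h \<in> Hom (eC S) (eS S A) (eS S B)) \<and>
    (\<forall>A \<in> Obj (eC S). eExt S A (eEta S A) = Ide (eC S) (eS S A)) \<and>
    (\<forall>A \<in> Obj (eC S). \<forall>B \<in> Obj (eC S). \<forall>h \<in> Hom (eC S) A (eS S B).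
      eExt S B h \<cdot>\<^bsub>eC S\<^esub> eEta S A = h) \<and>
    (\<forall>A \<in> Obj (eC S). \<forall>B \<in> Obj (eC S). \<forall>D \<in> Obj (eC S).
      \<forall>h \<in> Hom (eC S) A (eS S B). \<forall>k \<in> Hom (eC S) B (eS S D).
      eExt S D (eExt S D k \<cdot>\<^bsub>eC S\<^esub> h) = eExt S D k \<cdot>\<^bsub>eC S\<^esub> eExt S B h)"

type_synonym ('o, 'm) ealg = "'o \<times> ('m \<Rightarrow> 'm)"
type_synonym ('o, 'm) ealg_arr = "('o, 'm) ealg \<times> 'm \<times> ('o, 'm) ealg"

definition ealgebra :: "('o, 'm) emonad \<Rightarrow> ('o, 'm) ealg \<Rightarrow> bool" where
  "ealgebra S = (\<lambda>(N, n).
    N \<in> Obj (eC S) \<and>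
    n \<in> Into (eC S) N \<rightarrow>\<^sub>E Arr (eC S) \<and>
    (\<forall>A \<in> Obj (eC S). \<forall>a \<in> Hom (eC S) A N.
      n a \<in> Hom (eC S) (eS S A) N \<and> n a \<cdot>\<^bsub>eC S\<^esub> eEta S A = a) \<and>
    (\<forall>A \<in> Obj (eC S). \<forall>B \<in> Obj (eC S). \<forall>b \<in> Hom (eC S) B N. \<forall>h \<in> Hom (eC S) A (eS S B).
      n (n b \<cdot>\<^bsub>eC S\<^esub> h) = n b \<cdot>\<^bsub>eC S\<^esub> eExt S B h))"

definition ealg_hom :: "('o, 'm) emonad \<Rightarrow> ('o, 'm) ealg \<Rightarrow> 'm \<Rightarrow> ('o, 'm) ealg \<Rightarrow> bool" where
  "ealg_hom S M q N \<longleftrightarrow>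
    q \<in> Hom (eC S) (fst M) (fst N) \<and>
    (\<forall>A \<in> Obj (eC S). \<forall>a \<in> Hom (eC S) A (fst M).
      snd N (q \<cdot>\<^bsub>eC S\<^esub> a) = q \<cdot>\<^bsub>eC S\<^esub> snd M a)"

definition EAlg :: "('o, 'm) emonad \<Rightarrow> (('o, 'm) ealg, ('o, 'm) ealg_arr) category" where
  "EAlg S = mk_category {N. ealgebra S N} {(M, q, N). ealgebra S M \<and> ealgebra S N \<and> ealg_hom S M q N}
    fst (\<lambda>m. snd (snd m)) (\<lambda>N. (N, Ide (eC S) (fst N), N))
    (\<lambda>g f. (fst f, fst (snd g) \<cdot>\<^bsub>eC S\<^esub> fst (snd f), snd (snd g)))"

definition eForget :: "('o, 'm) emonad \<Rightarrow> (('o, 'm) ealg, ('o, 'm) ealg_arr, 'o, 'm) fctr" where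
  "eForget S = \<lparr>FDom = EAlg S, FCod = eC S, FObj = restrict fst (Obj (EAlg S)),
    FArr = (\<lambda>m\<in>Arr (EAlg S). fst (snd m))\<rparr>"

definition eFree :: "('o, 'm) emonad \<Rightarrow> 'o \<Rightarrow> ('o, 'm) ealg" where
  "eFree S = (\<lambda>A\<in>Obj (eC S). (eS S A, eExt S A))"

record ('o, 'm) emonad1 =
  e1s :: "('o, 'm) emonad"
  e1t :: "('o, 'm) emonad"
  e1P :: "('o, 'm, 'o, 'm) fctr"
  e1Ext :: "'o \<Rightarrow> 'm \<Rightarrow> 'm"

definition emonad_1cell :: "('o, 'm) emonad1 \<Rightarrow> bool" where
  "emonad_1cell f \<longleftrightarrow>
    extensive_monad (e1s f) \<and> extensive_monad (e1t f) \<and>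
    functor_from_to (e1P f) (eC (e1s f)) (eC (e1t f)) \<and>
    e1Ext f \<in> extensional (Obj (eC (e1s f))) \<and>
    (\<forall>A \<in> Obj (eC (e1s f)). ealgebra (e1t f) (FObj (e1P f) (eS (e1s f) A), e1Ext f A)) \<and>
    (\<forall>A \<in> Obj (eC (e1s f)). \<forall>B \<in> Obj (eC (e1s f)). \<forall>h \<in> Hom (eC (e1s f)) A (eS (e1s f) B).
      ealg_hom (e1t f) (FObj (e1P f) (eS (e1s f) A), e1Ext f A)
        (FArr (e1P f) (eExt (e1s f) B h)) (FObj (e1P f) (eS (e1s f) B), e1Ext f B))"

record ('o, 'm) emonad2 =
  e2s :: "('o, 'm) emonad1"
  e2t :: "('o, 'm) emonad1"
  e2a :: "('o, 'm, 'o, 'm) ntrans"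

definition emonad_2cell :: "('o, 'm) emonad2 \<Rightarrow> bool" where
  "emonad_2cell \<theta> \<longleftrightarrow>
    emonad_1cell (e2s \<theta>) \<and> emonad_1cell (e2t \<theta>) \<and>
    e1s (e2t \<theta>) = e1s (e2s \<theta>) \<and> e1t (e2t \<theta>) = e1t (e2s \<theta>) \<and>
    nat_from_to (e2a \<theta>) (e1P (e2s \<theta>)) (e1P (e2t \<theta>)) \<and>
    (\<forall>A \<in> Obj (eC (e1s (e2s \<theta>))). ealg_hom (e1t (e2s \<theta>))
      (FObj (e1P (e2s \<theta>)) (eS (e1s (e2s \<theta>)) A), e1Ext (e2s \<theta>) A)
      (NCmp (e2a \<theta>) (eS (e1s (e2s \<theta>)) A))
      (FObj (e1P (e2t \<theta>)) (eS (e1s (e2s \<theta>)) A), e1Ext (e2t \<theta>) A))"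

definition emonad_one :: "('o, 'm) emonad \<Rightarrow> ('o, 'm) emonad1" where
  "emonad_one S = \<lparr>e1s = S, e1t = S, e1P = id_functor (eC S), e1Ext = eExt S\<rparr>"

definition emonad_comp1 :: "('o, 'm) emonad1 \<Rightarrow> ('o, 'm) emonad1 \<Rightarrow> ('o, 'm) emonad1" where
  "emonad_comp1 g f = \<lparr>e1s = e1s f, e1t = e1t g, e1P = e1P g \<circ>\<^sub>F e1P f,
    e1Ext = (\<lambda>A\<in>Obj (eC (e1s f)).
      let PSA = FObj (e1P f) (eS (e1s f) A) in
      (\<lambda>w\<in>Into (eC (e1t g)) (FObj (e1P g) PSA).
        FArr (e1P g) (e1Ext f A (Ide (eC (e1t f)) PSA)) \<cdot>\<^bsub>eC (e1t g)\<^esub>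
        e1Ext g PSA (FArr (e1P g) (eEta (e1t f) PSA) \<cdot>\<^bsub>eC (e1t g)\<^esub> w)))\<rparr>"

definition EMnd :: "(('o, 'm) emonad, ('o, 'm) emonad1, ('o, 'm) emonad2) two_category" where
  "EMnd = \<lparr>Cell0 = {S. extensive_monad S},
    Vert = mk_category {f. emonad_1cell f} {\<theta>. emonad_2cell \<theta>} e2s e2t
      (\<lambda>f. \<lparr>e2s = f, e2t = f, e2a = id_nat (e1P f)\<rparr>)
      (\<lambda>\<kappa> \<theta>. \<lparr>e2s = e2s \<theta>, e2t = e2t \<kappa>, e2a = e2a \<kappa> \<circ>\<^sub>V e2a \<theta>\<rparr>),
    src = e1s, trg = e1t, one = emonad_one, comp1 = emonad_comp1,
    comp2 = (\<lambda>\<kappa> \<theta>. \<lparr>e2s = emonad_comp1 (e2s \<kappa>) (e2s \<theta>), e2t = emonad_comp1 (e2t \<kappa>) (e2t \<theta>),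
      e2a = e2a \<kappa> \<star>\<^sub>h e2a \<theta>\<rparr>)\<rparr>"


section \<open>Classical monads\<close>

record ('o, 'm) cmonad =
  mS :: "('o, 'm, 'o, 'm) fctr"
  mEta :: "('o, 'm, 'o, 'm) ntrans"
  mMu :: "('o, 'm, 'o, 'm) ntrans"

abbreviation mC :: "('o, 'm) cmonad \<Rightarrow> ('o, 'm) category" where "mC M \<equiv> FDom (mS M)"

definition classical_monad :: "('o, 'm) cmonad \<Rightarrow> bool" where
  "classical_monad M \<longleftrightarrow>
    functor_from_to (mS M) (mC M) (mC M) \<and>
    nat_from_to (mEta M) (id_functor (mC M)) (mS M) \<and>
    nat_from_to (mMu M) (mS M \<circ>\<^sub>F mS M) (mS M) \<and>
    mMu M \<circ>\<^sub>V (mS M \<star>\<^sub>l mMu M) = mMu M \<circ>\<^sub>V (mMu M \<star>\<^sub>r mS M) \<and>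
    mMu M \<circ>\<^sub>V (mS M \<star>\<^sub>l mEta M) = id_nat (mS M) \<and>
    mMu M \<circ>\<^sub>V (mEta M \<star>\<^sub>r mS M) = id_nat (mS M)"

record ('o, 'm) cmonad1 =
  m1s :: "('o, 'm) cmonad"
  m1t :: "('o, 'm) cmonad"
  m1P :: "('o, 'm, 'o, 'm) fctr"
  m1phi :: "('o, 'm, 'o, 'm) ntrans"

definition cmonad_1cell :: "('o, 'm) cmonad1 \<Rightarrow> bool" where
  "cmonad_1cell f \<longleftrightarrow>
    classical_monad (m1s f) \<and> classical_monad (m1t f) \<and>
    functor_from_to (m1P f) (mC (m1s f)) (mC (m1t f)) \<and>
    nat_from_to (m1phi f) (mS (m1t f) \<circ>\<^sub>F m1P f) (m1P f \<circ>\<^sub>F mS (m1s f)) \<and>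
    m1phi f \<circ>\<^sub>V (mEta (m1t f) \<star>\<^sub>r m1P f) = m1P f \<star>\<^sub>l mEta (m1s f) \<and>
    m1phi f \<circ>\<^sub>V (mMu (m1t f) \<star>\<^sub>r m1P f) =
      (m1P f \<star>\<^sub>l mMu (m1s f)) \<circ>\<^sub>V (m1phi f \<star>\<^sub>r mS (m1s f)) \<circ>\<^sub>V (mS (m1t f) \<star>\<^sub>l m1phi f)"

record ('o, 'm) cmonad2 =
  m2s :: "('o, 'm) cmonad1"
  m2t :: "('o, 'm) cmonad1"
  m2a :: "('o, 'm, 'o, 'm) ntrans"

definition cmonad_2cell :: "('o, 'm) cmonad2 \<Rightarrow> bool" where
  "cmonad_2cell \<theta> \<longleftrightarrow>
    cmonad_1cell (m2s \<theta>) \<and> cmonad_1cell (m2t \<theta>) \<and>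
    m1s (m2t \<theta>) = m1s (m2s \<theta>) \<and> m1t (m2t \<theta>) = m1t (m2s \<theta>) \<and>
    nat_from_to (m2a \<theta>) (m1P (m2s \<theta>)) (m1P (m2t \<theta>)) \<and>
    m1phi (m2t \<theta>) \<circ>\<^sub>V (mS (m1t (m2s \<theta>)) \<star>\<^sub>l m2a \<theta>) =
      (m2a \<theta> \<star>\<^sub>r mS (m1s (m2s \<theta>))) \<circ>\<^sub>V m1phi (m2s \<theta>)"

definition cmonad_one :: "('o, 'm) cmonad \<Rightarrow> ('o, 'm) cmonad1" where
  "cmonad_one M = \<lparr>m1s = M, m1t = M, m1P = id_functor (mC M), m1phi = id_nat (mS M)\<rparr>"

definition cmonad_comp1 :: "('o, 'm) cmonad1 \<Rightarrow> ('o, 'm) cmonad1 \<Rightarrow> ('o, 'm) cmonad1" where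
  "cmonad_comp1 g f = \<lparr>m1s = m1s f, m1t = m1t g, m1P = m1P g \<circ>\<^sub>F m1P f,
    m1phi = (m1P g \<star>\<^sub>l m1phi f) \<circ>\<^sub>V (m1phi g \<star>\<^sub>r m1P f)\<rparr>"

definition MndE :: "(('o, 'm) cmonad, ('o, 'm) cmonad1, ('o, 'm) cmonad2) two_category" where
  "MndE = \<lparr>Cell0 = {M. classical_monad M},
    Vert = mk_category {f. cmonad_1cell f} {\<theta>. cmonad_2cell \<theta>} m2s m2t
      (\<lambda>f. \<lparr>m2s = f, m2t = f, m2a = id_nat (m1P f)\<rparr>)
      (\<lambda>\<kappa> \<theta>. \<lparr>m2s = m2s \<theta>, m2t = m2t \<kappa>, m2a = m2a \<kappa> \<circ>\<^sub>V m2a \<theta>\<rparr>),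
    src = m1s, trg = m1t, one = cmonad_one, comp1 = cmonad_comp1,
    comp2 = (\<lambda>\<kappa> \<theta>. \<lparr>m2s = cmonad_comp1 (m2s \<kappa>) (m2s \<theta>), m2t = cmonad_comp1 (m2t \<kappa>) (m2t \<theta>),
      m2a = m2a \<kappa> \<star>\<^sub>h m2a \<theta>\<rparr>)\<rparr>"

type_synonym ('o, 'm) calg = "'o \<times> 'm"
type_synonym ('o, 'm) calg_arr = "('o, 'm) calg \<times> 'm \<times> ('o, 'm) calg"

definition calgebra :: "('o, 'm) cmonad \<Rightarrow> ('o, 'm) calg \<Rightarrow> bool" where
  "calgebra M = (\<lambda>(N, n).
    N \<in> Obj (mC M) \<and> n \<in> Hom (mC M) (FObj (mS M) N) N \<and>
    n \<cdot>\<^bsub>mC M\<^esub> NCmp (mEta M) N = Ide (mC M) N \<and>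
    n \<cdot>\<^bsub>mC M\<^esub> FArr (mS M) n = n \<cdot>\<^bsub>mC M\<^esub> NCmp (mMu M) N)"

definition calg_hom :: "('o, 'm) cmonad \<Rightarrow> ('o, 'm) calg \<Rightarrow> 'm \<Rightarrow> ('o, 'm) calg \<Rightarrow> bool" where
  "calg_hom M A q B \<longleftrightarrow>
    q \<in> Hom (mC M) (fst A) (fst B) \<and>
    q \<cdot>\<^bsub>mC M\<^esub> snd A = snd B \<cdot>\<^bsub>mC M\<^esub> FArr (mS M) q"

definition CAlg :: "('o, 'm) cmonad \<Rightarrow> (('o, 'm) calg, ('o, 'm) calg_arr) category" where
  "CAlg M = mk_category {N. calgebra M N} {(A, q, B). calgebra M A \<and> calgebra M B \<and> calg_hom M A q B}
    fst (\<lambda>m. snd (snd m)) (\<lambda>N. (N, Ide (mC M) (fst N), N))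
    (\<lambda>g f. (fst f, fst (snd g) \<cdot>\<^bsub>mC M\<^esub> fst (snd f), snd (snd g)))"

definition cForget :: "('o, 'm) cmonad \<Rightarrow> (('o, 'm) calg, ('o, 'm) calg_arr, 'o, 'm) fctr" where
  "cForget M = \<lparr>FDom = CAlg M, FCod = mC M, FObj = restrict fst (Obj (CAlg M)),
    FArr = (\<lambda>m\<in>Arr (CAlg M). fst (snd m))\<rparr>"

definition cFree :: "('o, 'm) cmonad \<Rightarrow> ('o, 'm, ('o, 'm) calg, ('o, 'm) calg_arr) fctr" where
  "cFree M = (let fr = (\<lambda>A. (FObj (mS M) A, NCmp (mMu M) A)) in
    \<lparr>FDom = mC M, FCod = CAlg M, FObj = restrict fr (Obj (mC M)),
     FArr = (\<lambda>f\<in>Arr (mC M). (fr (Dom (mC M) f), FArr (mS M) f, fr (Cod (mC M) f)))\<rparr>)"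


section \<open>The horizontal 2-functors\<close>

definition F_0 :: "('o, 'm, 'x, 'y) uarr \<Rightarrow> ('o, 'm, 'x, 'y) adjn" where
  "F_0 U = (let
      L = \<lparr>FDom = uC U, FCod = uX U, FObj = uL U,
           FArr = (\<lambda>f\<in>Arr (uC U). uZeta U (uL U (Cod (uC U) f)) (uEta U (Cod (uC U) f) \<cdot>\<^bsub>uC U\<^esub> f))\<rparr>
    in \<lparr>aL = L, aR = uR U,
        aEta = \<lparr>NSrc = id_functor (uC U), NTrg = uR U \<circ>\<^sub>F L, NCmp = uEta U\<rparr>,
        aEps = \<lparr>NSrc = L \<circ>\<^sub>F uR U, NTrg = id_functor (uX U),
          NCmp = (\<lambda>X\<in>Obj (uX U). uZeta U X (Ide (uC U) (FObj (uR U) X)))\<rparr>\<rparr>)"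

definition F_1 :: "('o, 'm, 'x, 'y) uarr1 \<Rightarrow> ('o, 'm, 'x, 'y) adjn1" where
  "F_1 f = \<lparr>a1s = F_0 (u1s f), a1t = F_0 (u1t f), a1J = u1J f, a1V = u1V f, a1rho = u1rho f,
    a1lam = \<lparr>NSrc = aL (F_0 (u1t f)) \<circ>\<^sub>F u1J f, NTrg = u1V f \<circ>\<^sub>F aL (F_0 (u1s f)),
      NCmp = (\<lambda>A\<in>Obj (uC (u1s f)). uZeta (u1t f) (FObj (u1V f) (uL (u1s f) A))
        (NCmp (u1rho f) (uL (u1s f) A) \<cdot>\<^bsub>uC (u1t f)\<^esub> FArr (u1J f) (uEta (u1s f) A)))\<rparr>\<rparr>"

definition F_2f ::
  "(('o, 'm, 'x, 'y) uarr, ('o, 'm, 'x, 'y) uarr1, ('o, 'm, 'x, 'y) uarr2,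
    ('o, 'm, 'x, 'y) adjn, ('o, 'm, 'x, 'y) adjn1, ('o, 'm, 'x, 'y) adjn2) two_fctr" where
  "F_2f = \<lparr>F0 = F_0, F1 = F_1,
    F2 = (\<lambda>\<theta>. \<lparr>a2s = F_1 (u2s \<theta>), a2t = F_1 (u2t \<theta>), a2a = u2a \<theta>, a2b = u2b \<theta>\<rparr>)\<rparr>"

definition G_0 :: "('o, 'm, 'x, 'y) adjn \<Rightarrow> ('o, 'm, 'x, 'y) uarr" where
  "G_0 A = \<lparr>uR = aR A, uL = FObj (aL A), uEta = NCmp (aEta A),
    uZeta = (\<lambda>X\<in>Obj (aX A). \<lambda>v\<in>Into (aC A) (FObj (aR A) X).
      NCmp (aEps A) X \<cdot>\<^bsub>aX A\<^esub> FArr (aL A) v)\<rparr>"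

definition G_1 :: "('o, 'm, 'x, 'y) adjn1 \<Rightarrow> ('o, 'm, 'x, 'y) uarr1" where
  "G_1 f = \<lparr>u1s = G_0 (a1s f), u1t = G_0 (a1t f), u1J = a1J f, u1V = a1V f, u1rho = a1rho f\<rparr>"

definition G_2f ::
  "(('o, 'm, 'x, 'y) adjn, ('o, 'm, 'x, 'y) adjn1, ('o, 'm, 'x, 'y) adjn2,
    ('o, 'm, 'x, 'y) uarr, ('o, 'm, 'x, 'y) uarr1, ('o, 'm, 'x, 'y) uarr2) two_fctr" where
  "G_2f = \<lparr>F0 = G_0, F1 = G_1,
    F2 = (\<lambda>\<theta>. \<lparr>u2s = G_1 (a2s \<theta>), u2t = G_1 (a2t \<theta>), u2a = a2a \<theta>, u2b = a2b \<theta>\<rparr>)\<rparr>"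

definition H_0 :: "('o, 'm) emonad \<Rightarrow> ('o, 'm) cmonad" where
  "H_0 S = (let
      T = \<lparr>FDom = eC S, FCod = eC S, FObj = eS S,
           FArr = (\<lambda>f\<in>Arr (eC S). eExt S (Cod (eC S) f) (eEta S (Cod (eC S) f) \<cdot>\<^bsub>eC S\<^esub> f))\<rparr>
    in \<lparr>mS = T,
        mEta = \<lparr>NSrc = id_functor (eC S), NTrg = T, NCmp = eEta S\<rparr>,
        mMu = \<lparr>NSrc = T \<circ>\<^sub>F T, NTrg = T, NCmp = (\<lambda>A\<in>Obj (eC S). eExt S A (Ide (eC S) (eS S A)))\<rparr>\<rparr>)"

definition H_1 :: "('o, 'm) emonad1 \<Rightarrow> ('o, 'm) cmonad1" where
  "H_1 f = \<lparr>m1s = H_0 (e1s f), m1t = H_0 (e1t f), m1P = e1P f,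
    m1phi = \<lparr>NSrc = mS (H_0 (e1t f)) \<circ>\<^sub>F e1P f, NTrg = e1P f \<circ>\<^sub>F mS (H_0 (e1s f)),
      NCmp = (\<lambda>A\<in>Obj (eC (e1s f)). e1Ext f A (FArr (e1P f) (eEta (e1s f) A)))\<rparr>\<rparr>"

definition H_2f ::
  "(('o, 'm) emonad, ('o, 'm) emonad1, ('o, 'm) emonad2,
    ('o, 'm) cmonad, ('o, 'm) cmonad1, ('o, 'm) cmonad2) two_fctr" where
  "H_2f = \<lparr>F0 = H_0, F1 = H_1, F2 = (\<lambda>\<theta>. \<lparr>m2s = H_1 (e2s \<theta>), m2t = H_1 (e2t \<theta>), m2a = e2a \<theta>\<rparr>)\<rparr>"

definition K_0 :: "('o, 'm) cmonad \<Rightarrow> ('o, 'm) emonad" where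
  "K_0 M = \<lparr>eC = mC M, eS = FObj (mS M), eEta = NCmp (mEta M),
    eExt = (\<lambda>B\<in>Obj (mC M). \<lambda>h\<in>Into (mC M) (FObj (mS M) B). NCmp (mMu M) B \<cdot>\<^bsub>mC M\<^esub> FArr (mS M) h)\<rparr>"

definition K_1 :: "('o, 'm) cmonad1 \<Rightarrow> ('o, 'm) emonad1" where
  "K_1 f = \<lparr>e1s = K_0 (m1s f), e1t = K_0 (m1t f), e1P = m1P f,
    e1Ext = (\<lambda>A\<in>Obj (mC (m1s f)). \<lambda>r\<in>Into (mC (m1t f)) (FObj (m1P f) (FObj (mS (m1s f)) A)).
      FArr (m1P f) (NCmp (mMu (m1s f)) A) \<cdot>\<^bsub>mC (m1t f)\<^esub>
      NCmp (m1phi f) (FObj (mS (m1s f)) A) \<cdot>\<^bsub>mC (m1t f)\<^esub> FArr (mS (m1t f)) r)\<rparr>"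

definition K_2f ::
  "(('o, 'm) cmonad, ('o, 'm) cmonad1, ('o, 'm) cmonad2,
    ('o, 'm) emonad, ('o, 'm) emonad1, ('o, 'm) emonad2) two_fctr" where
  "K_2f = \<lparr>F0 = K_0, F1 = K_1, F2 = (\<lambda>\<theta>. \<lparr>e2s = K_1 (m2s \<theta>), e2t = K_1 (m2t \<theta>), e2a = m2a \<theta>\<rparr>)\<rparr>"


section \<open>The vertical 2-functors to monads\<close>

definition Phi_0 :: "('o, 'm, 'x, 'y) uarr \<Rightarrow> ('o, 'm) emonad" where
  "Phi_0 U = \<lparr>eC = uC U, eS = (\<lambda>A\<in>Obj (uC U). FObj (uR U) (uL U A)), eEta = uEta U,
    eExt = (\<lambda>B\<in>Obj (uC U). \<lambda>h\<in>Into (uC U) (FObj (uR U) (uL U B)). FArr (uR U) (uZeta U (uL U B) h))\<rparr>"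

definition Phi_1 :: "('o, 'm, 'x, 'y) uarr1 \<Rightarrow> ('o, 'm) emonad1" where
  "Phi_1 f = \<lparr>e1s = Phi_0 (u1s f), e1t = Phi_0 (u1t f), e1P = u1J f,
    e1Ext = (\<lambda>A\<in>Obj (uC (u1s f)).
      let LA = uL (u1s f) A in
      (\<lambda>p\<in>Into (uC (u1t f)) (FObj (u1J f) (FObj (uR (u1s f)) LA)).
        NCmp (nat_inv (u1rho f)) LA \<cdot>\<^bsub>uC (u1t f)\<^esub>
        FArr (uR (u1t f)) (uZeta (u1t f) (FObj (u1V f) LA) (NCmp (u1rho f) LA \<cdot>\<^bsub>uC (u1t f)\<^esub> p))))\<rparr>"

definition Phi ::
  "(('o, 'm, 'x, 'y) uarr, ('o, 'm, 'x, 'y) uarr1, ('o, 'm, 'x, 'y) uarr2,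
    ('o, 'm) emonad, ('o, 'm) emonad1, ('o, 'm) emonad2) two_fctr" where
  "Phi = \<lparr>F0 = Phi_0, F1 = Phi_1,
    F2 = (\<lambda>\<theta>. \<lparr>e2s = Phi_1 (u2s \<theta>), e2t = Phi_1 (u2t \<theta>), e2a = u2a \<theta>\<rparr>)\<rparr>"

definition PhiE_0 :: "('o, 'm, 'x, 'y) adjn \<Rightarrow> ('o, 'm) cmonad" where
  "PhiE_0 A = \<lparr>mS = aR A \<circ>\<^sub>F aL A, mEta = aEta A, mMu = aR A \<star>\<^sub>l (aEps A \<star>\<^sub>r aL A)\<rparr>"

definition PhiE_1 :: "('o, 'm, 'x, 'y) adjn1 \<Rightarrow> ('o, 'm) cmonad1" where
  "PhiE_1 f = \<lparr>m1s = PhiE_0 (a1s f), m1t = PhiE_0 (a1t f), m1P = a1J f,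
    m1phi = (nat_inv (a1rho f) \<star>\<^sub>r aL (a1s f)) \<circ>\<^sub>V (aR (a1t f) \<star>\<^sub>l a1lam f)\<rparr>"

definition PhiE ::
  "(('o, 'm, 'x, 'y) adjn, ('o, 'm, 'x, 'y) adjn1, ('o, 'm, 'x, 'y) adjn2,
    ('o, 'm) cmonad, ('o, 'm) cmonad1, ('o, 'm) cmonad2) two_fctr" where
  "PhiE = \<lparr>F0 = PhiE_0, F1 = PhiE_1,
    F2 = (\<lambda>\<theta>. \<lparr>m2s = PhiE_1 (a2s \<theta>), m2t = PhiE_1 (a2t \<theta>), m2a = a2a \<theta>\<rparr>)\<rparr>"


section \<open>The vertical 2-functors to universal arrows and adjunctions\<close>

text \<open>
  The constructions with values in the categories of algebras themselves come first. These
  categories live in types built from those of the base category; to have \<open>Psi\<close> and \<open>PsiE\<close> land in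
  the 2-categories \<open>UArr\<close> and \<open>AdjR\<close> on which \<open>Phi\<close> and \<open>PhiE\<close> are defined, where the domain
  category of the right adjoint has arbitrary types \<open>'x\<close> and \<open>'y\<close>, they are afterwards renamed
  along injections of algebras into \<open>'x\<close> and of algebra morphisms into \<open>'y\<close>.
\<close>

definition Psi_0 :: "('o, 'm) emonad \<Rightarrow> ('o, 'm, ('o, 'm) ealg, ('o, 'm) ealg_arr) uarr" where
  "Psi_0 S = \<lparr>uR = eForget S, uL = eFree S, uEta = eEta S,
    uZeta = (\<lambda>N\<in>Obj (EAlg S). \<lambda>v\<in>Into (eC S) (fst N). (eFree S (Dom (eC S) v), snd N v, N))\<rparr>"

definition ehat_obj :: "('o, 'm) emonad1 \<Rightarrow> ('o, 'm) ealg \<Rightarrow> ('o, 'm) ealg" where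
  "ehat_obj f = (\<lambda>(N, n). (FObj (e1P f) N,
    \<lambda>q\<in>Into (eC (e1t f)) (FObj (e1P f) N).
      FArr (e1P f) (n (Ide (eC (e1s f)) N)) \<cdot>\<^bsub>eC (e1t f)\<^esub>
      e1Ext f N (FArr (e1P f) (eEta (e1s f) N) \<cdot>\<^bsub>eC (e1t f)\<^esub> q)))"

definition ehat ::
  "('o, 'm) emonad1 \<Rightarrow> (('o, 'm) ealg, ('o, 'm) ealg_arr, ('o, 'm) ealg, ('o, 'm) ealg_arr) fctr" where
  "ehat f = \<lparr>FDom = EAlg (e1s f), FCod = EAlg (e1t f),
    FObj = restrict (ehat_obj f) (Obj (EAlg (e1s f))),
    FArr = (\<lambda>(M, q, N)\<in>Arr (EAlg (e1s f)). (ehat_obj f M, FArr (e1P f) q, ehat_obj f N))\<rparr>"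

definition Psi_1 :: "('o, 'm) emonad1 \<Rightarrow> ('o, 'm, ('o, 'm) ealg, ('o, 'm) ealg_arr) uarr1" where
  "Psi_1 f = \<lparr>u1s = Psi_0 (e1s f), u1t = Psi_0 (e1t f), u1J = e1P f, u1V = ehat f,
    u1rho = id_nat (e1P f \<circ>\<^sub>F eForget (e1s f))\<rparr>"

definition Psi_2 :: "('o, 'm) emonad2 \<Rightarrow> ('o, 'm, ('o, 'm) ealg, ('o, 'm) ealg_arr) uarr2" where
  "Psi_2 \<theta> = \<lparr>u2s = Psi_1 (e2s \<theta>), u2t = Psi_1 (e2t \<theta>), u2a = e2a \<theta>,
    u2b = \<lparr>NSrc = ehat (e2s \<theta>), NTrg = ehat (e2t \<theta>),
      NCmp = (\<lambda>N\<in>Obj (EAlg (e1s (e2s \<theta>))).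
        (ehat_obj (e2s \<theta>) N, NCmp (e2a \<theta>) (fst N), ehat_obj (e2t \<theta>) N))\<rparr>\<rparr>"

definition PsiE_0 :: "('o, 'm) cmonad \<Rightarrow> ('o, 'm, ('o, 'm) calg, ('o, 'm) calg_arr) adjn" where
  "PsiE_0 M = \<lparr>aL = cFree M, aR = cForget M,
    aEta = \<lparr>NSrc = id_functor (mC M), NTrg = cForget M \<circ>\<^sub>F cFree M, NCmp = NCmp (mEta M)\<rparr>,
    aEps = \<lparr>NSrc = cFree M \<circ>\<^sub>F cForget M, NTrg = id_functor (CAlg M),
      NCmp = (\<lambda>N\<in>Obj (CAlg M). (FObj (cFree M) (fst N), snd N, N))\<rparr>\<rparr>"

definition cbar_obj :: "('o, 'm) cmonad1 \<Rightarrow> ('o, 'm) calg \<Rightarrow> ('o, 'm) calg" where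
  "cbar_obj f = (\<lambda>(N, n). (FObj (m1P f) N, FArr (m1P f) n \<cdot>\<^bsub>mC (m1t f)\<^esub> NCmp (m1phi f) N))"

definition cbar ::
  "('o, 'm) cmonad1 \<Rightarrow> (('o, 'm) calg, ('o, 'm) calg_arr, ('o, 'm) calg, ('o, 'm) calg_arr) fctr" where
  "cbar f = \<lparr>FDom = CAlg (m1s f), FCod = CAlg (m1t f),
    FObj = restrict (cbar_obj f) (Obj (CAlg (m1s f))),
    FArr = (\<lambda>(A, q, B)\<in>Arr (CAlg (m1s f)). (cbar_obj f A, FArr (m1P f) q, cbar_obj f B))\<rparr>"

definition PsiE_1 :: "('o, 'm) cmonad1 \<Rightarrow> ('o, 'm, ('o, 'm) calg, ('o, 'm) calg_arr) adjn1" where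
  "PsiE_1 f = \<lparr>a1s = PsiE_0 (m1s f), a1t = PsiE_0 (m1t f), a1J = m1P f, a1V = cbar f,
    a1rho = id_nat (m1P f \<circ>\<^sub>F cForget (m1s f)),
    a1lam = mate (PsiE_0 (m1s f)) (PsiE_0 (m1t f)) (m1P f) (cbar f) (id_nat (m1P f \<circ>\<^sub>F cForget (m1s f)))\<rparr>"

definition PsiE_2 :: "('o, 'm) cmonad2 \<Rightarrow> ('o, 'm, ('o, 'm) calg, ('o, 'm) calg_arr) adjn2" where
  "PsiE_2 \<theta> = \<lparr>a2s = PsiE_1 (m2s \<theta>), a2t = PsiE_1 (m2t \<theta>), a2a = m2a \<theta>,
    a2b = \<lparr>NSrc = cbar (m2s \<theta>), NTrg = cbar (m2t \<theta>),
      NCmp = (\<lambda>N\<in>Obj (CAlg (m1s (m2s \<theta>))).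
        (cbar_obj (m2s \<theta>) N, NCmp (m2a \<theta>) (fst N), cbar_obj (m2t \<theta>) N))\<rparr>\<rparr>"

subsection \<open>Renaming objects and arrows\<close>

definition rename :: "('a \<Rightarrow> 'x) \<Rightarrow> ('b \<Rightarrow> 'y) \<Rightarrow> ('a, 'b) category \<Rightarrow> ('x, 'y) category" where
  "rename i j C = (let j' = inv_into (Arr C) j in
    mk_category (i ` Obj C) (j ` Arr C) (\<lambda>f. i (Dom C (j' f))) (\<lambda>f. i (Cod C (j' f)))
      (\<lambda>A. j (Ide C (inv_into (Obj C) i A))) (\<lambda>g f. j (j' g \<cdot>\<^bsub>C\<^esub> j' f)))"

definition enc :: "('a \<Rightarrow> 'x) \<Rightarrow> ('b \<Rightarrow> 'y) \<Rightarrow> ('a, 'b) category \<Rightarrow> ('a, 'b, 'x, 'y) fctr" where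
  "enc i j C = \<lparr>FDom = C, FCod = rename i j C, FObj = restrict i (Obj C), FArr = restrict j (Arr C)\<rparr>"

definition dec :: "('a \<Rightarrow> 'x) \<Rightarrow> ('b \<Rightarrow> 'y) \<Rightarrow> ('a, 'b) category \<Rightarrow> ('x, 'y, 'a, 'b) fctr" where
  "dec i j C = \<lparr>FDom = rename i j C, FCod = C,
    FObj = restrict (inv_into (Obj C) i) (i ` Obj C), FArr = restrict (inv_into (Arr C) j) (j ` Arr C)\<rparr>"

definition rename_uarr ::
  "('a \<Rightarrow> 'x) \<Rightarrow> ('b \<Rightarrow> 'y) \<Rightarrow> ('o, 'm, 'a, 'b) uarr \<Rightarrow> ('o, 'm, 'x, 'y) uarr" where
  "rename_uarr i j U = (let D = dec i j (uX U) in
    \<lparr>uR = uR U \<circ>\<^sub>F D, uL = (\<lambda>A\<in>Obj (uC U). i (uL U A)), uEta = uEta U,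
     uZeta = (\<lambda>X\<in>i ` Obj (uX U). \<lambda>v\<in>Into (uC U) (FObj (uR U) (FObj D X)). j (uZeta U (FObj D X) v))\<rparr>)"

definition rename_adjn ::
  "('a \<Rightarrow> 'x) \<Rightarrow> ('b \<Rightarrow> 'y) \<Rightarrow> ('o, 'm, 'a, 'b) adjn \<Rightarrow> ('o, 'm, 'x, 'y) adjn" where
  "rename_adjn i j A = (let E = enc i j (aX A); D = dec i j (aX A) in
    \<lparr>aL = E \<circ>\<^sub>F aL A, aR = aR A \<circ>\<^sub>F D,
     aEta = \<lparr>NSrc = id_functor (aC A), NTrg = (aR A \<circ>\<^sub>F D) \<circ>\<^sub>F (E \<circ>\<^sub>F aL A), NCmp = NCmp (aEta A)\<rparr>,
     aEps = \<lparr>NSrc = (E \<circ>\<^sub>F aL A) \<circ>\<^sub>F (aR A \<circ>\<^sub>F D), NTrg = id_functor (rename i j (aX A)),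
       NCmp = (\<lambda>X\<in>i ` Obj (aX A). j (NCmp (aEps A) (FObj D X)))\<rparr>\<rparr>)"

text \<open>
  The families \<open>i\<close> and \<open>j\<close> of injections below are indexed by the monad: the code of an algebra may
  depend on it, and injectivity matters only within one category of algebras at a time.
\<close>

definition Psi_enc1 ::
  "(('o, 'm) emonad \<Rightarrow> ('o, 'm) ealg \<Rightarrow> 'x) \<Rightarrow> (('o, 'm) emonad \<Rightarrow> ('o, 'm) ealg_arr \<Rightarrow> 'y)
    \<Rightarrow> ('o, 'm) emonad1 \<Rightarrow> ('o, 'm, 'x, 'y) uarr1" where
  "Psi_enc1 i j f = (let
      D = dec (i (e1s f)) (j (e1s f)) (EAlg (e1s f));
      E = enc (i (e1t f)) (j (e1t f)) (EAlg (e1t f))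
    in \<lparr>u1s = rename_uarr (i (e1s f)) (j (e1s f)) (u1s (Psi_1 f)),
        u1t = rename_uarr (i (e1t f)) (j (e1t f)) (u1t (Psi_1 f)),
        u1J = u1J (Psi_1 f), u1V = E \<circ>\<^sub>F u1V (Psi_1 f) \<circ>\<^sub>F D, u1rho = u1rho (Psi_1 f) \<star>\<^sub>r D\<rparr>)"

definition Psi ::
  "(('o, 'm) emonad \<Rightarrow> ('o, 'm) ealg \<Rightarrow> 'x) \<Rightarrow> (('o, 'm) emonad \<Rightarrow> ('o, 'm) ealg_arr \<Rightarrow> 'y)
    \<Rightarrow> (('o, 'm) emonad, ('o, 'm) emonad1, ('o, 'm) emonad2,
    ('o, 'm, 'x, 'y) uarr, ('o, 'm, 'x, 'y) uarr1, ('o, 'm, 'x, 'y) uarr2) two_fctr" where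
  "Psi i j = \<lparr>F0 = (\<lambda>S. rename_uarr (i S) (j S) (Psi_0 S)), F1 = Psi_enc1 i j,
    F2 = (\<lambda>\<theta>. let S = e1s (e2s \<theta>); T = e1t (e2s \<theta>) in
      \<lparr>u2s = Psi_enc1 i j (e2s \<theta>), u2t = Psi_enc1 i j (e2t \<theta>), u2a = u2a (Psi_2 \<theta>),
       u2b = enc (i T) (j T) (EAlg T) \<star>\<^sub>l (u2b (Psi_2 \<theta>) \<star>\<^sub>r dec (i S) (j S) (EAlg S))\<rparr>)\<rparr>"

definition PsiE_enc1 ::
  "(('o, 'm) cmonad \<Rightarrow> ('o, 'm) calg \<Rightarrow> 'x) \<Rightarrow> (('o, 'm) cmonad \<Rightarrow> ('o, 'm) calg_arr \<Rightarrow> 'y)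
    \<Rightarrow> ('o, 'm) cmonad1 \<Rightarrow> ('o, 'm, 'x, 'y) adjn1" where
  "PsiE_enc1 i j f = (let
      D = dec (i (m1s f)) (j (m1s f)) (CAlg (m1s f));
      E = enc (i (m1t f)) (j (m1t f)) (CAlg (m1t f))
    in \<lparr>a1s = rename_adjn (i (m1s f)) (j (m1s f)) (a1s (PsiE_1 f)),
        a1t = rename_adjn (i (m1t f)) (j (m1t f)) (a1t (PsiE_1 f)),
        a1J = a1J (PsiE_1 f), a1V = E \<circ>\<^sub>F a1V (PsiE_1 f) \<circ>\<^sub>F D, a1rho = a1rho (PsiE_1 f) \<star>\<^sub>r D,
        a1lam = E \<star>\<^sub>l a1lam (PsiE_1 f)\<rparr>)"

definition PsiE ::
  "(('o, 'm) cmonad \<Rightarrow> ('o, 'm) calg \<Rightarrow> 'x) \<Rightarrow> (('o, 'm) cmonad \<Rightarrow> ('o, 'm) calg_arr \<Rightarrow> 'y)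
    \<Rightarrow> (('o, 'm) cmonad, ('o, 'm) cmonad1, ('o, 'm) cmonad2,
    ('o, 'm, 'x, 'y) adjn, ('o, 'm, 'x, 'y) adjn1, ('o, 'm, 'x, 'y) adjn2) two_fctr" where
  "PsiE i j = \<lparr>F0 = (\<lambda>M. rename_adjn (i M) (j M) (PsiE_0 M)), F1 = PsiE_enc1 i j,
    F2 = (\<lambda>\<theta>. let S = m1s (m2s \<theta>); T = m1t (m2s \<theta>) in
      \<lparr>a2s = PsiE_enc1 i j (m2s \<theta>), a2t = PsiE_enc1 i j (m2t \<theta>), a2a = a2a (PsiE_2 \<theta>),
       a2b = enc (i T) (j T) (CAlg T) \<star>\<^sub>l (a2b (PsiE_2 \<theta>) \<star>\<^sub>r dec (i S) (j S) (CAlg S))\<rparr>)\<rparr>"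


section \<open>Extensive versus classical algebras\<close>

text \<open>
  An algebra of an extensive monad and an algebra of the corresponding classical monad are
  different kinds of data, identified along the isomorphism of categories which sends an algebra
  structure to its value at the identity.
\<close>

definition alg_iso ::
  "('o, 'm) emonad \<Rightarrow> (('o, 'm) ealg, ('o, 'm) ealg_arr, ('o, 'm) calg, ('o, 'm) calg_arr) fctr" where
  "alg_iso S = (let c = (\<lambda>(N, n). (N, n (Ide (eC S) N))) in
    \<lparr>FDom = EAlg S, FCod = CAlg (H_0 S), FObj = restrict c (Obj (EAlg S)),
     FArr = (\<lambda>(M, q, N)\<in>Arr (EAlg S). (c M, q, c N))\<rparr>)"

definition alg_iso_enc ::
  "(('o, 'm) emonad \<Rightarrow> ('o, 'm) ealg \<Rightarrow> 'x) \<Rightarrow> (('o, 'm) emonad \<Rightarrow> ('o, 'm) ealg_arr \<Rightarrow> 'y)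
    \<Rightarrow> (('o, 'm) cmonad \<Rightarrow> ('o, 'm) calg \<Rightarrow> 'x) \<Rightarrow> (('o, 'm) cmonad \<Rightarrow> ('o, 'm) calg_arr \<Rightarrow> 'y)
    \<Rightarrow> ('o, 'm) emonad \<Rightarrow> ('x, 'y, 'x, 'y) fctr" where
  "alg_iso_enc iX jX iE jE S =
    enc (iE (H_0 S)) (jE (H_0 S)) (CAlg (H_0 S)) \<circ>\<^sub>F alg_iso S \<circ>\<^sub>F dec (iX S) (jX S) (EAlg S)"

definition adjn_comparison ::
  "(('o, 'm) emonad \<Rightarrow> ('o, 'm) ealg \<Rightarrow> 'x) \<Rightarrow> (('o, 'm) emonad \<Rightarrow> ('o, 'm) ealg_arr \<Rightarrow> 'y)
    \<Rightarrow> (('o, 'm) cmonad \<Rightarrow> ('o, 'm) calg \<Rightarrow> 'x) \<Rightarrow> (('o, 'm) cmonad \<Rightarrow> ('o, 'm) calg_arr \<Rightarrow> 'y)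
    \<Rightarrow> ('o, 'm) emonad \<Rightarrow> ('o, 'm, 'x, 'y) adjn1" where
  "adjn_comparison iX jX iE jE S = (let
      A = F0 (F_2f \<circ>\<^sub>2 Psi iX jX) S; B = F0 (PsiE iE jE \<circ>\<^sub>2 H_2f) S
    in \<lparr>a1s = A, a1t = B, a1J = id_functor (eC S), a1V = alg_iso_enc iX jX iE jE S,
        a1rho = id_nat (aR A), a1lam = id_nat (aL B)\<rparr>)"

definition uarr_comparison ::
  "(('o, 'm) emonad \<Rightarrow> ('o, 'm) ealg \<Rightarrow> 'x) \<Rightarrow> (('o, 'm) emonad \<Rightarrow> ('o, 'm) ealg_arr \<Rightarrow> 'y)
    \<Rightarrow> (('o, 'm) cmonad \<Rightarrow> ('o, 'm) calg \<Rightarrow> 'x) \<Rightarrow> (('o, 'm) cmonad \<Rightarrow> ('o, 'm) calg_arr \<Rightarrow> 'y)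
    \<Rightarrow> ('o, 'm) cmonad \<Rightarrow> ('o, 'm, 'x, 'y) uarr1" where
  "uarr_comparison iX jX iE jE M = (let
      A = F0 (Psi iX jX \<circ>\<^sub>2 K_2f) M; B = F0 (G_2f \<circ>\<^sub>2 PsiE iE jE) M
    in \<lparr>u1s = A, u1t = B, u1J = id_functor (mC M), u1V = alg_iso_enc iX jX iE jE (K_0 M),
        u1rho = id_nat (uR A)\<rparr>)"

end

theory Submission
  imports Defs
begin

text \<open>
  A universal arrow and an adjunction are two presentations of one structure, and so are an
  extensive and a classical monad. The universal property determines the functor \<open>L\<close>, the counit
  and the mates; the extension operation and the multiplication determine each other by
  \<open>h\<^sup>S = \<mu> \<cdot> S h\<close> and \<open>\<mu> = 1\<^sup>S\<close>. The translations \<open>F\<close>, \<open>G\<close> and \<open>H\<close>, \<open>K\<close> are therefore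
  bijective on cells. The axioms of a 2-category are verified for \<open>UArr\<close> and \<open>EMnd\<close> only and
  carried over to \<open>AdjR\<close> and \<open>MndE\<close> (\<open>mutually_inverse_transport\<close>, \<open>UArr_AdjR_inverse\<close>,
  \<open>EMnd_MndE_inverse\<close>).

  The left-hand side of the square rests on the action of 1-cells of extensive monads on algebras
  (\<open>ehat_obj\<close>). An algebra \<open>N\<close> with \<open>a = 1\<^sup>N\<close> is a retract of the free algebra \<open>S N\<close>, with
  section \<open>\<eta>\<close>, so an algebra structure on \<open>P S N\<close> induces one on \<open>P N\<close>. Composition of 1-cells is
  this action applied to the algebras which make up a 1-cell (\<open>e1Alg_comp1\<close>), and the laws of
  \<open>EMnd\<close> express its functoriality. For a universal arrow every \<open>R X\<close> is an algebra of the
  associated monad, and a 1-cell \<open>(J, V, \<rho>)\<close> gives an algebra \<open>J R X\<close> by transport along \<open>\<rho>\<close>.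
  The induced action takes the first algebra to the second (\<open>ehat_obj_cmp_alg\<close>); this makes \<open>\<Phi>\<close>
  preserve composition. In the other direction \<open>\<Psi>\<close> takes algebras, \<open>\<Phi> \<Psi>\<close> is the identity, and
  the comparison of a universal arrow with the algebras of its monad is the unit of a 2-adjunction
  (\<open>two_adjunction_Phi_Psi\<close>).

  The equation \<open>H \<Phi> = \<Phi>\<^sub>E F\<close> is a computation (\<open>HPhi_eq_PhiEF\<close>). For \<open>F \<Psi> = \<Psi>\<^sub>E H\<close>, extensive
  and classical algebras are different data, identified by an isomorphism of categories. Call codes
  the injections along which the categories of algebras are renamed. If the codes of corresponding
  algebras agree, then the renamed categories are equal and the equation holds
  (\<open>FPsi_eq_PsiEH\<close>). The assertions about \<open>\<Phi>\<^sub>E\<close> and \<open>\<Psi>\<^sub>E\<close> now follow from those about \<open>\<Phi>\<close> and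
  \<open>\<Psi>\<close> by cancelling the isomorphisms \<open>F\<close>, \<open>G\<close>, \<open>H\<close>, \<open>K\<close>: that they are 2-functors, the two
  remaining equations (\<open>square_conjugate\<close>), and the 2-adjunction between \<open>\<Phi>\<^sub>E\<close> and \<open>\<Psi>\<^sub>E\<close>
  (\<open>two_adjunction_transport\<close>). For unrelated codes, two choices of codes of extensive algebras
  give isomorphic 2-functors \<open>\<Psi>\<close> (\<open>Psi_recode\<close>). Changing to codes that match those of the
  classical algebras yields the comparison transformations.
\<close>

section \<open>Calculus of categories, functors and transformations\<close>

lemma mem_Hom [simp]: "f \<in> Hom C A B \<longleftrightarrow> f \<in> Arr C \<and> Dom C f = A \<and> Cod C f = B"
  by (simp add: Hom_def)

lemma mem_Into [simp]: "f \<in> Into C B \<longleftrightarrow> f \<in> Arr C \<and> Cod C f = B"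
  by (simp add: Into_def)

lemma Dom_Obj [simp]: "category C \<Longrightarrow> f \<in> Arr C \<Longrightarrow> Dom C f \<in> Obj C"
  using category.Dom_closed[of C] by auto

lemma Cod_Obj [simp]: "category C \<Longrightarrow> f \<in> Arr C \<Longrightarrow> Cod C f \<in> Obj C"
  using category.Cod_closed[of C] by auto

lemma Ide_simps [simp]:
  assumes "category C" "A \<in> Obj C"
  shows "Ide C A \<in> Arr C" "Dom C (Ide C A) = A" "Cod C (Ide C A) = A"
  using category.Ide_Hom[OF assms] by auto

lemma Cmp_simps [simp]:
  assumes "category C" "f \<in> Arr C" "g \<in> Arr C" "Dom C g = Cod C f"
  shows "g \<cdot>\<^bsub>C\<^esub> f \<in> Arr C" "Dom C (g \<cdot>\<^bsub>C\<^esub> f) = Dom C f" "Cod C (g \<cdot>\<^bsub>C\<^esub> f) = Cod C g"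
  using category.Cmp_Hom[OF assms(1), of f "Dom C f" "Cod C f" g "Cod C g"] assms by auto

lemma Cmp_Ide_left [simp]: "category C \<Longrightarrow> f \<in> Arr C \<Longrightarrow> A = Cod C f \<Longrightarrow> Ide C A \<cdot>\<^bsub>C\<^esub> f = f"
  using category.Ide_left[of C f] by simp

lemma Cmp_Ide_right [simp]: "category C \<Longrightarrow> f \<in> Arr C \<Longrightarrow> A = Dom C f \<Longrightarrow> f \<cdot>\<^bsub>C\<^esub> Ide C A = f"
  using category.Ide_right[of C f] by simp

lemma Cmp_assoc [simp]:
  assumes "category C" "f \<in> Arr C" "g \<in> Arr C" "h \<in> Arr C" "Dom C g = Cod C f" "Dom C h = Cod C g"
  shows "(h \<cdot>\<^bsub>C\<^esub> g) \<cdot>\<^bsub>C\<^esub> f = h \<cdot>\<^bsub>C\<^esub> (g \<cdot>\<^bsub>C\<^esub> f)"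
  using category.Cmp_assoc[OF assms(1), of f "Dom C f" "Cod C f" g "Cod C g" h "Cod C h"] assms by simp

text \<open>
  With composition normalised to the right, an equation between composites of two arrows has
  to be applied to the first two factors of a longer composite.
\<close>

lemma Cmp_extend:
  assumes "g \<cdot>\<^bsub>C\<^esub> f = k" "category C" "f \<in> Arr C" "g \<in> Arr C" "x \<in> Arr C"
    "Dom C g = Cod C f" "Dom C f = Cod C x"
  shows "g \<cdot>\<^bsub>C\<^esub> (f \<cdot>\<^bsub>C\<^esub> x) = k \<cdot>\<^bsub>C\<^esub> x"
  using assms by (metis Cmp_assoc)

lemma iso_cancel_left:
  assumes "category C" "i \<in> Arr C" "j \<in> Arr C" "Dom C j = Cod C i" "j \<cdot>\<^bsub>C\<^esub> i = Ide C (Dom C i)"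
    and "f \<in> Arr C" "g \<in> Arr C" "Cod C f = Dom C i" "Cod C g = Dom C i"
    and "i \<cdot>\<^bsub>C\<^esub> f = i \<cdot>\<^bsub>C\<^esub> g"
  shows "f = g"
proof -
  have "j \<cdot>\<^bsub>C\<^esub> (i \<cdot>\<^bsub>C\<^esub> f) = f" "j \<cdot>\<^bsub>C\<^esub> (i \<cdot>\<^bsub>C\<^esub> g) = g"
    using assms(1-4,6-9) by (simp_all add: Cmp_extend[OF assms(5)])
  with assms(10) show ?thesis by metis
qed

lemma mk_category_simps [simp]:
  "Obj (mk_category Ob Ar d c i m) = Ob"
  "Arr (mk_category Ob Ar d c i m) = Ar"
  "f \<in> Ar \<Longrightarrow> Dom (mk_category Ob Ar d c i m) f = d f"
  "f \<in> Ar \<Longrightarrow> Cod (mk_category Ob Ar d c i m) f = c f"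
  "A \<in> Ob \<Longrightarrow> Ide (mk_category Ob Ar d c i m) A = i A"
  "f \<in> Ar \<Longrightarrow> g \<in> Ar \<Longrightarrow> d g = c f \<Longrightarrow> g \<cdot>\<^bsub>mk_category Ob Ar d c i m\<^esub> f = m g f"
  by (simp_all add: mk_category_def)

lemma category_mk_category:
  assumes "\<And>f. f \<in> Ar \<Longrightarrow> d f \<in> Ob" "\<And>f. f \<in> Ar \<Longrightarrow> c f \<in> Ob"
    and "\<And>A. A \<in> Ob \<Longrightarrow> i A \<in> Ar" "\<And>A. A \<in> Ob \<Longrightarrow> d (i A) = A" "\<And>A. A \<in> Ob \<Longrightarrow> c (i A) = A"
    and "\<And>f g. f \<in> Ar \<Longrightarrow> g \<in> Ar \<Longrightarrow> d g = c f \<Longrightarrow> m g f \<in> Ar"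
    and "\<And>f g. f \<in> Ar \<Longrightarrow> g \<in> Ar \<Longrightarrow> d g = c f \<Longrightarrow> d (m g f) = d f"
    and "\<And>f g. f \<in> Ar \<Longrightarrow> g \<in> Ar \<Longrightarrow> d g = c f \<Longrightarrow> c (m g f) = c g"
    and "\<And>f. f \<in> Ar \<Longrightarrow> m (i (c f)) f = f" "\<And>f. f \<in> Ar \<Longrightarrow> m f (i (d f)) = f"
    and "\<And>f g h. f \<in> Ar \<Longrightarrow> g \<in> Ar \<Longrightarrow> h \<in> Ar \<Longrightarrow> d g = c f \<Longrightarrow> d h = c g \<Longrightarrow> m h (m g f) = m (m h g) f"
  shows "category (mk_category Ob Ar d c i m)"
proof
  show "\<And>f g. \<not> (f \<in> Arr (mk_category Ob Ar d c i m) \<and> g \<in> Arr (mk_category Ob Ar d c i m) \<and>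
      Dom (mk_category Ob Ar d c i m) g = Cod (mk_category Ob Ar d c i m) f) \<Longrightarrow>
      g \<cdot>\<^bsub>mk_category Ob Ar d c i m\<^esub> f = undefined"
    by (auto simp: mk_category_def)
qed (use assms in \<open>auto simp: mk_category_def\<close>)

lemma cat_functor_category [simp]:
  "cat_functor F \<Longrightarrow> category (FDom F)" "cat_functor F \<Longrightarrow> category (FCod F)"
  by (auto simp: cat_functor_def)

lemma FObj_Obj [simp]:
  "cat_functor F \<Longrightarrow> FCod F = D \<Longrightarrow> A \<in> Obj (FDom F) \<Longrightarrow> FObj F A \<in> Obj D"
  unfolding cat_functor_def PiE_iff by blast

lemma FArr_simps [simp]:
  assumes "cat_functor F" "FCod F = D" "f \<in> Arr (FDom F)"
  shows "FArr F f \<in> Arr D" "Dom D (FArr F f) = FObj F (Dom (FDom F) f)"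
    "Cod D (FArr F f) = FObj F (Cod (FDom F) f)"
proof -
  have "FArr F f \<in> Hom (FCod F) (FObj F (Dom (FDom F) f)) (FObj F (Cod (FDom F) f))"
    using assms(1,3) unfolding cat_functor_def by blast
  with assms(2) show "FArr F f \<in> Arr D" "Dom D (FArr F f) = FObj F (Dom (FDom F) f)"
    "Cod D (FArr F f) = FObj F (Cod (FDom F) f)" by auto
qed

lemma FArr_Ide [simp]:
  "cat_functor F \<Longrightarrow> FDom F = C \<Longrightarrow> A \<in> Obj C \<Longrightarrow> FArr F (Ide C A) = Ide (FCod F) (FObj F A)"
  unfolding cat_functor_def by blast

lemma FArr_Cmp [simp]:
  "cat_functor F \<Longrightarrow> FDom F = C \<Longrightarrow> f \<in> Arr C \<Longrightarrow> g \<in> Arr C \<Longrightarrow> Dom C g = Cod C f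
    \<Longrightarrow> FArr F (g \<cdot>\<^bsub>C\<^esub> f) = FArr F g \<cdot>\<^bsub>FCod F\<^esub> FArr F f"
  unfolding cat_functor_def by blast

lemma FArr_equation:
  "g \<cdot>\<^bsub>C\<^esub> f = k \<Longrightarrow> cat_functor F \<Longrightarrow> FDom F = C \<Longrightarrow> f \<in> Arr C \<Longrightarrow> g \<in> Arr C \<Longrightarrow> Dom C g = Cod C f
    \<Longrightarrow> FCod F = D \<Longrightarrow> FArr F g \<cdot>\<^bsub>D\<^esub> FArr F f = FArr F k"
  using FArr_Cmp by metis

lemma FObj_ext: "cat_functor F \<Longrightarrow> FObj F \<in> extensional (Obj (FDom F))"
  and FArr_ext: "cat_functor F \<Longrightarrow> FArr F \<in> extensional (Arr (FDom F))"
  unfolding cat_functor_def PiE_def by blast+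

lemma cat_functorI:
  assumes "category (FDom F)" "category (FCod F)"
    and "FObj F \<in> extensional (Obj (FDom F))" "FArr F \<in> extensional (Arr (FDom F))"
    and "\<And>A. A \<in> Obj (FDom F) \<Longrightarrow> FObj F A \<in> Obj (FCod F)"
    and "\<And>f. f \<in> Arr (FDom F) \<Longrightarrow> FArr F f \<in> Arr (FCod F)"
    and "\<And>f. f \<in> Arr (FDom F) \<Longrightarrow> Dom (FCod F) (FArr F f) = FObj F (Dom (FDom F) f)"
    and "\<And>f. f \<in> Arr (FDom F) \<Longrightarrow> Cod (FCod F) (FArr F f) = FObj F (Cod (FDom F) f)"
    and "\<And>A. A \<in> Obj (FDom F) \<Longrightarrow> FArr F (Ide (FDom F) A) = Ide (FCod F) (FObj F A)"
    and "\<And>f g. f \<in> Arr (FDom F) \<Longrightarrow> g \<in> Arr (FDom F) \<Longrightarrow> Dom (FDom F) g = Cod (FDom F) f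
      \<Longrightarrow> FArr F (g \<cdot>\<^bsub>FDom F\<^esub> f) = FArr F g \<cdot>\<^bsub>FCod F\<^esub> FArr F f"
  shows "cat_functor F"
  unfolding cat_functor_def PiE_iff mem_Hom using assms by blast

lemma functor_eqI:
  fixes F G :: "('a, 'b, 'c, 'd) fctr"
  assumes "cat_functor F" "cat_functor G" "FDom F = FDom G" "FCod F = FCod G"
    and "\<And>A. A \<in> Obj (FDom G) \<Longrightarrow> FObj F A = FObj G A"
    and "\<And>f. f \<in> Arr (FDom G) \<Longrightarrow> FArr F f = FArr G f"
  shows "F = G"
proof -
  have "FObj F = FObj G" "FArr F = FArr G"
    using assms FObj_ext[OF assms(1)] FObj_ext[OF assms(2)] FArr_ext[OF assms(1)] FArr_ext[OF assms(2)]
    by (auto intro: extensionalityI)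
  then show ?thesis using assms(3,4) by (cases F; cases G) simp
qed

lemma id_functor_simps [simp]:
  "FDom (id_functor C) = C" "FCod (id_functor C) = C"
  "A \<in> Obj C \<Longrightarrow> FObj (id_functor C) A = A" "f \<in> Arr C \<Longrightarrow> FArr (id_functor C) f = f"
  by (simp_all add: id_functor_def)

lemma cat_functor_id [simp]: "category C \<Longrightarrow> cat_functor (id_functor C)"
  by (rule cat_functorI) (auto simp: id_functor_def)

lemma comp_functor_simps [simp]:
  "FDom (G \<circ>\<^sub>F F) = FDom F" "FCod (G \<circ>\<^sub>F F) = FCod G"
  "A \<in> Obj (FDom F) \<Longrightarrow> FObj (G \<circ>\<^sub>F F) A = FObj G (FObj F A)"
  "f \<in> Arr (FDom F) \<Longrightarrow> FArr (G \<circ>\<^sub>F F) f = FArr G (FArr F f)"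
  by (simp_all add: comp_functor_def compose_def)

lemma cat_functor_comp [simp]:
  assumes "cat_functor F" "cat_functor G" "FDom G = FCod F"
  shows "cat_functor (G \<circ>\<^sub>F F)"
proof (rule cat_functorI)
  show "FObj (G \<circ>\<^sub>F F) \<in> extensional (Obj (FDom (G \<circ>\<^sub>F F)))"
    "FArr (G \<circ>\<^sub>F F) \<in> extensional (Arr (FDom (G \<circ>\<^sub>F F)))"
    by (simp_all add: comp_functor_def compose_def)
qed (use assms in simp_all)

text \<open>
  Values off the domain are fixed by extensionality, so two such records can be compared before
  they are known to be functors.
\<close>

lemma fctr_eqI:
  fixes F G :: "('a, 'b, 'c, 'd) fctr"
  assumes "FDom F = FDom G" "FCod F = FCod G"
    and "FObj F \<in> extensional (Obj (FDom G))" "FObj G \<in> extensional (Obj (FDom G))"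
    and "FArr F \<in> extensional (Arr (FDom G))" "FArr G \<in> extensional (Arr (FDom G))"
    and "\<And>A. A \<in> Obj (FDom G) \<Longrightarrow> FObj F A = FObj G A"
    and "\<And>f. f \<in> Arr (FDom G) \<Longrightarrow> FArr F f = FArr G f"
  shows "F = G"
  using assms by (intro fctr.equality extensionalityI) auto

lemma comp_functor_ext [simp]:
  "FDom F = C \<Longrightarrow> FObj (G \<circ>\<^sub>F F) \<in> extensional (Obj C)"
  "FDom F = C \<Longrightarrow> FArr (G \<circ>\<^sub>F F) \<in> extensional (Arr C)"
  by (simp_all add: comp_functor_def compose_def)

lemma comp_functor_assoc [simp]:
  assumes "cat_functor F" "FDom G = FCod F"
  shows "(H \<circ>\<^sub>F G) \<circ>\<^sub>F F = H \<circ>\<^sub>F (G \<circ>\<^sub>F F)"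
  by (rule fctr_eqI) (use assms in simp_all)

lemma comp_functor_extend:
  assumes "H \<circ>\<^sub>F G = K" "cat_functor F" "FDom G = FCod F"
  shows "H \<circ>\<^sub>F (G \<circ>\<^sub>F F) = K \<circ>\<^sub>F F"
  using assms comp_functor_assoc by metis

lemma comp_functor_id_right [simp]:
  "cat_functor F \<Longrightarrow> FDom F = C \<Longrightarrow> F \<circ>\<^sub>F id_functor C = F"
  by (rule functor_eqI) auto

lemma comp_functor_id_left [simp]:
  "cat_functor F \<Longrightarrow> FCod F = C \<Longrightarrow> id_functor C \<circ>\<^sub>F F = F"
  by (rule functor_eqI) auto

lemma NCmp_simps [simp]:
  assumes "nat_trans \<alpha>" "FCod (NSrc \<alpha>) = D" "A \<in> Obj (FDom (NSrc \<alpha>))"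
  shows "NCmp \<alpha> A \<in> Arr D" "Dom D (NCmp \<alpha> A) = FObj (NSrc \<alpha>) A" "Cod D (NCmp \<alpha> A) = FObj (NTrg \<alpha>) A"
proof -
  have "NCmp \<alpha> A \<in> Hom (FCod (NSrc \<alpha>)) (FObj (NSrc \<alpha>) A) (FObj (NTrg \<alpha>) A)"
    using assms(1,3) unfolding nat_trans_def by blast
  with assms(2) show "NCmp \<alpha> A \<in> Arr D" "Dom D (NCmp \<alpha> A) = FObj (NSrc \<alpha>) A"
    "Cod D (NCmp \<alpha> A) = FObj (NTrg \<alpha>) A" by auto
qed

lemma NCmp_ext: "nat_trans \<alpha> \<Longrightarrow> NCmp \<alpha> \<in> extensional (Obj (FDom (NSrc \<alpha>)))"
  unfolding nat_trans_def by blast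

lemma nat_trans_functors [simp]:
  assumes "nat_trans \<alpha>"
  shows "cat_functor (NSrc \<alpha>)" "cat_functor (NTrg \<alpha>)"
    "FDom (NTrg \<alpha>) = FDom (NSrc \<alpha>)" "FCod (NTrg \<alpha>) = FCod (NSrc \<alpha>)"
  using assms unfolding nat_trans_def by blast+

lemma naturality:
  "nat_trans \<alpha> \<Longrightarrow> FCod (NSrc \<alpha>) = D \<Longrightarrow> f \<in> Arr (FDom (NSrc \<alpha>)) \<Longrightarrow>
    NCmp \<alpha> (Cod (FDom (NSrc \<alpha>)) f) \<cdot>\<^bsub>D\<^esub> FArr (NSrc \<alpha>) f =
    FArr (NTrg \<alpha>) f \<cdot>\<^bsub>D\<^esub> NCmp \<alpha> (Dom (FDom (NSrc \<alpha>)) f)"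
  unfolding nat_trans_def by blast

lemma nat_transI:
  assumes "cat_functor (NSrc \<alpha>)" "cat_functor (NTrg \<alpha>)"
    "FDom (NTrg \<alpha>) = FDom (NSrc \<alpha>)" "FCod (NTrg \<alpha>) = FCod (NSrc \<alpha>)"
    and "NCmp \<alpha> \<in> extensional (Obj (FDom (NSrc \<alpha>)))"
    and "\<And>A. A \<in> Obj (FDom (NSrc \<alpha>)) \<Longrightarrow> NCmp \<alpha> A \<in> Arr (FCod (NSrc \<alpha>))"
    and "\<And>A. A \<in> Obj (FDom (NSrc \<alpha>)) \<Longrightarrow> Dom (FCod (NSrc \<alpha>)) (NCmp \<alpha> A) = FObj (NSrc \<alpha>) A"
    and "\<And>A. A \<in> Obj (FDom (NSrc \<alpha>)) \<Longrightarrow> Cod (FCod (NSrc \<alpha>)) (NCmp \<alpha> A) = FObj (NTrg \<alpha>) A"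
    and "\<And>f. f \<in> Arr (FDom (NSrc \<alpha>)) \<Longrightarrow>
      NCmp \<alpha> (Cod (FDom (NSrc \<alpha>)) f) \<cdot>\<^bsub>FCod (NSrc \<alpha>)\<^esub> FArr (NSrc \<alpha>) f =
      FArr (NTrg \<alpha>) f \<cdot>\<^bsub>FCod (NSrc \<alpha>)\<^esub> NCmp \<alpha> (Dom (FDom (NSrc \<alpha>)) f)"
  shows "nat_trans \<alpha>"
  unfolding nat_trans_def mem_Hom using assms by blast

lemma ntrans_eqI:
  fixes \<alpha> \<beta> :: "('a, 'b, 'c, 'd) ntrans"
  assumes "nat_trans \<alpha>" "nat_trans \<beta>" "NSrc \<alpha> = NSrc \<beta>" "NTrg \<alpha> = NTrg \<beta>"
    and "\<And>A. A \<in> Obj (FDom (NSrc \<beta>)) \<Longrightarrow> NCmp \<alpha> A = NCmp \<beta> A"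
  shows "\<alpha> = \<beta>"
proof -
  have "NCmp \<alpha> = NCmp \<beta>"
    using assms NCmp_ext[OF assms(1)] NCmp_ext[OF assms(2)] by (auto intro: extensionalityI)
  then show ?thesis using assms(3,4) by (cases \<alpha>; cases \<beta>) simp
qed

lemma ntrans_eqI':
  fixes \<alpha> \<beta> :: "('a, 'b, 'c, 'd) ntrans"
  assumes "NSrc \<alpha> = NSrc \<beta>" "NTrg \<alpha> = NTrg \<beta>" "NCmp \<alpha> \<in> extensional A" "NCmp \<beta> \<in> extensional A"
    and "\<And>a. a \<in> A \<Longrightarrow> NCmp \<alpha> a = NCmp \<beta> a"
  shows "\<alpha> = \<beta>"
  using assms by (intro ntrans.equality extensionalityI) auto

lemma id_nat_simps [simp]:
  "NSrc (id_nat F) = F" "NTrg (id_nat F) = F"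
  "A \<in> Obj (FDom F) \<Longrightarrow> NCmp (id_nat F) A = Ide (FCod F) (FObj F A)"
  by (simp_all add: id_nat_def)

lemma nat_trans_id [simp]: "cat_functor F \<Longrightarrow> nat_trans (id_nat F)"
  by (rule nat_transI) (auto simp: id_nat_def)

lemma vcomp_simps [simp]:
  "NSrc (\<beta> \<circ>\<^sub>V \<alpha>) = NSrc \<alpha>" "NTrg (\<beta> \<circ>\<^sub>V \<alpha>) = NTrg \<beta>"
  "A \<in> Obj (FDom (NSrc \<alpha>)) \<Longrightarrow> NCmp (\<beta> \<circ>\<^sub>V \<alpha>) A = NCmp \<beta> A \<cdot>\<^bsub>FCod (NSrc \<alpha>)\<^esub> NCmp \<alpha> A"
  by (simp_all add: vcomp_def)

lemma nat_trans_vcomp [simp]: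
  assumes "nat_trans \<alpha>" "nat_trans \<beta>" "NSrc \<beta> = NTrg \<alpha>"
  shows "nat_trans (\<beta> \<circ>\<^sub>V \<alpha>)"
proof (rule nat_transI)
  fix f assume "f \<in> Arr (FDom (NSrc (\<beta> \<circ>\<^sub>V \<alpha>)))"
  then have f: "f \<in> Arr (FDom (NSrc \<alpha>))" by simp
  have n: "NCmp \<beta> (Cod (FDom (NSrc \<alpha>)) f) \<cdot>\<^bsub>FCod (NSrc \<alpha>)\<^esub> FArr (NTrg \<alpha>) f =
    FArr (NTrg \<beta>) f \<cdot>\<^bsub>FCod (NSrc \<alpha>)\<^esub> NCmp \<beta> (Dom (FDom (NSrc \<alpha>)) f)"
    using naturality[OF assms(2), of "FCod (NSrc \<alpha>)" f] assms f by simp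
  show "NCmp (\<beta> \<circ>\<^sub>V \<alpha>) (Cod (FDom (NSrc (\<beta> \<circ>\<^sub>V \<alpha>))) f) \<cdot>\<^bsub>FCod (NSrc (\<beta> \<circ>\<^sub>V \<alpha>))\<^esub> FArr (NSrc (\<beta> \<circ>\<^sub>V \<alpha>)) f =
      FArr (NTrg (\<beta> \<circ>\<^sub>V \<alpha>)) f \<cdot>\<^bsub>FCod (NSrc (\<beta> \<circ>\<^sub>V \<alpha>))\<^esub> NCmp (\<beta> \<circ>\<^sub>V \<alpha>) (Dom (FDom (NSrc (\<beta> \<circ>\<^sub>V \<alpha>))) f)"
    using assms f by (simp add: naturality[OF assms(1)] Cmp_extend[OF n])
qed (use assms in \<open>simp_all add: vcomp_def\<close>)

lemma vcomp_assoc [simp]: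
  assumes "nat_trans \<alpha>" "nat_trans \<beta>" "nat_trans \<gamma>" "NSrc \<beta> = NTrg \<alpha>" "NSrc \<gamma> = NTrg \<beta>"
  shows "(\<gamma> \<circ>\<^sub>V \<beta>) \<circ>\<^sub>V \<alpha> = \<gamma> \<circ>\<^sub>V (\<beta> \<circ>\<^sub>V \<alpha>)"
  by (rule ntrans_eqI) (use assms in simp_all)

lemma vcomp_id_left [simp]: "nat_trans \<alpha> \<Longrightarrow> NTrg \<alpha> = F \<Longrightarrow> id_nat F \<circ>\<^sub>V \<alpha> = \<alpha>"
  by (rule ntrans_eqI) auto

lemma vcomp_id_right [simp]: "nat_trans \<alpha> \<Longrightarrow> NSrc \<alpha> = F \<Longrightarrow> \<alpha> \<circ>\<^sub>V id_nat F = \<alpha>"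
  by (rule ntrans_eqI) auto

lemma whisker_left_simps [simp]:
  "NSrc (H \<star>\<^sub>l \<alpha>) = H \<circ>\<^sub>F NSrc \<alpha>" "NTrg (H \<star>\<^sub>l \<alpha>) = H \<circ>\<^sub>F NTrg \<alpha>"
  "A \<in> Obj (FDom (NSrc \<alpha>)) \<Longrightarrow> NCmp (H \<star>\<^sub>l \<alpha>) A = FArr H (NCmp \<alpha> A)"
  by (simp_all add: whisker_left_def)

lemma whisker_right_simps [simp]:
  "NSrc (\<alpha> \<star>\<^sub>r H) = NSrc \<alpha> \<circ>\<^sub>F H" "NTrg (\<alpha> \<star>\<^sub>r H) = NTrg \<alpha> \<circ>\<^sub>F H"
  "A \<in> Obj (FDom H) \<Longrightarrow> NCmp (\<alpha> \<star>\<^sub>r H) A = NCmp \<alpha> (FObj H A)"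
  by (simp_all add: whisker_right_def)

lemma nat_trans_whisker_left [simp]:
  assumes "nat_trans \<alpha>" "cat_functor H" "FDom H = FCod (NSrc \<alpha>)"
  shows "nat_trans (H \<star>\<^sub>l \<alpha>)"
proof (rule nat_transI)
  fix f assume "f \<in> Arr (FDom (NSrc (H \<star>\<^sub>l \<alpha>)))"
  then have f: "f \<in> Arr (FDom (NSrc \<alpha>))" by simp
  show "NCmp (H \<star>\<^sub>l \<alpha>) (Cod (FDom (NSrc (H \<star>\<^sub>l \<alpha>))) f) \<cdot>\<^bsub>FCod (NSrc (H \<star>\<^sub>l \<alpha>))\<^esub> FArr (NSrc (H \<star>\<^sub>l \<alpha>)) f =
      FArr (NTrg (H \<star>\<^sub>l \<alpha>)) f \<cdot>\<^bsub>FCod (NSrc (H \<star>\<^sub>l \<alpha>))\<^esub> NCmp (H \<star>\<^sub>l \<alpha>) (Dom (FDom (NSrc (H \<star>\<^sub>l \<alpha>))) f)"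
    using assms f arg_cong[OF naturality[OF assms(1) refl f], of "FArr H"] by simp
qed (use assms in \<open>simp_all add: whisker_left_def\<close>)

lemma nat_trans_whisker_right [simp]:
  assumes "nat_trans \<alpha>" "cat_functor H" "FCod H = FDom (NSrc \<alpha>)"
  shows "nat_trans (\<alpha> \<star>\<^sub>r H)"
proof (rule nat_transI)
  fix f assume "f \<in> Arr (FDom (NSrc (\<alpha> \<star>\<^sub>r H)))"
  then have f: "f \<in> Arr (FDom H)" by simp
  then show "NCmp (\<alpha> \<star>\<^sub>r H) (Cod (FDom (NSrc (\<alpha> \<star>\<^sub>r H))) f) \<cdot>\<^bsub>FCod (NSrc (\<alpha> \<star>\<^sub>r H))\<^esub> FArr (NSrc (\<alpha> \<star>\<^sub>r H)) f =
      FArr (NTrg (\<alpha> \<star>\<^sub>r H)) f \<cdot>\<^bsub>FCod (NSrc (\<alpha> \<star>\<^sub>r H))\<^esub> NCmp (\<alpha> \<star>\<^sub>r H) (Dom (FDom (NSrc (\<alpha> \<star>\<^sub>r H))) f)"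
    using assms naturality[OF assms(1) refl, of "FArr H f"] by simp
qed (use assms in \<open>simp_all add: whisker_right_def\<close>)

lemma whisker_left_comp:
  assumes a: "nat_trans \<alpha>" and "FDom G = FCod (NSrc \<alpha>)"
  shows "(H \<circ>\<^sub>F G) \<star>\<^sub>l \<alpha> = H \<star>\<^sub>l (G \<star>\<^sub>l \<alpha>)"
  by (rule ntrans_eqI'[where A = "Obj (FDom (NSrc \<alpha>))"]) (use assms in \<open>simp_all\<close>, simp_all add: whisker_left_def)

lemma hcomp_simps [simp]:
  "NSrc (\<beta> \<star>\<^sub>h \<alpha>) = NSrc \<beta> \<circ>\<^sub>F NSrc \<alpha>" "NTrg (\<beta> \<star>\<^sub>h \<alpha>) = NTrg \<beta> \<circ>\<^sub>F NTrg \<alpha>"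
  by (simp_all add: hcomp_def)

lemma NCmp_hcomp [simp]:
  "nat_trans \<alpha> \<Longrightarrow> A \<in> Obj (FDom (NSrc \<alpha>)) \<Longrightarrow>
    NCmp (\<beta> \<star>\<^sub>h \<alpha>) A = NCmp \<beta> (FObj (NTrg \<alpha>) A) \<cdot>\<^bsub>FCod (NSrc \<beta>)\<^esub> FArr (NSrc \<beta>) (NCmp \<alpha> A)"
  by (simp add: hcomp_def)

lemma nat_trans_hcomp [simp]:
  "nat_trans \<alpha> \<Longrightarrow> nat_trans \<beta> \<Longrightarrow> FDom (NSrc \<beta>) = FCod (NSrc \<alpha>) \<Longrightarrow> nat_trans (\<beta> \<star>\<^sub>h \<alpha>)"
  by (simp add: hcomp_def)

lemma hcomp_assoc:
  assumes "nat_trans \<alpha>" "nat_trans \<beta>" "nat_trans \<gamma>"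
    "FDom (NSrc \<beta>) = FCod (NSrc \<alpha>)" "FDom (NSrc \<gamma>) = FCod (NSrc \<beta>)"
  shows "(\<gamma> \<star>\<^sub>h \<beta>) \<star>\<^sub>h \<alpha> = \<gamma> \<star>\<^sub>h (\<beta> \<star>\<^sub>h \<alpha>)"
  by (rule ntrans_eqI) (use assms in simp_all)

lemma hcomp_id_right [simp]:
  "nat_trans \<alpha> \<Longrightarrow> FDom (NSrc \<alpha>) = C \<Longrightarrow> \<alpha> \<star>\<^sub>h id_nat (id_functor C) = \<alpha>"
  by (rule ntrans_eqI) auto

lemma hcomp_id_left [simp]:
  "nat_trans \<alpha> \<Longrightarrow> FCod (NSrc \<alpha>) = C \<Longrightarrow> id_nat (id_functor C) \<star>\<^sub>h \<alpha> = \<alpha>"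
  by (rule ntrans_eqI) auto

lemma hcomp_id_id [simp]:
  "cat_functor F \<Longrightarrow> cat_functor G \<Longrightarrow> FDom G = FCod F \<Longrightarrow> id_nat G \<star>\<^sub>h id_nat F = id_nat (G \<circ>\<^sub>F F)"
  by (rule ntrans_eqI) auto

lemma hcomp_interchange:
  assumes "nat_trans \<alpha>" "nat_trans \<alpha>'" "nat_trans \<beta>" "nat_trans \<beta>'"
    and "NSrc \<alpha>' = NTrg \<alpha>" "NSrc \<beta>' = NTrg \<beta>" "FDom (NSrc \<beta>) = FCod (NSrc \<alpha>)"
  shows "(\<beta>' \<circ>\<^sub>V \<beta>) \<star>\<^sub>h (\<alpha>' \<circ>\<^sub>V \<alpha>) = (\<beta>' \<star>\<^sub>h \<alpha>') \<circ>\<^sub>V (\<beta> \<star>\<^sub>h \<alpha>)"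
proof (rule ntrans_eqI)
  fix A assume "A \<in> Obj (FDom (NSrc ((\<beta>' \<star>\<^sub>h \<alpha>') \<circ>\<^sub>V (\<beta> \<star>\<^sub>h \<alpha>))))"
  then have A: "A \<in> Obj (FDom (NSrc \<alpha>))" by simp
  have n: "NCmp \<beta> (FObj (NTrg \<alpha>') A) \<cdot>\<^bsub>FCod (NSrc \<beta>)\<^esub> FArr (NSrc \<beta>) (NCmp \<alpha>' A) =
      FArr (NTrg \<beta>) (NCmp \<alpha>' A) \<cdot>\<^bsub>FCod (NSrc \<beta>)\<^esub> NCmp \<beta> (FObj (NTrg \<alpha>) A)"
    using naturality[OF assms(3) refl, of "NCmp \<alpha>' A"] assms A by simp
  show "NCmp ((\<beta>' \<circ>\<^sub>V \<beta>) \<star>\<^sub>h (\<alpha>' \<circ>\<^sub>V \<alpha>)) A = NCmp ((\<beta>' \<star>\<^sub>h \<alpha>') \<circ>\<^sub>V (\<beta> \<star>\<^sub>h \<alpha>)) A"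
    using assms A by (simp add: Cmp_extend[OF n])
qed (use assms in simp_all)

lemma inverse_nat_unique: "inverse_nat \<rho> \<sigma> \<Longrightarrow> inverse_nat \<rho> \<tau> \<Longrightarrow> \<sigma> = \<tau>"
proof -
  assume a: "inverse_nat \<rho> \<sigma>" "inverse_nat \<rho> \<tau>"
  then have "NSrc (\<rho> \<circ>\<^sub>V \<sigma>) = NTrg \<rho>" "NTrg (\<tau> \<circ>\<^sub>V \<rho>) = NSrc \<rho>"
    "NSrc (\<rho> \<circ>\<^sub>V \<tau>) = NTrg \<rho>" "NTrg (\<sigma> \<circ>\<^sub>V \<rho>) = NSrc \<rho>"
    by (auto simp only: inverse_nat_def id_nat_simps)
  then have s: "NSrc \<sigma> = NTrg \<rho>" "NSrc \<rho> = NTrg \<tau>" "NSrc \<tau> = NTrg \<rho>" "NSrc \<rho> = NTrg \<sigma>"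
    by simp_all
  have n: "nat_trans \<rho>" "nat_trans \<sigma>" "nat_trans \<tau>"
    and e: "\<rho> \<circ>\<^sub>V \<sigma> = id_nat (NTrg \<rho>)" "\<tau> \<circ>\<^sub>V \<rho> = id_nat (NSrc \<rho>)"
    using a by (auto simp only: inverse_nat_def)
  have "\<sigma> = (\<tau> \<circ>\<^sub>V \<rho>) \<circ>\<^sub>V \<sigma>" unfolding e(2) using vcomp_id_left[OF n(2)] s(4) by metis
  also have "\<dots> = \<tau> \<circ>\<^sub>V (\<rho> \<circ>\<^sub>V \<sigma>)" by (rule vcomp_assoc) (use n s in metis)+
  also have "\<dots> = \<tau>" unfolding e(1) using vcomp_id_right[OF n(3)] s(3) by metis
  finally show ?thesis .
qed

lemma nat_inv_eq: "inverse_nat \<rho> \<sigma> \<Longrightarrow> nat_inv \<rho> = \<sigma>"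
  unfolding nat_inv_def using inverse_nat_unique by blast

lemma nat_iso_inverse: "nat_iso_from_to \<rho> F G \<Longrightarrow> inverse_nat \<rho> (nat_inv \<rho>)"
  unfolding nat_iso_from_to_def using nat_inv_eq by blast

lemma nat_inv_simps:
  assumes "nat_iso_from_to \<rho> F G"
  shows "nat_trans (nat_inv \<rho>)" "NSrc (nat_inv \<rho>) = G" "NTrg (nat_inv \<rho>) = F"
    "A \<in> Obj (FDom F) \<Longrightarrow> NCmp \<rho> A \<cdot>\<^bsub>FCod F\<^esub> NCmp (nat_inv \<rho>) A = Ide (FCod F) (FObj G A)"
    "A \<in> Obj (FDom F) \<Longrightarrow> NCmp (nat_inv \<rho>) A \<cdot>\<^bsub>FCod F\<^esub> NCmp \<rho> A = Ide (FCod F) (FObj F A)"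
proof -
  have i: "nat_trans \<rho>" "nat_trans (nat_inv \<rho>)" "NSrc \<rho> = F" "NTrg \<rho> = G"
    "nat_inv \<rho> \<circ>\<^sub>V \<rho> = id_nat F" "\<rho> \<circ>\<^sub>V nat_inv \<rho> = id_nat G"
    using nat_iso_inverse[OF assms] assms by (auto simp: inverse_nat_def nat_iso_from_to_def nat_from_to_def)
  show t: "nat_trans (nat_inv \<rho>)" by (fact i)
  show s: "NSrc (nat_inv \<rho>) = G" "NTrg (nat_inv \<rho>) = F"
    using arg_cong[OF i(6), of NSrc] arg_cong[OF i(5), of NTrg] by simp_all
  have f: "FDom G = FDom F" "FCod G = FCod F"
    using nat_trans_functors[OF i(1)] i by simp_all
  show "A \<in> Obj (FDom F) \<Longrightarrow> NCmp \<rho> A \<cdot>\<^bsub>FCod F\<^esub> NCmp (nat_inv \<rho>) A = Ide (FCod F) (FObj G A)"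
    using fun_cong[OF arg_cong[OF i(6), of NCmp], of A] s i(1-4) f by simp
  show "A \<in> Obj (FDom F) \<Longrightarrow> NCmp (nat_inv \<rho>) A \<cdot>\<^bsub>FCod F\<^esub> NCmp \<rho> A = Ide (FCod F) (FObj F A)"
    using fun_cong[OF arg_cong[OF i(5), of NCmp], of A] s i(1-4) f by simp
qed

text \<open>Inverses of the components of a natural transformation are automatically natural.\<close>

lemma nat_iso_from_toI:
  assumes t: "nat_from_to \<rho> F G"
    and s: "\<And>A. A \<in> Obj (FDom F) \<Longrightarrow> s A \<in> Arr (FCod F)" "\<And>A. A \<in> Obj (FDom F) \<Longrightarrow> Dom (FCod F) (s A) = FObj G A"
      "\<And>A. A \<in> Obj (FDom F) \<Longrightarrow> Cod (FCod F) (s A) = FObj F A"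
    and l: "\<And>A. A \<in> Obj (FDom F) \<Longrightarrow> s A \<cdot>\<^bsub>FCod F\<^esub> NCmp \<rho> A = Ide (FCod F) (FObj F A)"
    and r: "\<And>A. A \<in> Obj (FDom F) \<Longrightarrow> NCmp \<rho> A \<cdot>\<^bsub>FCod F\<^esub> s A = Ide (FCod F) (FObj G A)"
  shows "nat_iso_from_to \<rho> F G"
proof -
  have i [simp]: "nat_trans \<rho>" "NSrc \<rho> = F" "NTrg \<rho> = G" using t by (auto simp: nat_from_to_def)
  have f [simp]: "FDom G = FDom F" "FCod G = FCod F" "cat_functor F" "cat_functor G"
    using nat_trans_functors[OF i(1)] i(2,3) by simp_all
  define \<sigma> where "\<sigma> = \<lparr>NSrc = G, NTrg = F, NCmp = (\<lambda>A\<in>Obj (FDom F). s A)\<rparr>"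
  have \<sigma>: "NSrc \<sigma> = G" "NTrg \<sigma> = F" "\<And>A. A \<in> Obj (FDom F) \<Longrightarrow> NCmp \<sigma> A = s A" by (simp_all add: \<sigma>_def)
  have ns: "nat_trans \<sigma>"
  proof (rule nat_transI)
    fix h assume "h \<in> Arr (FDom (NSrc \<sigma>))"
    then have h: "h \<in> Arr (FDom F)" by (simp add: \<sigma>)
    let ?A = "Dom (FDom F) h" and ?B = "Cod (FDom F) h" and ?D = "FCod F"
    have n: "NCmp \<rho> ?B \<cdot>\<^bsub>?D\<^esub> FArr F h = FArr G h \<cdot>\<^bsub>?D\<^esub> NCmp \<rho> ?A"
      using naturality[OF i(1), of ?D h] h by simp
    have "s ?B \<cdot>\<^bsub>?D\<^esub> FArr G h = s ?B \<cdot>\<^bsub>?D\<^esub> FArr G h \<cdot>\<^bsub>?D\<^esub> NCmp \<rho> ?A \<cdot>\<^bsub>?D\<^esub> s ?A"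
      using h s r by simp
    also have "\<dots> = s ?B \<cdot>\<^bsub>?D\<^esub> NCmp \<rho> ?B \<cdot>\<^bsub>?D\<^esub> FArr F h \<cdot>\<^bsub>?D\<^esub> s ?A"
      using h s by (simp add: Cmp_extend[OF n])
    also have "\<dots> = FArr F h \<cdot>\<^bsub>?D\<^esub> s ?A"
      using h s by (simp add: Cmp_extend[OF l])
    finally show "NCmp \<sigma> (Cod (FDom (NSrc \<sigma>)) h) \<cdot>\<^bsub>FCod (NSrc \<sigma>)\<^esub> FArr (NSrc \<sigma>) h =
         FArr (NTrg \<sigma>) h \<cdot>\<^bsub>FCod (NSrc \<sigma>)\<^esub> NCmp \<sigma> (Dom (FDom (NSrc \<sigma>)) h)"
      using h by (simp add: \<sigma>)
  qed (use s in \<open>simp_all add: \<sigma>_def\<close>)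
  have "\<sigma> \<circ>\<^sub>V \<rho> = id_nat F" "\<rho> \<circ>\<^sub>V \<sigma> = id_nat G"
    by (rule ntrans_eqI; use ns l r \<sigma> in auto)+
  then show ?thesis unfolding nat_iso_from_to_def inverse_nat_def using t ns i by metis
qed

lemma nat_iso_id: "cat_functor F \<Longrightarrow> nat_iso_from_to (id_nat F) F F"
  by (rule nat_iso_from_toI[where s = "\<lambda>A. Ide (FCod F) (FObj F A)"]) (auto simp: nat_from_to_def)

lemma nat_inv_id: "cat_functor F \<Longrightarrow> nat_inv (id_nat F) = id_nat F"
  by (rule nat_inv_eq) (simp add: inverse_nat_def)

section \<open>2-functors\<close>

lemma two_functorD:
  assumes "two_functor K M F"
  shows "two_category K" "two_category M"
    "\<And>A. A \<in> Cell0 K \<Longrightarrow> F0 F A \<in> Cell0 M"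
    "\<And>f. f \<in> Cell1 K \<Longrightarrow> F1 F f \<in> Cell1 M"
    "\<And>f. f \<in> Cell1 K \<Longrightarrow> src M (F1 F f) = F0 F (src K f)"
    "\<And>f. f \<in> Cell1 K \<Longrightarrow> trg M (F1 F f) = F0 F (trg K f)"
    "\<And>\<theta>. \<theta> \<in> Cell2 K \<Longrightarrow> F2 F \<theta> \<in> Cell2 M"
    "\<And>\<theta>. \<theta> \<in> Cell2 K \<Longrightarrow> Dom (Vert M) (F2 F \<theta>) = F1 F (Dom (Vert K) \<theta>)"
    "\<And>\<theta>. \<theta> \<in> Cell2 K \<Longrightarrow> Cod (Vert M) (F2 F \<theta>) = F1 F (Cod (Vert K) \<theta>)"
    "\<And>f. f \<in> Cell1 K \<Longrightarrow> F2 F (Ide (Vert K) f) = Ide (Vert M) (F1 F f)"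
    "\<And>\<theta> \<kappa>. \<theta> \<in> Cell2 K \<Longrightarrow> \<kappa> \<in> Cell2 K \<Longrightarrow> Dom (Vert K) \<kappa> = Cod (Vert K) \<theta> \<Longrightarrow>
      F2 F (\<kappa> \<cdot>\<^bsub>Vert K\<^esub> \<theta>) = F2 F \<kappa> \<cdot>\<^bsub>Vert M\<^esub> F2 F \<theta>"
    "\<And>A. A \<in> Cell0 K \<Longrightarrow> F1 F (one K A) = one M (F0 F A)"
    "\<And>f g. f \<in> Cell1 K \<Longrightarrow> g \<in> Cell1 K \<Longrightarrow> src K g = trg K f \<Longrightarrow>
      F1 F (g \<odot>\<^bsub>K\<^esub> f) = F1 F g \<odot>\<^bsub>M\<^esub> F1 F f"
    "\<And>\<theta> \<kappa>. \<theta> \<in> Cell2 K \<Longrightarrow> \<kappa> \<in> Cell2 K \<Longrightarrow> src2 K \<kappa> = trg2 K \<theta> \<Longrightarrow>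
      F2 F (\<kappa> \<diamondop>\<^bsub>K\<^esub> \<theta>) = F2 F \<kappa> \<diamondop>\<^bsub>M\<^esub> F2 F \<theta>"
  using assms unfolding two_functor_def mem_Hom by blast+

lemma two_functorI:
  assumes "two_category K" "two_category M"
    "\<And>A. A \<in> Cell0 K \<Longrightarrow> F0 F A \<in> Cell0 M"
    "\<And>f. f \<in> Cell1 K \<Longrightarrow> F1 F f \<in> Cell1 M"
    "\<And>f. f \<in> Cell1 K \<Longrightarrow> src M (F1 F f) = F0 F (src K f)"
    "\<And>f. f \<in> Cell1 K \<Longrightarrow> trg M (F1 F f) = F0 F (trg K f)"
    "\<And>\<theta>. \<theta> \<in> Cell2 K \<Longrightarrow> F2 F \<theta> \<in> Cell2 M"
    "\<And>\<theta>. \<theta> \<in> Cell2 K \<Longrightarrow> Dom (Vert M) (F2 F \<theta>) = F1 F (Dom (Vert K) \<theta>)"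
    "\<And>\<theta>. \<theta> \<in> Cell2 K \<Longrightarrow> Cod (Vert M) (F2 F \<theta>) = F1 F (Cod (Vert K) \<theta>)"
    "\<And>f. f \<in> Cell1 K \<Longrightarrow> F2 F (Ide (Vert K) f) = Ide (Vert M) (F1 F f)"
    "\<And>\<theta> \<kappa>. \<theta> \<in> Cell2 K \<Longrightarrow> \<kappa> \<in> Cell2 K \<Longrightarrow> Dom (Vert K) \<kappa> = Cod (Vert K) \<theta> \<Longrightarrow>
      F2 F (\<kappa> \<cdot>\<^bsub>Vert K\<^esub> \<theta>) = F2 F \<kappa> \<cdot>\<^bsub>Vert M\<^esub> F2 F \<theta>"
    "\<And>A. A \<in> Cell0 K \<Longrightarrow> F1 F (one K A) = one M (F0 F A)"
    "\<And>f g. f \<in> Cell1 K \<Longrightarrow> g \<in> Cell1 K \<Longrightarrow> src K g = trg K f \<Longrightarrow>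
      F1 F (g \<odot>\<^bsub>K\<^esub> f) = F1 F g \<odot>\<^bsub>M\<^esub> F1 F f"
    "\<And>\<theta> \<kappa>. \<theta> \<in> Cell2 K \<Longrightarrow> \<kappa> \<in> Cell2 K \<Longrightarrow> src2 K \<kappa> = trg2 K \<theta> \<Longrightarrow>
      F2 F (\<kappa> \<diamondop>\<^bsub>K\<^esub> \<theta>) = F2 F \<kappa> \<diamondop>\<^bsub>M\<^esub> F2 F \<theta>"
  shows "two_functor K M F"
  unfolding two_functor_def mem_Hom using assms by blast

lemma two_categoryD:
  assumes "two_category K"
  shows "category (Vert K)"
    "\<And>f. f \<in> Cell1 K \<Longrightarrow> src K f \<in> Cell0 K" "\<And>f. f \<in> Cell1 K \<Longrightarrow> trg K f \<in> Cell0 K"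
    "\<And>\<theta>. \<theta> \<in> Cell2 K \<Longrightarrow> src K (Cod (Vert K) \<theta>) = src2 K \<theta>"
    "\<And>\<theta>. \<theta> \<in> Cell2 K \<Longrightarrow> trg K (Cod (Vert K) \<theta>) = trg2 K \<theta>"
    "\<And>A. A \<in> Cell0 K \<Longrightarrow> one K A \<in> Cell1 K"
    "\<And>A. A \<in> Cell0 K \<Longrightarrow> src K (one K A) = A" "\<And>A. A \<in> Cell0 K \<Longrightarrow> trg K (one K A) = A"
    "\<And>f g. f \<in> Cell1 K \<Longrightarrow> g \<in> Cell1 K \<Longrightarrow> src K g = trg K f \<Longrightarrow> g \<odot>\<^bsub>K\<^esub> f \<in> Cell1 K"
    "\<And>f g. f \<in> Cell1 K \<Longrightarrow> g \<in> Cell1 K \<Longrightarrow> src K g = trg K f \<Longrightarrow> src K (g \<odot>\<^bsub>K\<^esub> f) = src K f"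
    "\<And>f g. f \<in> Cell1 K \<Longrightarrow> g \<in> Cell1 K \<Longrightarrow> src K g = trg K f \<Longrightarrow> trg K (g \<odot>\<^bsub>K\<^esub> f) = trg K g"
    "\<And>\<theta> \<kappa>. \<theta> \<in> Cell2 K \<Longrightarrow> \<kappa> \<in> Cell2 K \<Longrightarrow> src2 K \<kappa> = trg2 K \<theta> \<Longrightarrow> \<kappa> \<diamondop>\<^bsub>K\<^esub> \<theta> \<in> Cell2 K"
    "\<And>\<theta> \<kappa>. \<theta> \<in> Cell2 K \<Longrightarrow> \<kappa> \<in> Cell2 K \<Longrightarrow> src2 K \<kappa> = trg2 K \<theta> \<Longrightarrow>
      Dom (Vert K) (\<kappa> \<diamondop>\<^bsub>K\<^esub> \<theta>) = Dom (Vert K) \<kappa> \<odot>\<^bsub>K\<^esub> Dom (Vert K) \<theta>"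
    "\<And>\<theta> \<kappa>. \<theta> \<in> Cell2 K \<Longrightarrow> \<kappa> \<in> Cell2 K \<Longrightarrow> src2 K \<kappa> = trg2 K \<theta> \<Longrightarrow>
      Cod (Vert K) (\<kappa> \<diamondop>\<^bsub>K\<^esub> \<theta>) = Cod (Vert K) \<kappa> \<odot>\<^bsub>K\<^esub> Cod (Vert K) \<theta>"
    "\<And>\<theta>. \<theta> \<in> Cell2 K \<Longrightarrow> Dom (Vert K) \<theta> \<in> Cell1 K" "\<And>\<theta>. \<theta> \<in> Cell2 K \<Longrightarrow> Cod (Vert K) \<theta> \<in> Cell1 K"
  using assms two_category.comp2_closed[OF assms, of _ "Dom (Vert K) _" "Cod (Vert K) _" _ "Dom (Vert K) _" "Cod (Vert K) _"]
    two_category.comp1_closed[OF assms]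
  by (simp_all add: two_category_def)

lemma two_id_simps [simp]: "F0 two_id = id" "F1 two_id = id" "F2 two_id = id"
  by (simp_all add: two_id_def)

lemma two_comp_simps [simp]:
  "F0 (G \<circ>\<^sub>2 F) A = F0 G (F0 F A)" "F1 (G \<circ>\<^sub>2 F) f = F1 G (F1 F f)" "F2 (G \<circ>\<^sub>2 F) \<theta> = F2 G (F2 F \<theta>)"
  by (simp_all add: two_comp_def)

lemma two_functor_id: "two_category K \<Longrightarrow> two_functor K K two_id"
  by (rule two_functorI) simp_all

lemma two_functor_comp:
  assumes "two_functor K M F" "two_functor M N G"
  shows "two_functor K N (G \<circ>\<^sub>2 F)"
proof -
  note FD = two_functorD[OF assms(1)] and GD = two_functorD[OF assms(2)]
  show ?thesis
    by (rule two_functorI) (simp_all add: FD GD two_categoryD(15,16)[OF FD(1)])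
qed

lemma two_functor_eqD:
  assumes "two_functor_eq K F G"
  shows "\<And>A. A \<in> Cell0 K \<Longrightarrow> F0 F A = F0 G A" "\<And>f. f \<in> Cell1 K \<Longrightarrow> F1 F f = F1 G f"
    "\<And>\<theta>. \<theta> \<in> Cell2 K \<Longrightarrow> F2 F \<theta> = F2 G \<theta>"
  using assms by (auto simp: two_functor_eq_def)

lemma two_functor_eq_sym: "two_functor_eq K F G \<Longrightarrow> two_functor_eq K G F"
  by (simp add: two_functor_eq_def)

lemma two_functor_eq_trans: "two_functor_eq K F G \<Longrightarrow> two_functor_eq K G H \<Longrightarrow> two_functor_eq K F H"
  by (simp add: two_functor_eq_def)

lemma two_functor_eq_comp_left: "two_functor_eq K F G \<Longrightarrow> two_functor_eq K (H \<circ>\<^sub>2 F) (H \<circ>\<^sub>2 G)"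
  by (simp add: two_functor_eq_def)

lemma two_functor_eq_comp_right:
  assumes "two_functor_eq K F G" "two_functor L K H"
  shows "two_functor_eq L (F \<circ>\<^sub>2 H) (G \<circ>\<^sub>2 H)"
  using two_functor_eqD[OF assms(1)] two_functorD[OF assms(2)] by (simp add: two_functor_eq_def)

lemma two_functor_cong:
  assumes F: "two_functor K M F" and e: "two_functor_eq K F G"
  shows "two_functor K M G"
  by (rule two_functorI)
    (simp_all add: two_functorD(1,2)[OF F] two_functorD(3-)[OF F] two_categoryD[OF two_functorD(1)[OF F]]
      two_functor_eqD[OF e, symmetric])

section \<open>Transport along isomorphisms\<close>

text \<open>
  Each axiom for cells of \<open>M\<close> is the image of the axiom for their preimages in \<open>K\<close>. So a
  structure \<open>M\<close> in bijection with a 2-category \<open>K\<close>, compatibly with sources, targets, units and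
  compositions, is a 2-category isomorphic to \<open>K\<close>.
\<close>

lemma mutually_inverse_transport:
  fixes F :: "('p, 'q, 'r, 's, 't, 'u) two_fctr" and G :: "('s, 't, 'u, 'p, 'q, 'r) two_fctr"
  assumes K: "two_category K" and V: "category (Vert M)"
    and F0: "\<And>A. A \<in> Cell0 K \<Longrightarrow> F0 F A \<in> Cell0 M" and G0: "\<And>A. A \<in> Cell0 M \<Longrightarrow> F0 G A \<in> Cell0 K"
    and F1: "\<And>f. f \<in> Cell1 K \<Longrightarrow> F1 F f \<in> Cell1 M" and G1: "\<And>f. f \<in> Cell1 M \<Longrightarrow> F1 G f \<in> Cell1 K"
    and F2: "\<And>\<theta>. \<theta> \<in> Cell2 K \<Longrightarrow> F2 F \<theta> \<in> Cell2 M" and G2: "\<And>\<theta>. \<theta> \<in> Cell2 M \<Longrightarrow> F2 G \<theta> \<in> Cell2 K"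
    and GF: "two_functor_eq K (G \<circ>\<^sub>2 F) two_id" and FG: "two_functor_eq M (F \<circ>\<^sub>2 G) two_id"
    and s: "\<And>f. f \<in> Cell1 K \<Longrightarrow> src M (F1 F f) = F0 F (src K f)"
    and t: "\<And>f. f \<in> Cell1 K \<Longrightarrow> trg M (F1 F f) = F0 F (trg K f)"
    and d: "\<And>\<theta>. \<theta> \<in> Cell2 K \<Longrightarrow> Dom (Vert M) (F2 F \<theta>) = F1 F (Dom (Vert K) \<theta>)"
    and c: "\<And>\<theta>. \<theta> \<in> Cell2 K \<Longrightarrow> Cod (Vert M) (F2 F \<theta>) = F1 F (Cod (Vert K) \<theta>)"
    and I: "\<And>f. f \<in> Cell1 K \<Longrightarrow> Ide (Vert M) (F1 F f) = F2 F (Ide (Vert K) f)"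
    and m: "\<And>\<theta> \<kappa>. \<theta> \<in> Cell2 K \<Longrightarrow> \<kappa> \<in> Cell2 K \<Longrightarrow> Dom (Vert K) \<kappa> = Cod (Vert K) \<theta> \<Longrightarrow>
      F2 F \<kappa> \<cdot>\<^bsub>Vert M\<^esub> F2 F \<theta> = F2 F (\<kappa> \<cdot>\<^bsub>Vert K\<^esub> \<theta>)"
    and o: "\<And>A. A \<in> Cell0 K \<Longrightarrow> one M (F0 F A) = F1 F (one K A)"
    and m1: "\<And>f g. f \<in> Cell1 K \<Longrightarrow> g \<in> Cell1 K \<Longrightarrow> src K g = trg K f \<Longrightarrow>
      F1 F g \<odot>\<^bsub>M\<^esub> F1 F f = F1 F (g \<odot>\<^bsub>K\<^esub> f)"
    and m2: "\<And>\<theta> \<kappa>. \<theta> \<in> Cell2 K \<Longrightarrow> \<kappa> \<in> Cell2 K \<Longrightarrow> src2 K \<kappa> = trg2 K \<theta> \<Longrightarrow>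
      F2 F \<kappa> \<diamondop>\<^bsub>M\<^esub> F2 F \<theta> = F2 F (\<kappa> \<diamondop>\<^bsub>K\<^esub> \<theta>)"
  shows "mutually_inverse K M F G"
proof -
  note D = two_categoryD[OF K]
  interpret K: two_category K by (fact K)
  have i: "F0 G (F0 F A) = A" if "A \<in> Cell0 K" for A using two_functor_eqD(1)[OF GF that] by simp
  have i1: "F1 G (F1 F A) = A" if "A \<in> Cell1 K" for A using two_functor_eqD(2)[OF GF that] by simp
  have i2: "F2 G (F2 F A) = A" if "A \<in> Cell2 K" for A using two_functor_eqD(3)[OF GF that] by simp
  have e0: "F0 F A = F0 F B \<longleftrightarrow> A = B" if "A \<in> Cell0 K" "B \<in> Cell0 K" for A B
    using i[OF that(1)] i[OF that(2)] by metis
  have e1: "F1 F A = F1 F B \<longleftrightarrow> A = B" if "A \<in> Cell1 K" "B \<in> Cell1 K" for A B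
    using i1[OF that(1)] i1[OF that(2)] by metis
  have p0: "\<exists>B \<in> Cell0 K. A = F0 F B" if "A \<in> Cell0 M" for A
    using that G0 two_functor_eqD(1)[OF FG that] by force
  have p1: "\<exists>B \<in> Cell1 K. A = F1 F B" if "A \<in> Cell1 M" for A
    using that G1 two_functor_eqD(2)[OF FG that] by force
  have p2: "\<exists>B \<in> Cell2 K. A = F2 F B" if "A \<in> Cell2 M" for A
    using that G2 two_functor_eqD(3)[OF FG that] by force
  note S = F0 F1 F2 s t d c I m o m1 m2 e0 e1 D Dom_Obj[OF D(1)] Cod_Obj[OF D(1)]
    Ide_simps[OF D(1)] Cmp_simps[OF D(1)]
  have M: "two_category M"
  proof (rule two_category.intro)
    show "category (Vert M)" by (fact V)
    show "src M f \<in> Cell0 M" "trg M f \<in> Cell0 M" if "f \<in> Cell1 M" for f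
      using p1[OF that] by (auto simp: S)
    show "src M (Cod (Vert M) \<theta>) = src2 M \<theta>" "trg M (Cod (Vert M) \<theta>) = trg2 M \<theta>" if "\<theta> \<in> Cell2 M" for \<theta>
      using p2[OF that] by (auto simp: S)
    show "one M A \<in> Cell1 M \<and> src M (one M A) = A \<and> trg M (one M A) = A" if "A \<in> Cell0 M" for A
      using p0[OF that] by (auto simp: S)
    show "g \<odot>\<^bsub>M\<^esub> f \<in> Cell1 M \<and> src M (g \<odot>\<^bsub>M\<^esub> f) = src M f \<and> trg M (g \<odot>\<^bsub>M\<^esub> f) = trg M g"
      if "f \<in> Cell1 M" "g \<in> Cell1 M" "src M g = trg M f" for f g
      using p1[OF that(1)] p1[OF that(2)] that(3) by (auto simp: S)
    show "\<kappa> \<diamondop>\<^bsub>M\<^esub> \<theta> \<in> Hom (Vert M) (g \<odot>\<^bsub>M\<^esub> f) (g' \<odot>\<^bsub>M\<^esub> f')"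
      if "\<theta> \<in> Hom (Vert M) f f'" "\<kappa> \<in> Hom (Vert M) g g'" "src M g = trg M f" for f f' g g' \<theta> \<kappa>
      using p2[of \<theta>] p2[of \<kappa>] that by (auto simp: S)
    show "f \<odot>\<^bsub>M\<^esub> one M (src M f) = f" "one M (trg M f) \<odot>\<^bsub>M\<^esub> f = f" if "f \<in> Cell1 M" for f
      using p1[OF that] by (auto simp: S K.comp1_one_right K.comp1_one_left)
    show "h \<odot>\<^bsub>M\<^esub> g \<odot>\<^bsub>M\<^esub> f = (h \<odot>\<^bsub>M\<^esub> g) \<odot>\<^bsub>M\<^esub> f"
      if "f \<in> Cell1 M" "g \<in> Cell1 M" "h \<in> Cell1 M" "src M g = trg M f" "src M h = trg M g" for f g h
      using p1[OF that(1)] p1[OF that(2)] p1[OF that(3)] that(4,5) by (auto simp: S K.comp1_assoc)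
    show "\<theta> \<diamondop>\<^bsub>M\<^esub> Ide (Vert M) (one M (src2 M \<theta>)) = \<theta>" "Ide (Vert M) (one M (trg2 M \<theta>)) \<diamondop>\<^bsub>M\<^esub> \<theta> = \<theta>"
      if "\<theta> \<in> Cell2 M" for \<theta>
      using p2[OF that] by (auto simp: S K.comp2_one_right K.comp2_one_left)
    show "\<xi> \<diamondop>\<^bsub>M\<^esub> \<kappa> \<diamondop>\<^bsub>M\<^esub> \<theta> = (\<xi> \<diamondop>\<^bsub>M\<^esub> \<kappa>) \<diamondop>\<^bsub>M\<^esub> \<theta>"
      if "\<theta> \<in> Cell2 M" "\<kappa> \<in> Cell2 M" "\<xi> \<in> Cell2 M" "src2 M \<kappa> = trg2 M \<theta>" "src2 M \<xi> = trg2 M \<kappa>" for \<theta> \<kappa> \<xi>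
      using p2[OF that(1)] p2[OF that(2)] p2[OF that(3)] that(4,5) by (auto simp: S K.comp2_assoc)
    show "Ide (Vert M) g \<diamondop>\<^bsub>M\<^esub> Ide (Vert M) f = Ide (Vert M) (g \<odot>\<^bsub>M\<^esub> f)"
      if "f \<in> Cell1 M" "g \<in> Cell1 M" "src M g = trg M f" for f g
      using p1[OF that(1)] p1[OF that(2)] that(3) by (auto simp: S K.comp2_Ide)
    show "(\<kappa>' \<cdot>\<^bsub>Vert M\<^esub> \<kappa>) \<diamondop>\<^bsub>M\<^esub> (\<theta>' \<cdot>\<^bsub>Vert M\<^esub> \<theta>) = (\<kappa>' \<diamondop>\<^bsub>M\<^esub> \<theta>') \<cdot>\<^bsub>Vert M\<^esub> (\<kappa> \<diamondop>\<^bsub>M\<^esub> \<theta>)"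
      if h: "\<theta> \<in> Hom (Vert M) f f'" "\<theta>' \<in> Hom (Vert M) f' f''" "\<kappa> \<in> Hom (Vert M) g g'"
        "\<kappa>' \<in> Hom (Vert M) g' g''" "src M g = trg M f" for f f' f'' g g' g'' \<theta> \<theta>' \<kappa> \<kappa>'
    proof -
      obtain a a' b b' where ab: "a \<in> Cell2 K" "a' \<in> Cell2 K" "b \<in> Cell2 K" "b' \<in> Cell2 K"
        "\<theta> = F2 F a" "\<theta>' = F2 F a'" "\<kappa> = F2 F b" "\<kappa>' = F2 F b'"
        using p2 h unfolding mem_Hom by metis
      have x: "Dom (Vert K) a' = Cod (Vert K) a" "Dom (Vert K) b' = Cod (Vert K) b" "src2 K b = trg2 K a"
        using h ab by (auto simp: S)
      have y: "src K (Cod (Vert K) b) = trg K (Cod (Vert K) a)"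
        using x ab by (simp add: S)
      show ?thesis
        using K.interchange[of a "Dom (Vert K) a" "Cod (Vert K) a" a' "Cod (Vert K) a'"
            b "Dom (Vert K) b" "Cod (Vert K) b" b' "Cod (Vert K) b'"] ab x y
        by (simp add: S)
    qed
  qed
  have "two_functor K M F"
    by (rule two_functorI) (simp_all add: K M S)
  moreover have "two_functor M K G"
  proof (rule two_functorI)
    show "F1 G (g \<odot>\<^bsub>M\<^esub> f) = F1 G g \<odot>\<^bsub>K\<^esub> F1 G f" if "f \<in> Cell1 M" "g \<in> Cell1 M" "src M g = trg M f" for f g
      using p1[OF that(1)] p1[OF that(2)] that(3) by (auto simp: S i1)
    show "F2 G (\<kappa> \<cdot>\<^bsub>Vert M\<^esub> \<theta>) = F2 G \<kappa> \<cdot>\<^bsub>Vert K\<^esub> F2 G \<theta>"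
      if "\<theta> \<in> Cell2 M" "\<kappa> \<in> Cell2 M" "Dom (Vert M) \<kappa> = Cod (Vert M) \<theta>" for \<theta> \<kappa>
      using p2[OF that(1)] p2[OF that(2)] that(3) by (auto simp: S i2)
    show "F2 G (\<kappa> \<diamondop>\<^bsub>M\<^esub> \<theta>) = F2 G \<kappa> \<diamondop>\<^bsub>K\<^esub> F2 G \<theta>"
      if "\<theta> \<in> Cell2 M" "\<kappa> \<in> Cell2 M" "src2 M \<kappa> = trg2 M \<theta>" for \<theta> \<kappa>
      using p2[OF that(1)] p2[OF that(2)] that(3) by (auto simp: S i2)
  qed (use K M G0 G1 G2 in \<open>auto dest!: p0 p1 p2 simp: S i i1 i2\<close>)
  ultimately show ?thesis using GF FG by (simp add: mutually_inverse_def)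
qed

section \<open>2-natural transformations and 2-adjunctions\<close>

lemma two_naturalD:
  assumes "two_natural K M F G \<tau>"
  shows "two_functor K M F" "two_functor K M G"
    "\<And>A. A \<in> Cell0 K \<Longrightarrow> \<tau> A \<in> Cell1 M" "\<And>A. A \<in> Cell0 K \<Longrightarrow> src M (\<tau> A) = F0 F A"
    "\<And>A. A \<in> Cell0 K \<Longrightarrow> trg M (\<tau> A) = F0 G A"
    "\<And>f. f \<in> Cell1 K \<Longrightarrow> F1 G f \<odot>\<^bsub>M\<^esub> \<tau> (src K f) = \<tau> (trg K f) \<odot>\<^bsub>M\<^esub> F1 F f"
    "\<And>\<theta>. \<theta> \<in> Cell2 K \<Longrightarrow> F2 G \<theta> \<diamondop>\<^bsub>M\<^esub> Ide (Vert M) (\<tau> (src2 K \<theta>)) =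
      Ide (Vert M) (\<tau> (trg2 K \<theta>)) \<diamondop>\<^bsub>M\<^esub> F2 F \<theta>"
  using assms unfolding two_natural_def by blast+

lemma two_naturalI:
  assumes "two_functor K M F" "two_functor K M G"
    "\<And>A. A \<in> Cell0 K \<Longrightarrow> \<tau> A \<in> Cell1 M" "\<And>A. A \<in> Cell0 K \<Longrightarrow> src M (\<tau> A) = F0 F A"
    "\<And>A. A \<in> Cell0 K \<Longrightarrow> trg M (\<tau> A) = F0 G A"
    "\<And>f. f \<in> Cell1 K \<Longrightarrow> F1 G f \<odot>\<^bsub>M\<^esub> \<tau> (src K f) = \<tau> (trg K f) \<odot>\<^bsub>M\<^esub> F1 F f"
    "\<And>\<theta>. \<theta> \<in> Cell2 K \<Longrightarrow> F2 G \<theta> \<diamondop>\<^bsub>M\<^esub> Ide (Vert M) (\<tau> (src2 K \<theta>)) =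
      Ide (Vert M) (\<tau> (trg2 K \<theta>)) \<diamondop>\<^bsub>M\<^esub> F2 F \<theta>"
  shows "two_natural K M F G \<tau>"
  unfolding two_natural_def using assms by blast

lemma two_natural_whisker_left:
  assumes t: "two_natural K M F G \<tau>" and H: "two_functor M N H"
  shows "two_natural K N (H \<circ>\<^sub>2 F) (H \<circ>\<^sub>2 G) (\<lambda>A. F1 H (\<tau> A))"
proof -
  note T = two_naturalD[OF t] and HD = two_functorD[OF H]
  note FD = two_functorD[OF T(1)] and GD = two_functorD[OF T(2)]
  note KD = two_categoryD[OF FD(1)] and MD = two_categoryD[OF FD(2)]
  note V = Dom_Obj[OF KD(1)] Cod_Obj[OF KD(1)] Ide_simps[OF MD(1)]
  show ?thesis
  proof (rule two_naturalI)
    show "F1 (H \<circ>\<^sub>2 G) f \<odot>\<^bsub>N\<^esub> F1 H (\<tau> (src K f)) = F1 H (\<tau> (trg K f)) \<odot>\<^bsub>N\<^esub> F1 (H \<circ>\<^sub>2 F) f"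
      if "f \<in> Cell1 K" for f
      using that arg_cong[OF T(6)[OF that], of "F1 H"]
      by (simp add: HD(13) T(3-5) FD(3-6) GD(3-6) KD(2,3))
    show "F2 (H \<circ>\<^sub>2 G) \<theta> \<diamondop>\<^bsub>N\<^esub> Ide (Vert N) (F1 H (\<tau> (src2 K \<theta>))) =
        Ide (Vert N) (F1 H (\<tau> (trg2 K \<theta>))) \<diamondop>\<^bsub>N\<^esub> F2 (H \<circ>\<^sub>2 F) \<theta>" if "\<theta> \<in> Cell2 K" for \<theta>
    proof -
      have "F2 H (F2 G \<theta> \<diamondop>\<^bsub>M\<^esub> Ide (Vert M) (\<tau> (src2 K \<theta>))) = F2 H (F2 G \<theta>) \<diamondop>\<^bsub>N\<^esub> F2 H (Ide (Vert M) (\<tau> (src2 K \<theta>)))"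
        using that by (intro HD(14)) (simp_all add: T(3-5) FD(3-9) GD(3-9) KD(2,3) V)
      moreover have "F2 H (Ide (Vert M) (\<tau> (trg2 K \<theta>)) \<diamondop>\<^bsub>M\<^esub> F2 F \<theta>) = F2 H (Ide (Vert M) (\<tau> (trg2 K \<theta>))) \<diamondop>\<^bsub>N\<^esub> F2 H (F2 F \<theta>)"
        using that by (intro HD(14)) (simp_all add: T(3-5) FD(3-9) GD(3-9) KD(2,3) V)
      ultimately show ?thesis using T(7)[OF that] that by (simp add: HD(10) T(3) V KD(2,3))
    qed
  qed (simp_all add: two_functor_comp[OF T(1) H] two_functor_comp[OF T(2) H] HD T(3-5))
qed

lemma two_natural_whisker_right:
  assumes t: "two_natural K M F G \<tau>" and H: "two_functor L K H"
  shows "two_natural L M (F \<circ>\<^sub>2 H) (G \<circ>\<^sub>2 H) (\<lambda>A. \<tau> (F0 H A))"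
proof -
  note T = two_naturalD[OF t] and HD = two_functorD[OF H]
  note V = Dom_Obj[OF two_categoryD(1)[OF HD(1)]]
  show ?thesis
  proof (rule two_naturalI)
    show "F1 (G \<circ>\<^sub>2 H) f \<odot>\<^bsub>M\<^esub> \<tau> (F0 H (src L f)) = \<tau> (F0 H (trg L f)) \<odot>\<^bsub>M\<^esub> F1 (F \<circ>\<^sub>2 H) f"
      if "f \<in> Cell1 L" for f
      using T(6)[of "F1 H f"] that by (simp add: HD)
    show "F2 (G \<circ>\<^sub>2 H) \<theta> \<diamondop>\<^bsub>M\<^esub> Ide (Vert M) (\<tau> (F0 H (src2 L \<theta>))) =
        Ide (Vert M) (\<tau> (F0 H (trg2 L \<theta>))) \<diamondop>\<^bsub>M\<^esub> F2 (F \<circ>\<^sub>2 H) \<theta>" if "\<theta> \<in> Cell2 L" for \<theta>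
      using T(7)[of "F2 H \<theta>"] that by (simp add: HD V)
  qed (simp_all add: two_functor_comp[OF H T(1)] two_functor_comp[OF H T(2)] HD T(3-5))
qed

lemma two_natural_cong:
  assumes t: "two_natural K M F G \<tau>" and "two_functor_eq K F F'" "two_functor_eq K G G'"
    and e: "\<And>A. A \<in> Cell0 K \<Longrightarrow> \<tau> A = \<tau>' A"
  shows "two_natural K M F' G' \<tau>'"
proof -
  note T = two_naturalD[OF t]
  note KD = two_categoryD[OF two_functorD(1)[OF T(1)]]
  note V = Dom_Obj[OF KD(1)]
  show ?thesis
    by (rule two_naturalI)
      (use T two_functor_cong[OF T(1) assms(2)] two_functor_cong[OF T(2) assms(3)] KD V in
        \<open>simp_all add: two_functor_eqD[OF assms(2), symmetric] two_functor_eqD[OF assms(3), symmetric] e[symmetric]\<close>)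
qed

lemma invertible1_image:
  assumes "two_functor M N H" "invertible1 M f"
  shows "invertible1 N (F1 H f)"
proof -
  note HD = two_functorD[OF assms(1)]
  note MD = two_categoryD[OF HD(1)]
  obtain g where "f \<in> Cell1 M" "g \<in> Cell1 M" "src M g = trg M f" "trg M g = src M f"
      "g \<odot>\<^bsub>M\<^esub> f = one M (src M f)" "f \<odot>\<^bsub>M\<^esub> g = one M (trg M f)"
    using assms(2) unfolding invertible1_def by blast
  then show ?thesis unfolding invertible1_def
    by (intro conjI bexI[of _ "F1 H g"])
      (simp_all add: HD(4-6) HD(12)[symmetric] HD(13)[symmetric] MD(2,3))
qed

lemma two_natural_iso_whisker_left:
  "two_natural_iso K M F G \<tau> \<Longrightarrow> two_functor M N H \<Longrightarrow>
    two_natural_iso K N (H \<circ>\<^sub>2 F) (H \<circ>\<^sub>2 G) (\<lambda>A. F1 H (\<tau> A))"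
  by (auto simp: two_natural_iso_def intro: two_natural_whisker_left invertible1_image)

lemma two_natural_iso_whisker_right:
  "two_natural_iso K M F G \<tau> \<Longrightarrow> two_functor L K H \<Longrightarrow>
    two_natural_iso L M (F \<circ>\<^sub>2 H) (G \<circ>\<^sub>2 H) (\<lambda>A. \<tau> (F0 H A))"
  by (auto simp: two_natural_iso_def intro: two_natural_whisker_right dest: two_functorD(3))

lemma two_natural_iso_cong:
  "two_natural_iso K M F G \<tau> \<Longrightarrow> two_functor_eq K F F' \<Longrightarrow> two_functor_eq K G G' \<Longrightarrow>
    (\<And>A. A \<in> Cell0 K \<Longrightarrow> \<tau> A = \<tau>' A) \<Longrightarrow> two_natural_iso K M F' G' \<tau>'"
  using two_natural_cong[of K M F G \<tau> F' G' \<tau>'] by (simp add: two_natural_iso_def)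

lemma two_adjunction_cong:
  assumes "two_adjunction K M F G" and e: "two_functor_eq K F F'" "two_functor_eq M G G'"
  shows "two_adjunction K M F' G'"
proof -
  obtain \<eta> \<epsilon> where a: "two_functor K M F" "two_functor M K G"
    "two_natural K K two_id (G \<circ>\<^sub>2 F) \<eta>" "two_natural M M (F \<circ>\<^sub>2 G) two_id \<epsilon>"
    "\<And>A. A \<in> Cell0 K \<Longrightarrow> \<epsilon> (F0 F A) \<odot>\<^bsub>M\<^esub> F1 F (\<eta> A) = one M (F0 F A)"
    "\<And>B. B \<in> Cell0 M \<Longrightarrow> F1 G (\<epsilon> B) \<odot>\<^bsub>K\<^esub> \<eta> (F0 G B) = one K (F0 G B)"
    using assms(1) unfolding two_adjunction_def by metis
  note E = two_functor_eqD[OF e(1)] two_functor_eqD[OF e(2)]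
  have F: "two_functor K M F'" "two_functor M K G'"
    using two_functor_cong[OF a(1) e(1)] two_functor_cong[OF a(2) e(2)] .
  have "two_functor_eq K (G \<circ>\<^sub>2 F) (G' \<circ>\<^sub>2 F')"
    using two_functor_eq_trans[OF two_functor_eq_comp_left[OF e(1)] two_functor_eq_comp_right[OF e(2) F(1)]] .
  then have "two_natural K K two_id (G' \<circ>\<^sub>2 F') \<eta>"
    by (rule two_natural_cong[OF a(3), rotated]) (simp_all add: two_functor_eq_def)
  moreover have "two_functor_eq M (F \<circ>\<^sub>2 G) (F' \<circ>\<^sub>2 G')"
    using two_functor_eq_trans[OF two_functor_eq_comp_left[OF e(2)] two_functor_eq_comp_right[OF e(1) F(2)]] .
  then have "two_natural M M (F' \<circ>\<^sub>2 G') two_id \<epsilon>"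
    by (rule two_natural_cong[OF a(4)]) (simp_all add: two_functor_eq_def)
  ultimately show ?thesis
    unfolding two_adjunction_def using F a(5,6) E two_naturalD(3)[OF a(3)] two_naturalD(3)[OF a(4)] by metis
qed

text \<open>
  The unit and the counit are conjugated with the isomorphisms \<open>A\<close> and \<open>B\<close>, and the triangle
  identities are the images under \<open>B\<close> and \<open>A\<close> of the given ones.
\<close>

lemma two_adjunction_transport:
  assumes adj: "two_adjunction K M F G"
    and A: "mutually_inverse K K' A A'" and B: "mutually_inverse M M' B B'"
  shows "two_adjunction K' M' (B \<circ>\<^sub>2 F \<circ>\<^sub>2 A') (A \<circ>\<^sub>2 G \<circ>\<^sub>2 B')"
proof -
  obtain \<eta> \<epsilon> where a: "two_functor K M F" "two_functor M K G"
    "two_natural K K two_id (G \<circ>\<^sub>2 F) \<eta>" "two_natural M M (F \<circ>\<^sub>2 G) two_id \<epsilon>"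
    "\<And>A. A \<in> Cell0 K \<Longrightarrow> \<epsilon> (F0 F A) \<odot>\<^bsub>M\<^esub> F1 F (\<eta> A) = one M (F0 F A)"
    "\<And>B. B \<in> Cell0 M \<Longrightarrow> F1 G (\<epsilon> B) \<odot>\<^bsub>K\<^esub> \<eta> (F0 G B) = one K (F0 G B)"
    using adj unfolding two_adjunction_def by metis
  have f: "two_functor K K' A" "two_functor K' K A'" "two_functor M M' B" "two_functor M' M B'"
    and i: "two_functor_eq K (A' \<circ>\<^sub>2 A) two_id" "two_functor_eq K' (A \<circ>\<^sub>2 A') two_id"
      "two_functor_eq M (B' \<circ>\<^sub>2 B) two_id" "two_functor_eq M' (B \<circ>\<^sub>2 B') two_id"
    using A B unfolding mutually_inverse_def by blast+
  note fD = two_functorD(3-6)[OF f(1)] two_functorD(3-6)[OF f(2)] two_functorD(3-6)[OF f(3)] two_functorD(3-6)[OF f(4)]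
    two_functorD(3-7)[OF a(1)] two_functorD(3-7)[OF a(2)]
    two_functorD(7)[OF f(1)] two_functorD(7)[OF f(2)] two_functorD(7)[OF f(3)] two_functorD(7)[OF f(4)]
  note id = two_functor_eqD[OF i(1), simplified] two_functor_eqD[OF i(2), simplified]
    two_functor_eqD[OF i(3), simplified] two_functor_eqD[OF i(4), simplified]
  note N = two_naturalD(3-5)[OF a(3)] two_naturalD(3-5)[OF a(4)]
  have "two_natural K' K' two_id ((A \<circ>\<^sub>2 G \<circ>\<^sub>2 B') \<circ>\<^sub>2 (B \<circ>\<^sub>2 F \<circ>\<^sub>2 A')) (\<lambda>C. F1 A (\<eta> (F0 A' C)))"
    by (rule two_natural_cong[OF two_natural_whisker_left[OF two_natural_whisker_right[OF a(3) f(2)] f(1)]])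
      (simp_all add: two_functor_eq_def fD id)
  moreover have "two_natural M' M' ((B \<circ>\<^sub>2 F \<circ>\<^sub>2 A') \<circ>\<^sub>2 (A \<circ>\<^sub>2 G \<circ>\<^sub>2 B')) two_id (\<lambda>C. F1 B (\<epsilon> (F0 B' C)))"
    by (rule two_natural_cong[OF two_natural_whisker_left[OF two_natural_whisker_right[OF a(4) f(4)] f(3)]])
      (simp_all add: two_functor_eq_def fD id)
  moreover have "F1 B (\<epsilon> (F0 B' (F0 (B \<circ>\<^sub>2 F \<circ>\<^sub>2 A') C))) \<odot>\<^bsub>M'\<^esub> F1 (B \<circ>\<^sub>2 F \<circ>\<^sub>2 A') (F1 A (\<eta> (F0 A' C))) =
      one M' (F0 (B \<circ>\<^sub>2 F \<circ>\<^sub>2 A') C)" if "C \<in> Cell0 K'" for C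
    using that arg_cong[OF a(5)[of "F0 A' C"], of "F1 B"]
    by (simp add: id fD N two_functorD(12,13)[OF f(3)])
  moreover have "F1 (A \<circ>\<^sub>2 G \<circ>\<^sub>2 B') (F1 B (\<epsilon> (F0 B' C))) \<odot>\<^bsub>K'\<^esub> F1 A (\<eta> (F0 A' (F0 (A \<circ>\<^sub>2 G \<circ>\<^sub>2 B') C))) =
      one K' (F0 (A \<circ>\<^sub>2 G \<circ>\<^sub>2 B') C)" if "C \<in> Cell0 M'" for C
    using that arg_cong[OF a(6)[of "F0 B' C"], of "F1 A"]
    by (simp add: id fD N two_functorD(12,13)[OF f(1)])
  ultimately show ?thesis
    unfolding two_adjunction_def
    using two_functor_comp[OF two_functor_comp[OF f(2) a(1)] f(3)] two_functor_comp[OF two_functor_comp[OF f(4) a(2)] f(1)]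
    by (simp add: two_comp_def comp_assoc) blast
qed

text \<open>
  Cancelling the isomorphisms \<open>A\<close> and \<open>B\<close> from \<open>B F = G A\<close>. In particular \<open>G\<close> inherits
  2-functoriality from \<open>F\<close>.
\<close>

lemma square_conjugate:
  assumes A: "mutually_inverse K K' A A'" and B: "mutually_inverse M M' B B'" and F: "two_functor K M F"
    and e: "two_functor_eq K (B \<circ>\<^sub>2 F) (G \<circ>\<^sub>2 A)"
  shows "two_functor_eq K' (B \<circ>\<^sub>2 F \<circ>\<^sub>2 A') G" "two_functor_eq K' (F \<circ>\<^sub>2 A') (B' \<circ>\<^sub>2 G)" "two_functor K' M' G"
proof -
  have f: "two_functor K' K A'" "two_functor M M' B"
    and i: "two_functor_eq K' (A \<circ>\<^sub>2 A') two_id" "two_functor_eq M (B' \<circ>\<^sub>2 B) two_id"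
    using A B unfolding mutually_inverse_def by blast+
  note D = two_functorD(3,4)[OF f(1)] two_functorD(7)[OF f(1)] two_functorD(3,4)[OF F] two_functorD(7)[OF F]
  show g: "two_functor_eq K' (B \<circ>\<^sub>2 F \<circ>\<^sub>2 A') G"
    using D two_functor_eqD[OF e] two_functor_eqD[OF i(1)] by (simp add: two_functor_eq_def)
  show "two_functor_eq K' (F \<circ>\<^sub>2 A') (B' \<circ>\<^sub>2 G)"
    using D two_functor_eqD[OF i(2)] by (simp add: two_functor_eq_def two_functor_eqD[OF g, symmetric])
  show "two_functor K' M' G" by (rule two_functor_cong[OF two_functor_comp[OF two_functor_comp[OF f(1) F] f(2), simplified] g[simplified]])
qed

section \<open>Locally full sub-2-categories\<close>

lemma restrict_1cells_simps [simp]: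
  "Cell0 (restrict_1cells K P) = Cell0 K" "src (restrict_1cells K P) = src K"
  "trg (restrict_1cells K P) = trg K" "one (restrict_1cells K P) = one K"
  "comp1 (restrict_1cells K P) = comp1 K" "comp2 (restrict_1cells K P) = comp2 K"
  "Vert (restrict_1cells K P) = mk_category
    {f \<in> Cell1 K. P f} {\<theta> \<in> Cell2 K. P (Dom (Vert K) \<theta>) \<and> P (Cod (Vert K) \<theta>)}
    (Dom (Vert K)) (Cod (Vert K)) (Ide (Vert K)) (Cmp (Vert K))"
  by (simp_all add: restrict_1cells_def)

lemma two_category_restrict:
  assumes K: "two_category K"
    and P1: "\<And>A. A \<in> Cell0 K \<Longrightarrow> P (one K A)"
    and Pc: "\<And>f g. f \<in> Cell1 K \<Longrightarrow> g \<in> Cell1 K \<Longrightarrow> src K g = trg K f \<Longrightarrow> P f \<Longrightarrow> P g \<Longrightarrow> P (g \<odot>\<^bsub>K\<^esub> f)"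
  shows "two_category (restrict_1cells K P)"
proof -
  note D = two_categoryD[OF K]
  interpret K: two_category K by (fact K)
  note S = D Dom_Obj[OF D(1)] Cod_Obj[OF D(1)] Ide_simps[OF D(1)] Cmp_simps[OF D(1)] P1 Pc
    Cmp_Ide_left[OF D(1)] Cmp_Ide_right[OF D(1)] Cmp_assoc[OF D(1)]
  show ?thesis
  proof (rule two_category.intro)
    show "category (Vert (restrict_1cells K P))"
      unfolding restrict_1cells_simps by (rule category_mk_category) (auto simp: S)
    show "(\<kappa>' \<cdot>\<^bsub>Vert (restrict_1cells K P)\<^esub> \<kappa>) \<diamondop>\<^bsub>restrict_1cells K P\<^esub> (\<theta>' \<cdot>\<^bsub>Vert (restrict_1cells K P)\<^esub> \<theta>) =
        (\<kappa>' \<diamondop>\<^bsub>restrict_1cells K P\<^esub> \<theta>') \<cdot>\<^bsub>Vert (restrict_1cells K P)\<^esub> (\<kappa> \<diamondop>\<^bsub>restrict_1cells K P\<^esub> \<theta>)"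
      if h: "\<theta> \<in> Hom (Vert (restrict_1cells K P)) f f'" "\<theta>' \<in> Hom (Vert (restrict_1cells K P)) f' f''"
        "\<kappa> \<in> Hom (Vert (restrict_1cells K P)) g g'" "\<kappa>' \<in> Hom (Vert (restrict_1cells K P)) g' g''"
        "src (restrict_1cells K P) g = trg (restrict_1cells K P) f" for f f' f'' g g' g'' \<theta> \<theta>' \<kappa> \<kappa>'
    proof -
      have x: "src K (Cod (Vert K) \<kappa>) = trg K (Cod (Vert K) \<theta>)" using h by (auto simp: S)
      show ?thesis using h x K.interchange[of \<theta> f f' \<theta>' f'' \<kappa> g g' \<kappa>' g''] by (auto simp: S)
    qed
  qed (auto simp: S K.comp1_one_right K.comp1_one_left K.comp1_assoc K.comp2_one_right
      K.comp2_one_left K.comp2_assoc K.comp2_Ide)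
qed

lemma two_functor_restrict:
  assumes F: "two_functor K M F"
    and R: "two_category (restrict_1cells K P)" "two_category (restrict_1cells M Q)"
    and PQ: "\<And>f. f \<in> Cell1 K \<Longrightarrow> P f \<Longrightarrow> Q (F1 F f)"
  shows "two_functor (restrict_1cells K P) (restrict_1cells M Q) F"
proof -
  note FD = two_functorD[OF F]
  note S = Dom_Obj[OF two_categoryD(1)[OF FD(1)]] Cod_Obj[OF two_categoryD(1)[OF FD(1)]]
  show ?thesis by (rule two_functorI[OF R]) (auto simp: FD S PQ)
qed

lemma two_functor_restrict_source:
  assumes F: "two_functor K M F" and R: "two_category (restrict_1cells K P)"
  shows "two_functor (restrict_1cells K P) M F"
proof -
  note FD = two_functorD[OF F]
  note S = Dom_Obj[OF two_categoryD(1)[OF FD(1)]] Cod_Obj[OF two_categoryD(1)[OF FD(1)]]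
  show ?thesis by (rule two_functorI[OF R FD(2)]) (auto simp: FD S)
qed

lemma two_functor_restrict_target:
  assumes F: "two_functor K M F" and R: "two_category (restrict_1cells M Q)"
    and Q: "\<And>f. f \<in> Cell1 K \<Longrightarrow> Q (F1 F f)"
  shows "two_functor K (restrict_1cells M Q) F"
proof -
  note FD = two_functorD[OF F]
  note S = Dom_Obj[OF two_categoryD(1)[OF FD(1)]] Cod_Obj[OF two_categoryD(1)[OF FD(1)]]
  show ?thesis by (rule two_functorI[OF FD(1) R]) (auto simp: FD S Q)
qed

lemma mutually_inverse_restrict:
  assumes "mutually_inverse K M F G"
    and R: "two_category (restrict_1cells K P)" "two_category (restrict_1cells M Q)"
    and "\<And>f. f \<in> Cell1 K \<Longrightarrow> P f \<Longrightarrow> Q (F1 F f)" "\<And>f. f \<in> Cell1 M \<Longrightarrow> Q f \<Longrightarrow> P (F1 G f)"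
  shows "mutually_inverse (restrict_1cells K P) (restrict_1cells M Q) F G"
  using assms(1) two_functor_restrict[OF _ R assms(4)] two_functor_restrict[OF _ R(2,1) assms(5)]
  by (auto simp: mutually_inverse_def two_functor_eq_def)

lemma two_functor_eq_restrict: "two_functor_eq K F G \<Longrightarrow> two_functor_eq (restrict_1cells K P) F G"
  by (simp add: two_functor_eq_def restrict_1cells_def)

section \<open>The 2-category of universal arrows\<close>

lemma universal_arrow_simps [simp]:
  assumes "universal_arrow U"
  shows "cat_functor (uR U)"
    "A \<in> Obj (uC U) \<Longrightarrow> uL U A \<in> Obj (uX U)"
    "A \<in> Obj (uC U) \<Longrightarrow> uEta U A \<in> Arr (uC U)"
    "A \<in> Obj (uC U) \<Longrightarrow> Dom (uC U) (uEta U A) = A"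
    "A \<in> Obj (uC U) \<Longrightarrow> Cod (uC U) (uEta U A) = FObj (uR U) (uL U A)"
  using assms unfolding universal_arrow_def PiE_iff mem_Hom by blast+

lemma universal_arrow_ext:
  assumes "universal_arrow U"
  shows "uL U \<in> extensional (Obj (uC U))" "uEta U \<in> extensional (Obj (uC U))"
    "uZeta U \<in> extensional (Obj (uX U))"
    "X \<in> Obj (uX U) \<Longrightarrow> uZeta U X \<in> extensional (Into (uC U) (FObj (uR U) X))"
  using assms unfolding universal_arrow_def PiE_iff by blast+

lemma uZeta_simps [simp]:
  assumes "universal_arrow U" "X \<in> Obj (uX U)" "v \<in> Arr (uC U)" "Cod (uC U) v = FObj (uR U) X"
  shows "uZeta U X v \<in> Arr (uX U)" "Dom (uX U) (uZeta U X v) = uL U (Dom (uC U) v)"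
    "Cod (uX U) (uZeta U X v) = X"
    "A = Dom (uC U) v \<Longrightarrow> FArr (uR U) (uZeta U X v) \<cdot>\<^bsub>uC U\<^esub> uEta U A = v"
proof -
  have "Dom (uC U) v \<in> Obj (uC U)" "v \<in> Hom (uC U) (Dom (uC U) v) (FObj (uR U) X)"
    using assms by auto
  then have "uZeta U X v \<in> Hom (uX U) (uL U (Dom (uC U) v)) X \<and>
      FArr (uR U) (uZeta U X v) \<cdot>\<^bsub>uC U\<^esub> uEta U (Dom (uC U) v) = v"
    using assms(1,2) unfolding universal_arrow_def by blast
  then show "uZeta U X v \<in> Arr (uX U)" "Dom (uX U) (uZeta U X v) = uL U (Dom (uC U) v)"
    "Cod (uX U) (uZeta U X v) = X" "A = Dom (uC U) v \<Longrightarrow> FArr (uR U) (uZeta U X v) \<cdot>\<^bsub>uC U\<^esub> uEta U A = v"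
    by auto
qed

lemma uZeta_extend [simp]:
  assumes "universal_arrow U" "X \<in> Obj (uX U)" "v \<in> Arr (uC U)" "Cod (uC U) v = FObj (uR U) X"
    "x \<in> Arr (uC U)" "Cod (uC U) x = Dom (uC U) v" "A = Dom (uC U) v"
  shows "FArr (uR U) (uZeta U X v) \<cdot>\<^bsub>uC U\<^esub> uEta U A \<cdot>\<^bsub>uC U\<^esub> x = v \<cdot>\<^bsub>uC U\<^esub> x"
proof -
  have "Dom (uC U) v \<in> Obj (uC U)" using assms by simp
  then show ?thesis using assms by (simp add: Cmp_extend[OF uZeta_simps(4)[OF assms(1-4) refl]])
qed

lemma uZeta_unique:
  assumes "universal_arrow U" "A \<in> Obj (uC U)" "w \<in> Arr (uX U)" "Dom (uX U) w = uL U A" "Cod (uX U) w = X"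
    and "FArr (uR U) w \<cdot>\<^bsub>uC U\<^esub> uEta U A = v"
  shows "uZeta U X v = w"
proof -
  have X: "X \<in> Obj (uX U)" and w: "w \<in> Hom (uX U) (uL U A) X" using assms by auto
  have "v \<in> Hom (uC U) A (FObj (uR U) X)"
    unfolding assms(6)[symmetric] using assms(1-5) by simp
  then have "\<forall>w \<in> Hom (uX U) (uL U A) X. FArr (uR U) w \<cdot>\<^bsub>uC U\<^esub> uEta U A = v \<longrightarrow> w = uZeta U X v"
    using assms(1,2) X unfolding universal_arrow_def by blast
  then show ?thesis using assms(6) w by metis
qed

text \<open>
  The form in which universality is used most: equations between arrows out of \<open>L A\<close> are checked
  after applying \<open>R\<close> and restricting along \<open>\<eta>\<close>.
\<close>

lemma universal_arrow_eqI:
  assumes "universal_arrow U" "A \<in> Obj (uC U)" "w \<in> Arr (uX U)" "w' \<in> Arr (uX U)"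
    "Dom (uX U) w = uL U A" "Dom (uX U) w' = uL U A" "Cod (uX U) w = Cod (uX U) w'"
    and "FArr (uR U) w \<cdot>\<^bsub>uC U\<^esub> uEta U A = FArr (uR U) w' \<cdot>\<^bsub>uC U\<^esub> uEta U A"
  shows "w = w'"
  using uZeta_unique[OF assms(1-3,5) assms(7) assms(8)] uZeta_unique[OF assms(1,2,4,6) refl refl] by simp

lemma uZeta_eta [simp]:
  "universal_arrow U \<Longrightarrow> A \<in> Obj (uC U) \<Longrightarrow> uZeta U (uL U A) (uEta U A) = Ide (uX U) (uL U A)"
  by (rule uZeta_unique) auto

lemma uZeta_postcompose:
  assumes "universal_arrow U" "v \<in> Arr (uC U)" "Cod (uC U) v = FObj (uR U) (Dom (uX U) w)" "w \<in> Arr (uX U)"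
  shows "uZeta U (Cod (uX U) w) (FArr (uR U) w \<cdot>\<^bsub>uC U\<^esub> v) = w \<cdot>\<^bsub>uX U\<^esub> uZeta U (Dom (uX U) w) v"
  by (rule uZeta_unique[where A = "Dom (uC U) v"]) (use assms in simp_all)

lemma universal_arrowI:
  assumes "cat_functor (uR U)"
    "uL U \<in> extensional (Obj (uC U))" "uEta U \<in> extensional (Obj (uC U))"
    "uZeta U \<in> extensional (Obj (uX U))"
    "\<And>X. X \<in> Obj (uX U) \<Longrightarrow> uZeta U X \<in> extensional (Into (uC U) (FObj (uR U) X))"
    "\<And>A. A \<in> Obj (uC U) \<Longrightarrow> uL U A \<in> Obj (uX U)"
    "\<And>A. A \<in> Obj (uC U) \<Longrightarrow> uEta U A \<in> Hom (uC U) A (FObj (uR U) (uL U A))"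
    "\<And>X v. X \<in> Obj (uX U) \<Longrightarrow> v \<in> Arr (uC U) \<Longrightarrow> Cod (uC U) v = FObj (uR U) X \<Longrightarrow>
      uZeta U X v \<in> Hom (uX U) (uL U (Dom (uC U) v)) X"
    "\<And>X v. X \<in> Obj (uX U) \<Longrightarrow> v \<in> Arr (uC U) \<Longrightarrow> Cod (uC U) v = FObj (uR U) X \<Longrightarrow>
      FArr (uR U) (uZeta U X v) \<cdot>\<^bsub>uC U\<^esub> uEta U (Dom (uC U) v) = v"
    "\<And>A w. A \<in> Obj (uC U) \<Longrightarrow> w \<in> Arr (uX U) \<Longrightarrow> Dom (uX U) w = uL U A \<Longrightarrow>
      w = uZeta U (Cod (uX U) w) (FArr (uR U) w \<cdot>\<^bsub>uC U\<^esub> uEta U A)"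
  shows "universal_arrow U"
  unfolding universal_arrow_def PiE_iff
  using assms by (auto simp: PiE_iff)

lemma uarr_1cell_simps [simp]:
  assumes "uarr_1cell f"
  shows "universal_arrow (u1s f)" "universal_arrow (u1t f)"
    "cat_functor (u1J f)" "FDom (u1J f) = uC (u1s f)" "FCod (u1J f) = uC (u1t f)"
    "cat_functor (u1V f)" "FDom (u1V f) = uX (u1s f)" "FCod (u1V f) = uX (u1t f)"
    "nat_trans (u1rho f)" "NSrc (u1rho f) = u1J f \<circ>\<^sub>F uR (u1s f)" "NTrg (u1rho f) = uR (u1t f) \<circ>\<^sub>F u1V f"
  using assms unfolding uarr_1cell_def functor_from_to_def nat_iso_from_to_def nat_from_to_def by blast+

abbreviation u1rho' :: "('o, 'm, 'x, 'y) uarr1 \<Rightarrow> 'x \<Rightarrow> 'm" where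
  "u1rho' f X \<equiv> NCmp (nat_inv (u1rho f)) X"

lemma u1rho'_simps [simp]:
  assumes "uarr_1cell f" "X \<in> Obj (uX (u1s f))"
  shows "u1rho' f X \<in> Arr (uC (u1t f))"
    "Dom (uC (u1t f)) (u1rho' f X) = FObj (uR (u1t f)) (FObj (u1V f) X)"
    "Cod (uC (u1t f)) (u1rho' f X) = FObj (u1J f) (FObj (uR (u1s f)) X)"
    "NCmp (u1rho f) X \<cdot>\<^bsub>uC (u1t f)\<^esub> u1rho' f X = Ide (uC (u1t f)) (FObj (uR (u1t f)) (FObj (u1V f) X))"
    "u1rho' f X \<cdot>\<^bsub>uC (u1t f)\<^esub> NCmp (u1rho f) X = Ide (uC (u1t f)) (FObj (u1J f) (FObj (uR (u1s f)) X))"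
proof -
  have "nat_iso_from_to (u1rho f) (u1J f \<circ>\<^sub>F uR (u1s f)) (uR (u1t f) \<circ>\<^sub>F u1V f)"
    using assms(1) unfolding uarr_1cell_def by blast
  note i = nat_inv_simps[OF this]
  show "u1rho' f X \<in> Arr (uC (u1t f))"
    "Dom (uC (u1t f)) (u1rho' f X) = FObj (uR (u1t f)) (FObj (u1V f) X)"
    "Cod (uC (u1t f)) (u1rho' f X) = FObj (u1J f) (FObj (uR (u1s f)) X)"
    "NCmp (u1rho f) X \<cdot>\<^bsub>uC (u1t f)\<^esub> u1rho' f X = Ide (uC (u1t f)) (FObj (uR (u1t f)) (FObj (u1V f) X))"
    "u1rho' f X \<cdot>\<^bsub>uC (u1t f)\<^esub> NCmp (u1rho f) X = Ide (uC (u1t f)) (FObj (u1J f) (FObj (uR (u1s f)) X))"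
    using assms i(4,5)[of X] by (simp_all add: i(1-3))
qed

lemma u1rho'_extend [simp]:
  assumes "uarr_1cell f" "X \<in> Obj (uX (u1s f))" "x \<in> Arr (uC (u1t f))"
  shows "Cod (uC (u1t f)) x = FObj (uR (u1t f)) (FObj (u1V f) X) \<Longrightarrow>
      NCmp (u1rho f) X \<cdot>\<^bsub>uC (u1t f)\<^esub> u1rho' f X \<cdot>\<^bsub>uC (u1t f)\<^esub> x = x"
    "Cod (uC (u1t f)) x = FObj (u1J f) (FObj (uR (u1s f)) X) \<Longrightarrow>
      u1rho' f X \<cdot>\<^bsub>uC (u1t f)\<^esub> NCmp (u1rho f) X \<cdot>\<^bsub>uC (u1t f)\<^esub> x = x"
  using assms by (simp_all add: Cmp_extend[OF u1rho'_simps(4)] Cmp_extend[OF u1rho'_simps(5)])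

lemma u1rho_natural:
  assumes "uarr_1cell f" "w \<in> Arr (uX (u1s f))" "Dom (uX (u1s f)) w = X" "Cod (uX (u1s f)) w = Y"
  shows "NCmp (u1rho f) Y \<cdot>\<^bsub>uC (u1t f)\<^esub> FArr (u1J f) (FArr (uR (u1s f)) w) =
    FArr (uR (u1t f)) (FArr (u1V f) w) \<cdot>\<^bsub>uC (u1t f)\<^esub> NCmp (u1rho f) X"
  using naturality[of "u1rho f" "uC (u1t f)" w] assms by simp

lemma uarr_1cellI:
  assumes "universal_arrow (u1s f)" "universal_arrow (u1t f)"
    "cat_functor (u1J f)" "FDom (u1J f) = uC (u1s f)" "FCod (u1J f) = uC (u1t f)"
    "cat_functor (u1V f)" "FDom (u1V f) = uX (u1s f)" "FCod (u1V f) = uX (u1t f)"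
    "nat_iso_from_to (u1rho f) (u1J f \<circ>\<^sub>F uR (u1s f)) (uR (u1t f) \<circ>\<^sub>F u1V f)"
  shows "uarr_1cell f"
  unfolding uarr_1cell_def functor_from_to_def using assms by blast

lemma uarr_2cell_simps [simp]:
  assumes "uarr_2cell \<theta>"
  shows "uarr_1cell (u2s \<theta>)" "uarr_1cell (u2t \<theta>)"
    "u1s (u2t \<theta>) = u1s (u2s \<theta>)" "u1t (u2t \<theta>) = u1t (u2s \<theta>)"
    "nat_trans (u2a \<theta>)" "NSrc (u2a \<theta>) = u1J (u2s \<theta>)" "NTrg (u2a \<theta>) = u1J (u2t \<theta>)"
    "nat_trans (u2b \<theta>)" "NSrc (u2b \<theta>) = u1V (u2s \<theta>)" "NTrg (u2b \<theta>) = u1V (u2t \<theta>)"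
  using assms unfolding uarr_2cell_def nat_from_to_def by blast+

lemma uarr_2cell_rho:
  assumes "uarr_2cell \<theta>" "X \<in> Obj (uX (u1s (u2s \<theta>)))"
  shows "FArr (uR (u1t (u2s \<theta>))) (NCmp (u2b \<theta>) X) \<cdot>\<^bsub>uC (u1t (u2s \<theta>))\<^esub> NCmp (u1rho (u2s \<theta>)) X =
    NCmp (u1rho (u2t \<theta>)) X \<cdot>\<^bsub>uC (u1t (u2s \<theta>))\<^esub> NCmp (u2a \<theta>) (FObj (uR (u1s (u2s \<theta>))) X)"
proof -
  have "(uR (u1t (u2s \<theta>)) \<star>\<^sub>l u2b \<theta>) \<circ>\<^sub>V u1rho (u2s \<theta>) = u1rho (u2t \<theta>) \<circ>\<^sub>V (u2a \<theta> \<star>\<^sub>r uR (u1s (u2s \<theta>)))"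
    using assms(1) unfolding uarr_2cell_def by blast
  then have "NCmp ((uR (u1t (u2s \<theta>)) \<star>\<^sub>l u2b \<theta>) \<circ>\<^sub>V u1rho (u2s \<theta>)) X =
      NCmp (u1rho (u2t \<theta>) \<circ>\<^sub>V (u2a \<theta> \<star>\<^sub>r uR (u1s (u2s \<theta>)))) X" by simp
  then show ?thesis using assms by simp
qed

lemma uarr_2cellI:
  assumes "uarr_1cell (u2s \<theta>)" "uarr_1cell (u2t \<theta>)"
    "u1s (u2t \<theta>) = u1s (u2s \<theta>)" "u1t (u2t \<theta>) = u1t (u2s \<theta>)"
    "nat_trans (u2a \<theta>)" "NSrc (u2a \<theta>) = u1J (u2s \<theta>)" "NTrg (u2a \<theta>) = u1J (u2t \<theta>)"
    "nat_trans (u2b \<theta>)" "NSrc (u2b \<theta>) = u1V (u2s \<theta>)" "NTrg (u2b \<theta>) = u1V (u2t \<theta>)"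
    and "\<And>X. X \<in> Obj (uX (u1s (u2s \<theta>))) \<Longrightarrow>
      FArr (uR (u1t (u2s \<theta>))) (NCmp (u2b \<theta>) X) \<cdot>\<^bsub>uC (u1t (u2s \<theta>))\<^esub> NCmp (u1rho (u2s \<theta>)) X =
      NCmp (u1rho (u2t \<theta>)) X \<cdot>\<^bsub>uC (u1t (u2s \<theta>))\<^esub> NCmp (u2a \<theta>) (FObj (uR (u1s (u2s \<theta>))) X)"
  shows "uarr_2cell \<theta>"
proof -
  have "(uR (u1t (u2s \<theta>)) \<star>\<^sub>l u2b \<theta>) \<circ>\<^sub>V u1rho (u2s \<theta>) = u1rho (u2t \<theta>) \<circ>\<^sub>V (u2a \<theta> \<star>\<^sub>r uR (u1s (u2s \<theta>)))"
    by (rule ntrans_eqI) (use assms(1-10) uarr_1cell_simps[OF assms(2)] in \<open>simp_all add: assms(11)\<close>)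
  then show ?thesis unfolding uarr_2cell_def nat_from_to_def using assms(1-10) by blast
qed

lemma uarr_one_simps [simp]:
  "u1s (uarr_one U) = U" "u1t (uarr_one U) = U" "u1J (uarr_one U) = id_functor (uC U)"
  "u1V (uarr_one U) = id_functor (uX U)" "u1rho (uarr_one U) = id_nat (uR U)"
  by (simp_all add: uarr_one_def)

lemma uarr_comp1_simps [simp]:
  "u1s (uarr_comp1 g f) = u1s f" "u1t (uarr_comp1 g f) = u1t g"
  "u1J (uarr_comp1 g f) = u1J g \<circ>\<^sub>F u1J f" "u1V (uarr_comp1 g f) = u1V g \<circ>\<^sub>F u1V f"
  "u1rho (uarr_comp1 g f) = (u1rho g \<star>\<^sub>r u1V f) \<circ>\<^sub>V (u1J g \<star>\<^sub>l u1rho f)"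
  by (simp_all add: uarr_comp1_def)

lemma uarr_1cell_one [simp]: "universal_arrow U \<Longrightarrow> uarr_1cell (uarr_one U)"
  by (rule uarr_1cellI) (simp_all add: nat_iso_id)

lemma uarr_1cell_comp [simp]:
  assumes "uarr_1cell f" "uarr_1cell g" "u1s g = u1t f"
  shows "uarr_1cell (uarr_comp1 g f)"
proof (rule uarr_1cellI)
  let ?C = "uC (u1t g)"
  define s where "s X = FArr (u1J g) (u1rho' f X) \<cdot>\<^bsub>?C\<^esub> u1rho' g (FObj (u1V f) X)" for X
  have r: "FArr (u1J g) (NCmp (u1rho f) X) \<cdot>\<^bsub>?C\<^esub> FArr (u1J g) (u1rho' f X) =
      Ide ?C (FObj (u1J g) (FObj (uR (u1t f)) (FObj (u1V f) X)))"
    "FArr (u1J g) (u1rho' f X) \<cdot>\<^bsub>?C\<^esub> FArr (u1J g) (NCmp (u1rho f) X) =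
      Ide ?C (FObj (u1J g) (FObj (u1J f) (FObj (uR (u1s f)) X)))" if "X \<in> Obj (uX (u1s f))" for X
    using that assms FArr_equation[OF u1rho'_simps(4)[OF assms(1) that], of "u1J g" ?C]
      FArr_equation[OF u1rho'_simps(5)[OF assms(1) that], of "u1J g" ?C] by simp_all
  show "nat_iso_from_to (u1rho (uarr_comp1 g f)) (u1J (uarr_comp1 g f) \<circ>\<^sub>F uR (u1s (uarr_comp1 g f)))
      (uR (u1t (uarr_comp1 g f)) \<circ>\<^sub>F u1V (uarr_comp1 g f))"
    by (rule nat_iso_from_toI[where s = s])
      (use assms in \<open>simp_all add: s_def nat_from_to_def r Cmp_extend[OF r(1)] Cmp_extend[OF r(2)]\<close>)
qed (use assms in simp_all)

lemma UArr_simps [simp]: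
  "Cell0 UArr = {U. universal_arrow U}" "src UArr = u1s" "trg UArr = u1t" "one UArr = uarr_one"
  "comp1 UArr = uarr_comp1"
  "\<kappa> \<diamondop>\<^bsub>UArr\<^esub> \<theta> = \<lparr>u2s = uarr_comp1 (u2s \<kappa>) (u2s \<theta>), u2t = uarr_comp1 (u2t \<kappa>) (u2t \<theta>),
      u2a = u2a \<kappa> \<star>\<^sub>h u2a \<theta>, u2b = u2b \<kappa> \<star>\<^sub>h u2b \<theta>\<rparr>"
  "Vert UArr = mk_category {f. uarr_1cell f} {\<theta>. uarr_2cell \<theta>} u2s u2t
      (\<lambda>f. \<lparr>u2s = f, u2t = f, u2a = id_nat (u1J f), u2b = id_nat (u1V f)\<rparr>)
      (\<lambda>\<kappa> \<theta>. \<lparr>u2s = u2s \<theta>, u2t = u2t \<kappa>, u2a = u2a \<kappa> \<circ>\<^sub>V u2a \<theta>, u2b = u2b \<kappa> \<circ>\<^sub>V u2b \<theta>\<rparr>)"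
  by (simp_all add: UArr_def)

lemma uarr_2cell_vcomp:
  assumes "uarr_2cell \<theta>" "uarr_2cell \<kappa>" "u2s \<kappa> = u2t \<theta>"
  shows "uarr_2cell \<lparr>u2s = u2s \<theta>, u2t = u2t \<kappa>, u2a = u2a \<kappa> \<circ>\<^sub>V u2a \<theta>, u2b = u2b \<kappa> \<circ>\<^sub>V u2b \<theta>\<rparr>"
proof (rule uarr_2cellI)
  fix X assume "X \<in> Obj (uX (u1s (u2s \<lparr>u2s = u2s \<theta>, u2t = u2t \<kappa>, u2a = u2a \<kappa> \<circ>\<^sub>V u2a \<theta>, u2b = u2b \<kappa> \<circ>\<^sub>V u2b \<theta>\<rparr>)))"
  then have X: "X \<in> Obj (uX (u1s (u2s \<theta>)))" by simp
  have X': "X \<in> Obj (uX (u1s (u2s \<kappa>)))" using X assms by simp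
  note a = uarr_2cell_rho[OF assms(1) X] uarr_2cell_rho[OF assms(2) X']
  have b: "FArr (uR (u1t (u2s \<theta>))) (NCmp (u2b \<kappa>) X) \<cdot>\<^bsub>uC (u1t (u2s \<theta>))\<^esub> NCmp (u1rho (u2t \<theta>)) X =
    NCmp (u1rho (u2t \<kappa>)) X \<cdot>\<^bsub>uC (u1t (u2s \<theta>))\<^esub> NCmp (u2a \<kappa>) (FObj (uR (u1s (u2s \<theta>))) X)"
    using a(2) assms by simp
  show "FArr (uR (u1t (u2s \<lparr>u2s = u2s \<theta>, u2t = u2t \<kappa>, u2a = u2a \<kappa> \<circ>\<^sub>V u2a \<theta>, u2b = u2b \<kappa> \<circ>\<^sub>V u2b \<theta>\<rparr>)))
      (NCmp (u2b \<lparr>u2s = u2s \<theta>, u2t = u2t \<kappa>, u2a = u2a \<kappa> \<circ>\<^sub>V u2a \<theta>, u2b = u2b \<kappa> \<circ>\<^sub>V u2b \<theta>\<rparr>) X)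
     \<cdot>\<^bsub>uC (u1t (u2s \<lparr>u2s = u2s \<theta>, u2t = u2t \<kappa>, u2a = u2a \<kappa> \<circ>\<^sub>V u2a \<theta>, u2b = u2b \<kappa> \<circ>\<^sub>V u2b \<theta>\<rparr>))\<^esub>
     NCmp (u1rho (u2s \<lparr>u2s = u2s \<theta>, u2t = u2t \<kappa>, u2a = u2a \<kappa> \<circ>\<^sub>V u2a \<theta>, u2b = u2b \<kappa> \<circ>\<^sub>V u2b \<theta>\<rparr>)) X =
     NCmp (u1rho (u2t \<lparr>u2s = u2s \<theta>, u2t = u2t \<kappa>, u2a = u2a \<kappa> \<circ>\<^sub>V u2a \<theta>, u2b = u2b \<kappa> \<circ>\<^sub>V u2b \<theta>\<rparr>)) X
     \<cdot>\<^bsub>uC (u1t (u2s \<lparr>u2s = u2s \<theta>, u2t = u2t \<kappa>, u2a = u2a \<kappa> \<circ>\<^sub>V u2a \<theta>, u2b = u2b \<kappa> \<circ>\<^sub>V u2b \<theta>\<rparr>))\<^esub>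
     NCmp (u2a \<lparr>u2s = u2s \<theta>, u2t = u2t \<kappa>, u2a = u2a \<kappa> \<circ>\<^sub>V u2a \<theta>, u2b = u2b \<kappa> \<circ>\<^sub>V u2b \<theta>\<rparr>)
      (FObj (uR (u1s (u2s \<lparr>u2s = u2s \<theta>, u2t = u2t \<kappa>, u2a = u2a \<kappa> \<circ>\<^sub>V u2a \<theta>, u2b = u2b \<kappa> \<circ>\<^sub>V u2b \<theta>\<rparr>))) X)"
    using assms X uarr_2cell_simps(1-4)[OF assms(2)] by (simp add: a(1) Cmp_extend[OF b])
qed (use assms uarr_2cell_simps(1-4)[OF assms(2)] in simp_all)

text \<open>
  The square for a horizontal composite is pasted from the squares of the two 2-cells, the
  naturality of \<open>\<rho>\<close> at a component of the transformation \<open>\<beta>\<close> of \<open>\<theta>\<close>, and the naturality of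
  the transformation \<open>\<alpha>\<close> of \<open>\<kappa>\<close> at a component of \<open>\<rho>\<close>.
\<close>

lemma uarr_2cell_hcomp:
  assumes t: "uarr_2cell \<theta>" and k: "uarr_2cell \<kappa>" and c: "u1s (u2s \<kappa>) = u1t (u2s \<theta>)"
  shows "uarr_2cell (\<kappa> \<diamondop>\<^bsub>UArr\<^esub> \<theta>)"
proof (rule uarr_2cellI)
  have c': "u1s (u2t \<kappa>) = u1t (u2s \<theta>)" using k c by simp
  note S = t k c uarr_2cell_simps[OF t] uarr_2cell_simps[OF k] uarr_1cell_simps[OF uarr_2cell_simps(2)[OF t]]
    uarr_1cell_simps[OF uarr_2cell_simps(2)[OF k]]
  fix X assume "X \<in> Obj (uX (u1s (u2s (\<kappa> \<diamondop>\<^bsub>UArr\<^esub> \<theta>))))"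
  then have X: "X \<in> Obj (uX (u1s (u2s \<theta>)))" by simp
  let ?C = "uC (u1t (u2s \<kappa>))" and ?R = "uR (u1t (u2s \<kappa>))"
  let ?g = "u2s \<kappa>" and ?g' = "u2t \<kappa>" and ?f = "u2s \<theta>" and ?f' = "u2t \<theta>"
  let ?Y = "FObj (u1V ?f') X" and ?Z = "FObj (u1V ?f) X" and ?RX = "FObj (uR (u1s ?f)) X"
  have Y: "?Y \<in> Obj (uX (u1s ?g))" using X S by simp
  have 1: "FArr ?R (FArr (u1V ?g) (NCmp (u2b \<theta>) X)) \<cdot>\<^bsub>?C\<^esub> NCmp (u1rho ?g) ?Z =
      NCmp (u1rho ?g) ?Y \<cdot>\<^bsub>?C\<^esub> FArr (u1J ?g) (FArr (uR (u1t ?f)) (NCmp (u2b \<theta>) X))"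
    using u1rho_natural[of ?g "NCmp (u2b \<theta>) X" ?Z ?Y] X S by simp
  have 2: "FArr ?R (NCmp (u2b \<kappa>) ?Y) \<cdot>\<^bsub>?C\<^esub> NCmp (u1rho ?g) ?Y =
      NCmp (u1rho ?g') ?Y \<cdot>\<^bsub>?C\<^esub> NCmp (u2a \<kappa>) (FObj (uR (u1t ?f)) ?Y)"
    using uarr_2cell_rho[OF k Y] c by simp
  have 3: "FArr (u1J ?g) (FArr (uR (u1t ?f)) (NCmp (u2b \<theta>) X)) \<cdot>\<^bsub>?C\<^esub> FArr (u1J ?g) (NCmp (u1rho ?f) X) =
      FArr (u1J ?g) (NCmp (u1rho ?f') X) \<cdot>\<^bsub>?C\<^esub> FArr (u1J ?g) (NCmp (u2a \<theta>) ?RX)"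
    using arg_cong[OF uarr_2cell_rho[OF t X], of "FArr (u1J ?g)"] X S by simp
  have 4: "NCmp (u2a \<kappa>) (FObj (uR (u1t ?f)) ?Y) \<cdot>\<^bsub>?C\<^esub> FArr (u1J ?g) (NCmp (u1rho ?f') X) =
      FArr (u1J ?g') (NCmp (u1rho ?f') X) \<cdot>\<^bsub>?C\<^esub> NCmp (u2a \<kappa>) (FObj (u1J ?f') ?RX)"
    using naturality[of "u2a \<kappa>" ?C "NCmp (u1rho ?f') X"] X S by simp
  note T = X S c'
  have "FArr ?R (NCmp (u2b \<kappa>) ?Y) \<cdot>\<^bsub>?C\<^esub> FArr ?R (FArr (u1V ?g) (NCmp (u2b \<theta>) X)) \<cdot>\<^bsub>?C\<^esub>
      NCmp (u1rho ?g) ?Z \<cdot>\<^bsub>?C\<^esub> FArr (u1J ?g) (NCmp (u1rho ?f) X) =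
    FArr ?R (NCmp (u2b \<kappa>) ?Y) \<cdot>\<^bsub>?C\<^esub> NCmp (u1rho ?g) ?Y \<cdot>\<^bsub>?C\<^esub>
      FArr (u1J ?g) (FArr (uR (u1t ?f)) (NCmp (u2b \<theta>) X)) \<cdot>\<^bsub>?C\<^esub> FArr (u1J ?g) (NCmp (u1rho ?f) X)"
    using T by (simp add: Cmp_extend[OF 1])
  also have "\<dots> = NCmp (u1rho ?g') ?Y \<cdot>\<^bsub>?C\<^esub> NCmp (u2a \<kappa>) (FObj (uR (u1t ?f)) ?Y) \<cdot>\<^bsub>?C\<^esub>
      FArr (u1J ?g) (NCmp (u1rho ?f') X) \<cdot>\<^bsub>?C\<^esub> FArr (u1J ?g) (NCmp (u2a \<theta>) ?RX)"
    using T by (simp add: Cmp_extend[OF 2] 3)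
  also have "\<dots> = NCmp (u1rho ?g') ?Y \<cdot>\<^bsub>?C\<^esub> FArr (u1J ?g') (NCmp (u1rho ?f') X) \<cdot>\<^bsub>?C\<^esub>
      NCmp (u2a \<kappa>) (FObj (u1J ?f') ?RX) \<cdot>\<^bsub>?C\<^esub> FArr (u1J ?g) (NCmp (u2a \<theta>) ?RX)"
    using T by (simp add: Cmp_extend[OF 4])
  finally show "FArr (uR (u1t (u2s (\<kappa> \<diamondop>\<^bsub>UArr\<^esub> \<theta>)))) (NCmp (u2b (\<kappa> \<diamondop>\<^bsub>UArr\<^esub> \<theta>)) X)
      \<cdot>\<^bsub>uC (u1t (u2s (\<kappa> \<diamondop>\<^bsub>UArr\<^esub> \<theta>)))\<^esub> NCmp (u1rho (u2s (\<kappa> \<diamondop>\<^bsub>UArr\<^esub> \<theta>))) X =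
      NCmp (u1rho (u2t (\<kappa> \<diamondop>\<^bsub>UArr\<^esub> \<theta>))) X \<cdot>\<^bsub>uC (u1t (u2s (\<kappa> \<diamondop>\<^bsub>UArr\<^esub> \<theta>)))\<^esub>
      NCmp (u2a (\<kappa> \<diamondop>\<^bsub>UArr\<^esub> \<theta>)) (FObj (uR (u1s (u2s (\<kappa> \<diamondop>\<^bsub>UArr\<^esub> \<theta>)))) X)"
    using T by simp
qed (use t k c uarr_2cell_simps[OF t] uarr_2cell_simps[OF k] uarr_1cell_simps[OF uarr_2cell_simps(2)[OF t]]
    uarr_1cell_simps[OF uarr_2cell_simps(2)[OF k]] in simp_all)

lemma uarr_comp1_one:
  "uarr_1cell f \<Longrightarrow> u1s f = U \<Longrightarrow> uarr_comp1 f (uarr_one U) = f"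
  "uarr_1cell f \<Longrightarrow> u1t f = U \<Longrightarrow> uarr_comp1 (uarr_one U) f = f"
  by (auto intro!: uarr1.equality ntrans_eqI)

lemma uarr_comp1_assoc:
  "uarr_1cell f \<Longrightarrow> uarr_1cell g \<Longrightarrow> uarr_1cell h \<Longrightarrow> u1s g = u1t f \<Longrightarrow> u1s h = u1t g \<Longrightarrow>
    uarr_comp1 h (uarr_comp1 g f) = uarr_comp1 (uarr_comp1 h g) f"
  by (auto intro!: uarr1.equality ntrans_eqI)

lemma uarr_2cell_ide [simp]:
  "uarr_1cell f \<Longrightarrow> uarr_2cell \<lparr>u2s = f, u2t = f, u2a = id_nat (u1J f), u2b = id_nat (u1V f)\<rparr>"
  by (rule uarr_2cellI) simp_all

lemma two_category_UArr: "two_category (UArr :: (('o, 'm, 'x, 'y) uarr, _, _) two_category)"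
proof (rule two_category.intro)
  show "category (Vert (UArr :: (('o, 'm, 'x, 'y) uarr, _, _) two_category))"
    unfolding UArr_simps
    by (rule category_mk_category) (auto simp: uarr_2cell_vcomp intro!: uarr2.equality)
  fix \<theta> \<theta>' \<kappa> \<kappa>' :: "('o, 'm, 'x, 'y) uarr2" and f f' f'' g g' g'' :: "('o, 'm, 'x, 'y) uarr1"
  assume "\<theta> \<in> Hom (Vert UArr) f f'" "\<theta>' \<in> Hom (Vert UArr) f' f''" "\<kappa> \<in> Hom (Vert UArr) g g'"
    "\<kappa>' \<in> Hom (Vert UArr) g' g''" "src UArr g = trg UArr f"
  then show "(\<kappa>' \<cdot>\<^bsub>Vert UArr\<^esub> \<kappa>) \<diamondop>\<^bsub>UArr\<^esub> (\<theta>' \<cdot>\<^bsub>Vert UArr\<^esub> \<theta>) = (\<kappa>' \<diamondop>\<^bsub>UArr\<^esub> \<theta>') \<cdot>\<^bsub>Vert UArr\<^esub> (\<kappa> \<diamondop>\<^bsub>UArr\<^esub> \<theta>)"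
    using uarr_2cell_hcomp[of \<theta> \<kappa>] uarr_2cell_hcomp[of \<theta>' \<kappa>']
    by (auto simp: uarr_2cell_vcomp hcomp_interchange)
qed (use uarr_2cell_hcomp in \<open>auto simp: uarr_comp1_one uarr_comp1_assoc hcomp_assoc intro!: uarr2.equality\<close>)

lemma two_category_UArr_id: "two_category UArr_id"
  unfolding UArr_id_def
proof (rule two_category_restrict[OF two_category_UArr])
  fix f g :: "('o, 'm, 'x, 'y) uarr1"
  assume a: "f \<in> Cell1 UArr" "g \<in> Cell1 UArr" "src UArr g = trg UArr f"
    "u1rho f = id_nat (u1J f \<circ>\<^sub>F uR (u1s f))" "u1rho g = id_nat (u1J g \<circ>\<^sub>F uR (u1s g))"
  have f: "uR (u1t f) \<circ>\<^sub>F u1V f = u1J f \<circ>\<^sub>F uR (u1s f)" using uarr_1cell_simps(11)[of f] a(1,4) by simp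
  have "u1rho (uarr_comp1 g f) = id_nat (u1J (uarr_comp1 g f) \<circ>\<^sub>F uR (u1s (uarr_comp1 g f)))"
  proof (rule ntrans_eqI)
    show "nat_trans (u1rho (uarr_comp1 g f))"
      by (rule uarr_1cell_simps(9)) (use a in simp)
    show "NTrg (u1rho (uarr_comp1 g f)) = NTrg (id_nat (u1J (uarr_comp1 g f) \<circ>\<^sub>F uR (u1s (uarr_comp1 g f))))"
      using a f by simp
    have x: "FObj (uR (u1t f)) (FObj (u1V f) X) = FObj (u1J f) (FObj (uR (u1s f)) X)" if "X \<in> Obj (uX (u1s f))" for X
      using arg_cong[OF f, of "\<lambda>F. FObj F X"] that a by simp
    show "NCmp (u1rho (uarr_comp1 g f)) X = NCmp (id_nat (u1J (uarr_comp1 g f) \<circ>\<^sub>F uR (u1s (uarr_comp1 g f)))) X"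
      if "X \<in> Obj (FDom (NSrc (id_nat (u1J (uarr_comp1 g f) \<circ>\<^sub>F uR (u1s (uarr_comp1 g f))))))" for X
      using that a x by simp
  qed (use a in simp_all)
  then show "u1rho (g \<odot>\<^bsub>UArr\<^esub> f) = id_nat (u1J (g \<odot>\<^bsub>UArr\<^esub> f) \<circ>\<^sub>F uR (u1s (g \<odot>\<^bsub>UArr\<^esub> f)))" by simp
qed simp

section \<open>Adjunctions are universal arrows\<close>

lemma adjunction_simps [simp]:
  assumes "adjunction A"
  shows "cat_functor (aR A)" "cat_functor (aL A)" "FDom (aL A) = aC A" "FCod (aL A) = aX A"
    "nat_trans (aEta A)" "NSrc (aEta A) = id_functor (aC A)" "NTrg (aEta A) = aR A \<circ>\<^sub>F aL A"
    "nat_trans (aEps A)" "NSrc (aEps A) = aL A \<circ>\<^sub>F aR A" "NTrg (aEps A) = id_functor (aX A)"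
  using assms unfolding adjunction_def functor_from_to_def nat_from_to_def by blast+

lemma aEta_natural:
  assumes "adjunction A" "f \<in> Arr (aC A)"
  shows "NCmp (aEta A) (Cod (aC A) f) \<cdot>\<^bsub>aC A\<^esub> f = FArr (aR A) (FArr (aL A) f) \<cdot>\<^bsub>aC A\<^esub> NCmp (aEta A) (Dom (aC A) f)"
  using naturality[of "aEta A" "aC A" f] assms by simp

lemma aEps_natural:
  assumes "adjunction A" "f \<in> Arr (aX A)"
  shows "NCmp (aEps A) (Cod (aX A) f) \<cdot>\<^bsub>aX A\<^esub> FArr (aL A) (FArr (aR A) f) = f \<cdot>\<^bsub>aX A\<^esub> NCmp (aEps A) (Dom (aX A) f)"
  using naturality[of "aEps A" "aX A" f] assms by simp

lemma adjunction_triangles: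
  assumes "adjunction A"
  shows "B \<in> Obj (aC A) \<Longrightarrow> NCmp (aEps A) (FObj (aL A) B) \<cdot>\<^bsub>aX A\<^esub> FArr (aL A) (NCmp (aEta A) B) = Ide (aX A) (FObj (aL A) B)"
    "X \<in> Obj (aX A) \<Longrightarrow> FArr (aR A) (NCmp (aEps A) X) \<cdot>\<^bsub>aC A\<^esub> NCmp (aEta A) (FObj (aR A) X) = Ide (aC A) (FObj (aR A) X)"
proof -
  have t: "(aEps A \<star>\<^sub>r aL A) \<circ>\<^sub>V (aL A \<star>\<^sub>l aEta A) = id_nat (aL A)"
      "(aR A \<star>\<^sub>l aEps A) \<circ>\<^sub>V (aEta A \<star>\<^sub>r aR A) = id_nat (aR A)"
    using assms unfolding adjunction_def by blast+
  show "B \<in> Obj (aC A) \<Longrightarrow> NCmp (aEps A) (FObj (aL A) B) \<cdot>\<^bsub>aX A\<^esub> FArr (aL A) (NCmp (aEta A) B) = Ide (aX A) (FObj (aL A) B)"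
    using arg_cong[OF t(1), of "\<lambda>\<alpha>. NCmp \<alpha> B"] assms by simp
  show "X \<in> Obj (aX A) \<Longrightarrow> FArr (aR A) (NCmp (aEps A) X) \<cdot>\<^bsub>aC A\<^esub> NCmp (aEta A) (FObj (aR A) X) = Ide (aC A) (FObj (aR A) X)"
    using arg_cong[OF t(2), of "\<lambda>\<alpha>. NCmp \<alpha> X"] assms by simp
qed

lemma adjunctionI:
  assumes "cat_functor (aR A)" "cat_functor (aL A)" "FDom (aL A) = aC A" "FCod (aL A) = aX A"
    "nat_trans (aEta A)" "NSrc (aEta A) = id_functor (aC A)" "NTrg (aEta A) = aR A \<circ>\<^sub>F aL A"
    "nat_trans (aEps A)" "NSrc (aEps A) = aL A \<circ>\<^sub>F aR A" "NTrg (aEps A) = id_functor (aX A)"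
    and l: "\<And>B. B \<in> Obj (aC A) \<Longrightarrow> NCmp (aEps A) (FObj (aL A) B) \<cdot>\<^bsub>aX A\<^esub> FArr (aL A) (NCmp (aEta A) B) = Ide (aX A) (FObj (aL A) B)"
    and r: "\<And>X. X \<in> Obj (aX A) \<Longrightarrow> FArr (aR A) (NCmp (aEps A) X) \<cdot>\<^bsub>aC A\<^esub> NCmp (aEta A) (FObj (aR A) X) = Ide (aC A) (FObj (aR A) X)"
  shows "adjunction A"
proof -
  have "(aEps A \<star>\<^sub>r aL A) \<circ>\<^sub>V (aL A \<star>\<^sub>l aEta A) = id_nat (aL A)"
    by (rule ntrans_eqI) (use assms(1-10) l in simp_all)
  moreover have "(aR A \<star>\<^sub>l aEps A) \<circ>\<^sub>V (aEta A \<star>\<^sub>r aR A) = id_nat (aR A)"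
    by (rule ntrans_eqI) (use assms(1-10) r in simp_all)
  ultimately show ?thesis unfolding adjunction_def functor_from_to_def nat_from_to_def using assms(1-10) by blast
qed

lemma G_0_simps [simp]:
  "uR (G_0 A) = aR A" "uL (G_0 A) = FObj (aL A)" "uEta (G_0 A) = NCmp (aEta A)"
  "X \<in> Obj (aX A) \<Longrightarrow> v \<in> Arr (aC A) \<Longrightarrow> Cod (aC A) v = FObj (aR A) X \<Longrightarrow>
    uZeta (G_0 A) X v = NCmp (aEps A) X \<cdot>\<^bsub>aX A\<^esub> FArr (aL A) v"
  by (simp_all add: G_0_def)

lemma universal_arrow_G_0 [simp]:
  assumes A: "adjunction A"
  shows "universal_arrow (G_0 A)"
proof (rule universal_arrowI)
  show "uL (G_0 A) \<in> extensional (Obj (uC (G_0 A)))" using FObj_ext[of "aL A"] A by simp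
  show "uEta (G_0 A) \<in> extensional (Obj (uC (G_0 A)))" using NCmp_ext[of "aEta A"] A by simp
  show "uZeta (G_0 A) \<in> extensional (Obj (uX (G_0 A)))" by (simp add: G_0_def)
  show "uZeta (G_0 A) X \<in> extensional (Into (uC (G_0 A)) (FObj (uR (G_0 A)) X))"
    if "X \<in> Obj (uX (G_0 A))" for X using that by (simp add: G_0_def)
  show "FArr (uR (G_0 A)) (uZeta (G_0 A) X v) \<cdot>\<^bsub>uC (G_0 A)\<^esub> uEta (G_0 A) (Dom (uC (G_0 A)) v) = v"
    if "X \<in> Obj (uX (G_0 A))" "v \<in> Arr (uC (G_0 A))" "Cod (uC (G_0 A)) v = FObj (uR (G_0 A)) X" for X v
    using that A aEta_natural[OF A, of v] by (simp add: Cmp_extend[OF adjunction_triangles(2)[OF A]] flip: aEta_natural)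
  show "w = uZeta (G_0 A) (Cod (uX (G_0 A)) w) (FArr (uR (G_0 A)) w \<cdot>\<^bsub>uC (G_0 A)\<^esub> uEta (G_0 A) B)"
    if "B \<in> Obj (uC (G_0 A))" "w \<in> Arr (uX (G_0 A))" "Dom (uX (G_0 A)) w = uL (G_0 A) B" for B w
    using that A by (simp add: Cmp_extend[OF aEps_natural[OF A]] adjunction_triangles)
qed (use A in simp_all)

lemma F_0_simps [simp]:
  "aR (F_0 U) = uR U" "FDom (aL (F_0 U)) = uC U" "FCod (aL (F_0 U)) = uX U" "FObj (aL (F_0 U)) = uL U"
  "f \<in> Arr (uC U) \<Longrightarrow> Cod (uC U) f = B \<Longrightarrow> FArr (aL (F_0 U)) f = uZeta U (uL U B) (uEta U B \<cdot>\<^bsub>uC U\<^esub> f)"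
  "NSrc (aEta (F_0 U)) = id_functor (uC U)" "NTrg (aEta (F_0 U)) = uR U \<circ>\<^sub>F aL (F_0 U)"
  "NCmp (aEta (F_0 U)) = uEta U" "NSrc (aEps (F_0 U)) = aL (F_0 U) \<circ>\<^sub>F uR U"
  "NTrg (aEps (F_0 U)) = id_functor (uX U)"
  "X \<in> Obj (uX U) \<Longrightarrow> NCmp (aEps (F_0 U)) X = uZeta U X (Ide (uC U) (FObj (uR U) X))"
  by (simp_all add: F_0_def Let_def)

text \<open>
  Functoriality of \<open>L\<close> is forced: \<open>L (g \<cdot> f)\<close> and \<open>L g \<cdot> L f\<close> agree after restriction along
  \<open>\<eta>\<close>.
\<close>

lemma cat_functor_aL_F_0 [simp]:
  assumes U: "universal_arrow U"
  shows "cat_functor (aL (F_0 U))"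
proof (rule cat_functorI)
  show "FArr (aL (F_0 U)) \<in> extensional (Arr (FDom (aL (F_0 U))))" by (simp add: F_0_def Let_def)
  show "FObj (aL (F_0 U)) \<in> extensional (Obj (FDom (aL (F_0 U))))" using universal_arrow_ext(1)[OF U] by simp
  show "FArr (aL (F_0 U)) (g \<cdot>\<^bsub>FDom (aL (F_0 U))\<^esub> f) =
      FArr (aL (F_0 U)) g \<cdot>\<^bsub>FCod (aL (F_0 U))\<^esub> FArr (aL (F_0 U)) f"
    if "f \<in> Arr (FDom (aL (F_0 U)))" "g \<in> Arr (FDom (aL (F_0 U)))"
      "Dom (FDom (aL (F_0 U))) g = Cod (FDom (aL (F_0 U))) f" for f g
    by (rule universal_arrow_eqI[OF U, of "Dom (uC U) f"]) (use that U in simp_all)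
qed (use U in simp_all)

lemma adjunction_F_0 [simp]:
  assumes U: "universal_arrow U"
  shows "adjunction (F_0 U)"
proof (rule adjunctionI)
  show "nat_trans (aEta (F_0 U))"
  proof (rule nat_transI)
    show "NCmp (aEta (F_0 U)) \<in> extensional (Obj (FDom (NSrc (aEta (F_0 U)))))"
      using universal_arrow_ext(2)[OF U] by simp
  qed (use U in simp_all)
  show "nat_trans (aEps (F_0 U))"
  proof (rule nat_transI)
    show "NCmp (aEps (F_0 U)) \<in> extensional (Obj (FDom (NSrc (aEps (F_0 U)))))"
      using U by (simp add: F_0_def Let_def)
    show "NCmp (aEps (F_0 U)) (Cod (FDom (NSrc (aEps (F_0 U)))) f) \<cdot>\<^bsub>FCod (NSrc (aEps (F_0 U)))\<^esub> FArr (NSrc (aEps (F_0 U))) f =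
        FArr (NTrg (aEps (F_0 U))) f \<cdot>\<^bsub>FCod (NSrc (aEps (F_0 U)))\<^esub> NCmp (aEps (F_0 U)) (Dom (FDom (NSrc (aEps (F_0 U)))) f)"
      if "f \<in> Arr (FDom (NSrc (aEps (F_0 U))))" for f
      by (rule universal_arrow_eqI[OF U, of "Dom (uC U) (FArr (uR U) f)"]) (use that U in simp_all)
  qed (use U in simp_all)
  show "NCmp (aEps (F_0 U)) (FObj (aL (F_0 U)) B) \<cdot>\<^bsub>aX (F_0 U)\<^esub> FArr (aL (F_0 U)) (NCmp (aEta (F_0 U)) B) =
      Ide (aX (F_0 U)) (FObj (aL (F_0 U)) B)" if "B \<in> Obj (aC (F_0 U))" for B
    by (rule universal_arrow_eqI[OF U, of B]) (use that U in simp_all)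
qed (use U in simp_all)

lemma G_0_F_0 [simp]: "universal_arrow U \<Longrightarrow> G_0 (F_0 U) = U"
proof (rule uarr.equality)
  assume U: "universal_arrow U"
  show "uZeta (G_0 (F_0 U)) = uZeta U"
  proof (rule extensionalityI[OF _ universal_arrow_ext(3)[OF U]])
    show "uZeta (G_0 (F_0 U)) \<in> extensional (Obj (uX U))" by (simp add: G_0_def)
    show "uZeta (G_0 (F_0 U)) X = uZeta U X" if X: "X \<in> Obj (uX U)" for X
    proof (rule extensionalityI[OF _ universal_arrow_ext(4)[OF U X]])
      show "uZeta (G_0 (F_0 U)) X \<in> extensional (Into (uC U) (FObj (uR U) X))" using X by (simp add: G_0_def)
      show "uZeta (G_0 (F_0 U)) X v = uZeta U X v" if "v \<in> Into (uC U) (FObj (uR U) X)" for v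
        by (rule universal_arrow_eqI[OF U, of "Dom (uC U) v"]) (use that U X in simp_all)
    qed
  qed
qed simp_all

lemma F_0_G_0 [simp]:
  assumes A: "adjunction A"
  shows "F_0 (G_0 A) = A"
proof -
  have L: "aL (F_0 (G_0 A)) = aL A"
    by (rule functor_eqI) (use A in \<open>simp_all add: Cmp_extend[OF adjunction_triangles(1)[OF A]]\<close>)
  have "aEta (F_0 (G_0 A)) = aEta A"
    by (rule ntrans.equality) (use A L in simp_all)
  moreover have "aEps (F_0 (G_0 A)) = aEps A"
    by (rule ntrans_eqI) (use A L in simp_all)
  ultimately show ?thesis using L by (intro adjn.equality) simp_all
qed

lemma adjn_1cell_simps [simp]:
  assumes "adjn_1cell f"
  shows "adjunction (a1s f)" "adjunction (a1t f)"
    "cat_functor (a1J f)" "FDom (a1J f) = aC (a1s f)" "FCod (a1J f) = aC (a1t f)"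
    "cat_functor (a1V f)" "FDom (a1V f) = aX (a1s f)" "FCod (a1V f) = aX (a1t f)"
    "nat_trans (a1rho f)" "NSrc (a1rho f) = a1J f \<circ>\<^sub>F aR (a1s f)" "NTrg (a1rho f) = aR (a1t f) \<circ>\<^sub>F a1V f"
    "nat_iso_from_to (a1rho f) (a1J f \<circ>\<^sub>F aR (a1s f)) (aR (a1t f) \<circ>\<^sub>F a1V f)"
    "nat_trans (a1lam f)" "NSrc (a1lam f) = aL (a1t f) \<circ>\<^sub>F a1J f" "NTrg (a1lam f) = a1V f \<circ>\<^sub>F aL (a1s f)"
  using assms unfolding adjn_1cell_def functor_from_to_def nat_iso_from_to_def nat_from_to_def by blast+

lemma a1lam_mate:
  assumes "adjn_1cell f" "A \<in> Obj (aC (a1s f))"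
  shows "FArr (aR (a1t f)) (NCmp (a1lam f) A) \<cdot>\<^bsub>aC (a1t f)\<^esub> NCmp (aEta (a1t f)) (FObj (a1J f) A) =
    NCmp (a1rho f) (FObj (aL (a1s f)) A) \<cdot>\<^bsub>aC (a1t f)\<^esub> FArr (a1J f) (NCmp (aEta (a1s f)) A)"
proof -
  have "(aR (a1t f) \<star>\<^sub>l a1lam f) \<circ>\<^sub>V (aEta (a1t f) \<star>\<^sub>r a1J f) = (a1rho f \<star>\<^sub>r aL (a1s f)) \<circ>\<^sub>V (a1J f \<star>\<^sub>l aEta (a1s f))"
    using assms(1) unfolding adjn_1cell_def by blast
  from arg_cong[OF this, of "\<lambda>\<alpha>. NCmp \<alpha> A"] show ?thesis using assms by simp
qed

lemma adjn_1cellI: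
  assumes "adjunction (a1s f)" "adjunction (a1t f)"
    "cat_functor (a1J f)" "FDom (a1J f) = aC (a1s f)" "FCod (a1J f) = aC (a1t f)"
    "cat_functor (a1V f)" "FDom (a1V f) = aX (a1s f)" "FCod (a1V f) = aX (a1t f)"
    and r: "nat_iso_from_to (a1rho f) (a1J f \<circ>\<^sub>F aR (a1s f)) (aR (a1t f) \<circ>\<^sub>F a1V f)"
    and l: "nat_trans (a1lam f)" "NSrc (a1lam f) = aL (a1t f) \<circ>\<^sub>F a1J f" "NTrg (a1lam f) = a1V f \<circ>\<^sub>F aL (a1s f)"
    and m: "\<And>A. A \<in> Obj (aC (a1s f)) \<Longrightarrow>
      FArr (aR (a1t f)) (NCmp (a1lam f) A) \<cdot>\<^bsub>aC (a1t f)\<^esub> NCmp (aEta (a1t f)) (FObj (a1J f) A) =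
      NCmp (a1rho f) (FObj (aL (a1s f)) A) \<cdot>\<^bsub>aC (a1t f)\<^esub> FArr (a1J f) (NCmp (aEta (a1s f)) A)"
  shows "adjn_1cell f"
proof -
  have r': "nat_trans (a1rho f)" "NSrc (a1rho f) = a1J f \<circ>\<^sub>F aR (a1s f)" "NTrg (a1rho f) = aR (a1t f) \<circ>\<^sub>F a1V f"
    using r unfolding nat_iso_from_to_def nat_from_to_def by blast+
  have "(aR (a1t f) \<star>\<^sub>l a1lam f) \<circ>\<^sub>V (aEta (a1t f) \<star>\<^sub>r a1J f) = (a1rho f \<star>\<^sub>r aL (a1s f)) \<circ>\<^sub>V (a1J f \<star>\<^sub>l aEta (a1s f))"
    by (rule ntrans_eqI) (use assms(1-8) r' l in \<open>simp_all add: m\<close>)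
  then show ?thesis
    unfolding adjn_1cell_def functor_from_to_def nat_from_to_def using assms(1-12) by blast
qed

lemma F_1_simps [simp]:
  "a1s (F_1 f) = F_0 (u1s f)" "a1t (F_1 f) = F_0 (u1t f)" "a1J (F_1 f) = u1J f" "a1V (F_1 f) = u1V f"
  "a1rho (F_1 f) = u1rho f"
  "NSrc (a1lam (F_1 f)) = aL (F_0 (u1t f)) \<circ>\<^sub>F u1J f" "NTrg (a1lam (F_1 f)) = u1V f \<circ>\<^sub>F aL (F_0 (u1s f))"
  "A \<in> Obj (uC (u1s f)) \<Longrightarrow> NCmp (a1lam (F_1 f)) A = uZeta (u1t f) (FObj (u1V f) (uL (u1s f) A))
        (NCmp (u1rho f) (uL (u1s f) A) \<cdot>\<^bsub>uC (u1t f)\<^esub> FArr (u1J f) (uEta (u1s f) A))"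
  by (simp_all add: F_1_def)

lemma u1rho_iso: "uarr_1cell f \<Longrightarrow> nat_iso_from_to (u1rho f) (u1J f \<circ>\<^sub>F uR (u1s f)) (uR (u1t f) \<circ>\<^sub>F u1V f)"
  unfolding uarr_1cell_def by blast

lemma adjn_1cell_F_1 [simp]:
  assumes f: "uarr_1cell f"
  shows "adjn_1cell (F_1 f)"
proof (rule adjn_1cellI)
  show "nat_trans (a1lam (F_1 f))"
  proof (rule nat_transI)
    show "NCmp (a1lam (F_1 f)) \<in> extensional (Obj (FDom (NSrc (a1lam (F_1 f)))))"
      using f by (simp add: F_1_def)
    fix h assume "h \<in> Arr (FDom (NSrc (a1lam (F_1 f))))"
    then have h: "h \<in> Arr (uC (u1s f))" using f by simp
    let ?A = "Dom (uC (u1s f)) h" and ?B = "Cod (uC (u1s f)) h" and ?C = "uC (u1s f)" and ?D = "uC (u1t f)"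
    let ?Lh = "uZeta (u1s f) (uL (u1s f) ?B) (uEta (u1s f) ?B \<cdot>\<^bsub>?C\<^esub> h)"
    have Lh: "?Lh \<in> Arr (uX (u1s f))" "Dom (uX (u1s f)) ?Lh = uL (u1s f) ?A" "Cod (uX (u1s f)) ?Lh = uL (u1s f) ?B"
      using f h by simp_all
    have e: "FArr (u1J f) (FArr (uR (u1s f)) ?Lh) \<cdot>\<^bsub>?D\<^esub> FArr (u1J f) (uEta (u1s f) ?A) =
        FArr (u1J f) (uEta (u1s f) ?B \<cdot>\<^bsub>?C\<^esub> h)"
      by (rule FArr_equation[where C = ?C]) (use f h in simp_all)
    have "FArr (u1J f) (uEta (u1s f) ?B \<cdot>\<^bsub>?C\<^esub> h) = FArr (u1J f) (uEta (u1s f) ?B) \<cdot>\<^bsub>?D\<^esub> FArr (u1J f) h"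
      using f h by simp
    with e have e: "FArr (u1J f) (uEta (u1s f) ?B) \<cdot>\<^bsub>?D\<^esub> FArr (u1J f) h =
      FArr (u1J f) (FArr (uR (u1s f)) ?Lh) \<cdot>\<^bsub>?D\<^esub> FArr (u1J f) (uEta (u1s f) ?A)" by simp
    show "NCmp (a1lam (F_1 f)) (Cod (FDom (NSrc (a1lam (F_1 f)))) h) \<cdot>\<^bsub>FCod (NSrc (a1lam (F_1 f)))\<^esub> FArr (NSrc (a1lam (F_1 f))) h =
      FArr (NTrg (a1lam (F_1 f))) h \<cdot>\<^bsub>FCod (NSrc (a1lam (F_1 f)))\<^esub> NCmp (a1lam (F_1 f)) (Dom (FDom (NSrc (a1lam (F_1 f)))) h)"
      by (rule universal_arrow_eqI[of "u1t f" "FObj (u1J f) ?A"])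
        (use f h in \<open>simp_all add: e Cmp_extend[OF u1rho_natural[OF f Lh]]\<close>)
  qed (use f in simp_all)
  show "nat_iso_from_to (a1rho (F_1 f)) (a1J (F_1 f) \<circ>\<^sub>F aR (a1s (F_1 f))) (aR (a1t (F_1 f)) \<circ>\<^sub>F a1V (F_1 f))"
    using u1rho_iso[OF f] by simp
qed (use f in simp_all)

lemma G_1_simps [simp]:
  "u1s (G_1 f) = G_0 (a1s f)" "u1t (G_1 f) = G_0 (a1t f)" "u1J (G_1 f) = a1J f" "u1V (G_1 f) = a1V f"
  "u1rho (G_1 f) = a1rho f"
  by (simp_all add: G_1_def)

lemma uarr_1cell_G_1 [simp]: "adjn_1cell f \<Longrightarrow> uarr_1cell (G_1 f)"
  by (rule uarr_1cellI) simp_all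

lemma G_1_F_1 [simp]: "uarr_1cell f \<Longrightarrow> G_1 (F_1 f) = f"
  by (rule uarr1.equality) simp_all

text \<open>
  The mate \<open>\<lambda>\<close> is recovered because the equation \<open>R\<^sup>\<dagger> \<lambda> \<cdot> \<eta> = \<rho> \<cdot> J \<eta>\<close> determines its
  components by universality.
\<close>

lemma F_1_G_1 [simp]:
  assumes f: "adjn_1cell f"
  shows "F_1 (G_1 f) = f"
proof -
  have "a1lam (F_1 (G_1 f)) = a1lam f"
  proof (rule ntrans_eqI)
    show "nat_trans (a1lam (F_1 (G_1 f)))" using adjn_1cell_F_1[OF uarr_1cell_G_1[OF f]] by (rule adjn_1cell_simps)
    show "NCmp (a1lam (F_1 (G_1 f))) A = NCmp (a1lam f) A" if "A \<in> Obj (FDom (NSrc (a1lam f)))" for A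
    proof -
      have A: "A \<in> Obj (aC (a1s f))" using that f by simp
      have "uZeta (u1t (G_1 f)) (FObj (a1V f) (FObj (aL (a1s f)) A))
        (NCmp (a1rho f) (FObj (aL (a1s f)) A) \<cdot>\<^bsub>aC (a1t f)\<^esub> FArr (a1J f) (NCmp (aEta (a1s f)) A)) = NCmp (a1lam f) A"
        by (rule uZeta_unique[of _ "FObj (a1J f) A"]) (use f A in \<open>simp_all add: a1lam_mate\<close>)
      then show ?thesis using f A by (simp del: G_0_simps(4))
    qed
  qed (use f in simp_all)
  then show ?thesis using f by (intro adjn1.equality) simp_all
qed

lemma adjn_2cell_simps [simp]:
  assumes "adjn_2cell \<theta>"
  shows "adjn_1cell (a2s \<theta>)" "adjn_1cell (a2t \<theta>)"
    "a1s (a2t \<theta>) = a1s (a2s \<theta>)" "a1t (a2t \<theta>) = a1t (a2s \<theta>)"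
    "nat_trans (a2a \<theta>)" "NSrc (a2a \<theta>) = a1J (a2s \<theta>)" "NTrg (a2a \<theta>) = a1J (a2t \<theta>)"
    "nat_trans (a2b \<theta>)" "NSrc (a2b \<theta>) = a1V (a2s \<theta>)" "NTrg (a2b \<theta>) = a1V (a2t \<theta>)"
  using assms unfolding adjn_2cell_def nat_from_to_def by blast+

lemma FG_2f_simps [simp]:
  "F0 F_2f = F_0" "F1 F_2f = F_1" "F0 G_2f = G_0" "F1 G_2f = G_1"
  "a2s (F2 F_2f \<theta>) = F_1 (u2s \<theta>)" "a2t (F2 F_2f \<theta>) = F_1 (u2t \<theta>)"
  "a2a (F2 F_2f \<theta>) = u2a \<theta>" "a2b (F2 F_2f \<theta>) = u2b \<theta>"
  "u2s (F2 G_2f \<kappa>) = G_1 (a2s \<kappa>)" "u2t (F2 G_2f \<kappa>) = G_1 (a2t \<kappa>)"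
  "u2a (F2 G_2f \<kappa>) = a2a \<kappa>" "u2b (F2 G_2f \<kappa>) = a2b \<kappa>"
  by (simp_all add: F_2f_def G_2f_def)

lemma adjn_2cell_F_2f [simp]:
  assumes t: "uarr_2cell \<theta>"
  shows "adjn_2cell (F2 F_2f \<theta>)"
proof -
  let ?U = "u1s (u2s \<theta>)" and ?T = "u1t (u2s \<theta>)" and ?J = "u2s \<theta>" and ?K = "u2t \<theta>"
  note S = t uarr_2cell_simps[OF t] uarr_1cell_simps[OF uarr_2cell_simps(2)[OF t]]
  have rho: "(uR ?T \<star>\<^sub>l u2b \<theta>) \<circ>\<^sub>V u1rho ?J = u1rho ?K \<circ>\<^sub>V (u2a \<theta> \<star>\<^sub>r uR ?U)"
    using t unfolding uarr_2cell_def by blast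
  have n: "nat_trans (a1lam (F_1 ?J))" "nat_trans (a1lam (F_1 ?K))"
    using S by (intro adjn_1cell_simps adjn_1cell_F_1; simp)+
  have "a1lam (F_1 ?K) \<circ>\<^sub>V (aL (F_0 ?T) \<star>\<^sub>l u2a \<theta>) = (u2b \<theta> \<star>\<^sub>r aL (F_0 ?U)) \<circ>\<^sub>V a1lam (F_1 ?J)"
  proof (rule ntrans_eqI)
    fix A assume "A \<in> Obj (FDom (NSrc ((u2b \<theta> \<star>\<^sub>r aL (F_0 ?U)) \<circ>\<^sub>V a1lam (F_1 ?J))))"
    then have A: "A \<in> Obj (uC ?U)" using S by simp
    have LA: "uL ?U A \<in> Obj (uX ?U)" using S A by simp
    have a: "FArr (u1J ?K) (uEta ?U A) \<cdot>\<^bsub>uC ?T\<^esub> NCmp (u2a \<theta>) A =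
        NCmp (u2a \<theta>) (FObj (uR ?U) (uL ?U A)) \<cdot>\<^bsub>uC ?T\<^esub> FArr (u1J ?J) (uEta ?U A)"
      using naturality[of "u2a \<theta>" "uC ?T" "uEta ?U A"] S A by simp
    show "NCmp (a1lam (F_1 ?K) \<circ>\<^sub>V (aL (F_0 ?T) \<star>\<^sub>l u2a \<theta>)) A = NCmp ((u2b \<theta> \<star>\<^sub>r aL (F_0 ?U)) \<circ>\<^sub>V a1lam (F_1 ?J)) A"
      by (rule universal_arrow_eqI[of ?T "FObj (u1J ?J) A"])
        (use S A in \<open>simp_all add: a Cmp_extend[OF uarr_2cell_rho[OF t LA]]\<close>)
  qed (use S n in simp_all)
  with rho show ?thesis
    unfolding adjn_2cell_def nat_from_to_def using S by simp
qed

lemma uarr_2cell_G_2f [simp]: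
  assumes t: "adjn_2cell \<theta>"
  shows "uarr_2cell (F2 G_2f \<theta>)"
  using t unfolding adjn_2cell_def uarr_2cell_def by (simp add: nat_from_to_def)

lemma G_2f_F_2f [simp]: "uarr_2cell \<theta> \<Longrightarrow> F2 G_2f (F2 F_2f \<theta>) = \<theta>"
  by (rule uarr2.equality) simp_all

lemma F_2f_G_2f [simp]: "adjn_2cell \<theta> \<Longrightarrow> F2 F_2f (F2 G_2f \<theta>) = \<theta>"
  by (rule adjn2.equality) simp_all

lemma adjn_one_F_1: "universal_arrow U \<Longrightarrow> adjn_one (F_0 U) = F_1 (uarr_one U)"
proof (rule adjn1.equality)
  assume U: "universal_arrow U"
  show "a1lam (adjn_one (F_0 U)) = a1lam (F_1 (uarr_one U))"
  proof (rule ntrans_eqI)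
    show "nat_trans (a1lam (F_1 (uarr_one U)))" using U by (intro adjn_1cell_simps(13) adjn_1cell_F_1) simp
  qed (use U in \<open>simp_all add: adjn_one_def\<close>)
qed (simp_all add: adjn_one_def)

lemma adjn_comp1_F_1:
  assumes f: "uarr_1cell f" and g: "uarr_1cell g" and c: "u1s g = u1t f"
  shows "adjn_comp1 (F_1 g) (F_1 f) = F_1 (uarr_comp1 g f)"
proof (rule adjn1.equality)
  have n: "nat_trans (a1lam (F_1 f))" "nat_trans (a1lam (F_1 g))" "nat_trans (a1lam (F_1 (uarr_comp1 g f)))"
    using f g c by (intro adjn_1cell_simps adjn_1cell_F_1; simp)+
  let ?U = "u1s f" and ?T = "u1t f" and ?W = "u1t g"
  show "a1lam (adjn_comp1 (F_1 g) (F_1 f)) = a1lam (F_1 (uarr_comp1 g f))"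
  proof (rule ntrans_eqI)
    fix A assume "A \<in> Obj (FDom (NSrc (a1lam (F_1 (uarr_comp1 g f)))))"
    then have A: "A \<in> Obj (uC ?U)" using f g c by simp
    define l where "l = NCmp (a1lam (F_1 f)) A"
    have l: "l \<in> Arr (uX ?T)" "Dom (uX ?T) l = uL ?T (FObj (u1J f) A)" "Cod (uX ?T) l = FObj (u1V f) (uL ?U A)"
      "FArr (uR ?T) l \<cdot>\<^bsub>uC ?T\<^esub> uEta ?T (FObj (u1J f) A) = NCmp (u1rho f) (uL ?U A) \<cdot>\<^bsub>uC ?T\<^esub> FArr (u1J f) (uEta ?U A)"
      using f A unfolding l_def by simp_all
    have l': "l \<in> Arr (uX (u1s g))" "Dom (uX (u1s g)) l = uL ?T (FObj (u1J f) A)" "Cod (uX (u1s g)) l = FObj (u1V f) (uL ?U A)"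
      using l c by simp_all
    have m: "FArr (u1J g) (FArr (uR ?T) l) \<cdot>\<^bsub>uC ?W\<^esub> FArr (u1J g) (uEta ?T (FObj (u1J f) A)) =
        FArr (u1J g) (NCmp (u1rho f) (uL ?U A) \<cdot>\<^bsub>uC ?T\<^esub> FArr (u1J f) (uEta ?U A))"
      by (rule FArr_equation[OF l(4)]) (use f g c A l in simp_all)
    have r: "FArr (uR ?W) (FArr (u1V g) l) \<cdot>\<^bsub>uC ?W\<^esub> NCmp (u1rho g) (uL ?T (FObj (u1J f) A)) =
        NCmp (u1rho g) (FObj (u1V f) (uL ?U A)) \<cdot>\<^bsub>uC ?W\<^esub> FArr (u1J g) (FArr (uR ?T) l)"
      using u1rho_natural[OF g l'] c by simp
    have "NCmp (a1lam (adjn_comp1 (F_1 g) (F_1 f))) A =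
        FArr (u1V g) l \<cdot>\<^bsub>uX ?W\<^esub> NCmp (a1lam (F_1 g)) (FObj (u1J f) A)"
      using f g c A by (simp add: adjn_comp1_def l_def)
    also have "\<dots> = NCmp (a1lam (F_1 (uarr_comp1 g f))) A"
      by (rule universal_arrow_eqI[of ?W "FObj (u1J g) (FObj (u1J f) A)"])
        (use f g c A l in \<open>simp_all add: Cmp_extend[OF r] m\<close>)
    finally show "NCmp (a1lam (adjn_comp1 (F_1 g) (F_1 f))) A = NCmp (a1lam (F_1 (uarr_comp1 g f))) A" .
  qed (use n f g c in \<open>simp_all add: adjn_comp1_def\<close>)
qed (simp_all add: adjn_comp1_def)

lemma AdjR_simps [simp]:
  "Cell0 AdjR = {U. adjunction U}" "src AdjR = a1s" "trg AdjR = a1t" "one AdjR = adjn_one"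
  "comp1 AdjR = adjn_comp1"
  "\<kappa> \<diamondop>\<^bsub>AdjR\<^esub> \<theta> = \<lparr>a2s = adjn_comp1 (a2s \<kappa>) (a2s \<theta>), a2t = adjn_comp1 (a2t \<kappa>) (a2t \<theta>),
      a2a = a2a \<kappa> \<star>\<^sub>h a2a \<theta>, a2b = a2b \<kappa> \<star>\<^sub>h a2b \<theta>\<rparr>"
  "Vert AdjR = mk_category {f. adjn_1cell f} {\<theta>. adjn_2cell \<theta>} a2s a2t
      (\<lambda>f. \<lparr>a2s = f, a2t = f, a2a = id_nat (a1J f), a2b = id_nat (a1V f)\<rparr>)
      (\<lambda>\<kappa> \<theta>. \<lparr>a2s = a2s \<theta>, a2t = a2t \<kappa>, a2a = a2a \<kappa> \<circ>\<^sub>V a2a \<theta>, a2b = a2b \<kappa> \<circ>\<^sub>V a2b \<theta>\<rparr>)"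
  by (simp_all add: AdjR_def)

lemma adjn_2cell_vcomp:
  assumes "adjn_2cell \<theta>" "adjn_2cell \<kappa>" "a2s \<kappa> = a2t \<theta>"
  shows "adjn_2cell \<lparr>a2s = a2s \<theta>, a2t = a2t \<kappa>, a2a = a2a \<kappa> \<circ>\<^sub>V a2a \<theta>, a2b = a2b \<kappa> \<circ>\<^sub>V a2b \<theta>\<rparr>"
  using adjn_2cell_F_2f[OF uarr_2cell_vcomp[of "F2 G_2f \<theta>" "F2 G_2f \<kappa>"]] assms by (simp add: F_2f_def)

lemma adjn_2cell_ide:
  assumes "adjn_1cell f"
  shows "adjn_2cell \<lparr>a2s = f, a2t = f, a2a = id_nat (a1J f), a2b = id_nat (a1V f)\<rparr>"
  using adjn_2cell_F_2f[OF uarr_2cell_ide[of "G_1 f"]] assms by (simp add: F_2f_def)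

text \<open>
  \<open>L\<close>, \<open>\<epsilon>\<close> and \<open>\<lambda>\<close> are determined by the universal property, which makes \<open>F\<close> bijective on
  cells; the axioms of a 2-category for adjunctions then come from those for universal arrows.
\<close>

lemma UArr_AdjR_inverse: "mutually_inverse UArr AdjR F_2f G_2f"
proof (rule mutually_inverse_transport[OF two_category_UArr])
  show "category (Vert AdjR)"
    unfolding AdjR_simps
    by (rule category_mk_category) (auto simp: adjn_2cell_vcomp adjn_2cell_ide intro!: adjn2.equality)
  show "F2 F_2f \<kappa> \<cdot>\<^bsub>Vert AdjR\<^esub> F2 F_2f \<theta> = F2 F_2f (\<kappa> \<cdot>\<^bsub>Vert UArr\<^esub> \<theta>)"
    if "\<theta> \<in> Cell2 UArr" "\<kappa> \<in> Cell2 UArr" "Dom (Vert UArr) \<kappa> = Cod (Vert UArr) \<theta>" for \<theta> \<kappa> :: "('o, 'm, 'x, 'y) uarr2"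
    using that by (auto intro!: adjn2.equality)
qed (auto simp: two_functor_eq_def adjn_one_F_1 adjn_comp1_F_1 intro!: adjn2.equality)

lemma two_category_AdjR: "two_category AdjR"
  using UArr_AdjR_inverse two_functorD(2) unfolding mutually_inverse_def by blast

lemma two_category_AdjR_id: "two_category AdjR_id"
  unfolding AdjR_id_def
proof (rule two_category_restrict[OF two_category_AdjR])
  fix f g :: "('o, 'm, 'x, 'y) adjn1"
  assume a: "f \<in> Cell1 AdjR" "g \<in> Cell1 AdjR" "src AdjR g = trg AdjR f"
    "a1rho f = id_nat (a1J f \<circ>\<^sub>F aR (a1s f))" "a1rho g = id_nat (a1J g \<circ>\<^sub>F aR (a1s g))"
  then have "G_1 g \<odot>\<^bsub>UArr_id\<^esub> G_1 f \<in> Cell1 UArr_id"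
    by (intro two_categoryD(9)[OF two_category_UArr_id]) (simp_all add: UArr_id_def)
  then show "a1rho (g \<odot>\<^bsub>AdjR\<^esub> f) = id_nat (a1J (g \<odot>\<^bsub>AdjR\<^esub> f) \<circ>\<^sub>F aR (a1s (g \<odot>\<^bsub>AdjR\<^esub> f)))"
    by (simp add: UArr_id_def adjn_comp1_def)
qed (simp add: adjn_one_def)

lemma UArr_AdjR_id_inverse: "mutually_inverse UArr_id AdjR_id F_2f G_2f"
  unfolding UArr_id_def AdjR_id_def
  by (rule mutually_inverse_restrict[OF UArr_AdjR_inverse two_category_UArr_id[unfolded UArr_id_def]
        two_category_AdjR_id[unfolded AdjR_id_def]]) simp_all

section \<open>The 2-category of extensive monads\<close>

lemma extensive_monad_simps [simp]:
  assumes "extensive_monad S"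
  shows "category (eC S)"
    "A \<in> Obj (eC S) \<Longrightarrow> eS S A \<in> Obj (eC S)"
    "A \<in> Obj (eC S) \<Longrightarrow> eEta S A \<in> Arr (eC S)"
    "A \<in> Obj (eC S) \<Longrightarrow> Dom (eC S) (eEta S A) = A"
    "A \<in> Obj (eC S) \<Longrightarrow> Cod (eC S) (eEta S A) = eS S A"
    "A \<in> Obj (eC S) \<Longrightarrow> eExt S A (eEta S A) = Ide (eC S) (eS S A)"
  using assms unfolding extensive_monad_def PiE_iff mem_Hom by blast+

lemma extensive_monad_ext:
  assumes "extensive_monad S"
  shows "eS S \<in> extensional (Obj (eC S))" "eEta S \<in> extensional (Obj (eC S))"
    "eExt S \<in> extensional (Obj (eC S))"
    "A \<in> Obj (eC S) \<Longrightarrow> eExt S A \<in> extensional (Into (eC S) (eS S A))"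
  using assms unfolding extensive_monad_def PiE_iff by blast+

lemma eExt_simps [simp]:
  assumes S: "extensive_monad S" and B: "B \<in> Obj (eC S)" and h: "h \<in> Arr (eC S)" "Cod (eC S) h = eS S B"
  shows "eExt S B h \<in> Arr (eC S)" "Dom (eC S) (eExt S B h) = eS S (Dom (eC S) h)" "Cod (eC S) (eExt S B h) = eS S B"
    "A = Dom (eC S) h \<Longrightarrow> eExt S B h \<cdot>\<^bsub>eC S\<^esub> eEta S A = h"
proof -
  have "Dom (eC S) h \<in> Obj (eC S)" "h \<in> Hom (eC S) (Dom (eC S) h) (eS S B)" using assms by auto
  then have "eExt S B h \<in> Hom (eC S) (eS S (Dom (eC S) h)) (eS S B)"
    "eExt S B h \<cdot>\<^bsub>eC S\<^esub> eEta S (Dom (eC S) h) = h"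
    using S B unfolding extensive_monad_def by blast+
  then show "eExt S B h \<in> Arr (eC S)" "Dom (eC S) (eExt S B h) = eS S (Dom (eC S) h)" "Cod (eC S) (eExt S B h) = eS S B"
    "A = Dom (eC S) h \<Longrightarrow> eExt S B h \<cdot>\<^bsub>eC S\<^esub> eEta S A = h" by auto
qed

lemma eExt_eExt [simp]:
  assumes "extensive_monad S" "D \<in> Obj (eC S)" "k \<in> Arr (eC S)" "Cod (eC S) k = eS S D"
    "h \<in> Arr (eC S)" "Cod (eC S) h = eS S (Dom (eC S) k)"
  shows "eExt S D (eExt S D k \<cdot>\<^bsub>eC S\<^esub> h) = eExt S D k \<cdot>\<^bsub>eC S\<^esub> eExt S (Dom (eC S) k) h"
proof -
  have "Dom (eC S) h \<in> Obj (eC S)" "h \<in> Hom (eC S) (Dom (eC S) h) (eS S (Dom (eC S) k))"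
    "Dom (eC S) k \<in> Obj (eC S)" "k \<in> Hom (eC S) (Dom (eC S) k) (eS S D)"
    using assms by auto
  then show ?thesis using assms(1,2) unfolding extensive_monad_def by blast
qed

lemma extensive_monadI:
  assumes "category (eC S)"
    "eS S \<in> extensional (Obj (eC S))" "eEta S \<in> extensional (Obj (eC S))"
    "eExt S \<in> extensional (Obj (eC S))"
    "\<And>A. A \<in> Obj (eC S) \<Longrightarrow> eExt S A \<in> extensional (Into (eC S) (eS S A))"
    "\<And>A. A \<in> Obj (eC S) \<Longrightarrow> eS S A \<in> Obj (eC S)"
    "\<And>A. A \<in> Obj (eC S) \<Longrightarrow> eEta S A \<in> Hom (eC S) A (eS S A)"
    "\<And>B h. B \<in> Obj (eC S) \<Longrightarrow> h \<in> Arr (eC S) \<Longrightarrow> Cod (eC S) h = eS S B \<Longrightarrow>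
      eExt S B h \<in> Hom (eC S) (eS S (Dom (eC S) h)) (eS S B)"
    "\<And>A. A \<in> Obj (eC S) \<Longrightarrow> eExt S A (eEta S A) = Ide (eC S) (eS S A)"
    "\<And>B h. B \<in> Obj (eC S) \<Longrightarrow> h \<in> Arr (eC S) \<Longrightarrow> Cod (eC S) h = eS S B \<Longrightarrow>
      eExt S B h \<cdot>\<^bsub>eC S\<^esub> eEta S (Dom (eC S) h) = h"
    "\<And>D h k. D \<in> Obj (eC S) \<Longrightarrow> h \<in> Arr (eC S) \<Longrightarrow> k \<in> Arr (eC S) \<Longrightarrow>
      Cod (eC S) h = eS S (Dom (eC S) k) \<Longrightarrow> Cod (eC S) k = eS S D \<Longrightarrow>
      eExt S D (eExt S D k \<cdot>\<^bsub>eC S\<^esub> h) = eExt S D k \<cdot>\<^bsub>eC S\<^esub> eExt S (Dom (eC S) k) h"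
  shows "extensive_monad S"
  unfolding extensive_monad_def PiE_iff
  using assms by auto

subsection \<open>Algebras\<close>

lemma ealgebra_simps [simp]:
  assumes S: "extensive_monad S" and N: "ealgebra S N"
  shows "fst N \<in> Obj (eC S)"
    "a \<in> Arr (eC S) \<Longrightarrow> Cod (eC S) a = fst N \<Longrightarrow> snd N a \<in> Arr (eC S)"
    "a \<in> Arr (eC S) \<Longrightarrow> Cod (eC S) a = fst N \<Longrightarrow> Dom (eC S) (snd N a) = eS S (Dom (eC S) a)"
    "a \<in> Arr (eC S) \<Longrightarrow> Cod (eC S) a = fst N \<Longrightarrow> Cod (eC S) (snd N a) = fst N"
    "a \<in> Arr (eC S) \<Longrightarrow> Cod (eC S) a = fst N \<Longrightarrow> A = Dom (eC S) a \<Longrightarrow> snd N a \<cdot>\<^bsub>eC S\<^esub> eEta S A = a"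
    "b \<in> Arr (eC S) \<Longrightarrow> Cod (eC S) b = fst N \<Longrightarrow> h \<in> Arr (eC S) \<Longrightarrow> Cod (eC S) h = eS S (Dom (eC S) b) \<Longrightarrow>
      snd N (snd N b \<cdot>\<^bsub>eC S\<^esub> h) = snd N b \<cdot>\<^bsub>eC S\<^esub> eExt S (Dom (eC S) b) h"
proof -
  obtain N' n where [simp]: "N = (N', n)" by (cases N)
  have 1: "n a \<in> Hom (eC S) (eS S (Dom (eC S) a)) N' \<and> n a \<cdot>\<^bsub>eC S\<^esub> eEta S (Dom (eC S) a) = a"
    if "a \<in> Arr (eC S)" "Cod (eC S) a = N'" for a
  proof -
    have "Dom (eC S) a \<in> Obj (eC S)" "a \<in> Hom (eC S) (Dom (eC S) a) N'" using that S by auto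
    then show ?thesis using N unfolding ealgebra_def by auto
  qed
  show "fst N \<in> Obj (eC S)" using N by (simp add: ealgebra_def)
  show "a \<in> Arr (eC S) \<Longrightarrow> Cod (eC S) a = fst N \<Longrightarrow> snd N a \<in> Arr (eC S)"
    "a \<in> Arr (eC S) \<Longrightarrow> Cod (eC S) a = fst N \<Longrightarrow> Dom (eC S) (snd N a) = eS S (Dom (eC S) a)"
    "a \<in> Arr (eC S) \<Longrightarrow> Cod (eC S) a = fst N \<Longrightarrow> Cod (eC S) (snd N a) = fst N"
    "a \<in> Arr (eC S) \<Longrightarrow> Cod (eC S) a = fst N \<Longrightarrow> A = Dom (eC S) a \<Longrightarrow> snd N a \<cdot>\<^bsub>eC S\<^esub> eEta S A = a"
    using 1[of a] by auto
  show "snd N (snd N b \<cdot>\<^bsub>eC S\<^esub> h) = snd N b \<cdot>\<^bsub>eC S\<^esub> eExt S (Dom (eC S) b) h"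
    if "b \<in> Arr (eC S)" "Cod (eC S) b = fst N" "h \<in> Arr (eC S)" "Cod (eC S) h = eS S (Dom (eC S) b)"
  proof -
    have "Dom (eC S) b \<in> Obj (eC S)" "Dom (eC S) h \<in> Obj (eC S)" using that S by auto
    then show ?thesis using N that unfolding ealgebra_def by auto
  qed
qed

lemma ealgebra_eta_extend [simp]:
  assumes S: "extensive_monad S" and N: "ealgebra S N" and "a \<in> Arr (eC S)" "Cod (eC S) a = fst N"
    "A = Dom (eC S) a" "x \<in> Arr (eC S)" "Cod (eC S) x = A"
  shows "snd N a \<cdot>\<^bsub>eC S\<^esub> eEta S A \<cdot>\<^bsub>eC S\<^esub> x = a \<cdot>\<^bsub>eC S\<^esub> x"
proof -
  have "Dom (eC S) a \<in> Obj (eC S)" using assms by simp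
  then show ?thesis using assms by (simp add: Cmp_extend[OF ealgebra_simps(5)[OF S N assms(3,4) refl]])
qed

lemma ealgebra_ext: "ealgebra S N \<Longrightarrow> snd N \<in> extensional (Into (eC S) (fst N))"
  by (auto simp: ealgebra_def PiE_def)

lemma ealgebraI:
  assumes "fst N \<in> Obj (eC S)" "snd N \<in> extensional (Into (eC S) (fst N))"
    and "\<And>a. a \<in> Arr (eC S) \<Longrightarrow> Cod (eC S) a = fst N \<Longrightarrow> snd N a \<in> Hom (eC S) (eS S (Dom (eC S) a)) (fst N)"
    and "\<And>a. a \<in> Arr (eC S) \<Longrightarrow> Cod (eC S) a = fst N \<Longrightarrow> snd N a \<cdot>\<^bsub>eC S\<^esub> eEta S (Dom (eC S) a) = a"
    and "\<And>b h. b \<in> Arr (eC S) \<Longrightarrow> Cod (eC S) b = fst N \<Longrightarrow> h \<in> Arr (eC S) \<Longrightarrow> Cod (eC S) h = eS S (Dom (eC S) b) \<Longrightarrow>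
      snd N (snd N b \<cdot>\<^bsub>eC S\<^esub> h) = snd N b \<cdot>\<^bsub>eC S\<^esub> eExt S (Dom (eC S) b) h"
  shows "ealgebra S N"
  using assms by (cases N) (auto simp: ealgebra_def PiE_iff)

lemma ealgebra_eqI:
  assumes "ealgebra S M" "ealgebra S N" "fst M = fst N"
    "\<And>a. a \<in> Arr (eC S) \<Longrightarrow> Cod (eC S) a = fst N \<Longrightarrow> snd M a = snd N a"
  shows "M = N"
proof (rule prod_eqI)
  show "snd M = snd N"
    using ealgebra_ext[OF assms(1)] ealgebra_ext[OF assms(2)] assms(3,4) by (auto intro: extensionalityI)
qed fact

lemma ealg_hom_simps:
  assumes "ealg_hom S M q N" "category (eC S)"
  shows "q \<in> Arr (eC S)" "Dom (eC S) q = fst M" "Cod (eC S) q = fst N"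
    "a \<in> Arr (eC S) \<Longrightarrow> Cod (eC S) a = fst M \<Longrightarrow> snd N (q \<cdot>\<^bsub>eC S\<^esub> a) = q \<cdot>\<^bsub>eC S\<^esub> snd M a"
proof -
  show "q \<in> Arr (eC S)" "Dom (eC S) q = fst M" "Cod (eC S) q = fst N"
    using assms by (auto simp: ealg_hom_def)
  assume "a \<in> Arr (eC S)" "Cod (eC S) a = fst M"
  then have "Dom (eC S) a \<in> Obj (eC S)" "a \<in> Hom (eC S) (Dom (eC S) a) (fst M)" using assms(2) by auto
  then show "snd N (q \<cdot>\<^bsub>eC S\<^esub> a) = q \<cdot>\<^bsub>eC S\<^esub> snd M a"
    using assms(1) unfolding ealg_hom_def by blast
qed

lemma ealg_homI:
  assumes "q \<in> Arr (eC S)" "Dom (eC S) q = fst M" "Cod (eC S) q = fst N"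
    "\<And>a. a \<in> Arr (eC S) \<Longrightarrow> Cod (eC S) a = fst M \<Longrightarrow> snd N (q \<cdot>\<^bsub>eC S\<^esub> a) = q \<cdot>\<^bsub>eC S\<^esub> snd M a"
  shows "ealg_hom S M q N"
  using assms by (auto simp: ealg_hom_def)

lemma ealg_hom_comp:
  assumes S: "extensive_monad S" and M: "ealgebra S M"
    and p: "ealg_hom S M p N" and q: "ealg_hom S N q L"
  shows "ealg_hom S M (q \<cdot>\<^bsub>eC S\<^esub> p) L"
proof -
  have c: "category (eC S)" using S by simp
  note P = ealg_hom_simps[OF p c] and Q = ealg_hom_simps[OF q c]
  show ?thesis by (rule ealg_homI) (use S M in \<open>simp_all add: P Q\<close>)
qed

lemma ealg_hom_ide: "extensive_monad S \<Longrightarrow> ealgebra S N \<Longrightarrow> ealg_hom S N (Ide (eC S) (fst N)) N"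
  by (rule ealg_homI) simp_all

lemma eFree_simps [simp]:
  "A \<in> Obj (eC S) \<Longrightarrow> fst (eFree S A) = eS S A" "A \<in> Obj (eC S) \<Longrightarrow> snd (eFree S A) = eExt S A"
  by (simp_all add: eFree_def)

lemma ealgebra_eFree [simp]:
  assumes "extensive_monad S" "A \<in> Obj (eC S)"
  shows "ealgebra S (eFree S A)"
  by (rule ealgebraI) (use assms extensive_monad_ext(4)[OF assms] in simp_all)

lemma ealg_hom_free:
  assumes "extensive_monad S" "ealgebra S N" "a \<in> Arr (eC S)" "Cod (eC S) a = fst N"
  shows "ealg_hom S (eFree S (Dom (eC S) a)) (snd N a) N"
proof -
  have "Dom (eC S) a \<in> Obj (eC S)" using assms by simp
  then show ?thesis by (intro ealg_homI) (use assms in simp_all)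
qed

lemma EAlg_simps [simp]:
  "Obj (EAlg S) = {N. ealgebra S N}" "Arr (EAlg S) = {(M, q, N). ealgebra S M \<and> ealgebra S N \<and> ealg_hom S M q N}"
  "m \<in> Arr (EAlg S) \<Longrightarrow> Dom (EAlg S) m = fst m" "m \<in> Arr (EAlg S) \<Longrightarrow> Cod (EAlg S) m = snd (snd m)"
  "ealgebra S N \<Longrightarrow> Ide (EAlg S) N = (N, Ide (eC S) (fst N), N)"
  "l \<in> Arr (EAlg S) \<Longrightarrow> m \<in> Arr (EAlg S) \<Longrightarrow> fst l = snd (snd m) \<Longrightarrow>
    l \<cdot>\<^bsub>EAlg S\<^esub> m = (fst m, fst (snd l) \<cdot>\<^bsub>eC S\<^esub> fst (snd m), snd (snd l))"
  unfolding EAlg_def by simp_all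

lemma category_EAlg [simp]:
  assumes S: "extensive_monad S"
  shows "category (EAlg S)"
proof -
  have c: "category (eC S)" using S by simp
  note H = ealg_hom_simps(1-3)[OF _ c]
  show ?thesis
    unfolding EAlg_def
    by (rule category_mk_category) (use S in \<open>auto simp: ealg_hom_ide H intro: ealg_hom_comp\<close>)
qed

subsection \<open>1-cells act on algebras\<close>

text \<open>
  A 1-cell is given by the algebra structures that it puts on the objects \<open>P S A\<close>; they will turn
  out to be the images of the free algebras.
\<close>

abbreviation e1Alg :: "('o, 'm) emonad1 \<Rightarrow> 'o \<Rightarrow> ('o, 'm) ealg" where
  "e1Alg f A \<equiv> (FObj (e1P f) (eS (e1s f) A), e1Ext f A)"

lemma emonad_1cell_simps [simp]:
  assumes "emonad_1cell f"
  shows "extensive_monad (e1s f)" "extensive_monad (e1t f)"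
    "cat_functor (e1P f)" "FDom (e1P f) = eC (e1s f)" "FCod (e1P f) = eC (e1t f)"
    "A \<in> Obj (eC (e1s f)) \<Longrightarrow> ealgebra (e1t f) (e1Alg f A)"
  using assms unfolding emonad_1cell_def functor_from_to_def by blast+

lemma e1Ext_ext: "emonad_1cell f \<Longrightarrow> e1Ext f \<in> extensional (Obj (eC (e1s f)))"
  unfolding emonad_1cell_def by blast

lemma e1Ext_simps [simp]:
  assumes f: "emonad_1cell f" and A: "A \<in> Obj (eC (e1s f))"
    and p: "p \<in> Arr (eC (e1t f))" "Cod (eC (e1t f)) p = FObj (e1P f) (eS (e1s f) A)"
  shows "e1Ext f A p \<in> Arr (eC (e1t f))" "Dom (eC (e1t f)) (e1Ext f A p) = eS (e1t f) (Dom (eC (e1t f)) p)"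
    "Cod (eC (e1t f)) (e1Ext f A p) = FObj (e1P f) (eS (e1s f) A)"
    "B = Dom (eC (e1t f)) p \<Longrightarrow> e1Ext f A p \<cdot>\<^bsub>eC (e1t f)\<^esub> eEta (e1t f) B = p"
    "h \<in> Arr (eC (e1t f)) \<Longrightarrow> Cod (eC (e1t f)) h = eS (e1t f) (Dom (eC (e1t f)) p) \<Longrightarrow>
      e1Ext f A (e1Ext f A p \<cdot>\<^bsub>eC (e1t f)\<^esub> h) = e1Ext f A p \<cdot>\<^bsub>eC (e1t f)\<^esub> eExt (e1t f) (Dom (eC (e1t f)) p) h"
    "B = Dom (eC (e1t f)) p \<Longrightarrow> h \<in> Arr (eC (e1t f)) \<Longrightarrow> Cod (eC (e1t f)) h = B \<Longrightarrow>
      e1Ext f A p \<cdot>\<^bsub>eC (e1t f)\<^esub> eEta (e1t f) B \<cdot>\<^bsub>eC (e1t f)\<^esub> h = p \<cdot>\<^bsub>eC (e1t f)\<^esub> h"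
  using ealgebra_simps(2-6)[OF emonad_1cell_simps(2)[OF f] emonad_1cell_simps(6)[OF f A], of p]
    ealgebra_eta_extend[OF emonad_1cell_simps(2)[OF f] emonad_1cell_simps(6)[OF f A] p(1), of B h] p by simp_all

lemma e1Ext_hom [simp]:
  assumes f: "emonad_1cell f" and B: "B \<in> Obj (eC (e1s f))" and h: "h \<in> Arr (eC (e1s f))" "Cod (eC (e1s f)) h = eS (e1s f) B"
    and p: "p \<in> Arr (eC (e1t f))" "Cod (eC (e1t f)) p = FObj (e1P f) (eS (e1s f) (Dom (eC (e1s f)) h))"
  shows "e1Ext f B (FArr (e1P f) (eExt (e1s f) B h) \<cdot>\<^bsub>eC (e1t f)\<^esub> p) =
    FArr (e1P f) (eExt (e1s f) B h) \<cdot>\<^bsub>eC (e1t f)\<^esub> e1Ext f (Dom (eC (e1s f)) h) p"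
proof -
  have A: "Dom (eC (e1s f)) h \<in> Obj (eC (e1s f))" "h \<in> Hom (eC (e1s f)) (Dom (eC (e1s f)) h) (eS (e1s f) B)"
    using f h by simp_all
  have "ealg_hom (e1t f) (e1Alg f (Dom (eC (e1s f)) h)) (FArr (e1P f) (eExt (e1s f) B h)) (e1Alg f B)"
    using f A B unfolding emonad_1cell_def by blast
  from ealg_hom_simps(4)[OF this, of p] show ?thesis using f p by simp
qed

lemma emonad_1cellI:
  assumes "extensive_monad (e1s f)" "extensive_monad (e1t f)"
    "cat_functor (e1P f)" "FDom (e1P f) = eC (e1s f)" "FCod (e1P f) = eC (e1t f)"
    "e1Ext f \<in> extensional (Obj (eC (e1s f)))"
    "\<And>A. A \<in> Obj (eC (e1s f)) \<Longrightarrow> ealgebra (e1t f) (e1Alg f A)"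
    "\<And>B h. B \<in> Obj (eC (e1s f)) \<Longrightarrow> h \<in> Arr (eC (e1s f)) \<Longrightarrow> Cod (eC (e1s f)) h = eS (e1s f) B \<Longrightarrow>
      ealg_hom (e1t f) (e1Alg f (Dom (eC (e1s f)) h)) (FArr (e1P f) (eExt (e1s f) B h)) (e1Alg f B)"
  shows "emonad_1cell f"
  unfolding emonad_1cell_def functor_from_to_def using assms by auto

lemma emonad1_eqI:
  assumes "emonad_1cell f" "emonad_1cell g" "e1s f = e1s g" "e1t f = e1t g" "e1P f = e1P g"
    "\<And>A. A \<in> Obj (eC (e1s g)) \<Longrightarrow> e1Ext f A = e1Ext g A"
  shows "f = g"
proof -
  have "e1Ext f = e1Ext g"
    using e1Ext_ext[OF assms(1)] e1Ext_ext[OF assms(2)] assms(3,6) by (auto intro: extensionalityI)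
  then show ?thesis using assms by (intro emonad1.equality) simp_all
qed

lemma ehat_obj_simps [simp]:
  "fst (ehat_obj f N) = FObj (e1P f) (fst N)"
  "q \<in> Arr (eC (e1t f)) \<Longrightarrow> Cod (eC (e1t f)) q = FObj (e1P f) (fst N) \<Longrightarrow>
    snd (ehat_obj f N) q = FArr (e1P f) (snd N (Ide (eC (e1s f)) (fst N))) \<cdot>\<^bsub>eC (e1t f)\<^esub>
      e1Ext f (fst N) (FArr (e1P f) (eEta (e1s f) (fst N)) \<cdot>\<^bsub>eC (e1t f)\<^esub> q)"
  by (simp_all add: ehat_obj_def case_prod_beta)

lemma e1P_eta_natural:
  assumes "emonad_1cell f" "q \<in> Arr (eC (e1s f))"
  shows "FArr (e1P f) (eEta (e1s f) (Cod (eC (e1s f)) q)) \<cdot>\<^bsub>eC (e1t f)\<^esub> FArr (e1P f) q =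
    FArr (e1P f) (eExt (e1s f) (Cod (eC (e1s f)) q) (eEta (e1s f) (Cod (eC (e1s f)) q) \<cdot>\<^bsub>eC (e1s f)\<^esub> q))
      \<cdot>\<^bsub>eC (e1t f)\<^esub> FArr (e1P f) (eEta (e1s f) (Dom (eC (e1s f)) q))"
proof -
  have "FArr (e1P f) (eExt (e1s f) (Cod (eC (e1s f)) q) (eEta (e1s f) (Cod (eC (e1s f)) q) \<cdot>\<^bsub>eC (e1s f)\<^esub> q))
      \<cdot>\<^bsub>eC (e1t f)\<^esub> FArr (e1P f) (eEta (e1s f) (Dom (eC (e1s f)) q)) =
    FArr (e1P f) (eEta (e1s f) (Cod (eC (e1s f)) q) \<cdot>\<^bsub>eC (e1s f)\<^esub> q)"
    by (rule FArr_equation[where C = "eC (e1s f)"]) (use assms in simp_all)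
  then show ?thesis using assms by simp
qed

text \<open>
  Both sides equal \<open>q\<^sup>N\<close>. With \<open>a\<close> and \<open>b\<close> the values of the two structures at identities,
  this is the square \<open>b \<cdot> S q = q \<cdot> a\<close> for homomorphisms of classical algebras.
\<close>

lemma ealg_hom_structure:
  assumes S: "extensive_monad S" and M: "ealgebra S M" and N: "ealgebra S N" and q: "ealg_hom S M q N"
  shows "snd N (Ide (eC S) (fst N)) \<cdot>\<^bsub>eC S\<^esub> eExt S (fst N) (eEta S (fst N) \<cdot>\<^bsub>eC S\<^esub> q) =
    q \<cdot>\<^bsub>eC S\<^esub> snd M (Ide (eC S) (fst M))"
proof -
  have c: "category (eC S)" using S by simp
  note Q = ealg_hom_simps[OF q c]
  have "snd N (Ide (eC S) (fst N)) \<cdot>\<^bsub>eC S\<^esub> eExt S (fst N) (eEta S (fst N) \<cdot>\<^bsub>eC S\<^esub> q) =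
      snd N (snd N (Ide (eC S) (fst N)) \<cdot>\<^bsub>eC S\<^esub> eEta S (fst N) \<cdot>\<^bsub>eC S\<^esub> q)"
    using S M N Q(1-3) ealgebra_simps(6)[OF S N, of "Ide (eC S) (fst N)" "eEta S (fst N) \<cdot>\<^bsub>eC S\<^esub> q"]
    by (simp del: ealgebra_simps(6) ealgebra_eta_extend)
  also have "\<dots> = snd N (q \<cdot>\<^bsub>eC S\<^esub> Ide (eC S) (fst M))" using S M N Q(1-3) by simp
  also have "\<dots> = q \<cdot>\<^bsub>eC S\<^esub> snd M (Ide (eC S) (fst M))" using S M by (intro Q(4)) simp_all
  finally show ?thesis .
qed

lemma ehat_hom_square:
  assumes f: "emonad_1cell f" and M: "ealgebra (e1s f) M" and N: "ealgebra (e1s f) N" and q: "ealg_hom (e1s f) M q N"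
  shows "FArr (e1P f) (snd N (Ide (eC (e1s f)) (fst N))) \<cdot>\<^bsub>eC (e1t f)\<^esub>
      FArr (e1P f) (eExt (e1s f) (fst N) (eEta (e1s f) (fst N) \<cdot>\<^bsub>eC (e1s f)\<^esub> q)) =
    FArr (e1P f) q \<cdot>\<^bsub>eC (e1t f)\<^esub> FArr (e1P f) (snd M (Ide (eC (e1s f)) (fst M)))"
proof -
  have c: "category (eC (e1s f))" using f by simp
  note Q = ealg_hom_simps(1-3)[OF q c]
  show ?thesis
    using FArr_equation[OF ealg_hom_structure[OF emonad_1cell_simps(1)[OF f] M N q], of "e1P f" "eC (e1t f)"] f M N Q
    by simp
qed

text \<open>
  With \<open>a\<close> and \<open>b\<close> the values at identities of the structures of \<open>M\<close> and \<open>N\<close>, the square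
  \<open>P b \<cdot> P S q = P q \<cdot> P a\<close> and the naturality of \<open>\<eta>\<close> move \<open>P q\<close> through the definition of the
  operation, because \<open>P S q\<close> is a homomorphism between the given algebras \<open>P S M\<close> and
  \<open>P S N\<close>.
\<close>

lemma ehat_obj_hom:
  assumes f: "emonad_1cell f" and M: "ealgebra (e1s f) M" and N: "ealgebra (e1s f) N" and q: "ealg_hom (e1s f) M q N"
  shows "ealg_hom (e1t f) (ehat_obj f M) (FArr (e1P f) q) (ehat_obj f N)"
proof -
  have c: "category (eC (e1s f))" using f by simp
  note Q = ealg_hom_simps(1-3)[OF q c]
  note n = e1P_eta_natural[OF f Q(1), unfolded Q]
  show ?thesis
    by (rule ealg_homI)
      (use f M N in \<open>simp_all add: Q Cmp_extend[OF n] Cmp_extend[OF ehat_hom_square[OF f M N q]]\<close>)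
qed

text \<open>
  Let \<open>a = 1\<^sup>N\<close>. The arrow \<open>P a : P S N \<rightarrow> P N\<close> is split by \<open>P \<eta>\<close>, and the operation of \<open>P N\<close>
  sends \<open>q\<close> to \<open>P a\<close> after the operation of \<open>P S N\<close> at \<open>P \<eta> \<cdot> q\<close>. Its associativity law
  reduces to that of \<open>P S N\<close> because \<open>a \<cdot> S a = a \<cdot> \<mu>\<close>, where \<open>P\<close> sends both \<open>S a\<close> and
  \<open>\<mu>\<close> to homomorphisms.
\<close>

lemma ealgebra_ehat_obj [simp]:
  assumes f: "emonad_1cell f" and N: "ealgebra (e1s f) N"
  shows "ealgebra (e1t f) (ehat_obj f N)"
proof (rule ealgebraI)
  show "snd (ehat_obj f N) \<in> extensional (Into (eC (e1t f)) (fst (ehat_obj f N)))"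
    by (simp add: ehat_obj_def case_prod_beta)
  show "fst (ehat_obj f N) \<in> Obj (eC (e1t f))" using f N by simp
  have r: "FArr (e1P f) (snd N (Ide (eC (e1s f)) (fst N))) \<cdot>\<^bsub>eC (e1t f)\<^esub> FArr (e1P f) (eEta (e1s f) (fst N)) =
    Ide (eC (e1t f)) (FObj (e1P f) (fst N))"
    using f N FArr_equation[OF ealgebra_simps(5)[OF emonad_1cell_simps(1)[OF f] N _ _ refl], of "Ide (eC (e1s f)) (fst N)" "e1P f" "eC (e1t f)"]
    by simp
  show "snd (ehat_obj f N) a \<cdot>\<^bsub>eC (e1t f)\<^esub> eEta (e1t f) (Dom (eC (e1t f)) a) = a"
    if "a \<in> Arr (eC (e1t f))" "Cod (eC (e1t f)) a = fst (ehat_obj f N)" for a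
    using that f N by (simp add: Cmp_extend[OF r])
  show "snd (ehat_obj f N) (snd (ehat_obj f N) b \<cdot>\<^bsub>eC (e1t f)\<^esub> h) =
      snd (ehat_obj f N) b \<cdot>\<^bsub>eC (e1t f)\<^esub> eExt (e1t f) (Dom (eC (e1t f)) b) h"
    if b: "b \<in> Arr (eC (e1t f))" "Cod (eC (e1t f)) b = fst (ehat_obj f N)" and
      h: "h \<in> Arr (eC (e1t f))" "Cod (eC (e1t f)) h = eS (e1t f) (Dom (eC (e1t f)) b)" for b h
  proof -
    let ?S = "e1s f" and ?T = "e1t f" and ?P = "e1P f" and ?N = "fst N"
    let ?a = "snd N (Ide (eC ?S) ?N)" and ?e = "e1Ext f ?N (FArr ?P (eEta ?S ?N) \<cdot>\<^bsub>eC ?T\<^esub> b)"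
    let ?SN = "eS ?S ?N"
    have a: "ealg_hom ?S (eFree ?S ?N) ?a N" using ealg_hom_free[OF _ N, of "Ide (eC ?S) ?N"] f N by simp
    have aA: "?a \<in> Arr (eC ?S)" "Dom (eC ?S) ?a = ?SN" "Cod (eC ?S) ?a = ?N" using f N by simp_all
    note n = e1P_eta_natural[OF f aA(1), unfolded aA]
    have s: "FArr ?P ?a \<cdot>\<^bsub>eC ?T\<^esub> FArr ?P (eExt ?S ?N (eEta ?S ?N \<cdot>\<^bsub>eC ?S\<^esub> ?a)) =
      FArr ?P ?a \<cdot>\<^bsub>eC ?T\<^esub> FArr ?P (eExt ?S ?N (Ide (eC ?S) ?SN))"
      using ehat_hom_square[OF f ealgebra_eFree N a] f N by simp
    have u: "FArr ?P (eExt ?S ?N (Ide (eC ?S) ?SN)) \<cdot>\<^bsub>eC ?T\<^esub> FArr ?P (eEta ?S ?SN) = Ide (eC ?T) (FObj ?P ?SN)"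
      using f N FArr_equation[OF eExt_simps(4)[OF emonad_1cell_simps(1)[OF f], of ?N "Ide (eC ?S) ?SN" ?SN], of ?P "eC ?T"]
      by simp
    have eh: "?e \<in> Arr (eC ?T)" "Cod (eC ?T) ?e = FObj ?P ?SN" "Dom (eC ?T) ?e = eS ?T (Dom (eC ?T) b)"
      using f N b by simp_all
    have "snd (ehat_obj f N) (snd (ehat_obj f N) b \<cdot>\<^bsub>eC ?T\<^esub> h) =
        FArr ?P ?a \<cdot>\<^bsub>eC ?T\<^esub> e1Ext f ?N (FArr ?P (eEta ?S ?N) \<cdot>\<^bsub>eC ?T\<^esub> FArr ?P ?a \<cdot>\<^bsub>eC ?T\<^esub> ?e \<cdot>\<^bsub>eC ?T\<^esub> h)"
      using f N b h by simp
    also have "\<dots> = FArr ?P ?a \<cdot>\<^bsub>eC ?T\<^esub> e1Ext f ?N (FArr ?P (eExt ?S ?N (eEta ?S ?N \<cdot>\<^bsub>eC ?S\<^esub> ?a)) \<cdot>\<^bsub>eC ?T\<^esub>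
        FArr ?P (eEta ?S ?SN) \<cdot>\<^bsub>eC ?T\<^esub> ?e \<cdot>\<^bsub>eC ?T\<^esub> h)"
      using f N eh h by (simp add: Cmp_extend[OF n] del: e1Ext_hom)
    also have "\<dots> = FArr ?P ?a \<cdot>\<^bsub>eC ?T\<^esub> FArr ?P (eExt ?S ?N (eEta ?S ?N \<cdot>\<^bsub>eC ?S\<^esub> ?a)) \<cdot>\<^bsub>eC ?T\<^esub>
        e1Ext f ?SN (FArr ?P (eEta ?S ?SN) \<cdot>\<^bsub>eC ?T\<^esub> ?e \<cdot>\<^bsub>eC ?T\<^esub> h)"
      using f N eh h by simp
    also have "\<dots> = FArr ?P ?a \<cdot>\<^bsub>eC ?T\<^esub> FArr ?P (eExt ?S ?N (Ide (eC ?S) ?SN)) \<cdot>\<^bsub>eC ?T\<^esub>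
        e1Ext f ?SN (FArr ?P (eEta ?S ?SN) \<cdot>\<^bsub>eC ?T\<^esub> ?e \<cdot>\<^bsub>eC ?T\<^esub> h)"
      using f N eh h by (simp add: Cmp_extend[OF s])
    also have "\<dots> = FArr ?P ?a \<cdot>\<^bsub>eC ?T\<^esub> e1Ext f ?N (FArr ?P (eExt ?S ?N (Ide (eC ?S) ?SN)) \<cdot>\<^bsub>eC ?T\<^esub>
        FArr ?P (eEta ?S ?SN) \<cdot>\<^bsub>eC ?T\<^esub> ?e \<cdot>\<^bsub>eC ?T\<^esub> h)"
      using f N eh h by simp
    also have "\<dots> = FArr ?P ?a \<cdot>\<^bsub>eC ?T\<^esub> e1Ext f ?N (?e \<cdot>\<^bsub>eC ?T\<^esub> h)"
      using f N eh h by (simp add: Cmp_extend[OF u] del: e1Ext_hom e1Ext_simps(5))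
    also have "\<dots> = snd (ehat_obj f N) b \<cdot>\<^bsub>eC ?T\<^esub> eExt ?T (Dom (eC ?T) b) h"
      using f N b h by simp
    finally show ?thesis .
  qed
qed (use f N in simp_all)

text \<open>At a free algebra the splitting is \<open>P \<mu> \<cdot> P \<eta> = 1\<close>, and \<open>P \<mu>\<close> is a homomorphism.\<close>

lemma ehat_obj_eFree:
  assumes f: "emonad_1cell f" and A: "A \<in> Obj (eC (e1s f))"
  shows "ehat_obj f (eFree (e1s f) A) = e1Alg f A"
proof (rule ealgebra_eqI[of "e1t f"])
  fix q assume q: "q \<in> Arr (eC (e1t f))" "Cod (eC (e1t f)) q = fst (e1Alg f A)"
  let ?S = "e1s f" and ?T = "e1t f" and ?P = "e1P f"
  let ?SA = "eS ?S A"
  have u: "FArr ?P (eExt ?S A (Ide (eC ?S) ?SA)) \<cdot>\<^bsub>eC ?T\<^esub> FArr ?P (eEta ?S ?SA) = Ide (eC ?T) (FObj ?P ?SA)"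
    using f A FArr_equation[OF eExt_simps(4)[OF emonad_1cell_simps(1)[OF f], of A "Ide (eC ?S) ?SA" ?SA], of ?P "eC ?T"]
    by simp
  have "snd (ehat_obj f (eFree ?S A)) q =
      e1Ext f A (FArr ?P (eExt ?S A (Ide (eC ?S) ?SA)) \<cdot>\<^bsub>eC ?T\<^esub> FArr ?P (eEta ?S ?SA) \<cdot>\<^bsub>eC ?T\<^esub> q)"
    using f A q by simp
  also have "\<dots> = e1Ext f A q" using f A q by (simp add: Cmp_extend[OF u] del: e1Ext_hom)
  finally show "snd (ehat_obj f (eFree ?S A)) q = snd (e1Alg f A) q" by simp
qed (use f A in simp_all)

lemma emonad_comp1_simps [simp]:
  "e1s (emonad_comp1 g f) = e1s f" "e1t (emonad_comp1 g f) = e1t g" "e1P (emonad_comp1 g f) = e1P g \<circ>\<^sub>F e1P f"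
  by (simp_all add: emonad_comp1_def)

text \<open>
  The formula for the extension operation of a composite 1-cell is the action of the second
  1-cell on the algebras which make up the first one. This reduces the laws of composition to
  functoriality of the action.
\<close>

lemma e1Alg_comp1:
  assumes "emonad_1cell f" "emonad_1cell g" "e1s g = e1t f" "A \<in> Obj (eC (e1s f))"
  shows "e1Alg (emonad_comp1 g f) A = ehat_obj g (e1Alg f A)"
  using assms by (simp add: emonad_comp1_def ehat_obj_def Let_def)

lemma e1Ext_comp1:
  assumes "emonad_1cell f" "emonad_1cell g" "e1s g = e1t f" "A \<in> Obj (eC (e1s f))"
  shows "e1Ext (emonad_comp1 g f) A = snd (ehat_obj g (e1Alg f A))"
  using arg_cong[OF e1Alg_comp1[OF assms], of snd] by simp

lemma emonad_1cell_comp1 [simp]: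
  assumes f: "emonad_1cell f" and g: "emonad_1cell g" and c: "e1s g = e1t f"
  shows "emonad_1cell (emonad_comp1 g f)"
proof (rule emonad_1cellI)
  show "e1Ext (emonad_comp1 g f) \<in> extensional (Obj (eC (e1s (emonad_comp1 g f))))"
    by (simp add: emonad_comp1_def)
  show "ealgebra (e1t (emonad_comp1 g f)) (e1Alg (emonad_comp1 g f) A)"
    if "A \<in> Obj (eC (e1s (emonad_comp1 g f)))" for A
    unfolding e1Alg_comp1[OF f g c that[unfolded emonad_comp1_simps]]
    using that f g c by simp
  show "ealg_hom (e1t (emonad_comp1 g f)) (e1Alg (emonad_comp1 g f) (Dom (eC (e1s (emonad_comp1 g f))) h))
      (FArr (e1P (emonad_comp1 g f)) (eExt (e1s (emonad_comp1 g f)) B h)) (e1Alg (emonad_comp1 g f) B)"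
    if "B \<in> Obj (eC (e1s (emonad_comp1 g f)))" "h \<in> Arr (eC (e1s (emonad_comp1 g f)))"
      "Cod (eC (e1s (emonad_comp1 g f))) h = eS (e1s (emonad_comp1 g f)) B" for B h
  proof -
    have B: "B \<in> Obj (eC (e1s f))" "h \<in> Arr (eC (e1s f))" "Cod (eC (e1s f)) h = eS (e1s f) B"
      using that by simp_all
    have A: "Dom (eC (e1s f)) h \<in> Obj (eC (e1s f))" using f B by simp
    have 1: "ealg_hom (e1s g) (e1Alg f (Dom (eC (e1s f)) h)) (FArr (e1P f) (eExt (e1s f) B h)) (e1Alg f B)"
      unfolding c by (rule ealg_homI) (use f A B in simp_all)
    have "ealg_hom (e1t g) (ehat_obj g (e1Alg f (Dom (eC (e1s f)) h)))
        (FArr (e1P g) (FArr (e1P f) (eExt (e1s f) B h))) (ehat_obj g (e1Alg f B))"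
      by (rule ehat_obj_hom[OF g _ _ 1]) (use f A B c in simp_all)
    then show ?thesis
      unfolding e1Alg_comp1[OF f g c A, symmetric] e1Alg_comp1[OF f g c B(1), symmetric]
      using f A B by simp
  qed
qed (use f g c in simp_all)

text \<open>
  With \<open>a = 1\<^sup>N\<close>, both sides send \<open>q\<close> to \<open>W P a\<close> after the operation of \<open>W P S N\<close> at
  \<open>W P \<eta> \<cdot> q\<close>: on the right because \<open>P a\<close> is a homomorphism onto \<open>P N\<close>, hence \<open>W P a\<close> is one
  onto \<open>W P N\<close>, and \<open>P a \<cdot> P \<eta> = 1\<close>.
\<close>

lemma ehat_obj_comp1:
  assumes f: "emonad_1cell f" and g: "emonad_1cell g" and c: "e1s g = e1t f" and N: "ealgebra (e1s f) N"
  shows "ehat_obj (emonad_comp1 g f) N = ehat_obj g (ehat_obj f N)"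
proof (rule ealgebra_eqI[of "e1t g"])
  let ?S = "e1s f" and ?T = "e1t f" and ?P = "e1P f" and ?W = "e1P g" and ?N = "fst N"
  let ?a = "snd N (Ide (eC ?S) ?N)"
  show "ealgebra (e1t g) (ehat_obj (emonad_comp1 g f) N)"
    using ealgebra_ehat_obj[of "emonad_comp1 g f" N] f g c N by simp
  show "ealgebra (e1t g) (ehat_obj g (ehat_obj f N))" using f g c N by simp
  show "fst (ehat_obj (emonad_comp1 g f) N) = fst (ehat_obj g (ehat_obj f N))" using f N by simp
  fix q assume q: "q \<in> Arr (eC (e1t g))" "Cod (eC (e1t g)) q = fst (ehat_obj g (ehat_obj f N))"
  have N': "?N \<in> Obj (eC ?S)" using f N by simp
  have a: "ealg_hom ?S (eFree ?S ?N) ?a N" using ealg_hom_free[OF _ N, of "Ide (eC ?S) ?N"] f N by simp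
  have r: "FArr ?P ?a \<cdot>\<^bsub>eC ?T\<^esub> FArr ?P (eEta ?S ?N) = Ide (eC ?T) (FObj ?P ?N)"
    using f N FArr_equation[OF ealgebra_simps(5)[OF emonad_1cell_simps(1)[OF f] N _ _ refl], of "Ide (eC ?S) ?N" ?P "eC ?T"]
    by simp
  have r': "FArr ?W (FArr ?P ?a) \<cdot>\<^bsub>eC (e1t g)\<^esub> FArr ?W (FArr ?P (eEta ?S ?N)) = Ide (eC (e1t g)) (FObj ?W (FObj ?P ?N))"
    using f g c N FArr_equation[OF r, of ?W "eC (e1t g)"] by simp
  have "ealg_hom ?T (e1Alg f ?N) (FArr ?P ?a) (ehat_obj f N)"
    using ehat_obj_hom[OF f _ N a] ehat_obj_eFree[OF f N'] f N by simp
  then have "ealg_hom (e1t g) (ehat_obj g (e1Alg f ?N)) (FArr ?W (FArr ?P ?a)) (ehat_obj g (ehat_obj f N))"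
    using f g c N N' by (intro ehat_obj_hom) simp_all
  note h = ealg_hom_simps(4)[OF this, of "FArr ?W (FArr ?P (eEta ?S ?N)) \<cdot>\<^bsub>eC (e1t g)\<^esub> q"]
  have "snd (ehat_obj (emonad_comp1 g f) N) q = FArr ?W (FArr ?P ?a) \<cdot>\<^bsub>eC (e1t g)\<^esub>
      snd (ehat_obj g (e1Alg f ?N)) (FArr ?W (FArr ?P (eEta ?S ?N)) \<cdot>\<^bsub>eC (e1t g)\<^esub> q)"
    using q f g c N N' by (simp add: e1Ext_comp1)
  also have "\<dots> = snd (ehat_obj g (ehat_obj f N)) (FArr ?W (FArr ?P ?a) \<cdot>\<^bsub>eC (e1t g)\<^esub> FArr ?W (FArr ?P (eEta ?S ?N)) \<cdot>\<^bsub>eC (e1t g)\<^esub> q)"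
    by (rule h[symmetric]) (use q f g c N N' in simp_all)
  also have "\<dots> = snd (ehat_obj g (ehat_obj f N)) q"
    using q f g c N N' by (simp add: Cmp_extend[OF r'])
  finally show "snd (ehat_obj (emonad_comp1 g f) N) q = snd (ehat_obj g (ehat_obj f N)) q" .
qed

lemma emonad_one_simps [simp]:
  "e1s (emonad_one S) = S" "e1t (emonad_one S) = S" "e1P (emonad_one S) = id_functor (eC S)"
  "e1Ext (emonad_one S) = eExt S"
  by (simp_all add: emonad_one_def)

lemma emonad_1cell_one [simp]:
  assumes S: "extensive_monad S"
  shows "emonad_1cell (emonad_one S)"
proof (rule emonad_1cellI)
  show "ealgebra (e1t (emonad_one S)) (e1Alg (emonad_one S) A)" if "A \<in> Obj (eC (e1s (emonad_one S)))" for A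
    using that S ealgebra_eFree[OF S, of A] by (simp add: eFree_def)
  show "ealg_hom (e1t (emonad_one S)) (e1Alg (emonad_one S) (Dom (eC (e1s (emonad_one S))) h))
      (FArr (e1P (emonad_one S)) (eExt (e1s (emonad_one S)) B h)) (e1Alg (emonad_one S) B)"
    if "B \<in> Obj (eC (e1s (emonad_one S)))" "h \<in> Arr (eC (e1s (emonad_one S)))"
      "Cod (eC (e1s (emonad_one S))) h = eS (e1s (emonad_one S)) B" for B h
    by (rule ealg_homI) (use that S in simp_all)
qed (use S extensive_monad_ext(3)[OF S] in simp_all)

lemma ehat_obj_one:
  assumes S: "extensive_monad S" and N: "ealgebra S N"
  shows "ehat_obj (emonad_one S) N = N"
proof (rule ealgebra_eqI[of S])
  show "ealgebra S (ehat_obj (emonad_one S) N)" using ealgebra_ehat_obj[of "emonad_one S" N] S N by simp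
  fix q assume q: "q \<in> Arr (eC S)" "Cod (eC S) q = fst N"
  have "snd N (Ide (eC S) (fst N)) \<cdot>\<^bsub>eC S\<^esub> eExt S (fst N) (eEta S (fst N) \<cdot>\<^bsub>eC S\<^esub> q) =
      snd N (snd N (Ide (eC S) (fst N)) \<cdot>\<^bsub>eC S\<^esub> eEta S (fst N) \<cdot>\<^bsub>eC S\<^esub> q)"
    using S N q ealgebra_simps(6)[OF S N, of "Ide (eC S) (fst N)" "eEta S (fst N) \<cdot>\<^bsub>eC S\<^esub> q"]
    by (simp del: ealgebra_simps(6) ealgebra_eta_extend)
  also have "\<dots> = snd N q" using S N q by simp
  finally show "snd (ehat_obj (emonad_one S) N) q = snd N q" using S N q by simp
qed (use S N in simp_all)

lemma emonad_comp1_one: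
  "emonad_1cell f \<Longrightarrow> e1s f = S \<Longrightarrow> emonad_comp1 f (emonad_one S) = f"
  "emonad_1cell f \<Longrightarrow> e1t f = S \<Longrightarrow> emonad_comp1 (emonad_one S) f = f"
proof -
  show "emonad_comp1 f (emonad_one S) = f" if f: "emonad_1cell f" "e1s f = S"
  proof (rule emonad1_eqI)
    show "e1Ext (emonad_comp1 f (emonad_one S)) A = e1Ext f A" if A: "A \<in> Obj (eC (e1s f))" for A
      using A f e1Ext_comp1[of "emonad_one S" f A] ehat_obj_eFree[OF f(1), of A] emonad_1cell_simps(1)[OF f(1)]
      by (simp add: eFree_def)
  qed (use f emonad_1cell_simps(1,4)[OF f(1)] in simp_all)
  show "emonad_comp1 (emonad_one S) f = f" if f: "emonad_1cell f" "e1t f = S"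
  proof (rule emonad1_eqI)
    show "e1Ext (emonad_comp1 (emonad_one S) f) A = e1Ext f A" if A: "A \<in> Obj (eC (e1s f))" for A
      using A f e1Ext_comp1[of f "emonad_one S" A] ehat_obj_one[of S "e1Alg f A"] emonad_1cell_simps(2,6)[OF f(1)]
      by simp
  qed (use f emonad_1cell_simps(2,5)[OF f(1)] in simp_all)
qed

lemma emonad_comp1_assoc:
  assumes f: "emonad_1cell f" and g: "emonad_1cell g" and h: "emonad_1cell h" and c: "e1s g = e1t f" "e1s h = e1t g"
  shows "emonad_comp1 h (emonad_comp1 g f) = emonad_comp1 (emonad_comp1 h g) f"
proof (rule emonad1_eqI)
  fix A assume "A \<in> Obj (eC (e1s (emonad_comp1 (emonad_comp1 h g) f)))"
  then have A: "A \<in> Obj (eC (e1s f))" by simp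
  have gf: "emonad_1cell (emonad_comp1 g f)" and hg: "emonad_1cell (emonad_comp1 h g)" using f g h c by simp_all
  have "e1Alg (emonad_comp1 h (emonad_comp1 g f)) A = ehat_obj h (ehat_obj g (e1Alg f A))"
    using e1Alg_comp1[OF gf h] e1Alg_comp1[OF f g c(1) A] c A by simp
  also have "\<dots> = e1Alg (emonad_comp1 (emonad_comp1 h g) f) A"
    using e1Alg_comp1[OF f hg _ A] ehat_obj_comp1[OF g h c(2), of "e1Alg f A"] emonad_1cell_simps(6)[OF f A] c by simp
  finally show "e1Ext (emonad_comp1 h (emonad_comp1 g f)) A = e1Ext (emonad_comp1 (emonad_comp1 h g) f) A" by simp
qed (use f g h c in simp_all)

lemma emonad_2cell_simps [simp]:
  assumes "emonad_2cell \<theta>"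
  shows "emonad_1cell (e2s \<theta>)" "emonad_1cell (e2t \<theta>)"
    "e1s (e2t \<theta>) = e1s (e2s \<theta>)" "e1t (e2t \<theta>) = e1t (e2s \<theta>)"
    "nat_trans (e2a \<theta>)" "NSrc (e2a \<theta>) = e1P (e2s \<theta>)" "NTrg (e2a \<theta>) = e1P (e2t \<theta>)"
  using assms unfolding emonad_2cell_def nat_from_to_def by blast+

lemma emonad_2cell_hom:
  assumes t: "emonad_2cell \<theta>" and A: "A \<in> Obj (eC (e1s (e2s \<theta>)))"
  shows "ealg_hom (e1t (e2s \<theta>)) (e1Alg (e2s \<theta>) A) (NCmp (e2a \<theta>) (eS (e1s (e2s \<theta>)) A)) (e1Alg (e2t \<theta>) A)"
proof -
  have "e1s (e2t \<theta>) = e1s (e2s \<theta>)" using t by simp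
  then show ?thesis using assms unfolding emonad_2cell_def by metis
qed

lemma emonad_2cellI:
  assumes "emonad_1cell (e2s \<theta>)" "emonad_1cell (e2t \<theta>)"
    and s: "e1s (e2t \<theta>) = e1s (e2s \<theta>)" and "e1t (e2t \<theta>) = e1t (e2s \<theta>)"
    "nat_trans (e2a \<theta>)" "NSrc (e2a \<theta>) = e1P (e2s \<theta>)" "NTrg (e2a \<theta>) = e1P (e2t \<theta>)"
    and h: "\<And>A. A \<in> Obj (eC (e1s (e2s \<theta>))) \<Longrightarrow>
      ealg_hom (e1t (e2s \<theta>)) (e1Alg (e2s \<theta>) A) (NCmp (e2a \<theta>) (eS (e1s (e2s \<theta>)) A)) (e1Alg (e2t \<theta>) A)"
  shows "emonad_2cell \<theta>"
  unfolding emonad_2cell_def nat_from_to_def using assms(1-7) h[unfolded s] by blast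

text \<open>
  The retraction of \<open>P S N\<close> onto \<open>P N\<close> is compatible with \<open>\<theta>\<close>, by naturality at \<open>a = 1\<^sup>N\<close> and
  at \<open>\<eta>\<close>, and \<open>\<theta> S N\<close> is a homomorphism.
\<close>

lemma ehat_obj_2cell:
  assumes t: "emonad_2cell \<theta>" and N: "ealgebra (e1s (e2s \<theta>)) N"
  shows "ealg_hom (e1t (e2s \<theta>)) (ehat_obj (e2s \<theta>) N) (NCmp (e2a \<theta>) (fst N)) (ehat_obj (e2t \<theta>) N)"
proof -
  let ?f = "e2s \<theta>" and ?g = "e2t \<theta>" and ?S = "e1s (e2s \<theta>)" and ?T = "e1t (e2s \<theta>)" and ?N = "fst N"
  note S = t emonad_2cell_simps[OF t] emonad_1cell_simps[OF emonad_2cell_simps(2)[OF t]]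
  have N': "?N \<in> Obj (eC ?S)" using t N by simp
  let ?a = "snd N (Ide (eC ?S) ?N)"
  have aA: "?a \<in> Arr (eC ?S)" "Dom (eC ?S) ?a = eS ?S ?N" "Cod (eC ?S) ?a = ?N"
    using N S by simp_all
  have n: "NCmp (e2a \<theta>) ?N \<cdot>\<^bsub>eC ?T\<^esub> FArr (e1P ?f) ?a = FArr (e1P ?g) ?a \<cdot>\<^bsub>eC ?T\<^esub> NCmp (e2a \<theta>) (eS ?S ?N)"
    using naturality[of "e2a \<theta>" "eC ?T" ?a] S aA by simp
  have e: "NCmp (e2a \<theta>) (eS ?S ?N) \<cdot>\<^bsub>eC ?T\<^esub> FArr (e1P ?f) (eEta ?S ?N) = FArr (e1P ?g) (eEta ?S ?N) \<cdot>\<^bsub>eC ?T\<^esub> NCmp (e2a \<theta>) ?N"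
    using naturality[of "e2a \<theta>" "eC ?T" "eEta ?S ?N"] S N' by simp
  have h: "e1Ext ?g ?N (NCmp (e2a \<theta>) (eS ?S ?N) \<cdot>\<^bsub>eC ?T\<^esub> x) = NCmp (e2a \<theta>) (eS ?S ?N) \<cdot>\<^bsub>eC ?T\<^esub> e1Ext ?f ?N x"
    if "x \<in> Arr (eC ?T)" "Cod (eC ?T) x = FObj (e1P ?f) (eS ?S ?N)" for x
    using ealg_hom_simps(4)[OF emonad_2cell_hom[OF t N'], of x] that S by simp
  show ?thesis
  proof (rule ealg_homI)
    fix q assume "q \<in> Arr (eC ?T)" "Cod (eC ?T) q = fst (ehat_obj ?f N)"
    then have q: "q \<in> Arr (eC ?T)" "Cod (eC ?T) q = FObj (e1P ?f) ?N" by simp_all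
    have "snd (ehat_obj ?g N) (NCmp (e2a \<theta>) ?N \<cdot>\<^bsub>eC ?T\<^esub> q) =
        FArr (e1P ?g) ?a \<cdot>\<^bsub>eC ?T\<^esub> e1Ext ?g ?N (FArr (e1P ?g) (eEta ?S ?N) \<cdot>\<^bsub>eC ?T\<^esub> NCmp (e2a \<theta>) ?N \<cdot>\<^bsub>eC ?T\<^esub> q)"
      using q S N N' by simp
    also have "\<dots> = FArr (e1P ?g) ?a \<cdot>\<^bsub>eC ?T\<^esub> e1Ext ?g ?N (NCmp (e2a \<theta>) (eS ?S ?N) \<cdot>\<^bsub>eC ?T\<^esub> FArr (e1P ?f) (eEta ?S ?N) \<cdot>\<^bsub>eC ?T\<^esub> q)"
      using q S N N' by (simp add: Cmp_extend[OF e])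
    also have "\<dots> = FArr (e1P ?g) ?a \<cdot>\<^bsub>eC ?T\<^esub> NCmp (e2a \<theta>) (eS ?S ?N) \<cdot>\<^bsub>eC ?T\<^esub> e1Ext ?f ?N (FArr (e1P ?f) (eEta ?S ?N) \<cdot>\<^bsub>eC ?T\<^esub> q)"
      using q S N N' by (simp add: h)
    also have "\<dots> = NCmp (e2a \<theta>) ?N \<cdot>\<^bsub>eC ?T\<^esub> snd (ehat_obj ?f N) q"
      using q S N N' aA by (simp add: Cmp_extend[OF n])
    finally show "snd (ehat_obj ?g N) (NCmp (e2a \<theta>) ?N \<cdot>\<^bsub>eC ?T\<^esub> q) = NCmp (e2a \<theta>) ?N \<cdot>\<^bsub>eC ?T\<^esub> snd (ehat_obj ?f N) q" .
  qed (use S N in simp_all)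
qed

lemma EMnd_simps [simp]:
  "Cell0 EMnd = {U. extensive_monad U}" "src EMnd = e1s" "trg EMnd = e1t" "one EMnd = emonad_one"
  "comp1 EMnd = emonad_comp1"
  "\<kappa> \<diamondop>\<^bsub>EMnd\<^esub> \<theta> = \<lparr>e2s = emonad_comp1 (e2s \<kappa>) (e2s \<theta>), e2t = emonad_comp1 (e2t \<kappa>) (e2t \<theta>), e2a = e2a \<kappa> \<star>\<^sub>h e2a \<theta>\<rparr>"
  "Vert EMnd = mk_category {f. emonad_1cell f} {\<theta>. emonad_2cell \<theta>} e2s e2t
      (\<lambda>f. \<lparr>e2s = f, e2t = f, e2a = id_nat (e1P f)\<rparr>)
      (\<lambda>\<kappa> \<theta>. \<lparr>e2s = e2s \<theta>, e2t = e2t \<kappa>, e2a = e2a \<kappa> \<circ>\<^sub>V e2a \<theta>\<rparr>)"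
  by (simp_all add: EMnd_def)

lemma emonad_2cell_vcomp:
  assumes t: "emonad_2cell \<theta>" and k: "emonad_2cell \<kappa>" and c: "e2s \<kappa> = e2t \<theta>"
  shows "emonad_2cell \<lparr>e2s = e2s \<theta>, e2t = e2t \<kappa>, e2a = e2a \<kappa> \<circ>\<^sub>V e2a \<theta>\<rparr>" (is "emonad_2cell ?x")
proof (rule emonad_2cellI)
  note S = t k c emonad_2cell_simps[OF t] emonad_2cell_simps(1-4)[OF k]
  fix A assume "A \<in> Obj (eC (e1s (e2s ?x)))"
  then have A: "A \<in> Obj (eC (e1s (e2s \<theta>)))" by simp
  have "ealg_hom (e1t (e2s \<theta>)) (e1Alg (e2t \<theta>) A) (NCmp (e2a \<kappa>) (eS (e1s (e2s \<theta>)) A)) (e1Alg (e2t \<kappa>) A)"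
    using emonad_2cell_hom[OF k, of A] S A by simp
  from ealg_hom_comp[OF _ _ emonad_2cell_hom[OF t A] this] S A emonad_1cell_simps(2,6)[OF emonad_2cell_simps(1)[OF t]]
  show "ealg_hom (e1t (e2s ?x)) (e1Alg (e2s ?x) A) (NCmp (e2a ?x) (eS (e1s (e2s ?x)) A)) (e1Alg (e2t ?x) A)"
    by simp
qed (use t k c emonad_2cell_simps[OF t] emonad_2cell_simps(1-4)[OF k] in simp_all)

text \<open>
  A component of the horizontal composite is the image of a homomorphism under the action of a
  1-cell, followed by a component of \<open>\<kappa>\<close> at an algebra.
\<close>

lemma emonad_2cell_hcomp:
  assumes t: "emonad_2cell \<theta>" and k: "emonad_2cell \<kappa>" and c: "e1s (e2s \<kappa>) = e1t (e2s \<theta>)"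
  shows "emonad_2cell (\<kappa> \<diamondop>\<^bsub>EMnd\<^esub> \<theta>)"
proof (rule emonad_2cellI)
  note S = t k c emonad_2cell_simps[OF t] emonad_2cell_simps[OF k]
    emonad_1cell_simps(3-5)[OF emonad_2cell_simps(2)[OF t]] emonad_1cell_simps(3-5)[OF emonad_2cell_simps(2)[OF k]]
  fix A assume "A \<in> Obj (eC (e1s (e2s (\<kappa> \<diamondop>\<^bsub>EMnd\<^esub> \<theta>))))"
  then have A: "A \<in> Obj (eC (e1s (e2s \<theta>)))" by simp
  let ?g = "e2s \<kappa>" and ?g' = "e2t \<kappa>" and ?f = "e2s \<theta>" and ?f' = "e2t \<theta>" and ?SA = "eS (e1s (e2s \<theta>)) A"
  have al: "ealgebra (e1s ?g) (e1Alg ?f A)" "ealgebra (e1s ?g) (e1Alg ?f' A)"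
    using emonad_1cell_simps(6)[OF emonad_2cell_simps(1)[OF t], of A] emonad_1cell_simps(6)[OF emonad_2cell_simps(2)[OF t], of A] S A by simp_all
  have "ealg_hom (e1t ?g) (ehat_obj ?g (e1Alg ?f A)) (FArr (e1P ?g) (NCmp (e2a \<theta>) ?SA)) (ehat_obj ?g (e1Alg ?f' A))"
    by (rule ehat_obj_hom) (use S A al emonad_2cell_hom[OF t A] in simp_all)
  moreover have "ealg_hom (e1t ?g) (ehat_obj ?g (e1Alg ?f' A)) (NCmp (e2a \<kappa>) (FObj (e1P ?f') ?SA)) (ehat_obj ?g' (e1Alg ?f' A))"
    using ehat_obj_2cell[OF k al(2)] S by simp
  ultimately have "ealg_hom (e1t ?g) (ehat_obj ?g (e1Alg ?f A))
      (NCmp (e2a \<kappa>) (FObj (e1P ?f') ?SA) \<cdot>\<^bsub>eC (e1t ?g)\<^esub> FArr (e1P ?g) (NCmp (e2a \<theta>) ?SA)) (ehat_obj ?g' (e1Alg ?f' A))"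
    using S al by (intro ealg_hom_comp) simp_all
  moreover have "e1Alg (emonad_comp1 ?g ?f) A = ehat_obj ?g (e1Alg ?f A)"
    by (rule e1Alg_comp1) (use S A in simp_all)
  moreover have "e1Alg (emonad_comp1 ?g' ?f') A = ehat_obj ?g' (e1Alg ?f' A)"
    by (rule e1Alg_comp1) (use S A in simp_all)
  ultimately show "ealg_hom (e1t (e2s (\<kappa> \<diamondop>\<^bsub>EMnd\<^esub> \<theta>))) (e1Alg (e2s (\<kappa> \<diamondop>\<^bsub>EMnd\<^esub> \<theta>)) A)
      (NCmp (e2a (\<kappa> \<diamondop>\<^bsub>EMnd\<^esub> \<theta>)) (eS (e1s (e2s (\<kappa> \<diamondop>\<^bsub>EMnd\<^esub> \<theta>))) A)) (e1Alg (e2t (\<kappa> \<diamondop>\<^bsub>EMnd\<^esub> \<theta>)) A)"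
    using S A by simp
qed (use t k c emonad_2cell_simps[OF t] emonad_2cell_simps[OF k]
    emonad_1cell_simps(3-5)[OF emonad_2cell_simps(2)[OF t]] emonad_1cell_simps(3-5)[OF emonad_2cell_simps(2)[OF k]] in simp_all)

lemma emonad_2cell_ide [simp]:
  assumes f: "emonad_1cell f"
  shows "emonad_2cell \<lparr>e2s = f, e2t = f, e2a = id_nat (e1P f)\<rparr>"
proof (rule emonad_2cellI)
  fix A assume "A \<in> Obj (eC (e1s (e2s \<lparr>e2s = f, e2t = f, e2a = id_nat (e1P f)\<rparr>)))"
  then show "ealg_hom (e1t (e2s \<lparr>e2s = f, e2t = f, e2a = id_nat (e1P f)\<rparr>))
      (e1Alg (e2s \<lparr>e2s = f, e2t = f, e2a = id_nat (e1P f)\<rparr>) A)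
      (NCmp (e2a \<lparr>e2s = f, e2t = f, e2a = id_nat (e1P f)\<rparr>) (eS (e1s (e2s \<lparr>e2s = f, e2t = f, e2a = id_nat (e1P f)\<rparr>)) A))
      (e1Alg (e2t \<lparr>e2s = f, e2t = f, e2a = id_nat (e1P f)\<rparr>) A)"
    using f ealg_hom_ide[of "e1t f" "e1Alg f A"] by simp
qed (use f in simp_all)

lemma two_category_EMnd: "two_category EMnd"
proof (rule two_category.intro)
  show "category (Vert EMnd)"
    unfolding EMnd_simps
    by (rule category_mk_category) (auto simp: emonad_2cell_vcomp intro!: emonad2.equality)
  fix \<theta> \<theta>' \<kappa> \<kappa>' :: "('o, 'm) emonad2" and f f' f'' g g' g'' :: "('o, 'm) emonad1"
  assume "\<theta> \<in> Hom (Vert EMnd) f f'" "\<theta>' \<in> Hom (Vert EMnd) f' f''" "\<kappa> \<in> Hom (Vert EMnd) g g'"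
    "\<kappa>' \<in> Hom (Vert EMnd) g' g''" "src EMnd g = trg EMnd f"
  then show "(\<kappa>' \<cdot>\<^bsub>Vert EMnd\<^esub> \<kappa>) \<diamondop>\<^bsub>EMnd\<^esub> (\<theta>' \<cdot>\<^bsub>Vert EMnd\<^esub> \<theta>) = (\<kappa>' \<diamondop>\<^bsub>EMnd\<^esub> \<theta>') \<cdot>\<^bsub>Vert EMnd\<^esub> (\<kappa> \<diamondop>\<^bsub>EMnd\<^esub> \<theta>)"
    using emonad_2cell_hcomp[of \<theta> \<kappa>] emonad_2cell_hcomp[of \<theta>' \<kappa>']
    by (auto simp: emonad_2cell_vcomp hcomp_interchange)
qed (use emonad_2cell_hcomp in \<open>auto simp: emonad_comp1_one emonad_comp1_assoc hcomp_assoc intro!: emonad2.equality\<close>)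

section \<open>Extensive monads are classical monads\<close>

text \<open>
  The laws directed towards a single extension. Equations between composites of extensions are
  decided in this normal form, which is opposite to that of the simplification rules above.
\<close>

lemma eExt_fuse:
  assumes "extensive_monad S" "D \<in> Obj (eC S)" "k \<in> Arr (eC S)" "Cod (eC S) k = eS S D"
    "h \<in> Arr (eC S)" "Cod (eC S) h = eS S B" "Dom (eC S) k = B"
  shows "eExt S D k \<cdot>\<^bsub>eC S\<^esub> eExt S B h = eExt S D (eExt S D k \<cdot>\<^bsub>eC S\<^esub> h)"
  using assms by simp

lemma e1Ext_fuse:
  assumes "emonad_1cell f" "A \<in> Obj (eC (e1s f))" "p \<in> Arr (eC (e1t f))"
    "Cod (eC (e1t f)) p = FObj (e1P f) (eS (e1s f) A)"
    "h \<in> Arr (eC (e1t f))" "Cod (eC (e1t f)) h = eS (e1t f) B" "Dom (eC (e1t f)) p = B"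
  shows "e1Ext f A p \<cdot>\<^bsub>eC (e1t f)\<^esub> eExt (e1t f) B h = e1Ext f A (e1Ext f A p \<cdot>\<^bsub>eC (e1t f)\<^esub> h)"
  using assms by simp

lemma e1Ext_hom_fuse:
  assumes "emonad_1cell f" "B \<in> Obj (eC (e1s f))" "h \<in> Arr (eC (e1s f))" "Cod (eC (e1s f)) h = eS (e1s f) B"
    "p \<in> Arr (eC (e1t f))" "Cod (eC (e1t f)) p = FObj (e1P f) (eS (e1s f) A)" "Dom (eC (e1s f)) h = A"
  shows "FArr (e1P f) (eExt (e1s f) B h) \<cdot>\<^bsub>eC (e1t f)\<^esub> e1Ext f A p =
    e1Ext f B (FArr (e1P f) (eExt (e1s f) B h) \<cdot>\<^bsub>eC (e1t f)\<^esub> p)"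
  using assms by simp

lemma eExt_eta_extend [simp]:
  assumes "extensive_monad S" "B \<in> Obj (eC S)" "h \<in> Arr (eC S)" "Cod (eC S) h = eS S B"
    "A = Dom (eC S) h" "x \<in> Arr (eC S)" "Cod (eC S) x = A"
  shows "eExt S B h \<cdot>\<^bsub>eC S\<^esub> eEta S A \<cdot>\<^bsub>eC S\<^esub> x = h \<cdot>\<^bsub>eC S\<^esub> x"
  using ealgebra_eta_extend[OF assms(1) ealgebra_eFree[OF assms(1,2)], of h A x] assms by simp

lemma e1P_ext_eta:
  assumes "emonad_1cell f" "B \<in> Obj (eC (e1s f))" "h \<in> Arr (eC (e1s f))" "Cod (eC (e1s f)) h = eS (e1s f) B"
    "A = Dom (eC (e1s f)) h"
  shows "FArr (e1P f) (eExt (e1s f) B h) \<cdot>\<^bsub>eC (e1t f)\<^esub> FArr (e1P f) (eEta (e1s f) A) = FArr (e1P f) h"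
proof -
  have "Dom (eC (e1s f)) h \<in> Obj (eC (e1s f))" using assms by simp
  then show ?thesis
    using assms FArr_equation[OF eExt_simps(4)[OF emonad_1cell_simps(1)[OF assms(1)] assms(2-4) refl], of "e1P f" "eC (e1t f)"]
    by simp
qed

lemma classical_monad_simps [simp]:
  assumes "classical_monad M"
  shows "cat_functor (mS M)" "FCod (mS M) = mC M"
    "nat_trans (mEta M)" "NSrc (mEta M) = id_functor (mC M)" "NTrg (mEta M) = mS M"
    "nat_trans (mMu M)" "NSrc (mMu M) = mS M \<circ>\<^sub>F mS M" "NTrg (mMu M) = mS M"
  using assms unfolding classical_monad_def functor_from_to_def nat_from_to_def by blast+

lemma classical_monad_laws:
  assumes M: "classical_monad M" and A: "A \<in> Obj (mC M)"
  shows "NCmp (mMu M) A \<cdot>\<^bsub>mC M\<^esub> FArr (mS M) (NCmp (mMu M) A) = NCmp (mMu M) A \<cdot>\<^bsub>mC M\<^esub> NCmp (mMu M) (FObj (mS M) A)"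
    "NCmp (mMu M) A \<cdot>\<^bsub>mC M\<^esub> FArr (mS M) (NCmp (mEta M) A) = Ide (mC M) (FObj (mS M) A)"
    "NCmp (mMu M) A \<cdot>\<^bsub>mC M\<^esub> NCmp (mEta M) (FObj (mS M) A) = Ide (mC M) (FObj (mS M) A)"
proof -
  have l: "mMu M \<circ>\<^sub>V (mS M \<star>\<^sub>l mMu M) = mMu M \<circ>\<^sub>V (mMu M \<star>\<^sub>r mS M)"
    "mMu M \<circ>\<^sub>V (mS M \<star>\<^sub>l mEta M) = id_nat (mS M)" "mMu M \<circ>\<^sub>V (mEta M \<star>\<^sub>r mS M) = id_nat (mS M)"
    using M unfolding classical_monad_def by blast+
  show "NCmp (mMu M) A \<cdot>\<^bsub>mC M\<^esub> FArr (mS M) (NCmp (mMu M) A) = NCmp (mMu M) A \<cdot>\<^bsub>mC M\<^esub> NCmp (mMu M) (FObj (mS M) A)"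
    using arg_cong[OF l(1), of "\<lambda>\<alpha>. NCmp \<alpha> A"] M A by simp
  show "NCmp (mMu M) A \<cdot>\<^bsub>mC M\<^esub> FArr (mS M) (NCmp (mEta M) A) = Ide (mC M) (FObj (mS M) A)"
    using arg_cong[OF l(2), of "\<lambda>\<alpha>. NCmp \<alpha> A"] M A by simp
  show "NCmp (mMu M) A \<cdot>\<^bsub>mC M\<^esub> NCmp (mEta M) (FObj (mS M) A) = Ide (mC M) (FObj (mS M) A)"
    using arg_cong[OF l(3), of "\<lambda>\<alpha>. NCmp \<alpha> A"] M A by simp
qed

lemma classical_monad_natural:
  assumes M: "classical_monad M" and f: "f \<in> Arr (mC M)" "Dom (mC M) f = A" "Cod (mC M) f = B"
  shows "NCmp (mMu M) B \<cdot>\<^bsub>mC M\<^esub> FArr (mS M) (FArr (mS M) f) = FArr (mS M) f \<cdot>\<^bsub>mC M\<^esub> NCmp (mMu M) A"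
    "NCmp (mEta M) B \<cdot>\<^bsub>mC M\<^esub> f = FArr (mS M) f \<cdot>\<^bsub>mC M\<^esub> NCmp (mEta M) A"
  using naturality[of "mMu M" "mC M" f] naturality[of "mEta M" "mC M" f] assms by simp_all

lemma classical_monadI:
  assumes "cat_functor (mS M)" "FCod (mS M) = mC M"
    "nat_trans (mEta M)" "NSrc (mEta M) = id_functor (mC M)" "NTrg (mEta M) = mS M"
    "nat_trans (mMu M)" "NSrc (mMu M) = mS M \<circ>\<^sub>F mS M" "NTrg (mMu M) = mS M"
    and l: "\<And>A. A \<in> Obj (mC M) \<Longrightarrow> NCmp (mMu M) A \<cdot>\<^bsub>mC M\<^esub> FArr (mS M) (NCmp (mMu M) A) = NCmp (mMu M) A \<cdot>\<^bsub>mC M\<^esub> NCmp (mMu M) (FObj (mS M) A)"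
    "\<And>A. A \<in> Obj (mC M) \<Longrightarrow> NCmp (mMu M) A \<cdot>\<^bsub>mC M\<^esub> FArr (mS M) (NCmp (mEta M) A) = Ide (mC M) (FObj (mS M) A)"
    "\<And>A. A \<in> Obj (mC M) \<Longrightarrow> NCmp (mMu M) A \<cdot>\<^bsub>mC M\<^esub> NCmp (mEta M) (FObj (mS M) A) = Ide (mC M) (FObj (mS M) A)"
  shows "classical_monad M"
proof -
  have "mMu M \<circ>\<^sub>V (mS M \<star>\<^sub>l mMu M) = mMu M \<circ>\<^sub>V (mMu M \<star>\<^sub>r mS M)"
    by (rule ntrans_eqI) (use assms(1-8) in \<open>simp_all add: l(1)\<close>)
  moreover have "mMu M \<circ>\<^sub>V (mS M \<star>\<^sub>l mEta M) = id_nat (mS M)"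
    by (rule ntrans_eqI) (use assms(1-8) in \<open>simp_all add: l(2)\<close>)
  moreover have "mMu M \<circ>\<^sub>V (mEta M \<star>\<^sub>r mS M) = id_nat (mS M)"
    by (rule ntrans_eqI) (use assms(1-8) in \<open>simp_all add: l(3)\<close>)
  ultimately show ?thesis unfolding classical_monad_def functor_from_to_def nat_from_to_def using assms(1-8) by blast
qed

lemma H_0_simps [simp]:
  "mC (H_0 S) = eC S" "FCod (mS (H_0 S)) = eC S" "FObj (mS (H_0 S)) = eS S"
  "f \<in> Arr (eC S) \<Longrightarrow> Cod (eC S) f = B \<Longrightarrow> FArr (mS (H_0 S)) f = eExt S B (eEta S B \<cdot>\<^bsub>eC S\<^esub> f)"
  "NSrc (mEta (H_0 S)) = id_functor (eC S)" "NTrg (mEta (H_0 S)) = mS (H_0 S)" "NCmp (mEta (H_0 S)) = eEta S"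
  "NSrc (mMu (H_0 S)) = mS (H_0 S) \<circ>\<^sub>F mS (H_0 S)" "NTrg (mMu (H_0 S)) = mS (H_0 S)"
  "A \<in> Obj (eC S) \<Longrightarrow> NCmp (mMu (H_0 S)) A = eExt S A (Ide (eC S) (eS S A))"
  by (simp_all add: H_0_def Let_def)

lemma classical_monad_H_0 [simp]:
  assumes S: "extensive_monad S"
  shows "classical_monad (H_0 S)"
proof (rule classical_monadI)
  show T: "cat_functor (mS (H_0 S))"
  proof (rule cat_functorI)
    show "FArr (mS (H_0 S)) \<in> extensional (Arr (mC (H_0 S)))" by (simp add: H_0_def Let_def)
    show "FObj (mS (H_0 S)) \<in> extensional (Obj (mC (H_0 S)))" using extensive_monad_ext(1)[OF S] by simp
  qed (use S in \<open>simp_all add: eExt_fuse del: eExt_eExt\<close>)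
  show "nat_trans (mEta (H_0 S))"
  proof (rule nat_transI)
    show "NCmp (mEta (H_0 S)) \<in> extensional (Obj (FDom (NSrc (mEta (H_0 S)))))"
      using extensive_monad_ext(2)[OF S] by simp
  qed (use S T in simp_all)
  show "nat_trans (mMu (H_0 S))"
  proof (rule nat_transI)
    show "NCmp (mMu (H_0 S)) \<in> extensional (Obj (FDom (NSrc (mMu (H_0 S)))))"
      by (simp add: H_0_def Let_def)
  qed (use S T in \<open>simp_all add: eExt_fuse del: eExt_eExt\<close>)
qed (use S in \<open>simp_all add: eExt_fuse del: eExt_eExt\<close>)

lemma K_0_simps [simp]:
  "eC (K_0 M) = mC M" "eS (K_0 M) = FObj (mS M)" "eEta (K_0 M) = NCmp (mEta M)"
  "B \<in> Obj (mC M) \<Longrightarrow> h \<in> Arr (mC M) \<Longrightarrow> Cod (mC M) h = FObj (mS M) B \<Longrightarrow>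
    eExt (K_0 M) B h = NCmp (mMu M) B \<cdot>\<^bsub>mC M\<^esub> FArr (mS M) h"
  by (simp_all add: K_0_def)

lemma extensive_monad_K_0 [simp]:
  assumes M: "classical_monad M"
  shows "extensive_monad (K_0 M)"
proof (rule extensive_monadI)
  have c: "category (mC M)" using M by simp
  then show "category (eC (K_0 M))" by simp
  show "eS (K_0 M) \<in> extensional (Obj (eC (K_0 M)))" using FObj_ext[of "mS M"] M by simp
  show "eEta (K_0 M) \<in> extensional (Obj (eC (K_0 M)))" using NCmp_ext[of "mEta M"] M by simp
  show "eExt (K_0 M) \<in> extensional (Obj (eC (K_0 M)))" by (simp add: K_0_def)
  show "eExt (K_0 M) A \<in> extensional (Into (eC (K_0 M)) (eS (K_0 M) A))" if "A \<in> Obj (eC (K_0 M))" for A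
    using that by (simp add: K_0_def)
  show "eExt (K_0 M) B h \<cdot>\<^bsub>eC (K_0 M)\<^esub> eEta (K_0 M) (Dom (eC (K_0 M)) h) = h"
    if "B \<in> Obj (eC (K_0 M))" "h \<in> Arr (eC (K_0 M))" "Cod (eC (K_0 M)) h = eS (K_0 M) B" for B h
    using that M c classical_monad_natural(2)[OF M, of h, symmetric]
    by (simp add: Cmp_extend[OF classical_monad_laws(3)[OF M]])
  show "eExt (K_0 M) D (eExt (K_0 M) D k \<cdot>\<^bsub>eC (K_0 M)\<^esub> h) = eExt (K_0 M) D k \<cdot>\<^bsub>eC (K_0 M)\<^esub> eExt (K_0 M) (Dom (eC (K_0 M)) k) h"
    if "D \<in> Obj (eC (K_0 M))" "h \<in> Arr (eC (K_0 M))" "k \<in> Arr (eC (K_0 M))"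
      "Cod (eC (K_0 M)) h = eS (K_0 M) (Dom (eC (K_0 M)) k)" "Cod (eC (K_0 M)) k = eS (K_0 M) D" for D h k
    using that M c classical_monad_natural(1)[OF M, of k "Dom (mC M) k" "FObj (mS M) D"]
    by (simp add: Cmp_extend[OF classical_monad_laws(1)[OF M]] Cmp_extend[OF classical_monad_natural(1)[OF M]])
  show "eExt (K_0 M) A (eEta (K_0 M) A) = Ide (eC (K_0 M)) (eS (K_0 M) A)" if "A \<in> Obj (eC (K_0 M))" for A
    using that M by (simp add: classical_monad_laws)
qed (use M in simp_all)

lemma K_0_H_0 [simp]:
  assumes S: "extensive_monad S"
  shows "K_0 (H_0 S) = S"
proof -
  have "eExt (K_0 (H_0 S)) = eExt S"
  proof (rule extensionalityI[OF _ extensive_monad_ext(3)[OF S]])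
    show "eExt (K_0 (H_0 S)) \<in> extensional (Obj (eC S))" by (simp add: K_0_def)
    show "eExt (K_0 (H_0 S)) B = eExt S B" if B: "B \<in> Obj (eC S)" for B
    proof (rule extensionalityI[OF _ extensive_monad_ext(4)[OF S B]])
      show "eExt (K_0 (H_0 S)) B \<in> extensional (Into (eC S) (eS S B))" using B by (simp add: K_0_def)
      show "eExt (K_0 (H_0 S)) B h = eExt S B h" if "h \<in> Into (eC S) (eS S B)" for h
        using that B S by (simp add: eExt_fuse del: eExt_eExt)
    qed
  qed
  then show ?thesis by (intro emonad.equality) simp_all
qed

lemma H_0_K_0 [simp]:
  assumes M: "classical_monad M"
  shows "H_0 (K_0 M) = M"
proof -
  have T: "mS (H_0 (K_0 M)) = mS M"
    by (rule functor_eqI) (use M classical_monad_simps(1)[OF classical_monad_H_0[OF extensive_monad_K_0[OF M]]] in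
        \<open>simp_all add: Cmp_extend[OF classical_monad_laws(2)[OF M]]\<close>)
  have "mEta (H_0 (K_0 M)) = mEta M" by (rule ntrans.equality) (use M T in simp_all)
  moreover have "mMu (H_0 (K_0 M)) = mMu M"
    by (rule ntrans_eqI) (use M T classical_monad_simps(6)[OF classical_monad_H_0[OF extensive_monad_K_0[OF M]]] in simp_all)
  ultimately show ?thesis using T by (intro cmonad.equality) simp_all
qed

lemma cmonad_1cell_simps [simp]:
  assumes "cmonad_1cell f"
  shows "classical_monad (m1s f)" "classical_monad (m1t f)"
    "cat_functor (m1P f)" "FDom (m1P f) = mC (m1s f)" "FCod (m1P f) = mC (m1t f)"
    "nat_trans (m1phi f)" "NSrc (m1phi f) = mS (m1t f) \<circ>\<^sub>F m1P f" "NTrg (m1phi f) = m1P f \<circ>\<^sub>F mS (m1s f)"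
  using assms unfolding cmonad_1cell_def functor_from_to_def nat_from_to_def by blast+

lemma cmonad_1cell_laws:
  assumes f: "cmonad_1cell f" and A: "A \<in> Obj (mC (m1s f))"
  shows "NCmp (m1phi f) A \<cdot>\<^bsub>mC (m1t f)\<^esub> NCmp (mEta (m1t f)) (FObj (m1P f) A) = FArr (m1P f) (NCmp (mEta (m1s f)) A)"
    "NCmp (m1phi f) A \<cdot>\<^bsub>mC (m1t f)\<^esub> NCmp (mMu (m1t f)) (FObj (m1P f) A) =
      FArr (m1P f) (NCmp (mMu (m1s f)) A) \<cdot>\<^bsub>mC (m1t f)\<^esub> NCmp (m1phi f) (FObj (mS (m1s f)) A) \<cdot>\<^bsub>mC (m1t f)\<^esub>
      FArr (mS (m1t f)) (NCmp (m1phi f) A)"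
proof -
  have l: "m1phi f \<circ>\<^sub>V (mEta (m1t f) \<star>\<^sub>r m1P f) = m1P f \<star>\<^sub>l mEta (m1s f)"
    "m1phi f \<circ>\<^sub>V (mMu (m1t f) \<star>\<^sub>r m1P f) =
      (m1P f \<star>\<^sub>l mMu (m1s f)) \<circ>\<^sub>V (m1phi f \<star>\<^sub>r mS (m1s f)) \<circ>\<^sub>V (mS (m1t f) \<star>\<^sub>l m1phi f)"
    using f unfolding cmonad_1cell_def by blast+
  show "NCmp (m1phi f) A \<cdot>\<^bsub>mC (m1t f)\<^esub> NCmp (mEta (m1t f)) (FObj (m1P f) A) = FArr (m1P f) (NCmp (mEta (m1s f)) A)"
    using arg_cong[OF l(1), of "\<lambda>\<alpha>. NCmp \<alpha> A"] f A by simp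
  show "NCmp (m1phi f) A \<cdot>\<^bsub>mC (m1t f)\<^esub> NCmp (mMu (m1t f)) (FObj (m1P f) A) =
      FArr (m1P f) (NCmp (mMu (m1s f)) A) \<cdot>\<^bsub>mC (m1t f)\<^esub> NCmp (m1phi f) (FObj (mS (m1s f)) A) \<cdot>\<^bsub>mC (m1t f)\<^esub>
      FArr (mS (m1t f)) (NCmp (m1phi f) A)"
    using arg_cong[OF l(2), of "\<lambda>\<alpha>. NCmp \<alpha> A"] f A by simp
qed

lemma m1phi_natural:
  assumes "cmonad_1cell f" "h \<in> Arr (mC (m1s f))" "Dom (mC (m1s f)) h = A" "Cod (mC (m1s f)) h = B"
  shows "NCmp (m1phi f) B \<cdot>\<^bsub>mC (m1t f)\<^esub> FArr (mS (m1t f)) (FArr (m1P f) h) =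
    FArr (m1P f) (FArr (mS (m1s f)) h) \<cdot>\<^bsub>mC (m1t f)\<^esub> NCmp (m1phi f) A"
  using naturality[of "m1phi f" "mC (m1t f)" h] assms by simp

lemma cmonad_1cellI:
  assumes "classical_monad (m1s f)" "classical_monad (m1t f)"
    "cat_functor (m1P f)" "FDom (m1P f) = mC (m1s f)" "FCod (m1P f) = mC (m1t f)"
    "nat_trans (m1phi f)" "NSrc (m1phi f) = mS (m1t f) \<circ>\<^sub>F m1P f" "NTrg (m1phi f) = m1P f \<circ>\<^sub>F mS (m1s f)"
    and l: "\<And>A. A \<in> Obj (mC (m1s f)) \<Longrightarrow>
      NCmp (m1phi f) A \<cdot>\<^bsub>mC (m1t f)\<^esub> NCmp (mEta (m1t f)) (FObj (m1P f) A) = FArr (m1P f) (NCmp (mEta (m1s f)) A)"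
    "\<And>A. A \<in> Obj (mC (m1s f)) \<Longrightarrow> NCmp (m1phi f) A \<cdot>\<^bsub>mC (m1t f)\<^esub> NCmp (mMu (m1t f)) (FObj (m1P f) A) =
      FArr (m1P f) (NCmp (mMu (m1s f)) A) \<cdot>\<^bsub>mC (m1t f)\<^esub> NCmp (m1phi f) (FObj (mS (m1s f)) A) \<cdot>\<^bsub>mC (m1t f)\<^esub>
      FArr (mS (m1t f)) (NCmp (m1phi f) A)"
  shows "cmonad_1cell f"
proof -
  have "m1phi f \<circ>\<^sub>V (mEta (m1t f) \<star>\<^sub>r m1P f) = m1P f \<star>\<^sub>l mEta (m1s f)"
    by (rule ntrans_eqI) (use assms(1-8) in \<open>simp_all add: l(1)\<close>)
  moreover have "m1phi f \<circ>\<^sub>V (mMu (m1t f) \<star>\<^sub>r m1P f) =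
      (m1P f \<star>\<^sub>l mMu (m1s f)) \<circ>\<^sub>V (m1phi f \<star>\<^sub>r mS (m1s f)) \<circ>\<^sub>V (mS (m1t f) \<star>\<^sub>l m1phi f)"
    by (rule ntrans_eqI) (use assms(1-8) in \<open>simp_all add: l(2)\<close>)
  ultimately show ?thesis
    unfolding cmonad_1cell_def functor_from_to_def nat_from_to_def using assms(1-8) by blast
qed

lemma H_1_simps [simp]:
  "m1s (H_1 f) = H_0 (e1s f)" "m1t (H_1 f) = H_0 (e1t f)" "m1P (H_1 f) = e1P f"
  "NSrc (m1phi (H_1 f)) = mS (H_0 (e1t f)) \<circ>\<^sub>F e1P f" "NTrg (m1phi (H_1 f)) = e1P f \<circ>\<^sub>F mS (H_0 (e1s f))"
  "A \<in> Obj (eC (e1s f)) \<Longrightarrow> NCmp (m1phi (H_1 f)) A = e1Ext f A (FArr (e1P f) (eEta (e1s f) A))"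
  by (simp_all add: H_1_def)

lemma cmonad_1cell_H_1 [simp]:
  assumes f: "emonad_1cell f"
  shows "cmonad_1cell (H_1 f)"
proof (rule cmonad_1cellI)
  let ?P = "e1P f" and ?S = "e1s f" and ?T = "e1t f"
  note fuse = eExt_fuse e1Ext_fuse e1Ext_hom_fuse
  note S = f emonad_1cell_simps[OF f] classical_monad_H_0[OF emonad_1cell_simps(1)[OF f]]
    classical_monad_H_0[OF emonad_1cell_simps(2)[OF f]]
  show "nat_trans (m1phi (H_1 f))"
  proof (rule nat_transI)
    show "NCmp (m1phi (H_1 f)) \<in> extensional (Obj (FDom (NSrc (m1phi (H_1 f)))))"
      using f by (simp add: H_1_def)
    fix h assume "h \<in> Arr (FDom (NSrc (m1phi (H_1 f))))"
    then have h: "h \<in> Arr (eC ?S)" using f by simp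
    show "NCmp (m1phi (H_1 f)) (Cod (FDom (NSrc (m1phi (H_1 f)))) h) \<cdot>\<^bsub>FCod (NSrc (m1phi (H_1 f)))\<^esub> FArr (NSrc (m1phi (H_1 f))) h =
      FArr (NTrg (m1phi (H_1 f))) h \<cdot>\<^bsub>FCod (NSrc (m1phi (H_1 f)))\<^esub> NCmp (m1phi (H_1 f)) (Dom (FDom (NSrc (m1phi (H_1 f)))) h)"
      using h S by (simp add: fuse e1P_eta_natural[OF f h] del: e1Ext_hom e1Ext_simps(5))
  qed (use S in simp_all)
  fix A assume "A \<in> Obj (mC (m1s (H_1 f)))"
  then have A: "A \<in> Obj (eC ?S)" by simp
  show "NCmp (m1phi (H_1 f)) A \<cdot>\<^bsub>mC (m1t (H_1 f))\<^esub> NCmp (mEta (m1t (H_1 f))) (FObj (m1P (H_1 f)) A) =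
      FArr (m1P (H_1 f)) (NCmp (mEta (m1s (H_1 f))) A)"
    using A S by simp
  have u: "FArr ?P (eExt ?S A (Ide (eC ?S) (eS ?S A))) \<cdot>\<^bsub>eC ?T\<^esub> FArr ?P (eEta ?S (eS ?S A)) = Ide (eC ?T) (FObj ?P (eS ?S A))"
    using e1P_ext_eta[OF f A, of "Ide (eC ?S) (eS ?S A)" "eS ?S A"] A S by simp
  show "NCmp (m1phi (H_1 f)) A \<cdot>\<^bsub>mC (m1t (H_1 f))\<^esub> NCmp (mMu (m1t (H_1 f))) (FObj (m1P (H_1 f)) A) =
      FArr (m1P (H_1 f)) (NCmp (mMu (m1s (H_1 f))) A) \<cdot>\<^bsub>mC (m1t (H_1 f))\<^esub> NCmp (m1phi (H_1 f)) (FObj (mS (m1s (H_1 f))) A) \<cdot>\<^bsub>mC (m1t (H_1 f))\<^esub>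
      FArr (mS (m1t (H_1 f))) (NCmp (m1phi (H_1 f)) A)"
    using A S by (simp add: fuse Cmp_extend[OF u] del: e1Ext_hom e1Ext_simps(5) eExt_eExt)
qed (use f in simp_all)

lemma K_1_simps [simp]:
  "e1s (K_1 f) = K_0 (m1s f)" "e1t (K_1 f) = K_0 (m1t f)" "e1P (K_1 f) = m1P f"
  "A \<in> Obj (mC (m1s f)) \<Longrightarrow> r \<in> Arr (mC (m1t f)) \<Longrightarrow> Cod (mC (m1t f)) r = FObj (m1P f) (FObj (mS (m1s f)) A) \<Longrightarrow>
    e1Ext (K_1 f) A r = FArr (m1P f) (NCmp (mMu (m1s f)) A) \<cdot>\<^bsub>mC (m1t f)\<^esub>
      NCmp (m1phi f) (FObj (mS (m1s f)) A) \<cdot>\<^bsub>mC (m1t f)\<^esub> FArr (mS (m1t f)) r"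
  by (simp_all add: K_1_def)

text \<open>
  The operation is \<open>r \<mapsto> c \<cdot> T r\<close> for the classical algebra \<open>c = P \<mu> \<cdot> \<phi> S : T P S A \<rightarrow> P S A\<close>,
  the image of the free algebra on \<open>A\<close> under the classical 1-cell.
\<close>

lemma emonad_1cell_K_1 [simp]:
  assumes f: "cmonad_1cell f"
  shows "emonad_1cell (K_1 f)"
proof (rule emonad_1cellI)
  let ?P = "m1P f" and ?S = "m1s f" and ?T = "m1t f"
  let ?C = "mC ?S" and ?D = "mC ?T"
  have MS: "classical_monad ?S" and MT: "classical_monad ?T" using f by simp_all
  show "e1Ext (K_1 f) \<in> extensional (Obj (eC (e1s (K_1 f))))" by (simp add: K_1_def)
  show "ealgebra (e1t (K_1 f)) (e1Alg (K_1 f) A)" if "A \<in> Obj (eC (e1s (K_1 f)))" for A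
  proof -
    have A: "A \<in> Obj ?C" using that by simp
    let ?SA = "FObj (mS ?S) A"
    have SA: "?SA \<in> Obj ?C" using A f by simp
    have 1: "FArr ?P (NCmp (mMu ?S) A) \<cdot>\<^bsub>?D\<^esub> FArr ?P (NCmp (mEta ?S) ?SA) = Ide ?D (FObj ?P ?SA)"
      using FArr_equation[OF classical_monad_laws(3)[OF MS A], of ?P ?D] A f by simp
    have 2: "FArr ?P (NCmp (mMu ?S) A) \<cdot>\<^bsub>?D\<^esub> FArr ?P (FArr (mS ?S) (NCmp (mMu ?S) A)) =
        FArr ?P (NCmp (mMu ?S) A) \<cdot>\<^bsub>?D\<^esub> FArr ?P (NCmp (mMu ?S) ?SA)"
      using FArr_equation[OF classical_monad_laws(1)[OF MS A], of ?P ?D] A f by simp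
    show ?thesis
    proof (rule ealgebraI)
      show "snd (e1Alg (K_1 f) A) \<in> extensional (Into (eC (e1t (K_1 f))) (fst (e1Alg (K_1 f) A)))"
        using A by (simp add: K_1_def)
      fix b assume "b \<in> Arr (eC (e1t (K_1 f)))" "Cod (eC (e1t (K_1 f))) b = fst (e1Alg (K_1 f) A)"
      then have b: "b \<in> Arr ?D" "Cod ?D b = FObj ?P ?SA" by simp_all
      show "snd (e1Alg (K_1 f) A) b \<in> Hom (eC (e1t (K_1 f))) (eS (e1t (K_1 f)) (Dom (eC (e1t (K_1 f))) b)) (fst (e1Alg (K_1 f) A))"
        using A b f by simp
      have 3: "FArr (mS ?T) b \<cdot>\<^bsub>?D\<^esub> NCmp (mEta ?T) (Dom ?D b) = NCmp (mEta ?T) (FObj ?P ?SA) \<cdot>\<^bsub>?D\<^esub> b"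
        using classical_monad_natural(2)[OF MT b(1) refl b(2)] by simp
      show "snd (e1Alg (K_1 f) A) b \<cdot>\<^bsub>eC (e1t (K_1 f))\<^esub> eEta (e1t (K_1 f)) (Dom (eC (e1t (K_1 f))) b) = b"
        using A SA b f by (simp add: 3 Cmp_extend[OF cmonad_1cell_laws(1)[OF f]] Cmp_extend[OF 1])
      fix h assume "h \<in> Arr (eC (e1t (K_1 f)))" "Cod (eC (e1t (K_1 f))) h = eS (e1t (K_1 f)) (Dom (eC (e1t (K_1 f))) b)"
      then have h: "h \<in> Arr ?D" "Cod ?D h = FObj (mS ?T) (Dom ?D b)" by simp_all
      have mu: "NCmp (mMu ?S) A \<in> Arr ?C" "Dom ?C (NCmp (mMu ?S) A) = FObj (mS ?S) ?SA" "Cod ?C (NCmp (mMu ?S) A) = ?SA"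
        using A f by simp_all
      have l2: "FArr ?P (NCmp (mMu ?S) ?SA) \<cdot>\<^bsub>?D\<^esub> NCmp (m1phi f) (FObj (mS ?S) ?SA) \<cdot>\<^bsub>?D\<^esub> FArr (mS ?T) (NCmp (m1phi f) ?SA) \<cdot>\<^bsub>?D\<^esub> x
          = NCmp (m1phi f) ?SA \<cdot>\<^bsub>?D\<^esub> NCmp (mMu ?T) (FObj ?P ?SA) \<cdot>\<^bsub>?D\<^esub> x"
        if "x \<in> Arr ?D" "Cod ?D x = FObj (mS ?T) (FObj (mS ?T) (FObj ?P ?SA))" for x
        using Cmp_extend[OF cmonad_1cell_laws(2)[OF f SA], of x] that f SA by simp
      note m1 = classical_monad_natural(1)[OF MT b(1) refl b(2)]
      show "snd (e1Alg (K_1 f) A) (snd (e1Alg (K_1 f) A) b \<cdot>\<^bsub>eC (e1t (K_1 f))\<^esub> h) =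
          snd (e1Alg (K_1 f) A) b \<cdot>\<^bsub>eC (e1t (K_1 f))\<^esub> eExt (e1t (K_1 f)) (Dom (eC (e1t (K_1 f))) b) h"
        using A SA b h f
        by (simp add: Cmp_extend[OF m1phi_natural[OF f mu]] Cmp_extend[OF 2] l2 Cmp_extend[OF m1])
    qed (use A f in simp_all)
  qed
  show "ealg_hom (e1t (K_1 f)) (e1Alg (K_1 f) (Dom (eC (e1s (K_1 f))) h)) (FArr (e1P (K_1 f)) (eExt (e1s (K_1 f)) B h)) (e1Alg (K_1 f) B)"
    if "B \<in> Obj (eC (e1s (K_1 f)))" "h \<in> Arr (eC (e1s (K_1 f)))" "Cod (eC (e1s (K_1 f))) h = eS (e1s (K_1 f)) B" for B h
  proof -
    have B: "B \<in> Obj ?C" "h \<in> Arr ?C" "Cod ?C h = FObj (mS ?S) B" using that by simp_all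
    let ?A = "Dom ?C h" and ?SB = "FObj (mS ?S) B"
    have A: "?A \<in> Obj ?C" using B f by simp
    have mu: "NCmp (mMu ?S) B \<in> Arr ?C" "Dom ?C (NCmp (mMu ?S) B) = FObj (mS ?S) ?SB" "Cod ?C (NCmp (mMu ?S) B) = ?SB"
      using B f by simp_all
    have Sh: "FArr (mS ?S) h \<in> Arr ?C" "Dom ?C (FArr (mS ?S) h) = FObj (mS ?S) ?A" "Cod ?C (FArr (mS ?S) h) = FObj (mS ?S) ?SB"
      using B f by simp_all
    have 2: "FArr ?P (NCmp (mMu ?S) B) \<cdot>\<^bsub>?D\<^esub> FArr ?P (FArr (mS ?S) (NCmp (mMu ?S) B)) =
        FArr ?P (NCmp (mMu ?S) B) \<cdot>\<^bsub>?D\<^esub> FArr ?P (NCmp (mMu ?S) ?SB)"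
      using FArr_equation[OF classical_monad_laws(1)[OF MS B(1)], of ?P ?D] B f by simp
    have 3: "FArr ?P (NCmp (mMu ?S) ?SB) \<cdot>\<^bsub>?D\<^esub> FArr ?P (FArr (mS ?S) (FArr (mS ?S) h)) =
        FArr ?P (FArr (mS ?S) h) \<cdot>\<^bsub>?D\<^esub> FArr ?P (NCmp (mMu ?S) ?A)"
      using FArr_equation[OF classical_monad_natural(1)[OF MS B(2) refl B(3)], of ?P ?D] B A f by simp
    show ?thesis
      by (rule ealg_homI)
        (use A B f in \<open>simp_all add: Cmp_extend[OF m1phi_natural[OF f mu]] Cmp_extend[OF m1phi_natural[OF f Sh]]
           Cmp_extend[OF 2] Cmp_extend[OF 3]\<close>)
  qed
qed (use f in simp_all)

lemma K_1_H_1 [simp]: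
  assumes f: "emonad_1cell f"
  shows "K_1 (H_1 f) = f"
proof (rule emonad1_eqI)
  let ?P = "e1P f" and ?S = "e1s f" and ?T = "e1t f"
  fix A assume A: "A \<in> Obj (eC ?S)"
  have u: "FArr ?P (eExt ?S A (Ide (eC ?S) (eS ?S A))) \<cdot>\<^bsub>eC ?T\<^esub> FArr ?P (eEta ?S (eS ?S A)) = Ide (eC ?T) (FObj ?P (eS ?S A))"
    using e1P_ext_eta[OF f A, of "Ide (eC ?S) (eS ?S A)" "eS ?S A"] A f by simp
  have K: "emonad_1cell (K_1 (H_1 f))" using f by simp
  have "e1Alg (K_1 (H_1 f)) A = e1Alg f A"
  proof (rule ealgebra_eqI[of ?T])
    show "ealgebra ?T (e1Alg (K_1 (H_1 f)) A)" using emonad_1cell_simps(6)[OF K, of A] f A by simp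
    fix r assume "r \<in> Arr (eC ?T)" "Cod (eC ?T) r = fst (e1Alg f A)"
    then show "snd (e1Alg (K_1 (H_1 f)) A) r = snd (e1Alg f A) r"
      using f A by (simp add: eExt_fuse e1Ext_fuse e1Ext_hom_fuse Cmp_extend[OF u] del: e1Ext_hom e1Ext_simps(5) eExt_eExt)
  qed (use f A in simp_all)
  then show "e1Ext (K_1 (H_1 f)) A = e1Ext f A" by simp
qed (use f in simp_all)

lemma H_1_K_1 [simp]:
  assumes f: "cmonad_1cell f"
  shows "H_1 (K_1 f) = f"
proof -
  have "m1phi (H_1 (K_1 f)) = m1phi f"
  proof (rule ntrans_eqI)
    show "nat_trans (m1phi (H_1 (K_1 f)))" using f by (intro cmonad_1cell_simps) simp
    fix A assume "A \<in> Obj (FDom (NSrc (m1phi f)))"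
    then have A: "A \<in> Obj (mC (m1s f))" using f by simp
    let ?P = "m1P f" and ?S = "m1s f" and ?T = "m1t f"
    have e: "NCmp (mEta ?S) A \<in> Arr (mC ?S)" "Dom (mC ?S) (NCmp (mEta ?S) A) = A" "Cod (mC ?S) (NCmp (mEta ?S) A) = FObj (mS ?S) A"
      using A f by simp_all
    have 2: "FArr ?P (NCmp (mMu ?S) A) \<cdot>\<^bsub>mC ?T\<^esub> FArr ?P (FArr (mS ?S) (NCmp (mEta ?S) A)) = Ide (mC ?T) (FObj ?P (FObj (mS ?S) A))"
      using FArr_equation[OF classical_monad_laws(2)[OF cmonad_1cell_simps(1)[OF f] A], of ?P "mC ?T"] A f by simp
    show "NCmp (m1phi (H_1 (K_1 f))) A = NCmp (m1phi f) A"
      using f A by (simp add: m1phi_natural[OF f e] Cmp_extend[OF 2])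
  qed (use f in simp_all)
  then show ?thesis using f by (intro cmonad1.equality) simp_all
qed

lemma cmonad_2cell_simps [simp]:
  assumes "cmonad_2cell \<theta>"
  shows "cmonad_1cell (m2s \<theta>)" "cmonad_1cell (m2t \<theta>)"
    "m1s (m2t \<theta>) = m1s (m2s \<theta>)" "m1t (m2t \<theta>) = m1t (m2s \<theta>)"
    "nat_trans (m2a \<theta>)" "NSrc (m2a \<theta>) = m1P (m2s \<theta>)" "NTrg (m2a \<theta>) = m1P (m2t \<theta>)"
  using assms unfolding cmonad_2cell_def nat_from_to_def by blast+

lemma cmonad_2cell_phi:
  assumes t: "cmonad_2cell \<theta>" and A: "A \<in> Obj (mC (m1s (m2s \<theta>)))"
  shows "NCmp (m1phi (m2t \<theta>)) A \<cdot>\<^bsub>mC (m1t (m2s \<theta>))\<^esub> FArr (mS (m1t (m2s \<theta>))) (NCmp (m2a \<theta>) A) =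
    NCmp (m2a \<theta>) (FObj (mS (m1s (m2s \<theta>))) A) \<cdot>\<^bsub>mC (m1t (m2s \<theta>))\<^esub> NCmp (m1phi (m2s \<theta>)) A"
proof -
  have l: "m1phi (m2t \<theta>) \<circ>\<^sub>V (mS (m1t (m2s \<theta>)) \<star>\<^sub>l m2a \<theta>) = (m2a \<theta> \<star>\<^sub>r mS (m1s (m2s \<theta>))) \<circ>\<^sub>V m1phi (m2s \<theta>)"
    using t unfolding cmonad_2cell_def by blast
  show ?thesis using arg_cong[OF l, of "\<lambda>\<alpha>. NCmp \<alpha> A"] t A by simp
qed

lemma HK_2f_simps [simp]:
  "F0 H_2f = H_0" "F1 H_2f = H_1" "F0 K_2f = K_0" "F1 K_2f = K_1"
  "m2s (F2 H_2f \<theta>) = H_1 (e2s \<theta>)" "m2t (F2 H_2f \<theta>) = H_1 (e2t \<theta>)" "m2a (F2 H_2f \<theta>) = e2a \<theta>"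
  "e2s (F2 K_2f \<kappa>) = K_1 (m2s \<kappa>)" "e2t (F2 K_2f \<kappa>) = K_1 (m2t \<kappa>)" "e2a (F2 K_2f \<kappa>) = m2a \<kappa>"
  by (simp_all add: H_2f_def K_2f_def)

lemma cmonad_2cell_H_2f [simp]:
  assumes t: "emonad_2cell \<theta>"
  shows "cmonad_2cell (F2 H_2f \<theta>)"
proof -
  let ?f = "e2s \<theta>" and ?g = "e2t \<theta>" and ?S = "e1s (e2s \<theta>)" and ?T = "e1t (e2s \<theta>)"
  note S = t emonad_2cell_simps[OF t] emonad_1cell_simps[OF emonad_2cell_simps(2)[OF t]]
    classical_monad_H_0[OF emonad_1cell_simps(1)[OF emonad_2cell_simps(1)[OF t]]]
    classical_monad_H_0[OF emonad_1cell_simps(2)[OF emonad_2cell_simps(1)[OF t]]]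
  have n: "nat_trans (m1phi (H_1 ?f))" "nat_trans (m1phi (H_1 ?g))"
    using S by (intro cmonad_1cell_simps cmonad_1cell_H_1; simp)+
  have "m1phi (H_1 ?g) \<circ>\<^sub>V (mS (H_0 ?T) \<star>\<^sub>l e2a \<theta>) = (e2a \<theta> \<star>\<^sub>r mS (H_0 ?S)) \<circ>\<^sub>V m1phi (H_1 ?f)"
  proof (rule ntrans_eqI)
    fix A assume "A \<in> Obj (FDom (NSrc ((e2a \<theta> \<star>\<^sub>r mS (H_0 ?S)) \<circ>\<^sub>V m1phi (H_1 ?f))))"
    then have A: "A \<in> Obj (eC ?S)" using S by simp
    have e: "FArr (e1P ?g) (eEta ?S A) \<cdot>\<^bsub>eC ?T\<^esub> NCmp (e2a \<theta>) A = NCmp (e2a \<theta>) (eS ?S A) \<cdot>\<^bsub>eC ?T\<^esub> FArr (e1P ?f) (eEta ?S A)"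
      using naturality[of "e2a \<theta>" "eC ?T" "eEta ?S A"] S A by simp
    have h: "e1Ext ?g A (NCmp (e2a \<theta>) (eS ?S A) \<cdot>\<^bsub>eC ?T\<^esub> x) = NCmp (e2a \<theta>) (eS ?S A) \<cdot>\<^bsub>eC ?T\<^esub> e1Ext ?f A x"
      if "x \<in> Arr (eC ?T)" "Cod (eC ?T) x = FObj (e1P ?f) (eS ?S A)" for x
      using ealg_hom_simps(4)[OF emonad_2cell_hom[OF t A], of x] that S by simp
    have "e1Ext ?g A (FArr (e1P ?g) (eEta ?S A)) \<cdot>\<^bsub>eC ?T\<^esub> eExt ?T (FObj (e1P ?g) A) (eEta ?T (FObj (e1P ?g) A) \<cdot>\<^bsub>eC ?T\<^esub> NCmp (e2a \<theta>) A) =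
      e1Ext ?g A (e1Ext ?g A (FArr (e1P ?g) (eEta ?S A)) \<cdot>\<^bsub>eC ?T\<^esub> eEta ?T (FObj (e1P ?g) A) \<cdot>\<^bsub>eC ?T\<^esub> NCmp (e2a \<theta>) A)"
      using e1Ext_fuse[of ?g A "FArr (e1P ?g) (eEta ?S A)" "eEta ?T (FObj (e1P ?g) A) \<cdot>\<^bsub>eC ?T\<^esub> NCmp (e2a \<theta>) A" "FObj (e1P ?g) A"] S A
      by (simp del: e1Ext_simps(5) ealgebra_eta_extend e1Ext_simps(6))
    also have "\<dots> = e1Ext ?g A (FArr (e1P ?g) (eEta ?S A) \<cdot>\<^bsub>eC ?T\<^esub> NCmp (e2a \<theta>) A)"
      using e1Ext_simps(6)[of ?g A "FArr (e1P ?g) (eEta ?S A)" "FObj (e1P ?g) A" "NCmp (e2a \<theta>) A"] S A by simp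
    also have "\<dots> = NCmp (e2a \<theta>) (eS ?S A) \<cdot>\<^bsub>eC ?T\<^esub> e1Ext ?f A (FArr (e1P ?f) (eEta ?S A))"
      using S A by (simp add: e h)
    finally show "NCmp (m1phi (H_1 ?g) \<circ>\<^sub>V (mS (H_0 ?T) \<star>\<^sub>l e2a \<theta>)) A = NCmp ((e2a \<theta> \<star>\<^sub>r mS (H_0 ?S)) \<circ>\<^sub>V m1phi (H_1 ?f)) A"
      using S A by simp
  qed (use S n in simp_all)
  then show ?thesis unfolding cmonad_2cell_def nat_from_to_def using S by simp
qed

lemma emonad_2cell_K_2f [simp]:
  assumes t: "cmonad_2cell \<theta>"
  shows "emonad_2cell (F2 K_2f \<theta>)"
proof (rule emonad_2cellI)
  let ?f = "m2s \<theta>" and ?g = "m2t \<theta>" and ?S = "m1s (m2s \<theta>)" and ?T = "m1t (m2s \<theta>)"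
  note S = t cmonad_2cell_simps[OF t] cmonad_1cell_simps[OF cmonad_2cell_simps(2)[OF t]]
  fix A assume "A \<in> Obj (eC (e1s (e2s (F2 K_2f \<theta>))))"
  then have A: "A \<in> Obj (mC ?S)" by simp
  have SA: "FObj (mS ?S) A \<in> Obj (mC ?S)" using A S by simp
  have n: "NCmp (m2a \<theta>) (FObj (mS ?S) A) \<cdot>\<^bsub>mC ?T\<^esub> FArr (m1P ?f) (NCmp (mMu ?S) A) =
      FArr (m1P ?g) (NCmp (mMu ?S) A) \<cdot>\<^bsub>mC ?T\<^esub> NCmp (m2a \<theta>) (FObj (mS ?S) (FObj (mS ?S) A))"
    using naturality[of "m2a \<theta>" "mC ?T" "NCmp (mMu ?S) A"] S A by simp
  show "ealg_hom (e1t (e2s (F2 K_2f \<theta>))) (e1Alg (e2s (F2 K_2f \<theta>)) A)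
      (NCmp (e2a (F2 K_2f \<theta>)) (eS (e1s (e2s (F2 K_2f \<theta>))) A)) (e1Alg (e2t (F2 K_2f \<theta>)) A)"
    by (rule ealg_homI)
      (use S A in \<open>simp_all add: Cmp_extend[OF cmonad_2cell_phi[OF t SA]] Cmp_extend[OF n]\<close>)
qed (use t cmonad_2cell_simps[OF t] in simp_all)

lemma K_2f_H_2f [simp]: "emonad_2cell \<theta> \<Longrightarrow> F2 K_2f (F2 H_2f \<theta>) = \<theta>"
  by (rule emonad2.equality) simp_all

lemma H_2f_K_2f [simp]: "cmonad_2cell \<theta> \<Longrightarrow> F2 H_2f (F2 K_2f \<theta>) = \<theta>"
  by (rule cmonad2.equality) simp_all

lemma cmonad_one_H_1: "extensive_monad S \<Longrightarrow> cmonad_one (H_0 S) = H_1 (emonad_one S)"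
proof (rule cmonad1.equality)
  assume S: "extensive_monad S"
  show "m1phi (cmonad_one (H_0 S)) = m1phi (H_1 (emonad_one S))"
  proof (rule ntrans_eqI)
    show "nat_trans (m1phi (H_1 (emonad_one S)))" using S by (intro cmonad_1cell_simps) simp
  qed (use S classical_monad_H_0[OF S] classical_monad_simps[OF classical_monad_H_0[OF S]] in \<open>simp_all add: cmonad_one_def\<close>)
qed (simp_all add: cmonad_one_def)

lemma cmonad_comp1_H_1:
  assumes f: "emonad_1cell f" and g: "emonad_1cell g" and c: "e1s g = e1t f"
  shows "cmonad_comp1 (H_1 g) (H_1 f) = H_1 (emonad_comp1 g f)"
proof (rule cmonad1.equality)
  let ?P = "e1P f" and ?S = "e1s f" and ?T = "e1t f" and ?W = "e1P g" and ?D = "eC (e1t g)"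
  note M = classical_monad_simps(1)[OF classical_monad_H_0[OF emonad_1cell_simps(1)[OF f]]]
    classical_monad_simps(1)[OF classical_monad_H_0[OF emonad_1cell_simps(2)[OF f]]]
    classical_monad_simps(1)[OF classical_monad_H_0[OF emonad_1cell_simps(2)[OF g]]]
  have n: "nat_trans (m1phi (H_1 f))" "nat_trans (m1phi (H_1 g))" "nat_trans (m1phi (H_1 (emonad_comp1 g f)))"
    using f g c by (intro cmonad_1cell_simps cmonad_1cell_H_1; simp)+
  show "m1phi (cmonad_comp1 (H_1 g) (H_1 f)) = m1phi (H_1 (emonad_comp1 g f))"
  proof (rule ntrans_eqI)
    fix A assume "A \<in> Obj (FDom (NSrc (m1phi (H_1 (emonad_comp1 g f)))))"
    then have A: "A \<in> Obj (eC ?S)" using f by simp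
    let ?PA = "FObj ?P A" and ?PSA = "FObj ?P (eS ?S A)" and ?p = "FArr ?P (eEta ?S A)"
    have p: "?p \<in> Arr (eC (e1s g))" "Dom (eC (e1s g)) ?p = ?PA" "Cod (eC (e1s g)) ?p = ?PSA"
      using f g c A by simp_all
    note w = e1P_eta_natural[OF g p(1), unfolded p]
    have i: "e1Ext f A (Ide (eC ?T) ?PSA) \<cdot>\<^bsub>eC ?T\<^esub> eExt ?T ?PSA (eEta ?T ?PSA \<cdot>\<^bsub>eC ?T\<^esub> ?p) = e1Ext f A ?p"
      using f A by (simp add: e1Ext_fuse del: e1Ext_simps(5))
    have j: "FArr ?W (e1Ext f A (Ide (eC ?T) ?PSA)) \<cdot>\<^bsub>?D\<^esub> FArr ?W (eExt ?T ?PSA (eEta ?T ?PSA \<cdot>\<^bsub>eC ?T\<^esub> ?p)) = FArr ?W (e1Ext f A ?p)"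
      using FArr_equation[OF i, of ?W ?D] f g c A by simp
    have "e1Ext g ?PSA (FArr ?W (eExt ?T ?PSA (eEta ?T ?PSA \<cdot>\<^bsub>eC ?T\<^esub> ?p)) \<cdot>\<^bsub>?D\<^esub> FArr ?W (eEta ?T ?PA)) =
        FArr ?W (eExt ?T ?PSA (eEta ?T ?PSA \<cdot>\<^bsub>eC ?T\<^esub> ?p)) \<cdot>\<^bsub>?D\<^esub> e1Ext g ?PA (FArr ?W (eEta ?T ?PA))"
      using e1Ext_hom[OF g, of ?PSA "eEta ?T ?PSA \<cdot>\<^bsub>eC ?T\<^esub> ?p" "FArr ?W (eEta ?T ?PA)"] f g c A by simp
    then show "NCmp (m1phi (cmonad_comp1 (H_1 g) (H_1 f))) A = NCmp (m1phi (H_1 (emonad_comp1 g f))) A"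
      using f g c A p M w by (simp add: cmonad_comp1_def e1Ext_comp1 Cmp_extend[OF j] del: FArr_Cmp)
  qed (use f g c n M in \<open>simp_all add: cmonad_comp1_def\<close>)
qed (simp_all add: cmonad_comp1_def)

lemma MndE_simps [simp]:
  "Cell0 MndE = {U. classical_monad U}" "src MndE = m1s" "trg MndE = m1t" "one MndE = cmonad_one"
  "comp1 MndE = cmonad_comp1"
  "\<kappa> \<diamondop>\<^bsub>MndE\<^esub> \<theta> = \<lparr>m2s = cmonad_comp1 (m2s \<kappa>) (m2s \<theta>), m2t = cmonad_comp1 (m2t \<kappa>) (m2t \<theta>), m2a = m2a \<kappa> \<star>\<^sub>h m2a \<theta>\<rparr>"
  "Vert MndE = mk_category {f. cmonad_1cell f} {\<theta>. cmonad_2cell \<theta>} m2s m2t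
      (\<lambda>f. \<lparr>m2s = f, m2t = f, m2a = id_nat (m1P f)\<rparr>)
      (\<lambda>\<kappa> \<theta>. \<lparr>m2s = m2s \<theta>, m2t = m2t \<kappa>, m2a = m2a \<kappa> \<circ>\<^sub>V m2a \<theta>\<rparr>)"
  by (simp_all add: MndE_def)

lemma cmonad_2cell_vcomp:
  assumes "cmonad_2cell \<theta>" "cmonad_2cell \<kappa>" "m2s \<kappa> = m2t \<theta>"
  shows "cmonad_2cell \<lparr>m2s = m2s \<theta>, m2t = m2t \<kappa>, m2a = m2a \<kappa> \<circ>\<^sub>V m2a \<theta>\<rparr>"
  using cmonad_2cell_H_2f[OF emonad_2cell_vcomp[of "F2 K_2f \<theta>" "F2 K_2f \<kappa>"]] assms by (simp add: H_2f_def)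

lemma cmonad_2cell_ide:
  assumes "cmonad_1cell f"
  shows "cmonad_2cell \<lparr>m2s = f, m2t = f, m2a = id_nat (m1P f)\<rparr>"
  using cmonad_2cell_H_2f[OF emonad_2cell_ide[of "K_1 f"]] assms by (simp add: H_2f_def)

lemma EMnd_MndE_inverse: "mutually_inverse EMnd MndE H_2f K_2f"
proof (rule mutually_inverse_transport[OF two_category_EMnd])
  show "category (Vert MndE)"
    unfolding MndE_simps
    by (rule category_mk_category) (auto simp: cmonad_2cell_vcomp cmonad_2cell_ide intro!: cmonad2.equality)
  show "F2 H_2f \<kappa> \<cdot>\<^bsub>Vert MndE\<^esub> F2 H_2f \<theta> = F2 H_2f (\<kappa> \<cdot>\<^bsub>Vert EMnd\<^esub> \<theta>)"
    if "\<theta> \<in> Cell2 EMnd" "\<kappa> \<in> Cell2 EMnd" "Dom (Vert EMnd) \<kappa> = Cod (Vert EMnd) \<theta>" for \<theta> \<kappa> :: "('o, 'm) emonad2"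
    using that by (auto intro!: cmonad2.equality)
qed (auto simp: two_functor_eq_def cmonad_one_H_1 cmonad_comp1_H_1 intro!: cmonad2.equality)

section \<open>The extensive monad of a universal arrow\<close>

lemma Phi_0_simps [simp]:
  "eC (Phi_0 U) = uC U" "A \<in> Obj (uC U) \<Longrightarrow> eS (Phi_0 U) A = FObj (uR U) (uL U A)" "eEta (Phi_0 U) = uEta U"
  "B \<in> Obj (uC U) \<Longrightarrow> h \<in> Arr (uC U) \<Longrightarrow> Cod (uC U) h = FObj (uR U) (uL U B) \<Longrightarrow>
    eExt (Phi_0 U) B h = FArr (uR U) (uZeta U (uL U B) h)"
  by (simp_all add: Phi_0_def)

lemma uZeta_R_compose [simp]:
  assumes "universal_arrow U" "v \<in> Arr (uC U)" "w \<in> Arr (uX U)" "Cod (uX U) w = Y"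
    "Cod (uC U) v = FObj (uR U) (Dom (uX U) w)"
  shows "uZeta U Y (FArr (uR U) w \<cdot>\<^bsub>uC U\<^esub> v) = w \<cdot>\<^bsub>uX U\<^esub> uZeta U (Dom (uX U) w) v"
  using uZeta_postcompose[of U v w] assms by simp

lemma extensive_monad_Phi_0 [simp]:
  assumes U: "universal_arrow U"
  shows "extensive_monad (Phi_0 U)"
proof (rule extensive_monadI)
  show "eEta (Phi_0 U) \<in> extensional (Obj (eC (Phi_0 U)))" using universal_arrow_ext(2)[OF U] by simp
  show "eExt (Phi_0 U) A \<in> extensional (Into (eC (Phi_0 U)) (eS (Phi_0 U) A))" if "A \<in> Obj (eC (Phi_0 U))" for A
    using that by (simp add: Phi_0_def)
qed (use U in \<open>simp_all, simp_all add: Phi_0_def\<close>)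

text \<open>
  The comparison of \<open>U\<close> with the algebras of its monad, on objects. At \<open>X = L A\<close> it gives the
  free algebra.
\<close>

definition cmp_alg :: "('o, 'm, 'x, 'y) uarr \<Rightarrow> 'x \<Rightarrow> ('o, 'm) ealg" where
  "cmp_alg U X = (FObj (uR U) X, \<lambda>v\<in>Into (uC U) (FObj (uR U) X). FArr (uR U) (uZeta U X v))"

lemma cmp_alg_simps [simp]:
  "fst (cmp_alg U X) = FObj (uR U) X"
  "v \<in> Arr (uC U) \<Longrightarrow> Cod (uC U) v = FObj (uR U) X \<Longrightarrow> snd (cmp_alg U X) v = FArr (uR U) (uZeta U X v)"
  by (simp_all add: cmp_alg_def)

lemma ealgebra_cmp_alg [simp]:
  assumes U: "universal_arrow U" and X: "X \<in> Obj (uX U)"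
  shows "ealgebra (Phi_0 U) (cmp_alg U X)"
proof (rule ealgebraI)
  show "snd (cmp_alg U X) \<in> extensional (Into (eC (Phi_0 U)) (fst (cmp_alg U X)))" by (simp add: cmp_alg_def)
next
  fix a assume a: "a \<in> Arr (eC (Phi_0 U))" "Cod (eC (Phi_0 U)) a = fst (cmp_alg U X)"
  then have "Dom (uC U) a \<in> Obj (uC U)" using U by simp
  then show "snd (cmp_alg U X) a \<in> Hom (eC (Phi_0 U)) (eS (Phi_0 U) (Dom (eC (Phi_0 U)) a)) (fst (cmp_alg U X))"
    using a U X by simp
next
  fix b h assume b: "b \<in> Arr (eC (Phi_0 U))" "Cod (eC (Phi_0 U)) b = fst (cmp_alg U X)" "h \<in> Arr (eC (Phi_0 U))"
    "Cod (eC (Phi_0 U)) h = eS (Phi_0 U) (Dom (eC (Phi_0 U)) b)"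
  then have "Dom (uC U) b \<in> Obj (uC U)" using U by simp
  then show "snd (cmp_alg U X) (snd (cmp_alg U X) b \<cdot>\<^bsub>eC (Phi_0 U)\<^esub> h) =
      snd (cmp_alg U X) b \<cdot>\<^bsub>eC (Phi_0 U)\<^esub> eExt (Phi_0 U) (Dom (eC (Phi_0 U)) b) h"
    using b U X by simp
qed (use U X in simp_all)

lemma cmp_alg_hom:
  assumes U: "universal_arrow U" and w: "w \<in> Arr (uX U)" "Dom (uX U) w = X" "Cod (uX U) w = Y"
  shows "ealg_hom (Phi_0 U) (cmp_alg U X) (FArr (uR U) w) (cmp_alg U Y)"
proof -
  have "X \<in> Obj (uX U)" "Y \<in> Obj (uX U)" using U w by auto
  then show ?thesis by (intro ealg_homI) (use U w in simp_all)
qed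

lemma cmp_alg_free: "universal_arrow U \<Longrightarrow> A \<in> Obj (uC U) \<Longrightarrow> cmp_alg U (uL U A) = eFree (Phi_0 U) A"
  by (rule ealgebra_eqI[of "Phi_0 U"]) simp_all

text \<open>
  The structure of the comparison algebra of \<open>V X\<close>, transported along the isomorphism
  \<open>\<rho> X : J R X \<rightarrow> R\<^sup>\<dagger> V X\<close>. At \<open>X = L A\<close> it is the structure which the image of \<open>(J, V, \<rho>)\<close>
  under \<open>\<Phi>\<close> puts on \<open>J R L A\<close>; all objects \<open>X\<close> are needed to compare actions on algebras.
\<close>

definition u1Alg :: "('o, 'm, 'x, 'y) uarr1 \<Rightarrow> 'x \<Rightarrow> ('o, 'm) ealg" where
  "u1Alg f X = (FObj (u1J f) (FObj (uR (u1s f)) X),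
    \<lambda>p\<in>Into (uC (u1t f)) (FObj (u1J f) (FObj (uR (u1s f)) X)).
      u1rho' f X \<cdot>\<^bsub>uC (u1t f)\<^esub> FArr (uR (u1t f)) (uZeta (u1t f) (FObj (u1V f) X) (NCmp (u1rho f) X \<cdot>\<^bsub>uC (u1t f)\<^esub> p)))"

lemma u1Alg_simps [simp]:
  "fst (u1Alg f X) = FObj (u1J f) (FObj (uR (u1s f)) X)"
  "p \<in> Arr (uC (u1t f)) \<Longrightarrow> Cod (uC (u1t f)) p = FObj (u1J f) (FObj (uR (u1s f)) X) \<Longrightarrow>
    snd (u1Alg f X) p = u1rho' f X \<cdot>\<^bsub>uC (u1t f)\<^esub>
      FArr (uR (u1t f)) (uZeta (u1t f) (FObj (u1V f) X) (NCmp (u1rho f) X \<cdot>\<^bsub>uC (u1t f)\<^esub> p))"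
  by (simp_all add: u1Alg_def)

lemma ealgebra_u1Alg [simp]:
  assumes f: "uarr_1cell f" and X: "X \<in> Obj (uX (u1s f))"
  shows "ealgebra (Phi_0 (u1t f)) (u1Alg f X)"
proof (rule ealgebraI)
  let ?T = "u1t f"
  show "snd (u1Alg f X) \<in> extensional (Into (eC (Phi_0 ?T)) (fst (u1Alg f X)))" by (simp add: u1Alg_def)
next
  fix a assume a: "a \<in> Arr (eC (Phi_0 (u1t f)))" "Cod (eC (Phi_0 (u1t f))) a = fst (u1Alg f X)"
  then have D: "Dom (uC (u1t f)) a \<in> Obj (uC (u1t f))" using f by simp
  then show "snd (u1Alg f X) a \<in> Hom (eC (Phi_0 (u1t f))) (eS (Phi_0 (u1t f)) (Dom (eC (Phi_0 (u1t f))) a)) (fst (u1Alg f X))"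
    using a f X by simp
  show "snd (u1Alg f X) a \<cdot>\<^bsub>eC (Phi_0 (u1t f))\<^esub> eEta (Phi_0 (u1t f)) (Dom (eC (Phi_0 (u1t f))) a) = a"
    using a f X D by simp
next
  fix b h assume b: "b \<in> Arr (eC (Phi_0 (u1t f)))" "Cod (eC (Phi_0 (u1t f))) b = fst (u1Alg f X)" "h \<in> Arr (eC (Phi_0 (u1t f)))"
    "Cod (eC (Phi_0 (u1t f))) h = eS (Phi_0 (u1t f)) (Dom (eC (Phi_0 (u1t f))) b)"
  then have "Dom (uC (u1t f)) b \<in> Obj (uC (u1t f))" using f by simp
  then show "snd (u1Alg f X) (snd (u1Alg f X) b \<cdot>\<^bsub>eC (Phi_0 (u1t f))\<^esub> h) =
      snd (u1Alg f X) b \<cdot>\<^bsub>eC (Phi_0 (u1t f))\<^esub> eExt (Phi_0 (u1t f)) (Dom (eC (Phi_0 (u1t f))) b) h"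
    using b f X by simp
qed (use f X in simp_all)

lemma u1rho'_natural:
  assumes f: "uarr_1cell f" and w: "w \<in> Arr (uX (u1s f))" "Dom (uX (u1s f)) w = X" "Cod (uX (u1s f)) w = Y"
  shows "u1rho' f Y \<cdot>\<^bsub>uC (u1t f)\<^esub> FArr (uR (u1t f)) (FArr (u1V f) w) =
    FArr (u1J f) (FArr (uR (u1s f)) w) \<cdot>\<^bsub>uC (u1t f)\<^esub> u1rho' f X"
proof -
  note i = nat_inv_simps[OF u1rho_iso[OF f]]
  show ?thesis using naturality[OF i(1), of "uC (u1t f)" w] f w by (simp add: i(2,3))
qed

lemma u1Alg_hom:
  assumes f: "uarr_1cell f" and w: "w \<in> Arr (uX (u1s f))" "Dom (uX (u1s f)) w = X" "Cod (uX (u1s f)) w = Y"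
  shows "ealg_hom (Phi_0 (u1t f)) (u1Alg f X) (FArr (u1J f) (FArr (uR (u1s f)) w)) (u1Alg f Y)"
proof -
  have "category (uX (u1s f))" using f by simp
  then have XY: "X \<in> Obj (uX (u1s f))" "Y \<in> Obj (uX (u1s f))" using w by auto
  show ?thesis
    by (rule ealg_homI)
      (use f w XY in \<open>simp_all add: Cmp_extend[OF u1rho_natural[OF f w]] Cmp_extend[OF u1rho'_natural[OF f w]]\<close>)
qed

lemma u1rho_hom:
  assumes f: "uarr_1cell f" and X: "X \<in> Obj (uX (u1s f))"
  shows "ealg_hom (Phi_0 (u1t f)) (u1Alg f X) (NCmp (u1rho f) X) (cmp_alg (u1t f) (FObj (u1V f) X))"
  by (rule ealg_homI) (use f X in simp_all)

lemma Phi_1_simps [simp]: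
  "e1s (Phi_1 f) = Phi_0 (u1s f)" "e1t (Phi_1 f) = Phi_0 (u1t f)" "e1P (Phi_1 f) = u1J f"
  "A \<in> Obj (uC (u1s f)) \<Longrightarrow> e1Ext (Phi_1 f) A = snd (u1Alg f (uL (u1s f) A))"
  by (simp_all add: Phi_1_def u1Alg_def Let_def)

lemma e1Alg_Phi_1: "A \<in> Obj (uC (u1s f)) \<Longrightarrow> e1Alg (Phi_1 f) A = u1Alg f (uL (u1s f) A)"
  by (rule prod_eqI) simp_all

lemma emonad_1cell_Phi_1 [simp]:
  assumes f: "uarr_1cell f"
  shows "emonad_1cell (Phi_1 f)"
proof (rule emonad_1cellI)
  show "e1Ext (Phi_1 f) \<in> extensional (Obj (eC (e1s (Phi_1 f))))" by (simp add: Phi_1_def)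
  show "ealgebra (e1t (Phi_1 f)) (e1Alg (Phi_1 f) A)" if "A \<in> Obj (eC (e1s (Phi_1 f)))" for A
    using that f e1Alg_Phi_1[of A f] ealgebra_u1Alg[OF f, of "uL (u1s f) A"] by simp
  show "ealg_hom (e1t (Phi_1 f)) (e1Alg (Phi_1 f) (Dom (eC (e1s (Phi_1 f))) h))
      (FArr (e1P (Phi_1 f)) (eExt (e1s (Phi_1 f)) B h)) (e1Alg (Phi_1 f) B)"
    if "B \<in> Obj (eC (e1s (Phi_1 f)))" "h \<in> Arr (eC (e1s (Phi_1 f)))"
      "Cod (eC (e1s (Phi_1 f))) h = eS (e1s (Phi_1 f)) B" for B h
  proof -
    have B: "B \<in> Obj (uC (u1s f))" "h \<in> Arr (uC (u1s f))" "Cod (uC (u1s f)) h = FObj (uR (u1s f)) (uL (u1s f) B)"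
      using that by simp_all
    have A: "Dom (uC (u1s f)) h \<in> Obj (uC (u1s f))" using f B by simp
    show ?thesis
      using u1Alg_hom[OF f, of "uZeta (u1s f) (uL (u1s f) B) h"] f B A
        e1Alg_Phi_1[OF A] e1Alg_Phi_1[OF B(1)]
      by simp
  qed
qed (use f in simp_all)

text \<open>
  The counit \<open>e : L R X \<rightarrow> X\<close> makes \<open>J R e\<close> a homomorphism from the structure on \<open>J R L R X\<close> to
  that on \<open>J R X\<close>, split by \<open>J \<eta>\<close>.
\<close>

lemma ehat_obj_cmp_alg:
  assumes f: "uarr_1cell f" and X: "X \<in> Obj (uX (u1s f))"
  shows "ehat_obj (Phi_1 f) (cmp_alg (u1s f) X) = u1Alg f X"
proof (rule ealgebra_eqI[of "Phi_0 (u1t f)"])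
  let ?R = "uR (u1s f)" and ?J = "u1J f" and ?C = "uC (u1t f)"
  show "ealgebra (Phi_0 (u1t f)) (ehat_obj (Phi_1 f) (cmp_alg (u1s f) X))"
    using ealgebra_ehat_obj[OF emonad_1cell_Phi_1[OF f], of "cmp_alg (u1s f) X"] f X by simp
  fix q assume q: "q \<in> Arr (eC (Phi_0 (u1t f)))" "Cod (eC (Phi_0 (u1t f))) q = fst (u1Alg f X)"
  define e where "e = uZeta (u1s f) X (Ide (uC (u1s f)) (FObj ?R X))"
  have RX: "FObj ?R X \<in> Obj (uC (u1s f))" using f X by simp
  have e: "e \<in> Arr (uX (u1s f))" "Dom (uX (u1s f)) e = uL (u1s f) (FObj ?R X)" "Cod (uX (u1s f)) e = X"
    using f X RX by (simp_all add: e_def)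
  have "FArr ?R e \<cdot>\<^bsub>uC (u1s f)\<^esub> uEta (u1s f) (FObj ?R X) = Ide (uC (u1s f)) (FObj ?R X)"
    using f X RX by (simp add: e_def)
  from FArr_equation[OF this, of ?J ?C]
  have u: "FArr ?J (FArr ?R e) \<cdot>\<^bsub>?C\<^esub> FArr ?J (uEta (u1s f) (FObj ?R X)) = Ide ?C (FObj ?J (FObj ?R X))"
    using f X RX e by simp
  note h = ealg_hom_simps(4)[OF u1Alg_hom[OF f e], of "FArr ?J (uEta (u1s f) (FObj ?R X)) \<cdot>\<^bsub>?C\<^esub> q"]
  have "snd (ehat_obj (Phi_1 f) (cmp_alg (u1s f) X)) q = FArr ?J (FArr ?R e) \<cdot>\<^bsub>?C\<^esub>
      snd (u1Alg f (uL (u1s f) (FObj ?R X))) (FArr ?J (uEta (u1s f) (FObj ?R X)) \<cdot>\<^bsub>?C\<^esub> q)"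
    using q f X RX by (simp add: e_def del: u1Alg_simps(2))
  also have "\<dots> = snd (u1Alg f X) (FArr ?J (FArr ?R e) \<cdot>\<^bsub>?C\<^esub> FArr ?J (uEta (u1s f) (FObj ?R X)) \<cdot>\<^bsub>?C\<^esub> q)"
    using h q f X RX by simp
  also have "\<dots> = snd (u1Alg f X) q"
    using q f X RX e by (simp add: Cmp_extend[OF u] del: u1Alg_simps(2))
  finally show "snd (ehat_obj (Phi_1 f) (cmp_alg (u1s f) X)) q = snd (u1Alg f X) q" .
qed (use f X in simp_all)

lemma u1rho'_comp1:
  assumes f: "uarr_1cell f" and g: "uarr_1cell g" and c: "u1s g = u1t f" and X: "X \<in> Obj (uX (u1s f))"
  shows "u1rho' (uarr_comp1 g f) X = FArr (u1J g) (u1rho' f X) \<cdot>\<^bsub>uC (u1t g)\<^esub> u1rho' g (FObj (u1V f) X)"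
proof -
  let ?C = "uC (u1t g)" and ?i = "NCmp (u1rho g) (FObj (u1V f) X) \<cdot>\<^bsub>uC (u1t g)\<^esub> FArr (u1J g) (NCmp (u1rho f) X)"
  have gf: "uarr_1cell (uarr_comp1 g f)" using f g c by simp
  have i: "NCmp (u1rho (uarr_comp1 g f)) X = ?i" using f g c X by simp
  note r = u1rho'_simps[OF gf, of X, unfolded i]
  have u: "FArr (u1J g) (NCmp (u1rho f) X) \<cdot>\<^bsub>?C\<^esub> FArr (u1J g) (u1rho' f X) =
      Ide ?C (FObj (u1J g) (FObj (uR (u1t f)) (FObj (u1V f) X)))"
    using FArr_equation[OF u1rho'_simps(4)[OF f X], of "u1J g" ?C] f g c X by simp
  show ?thesis
    by (rule iso_cancel_left[of ?C ?i "u1rho' (uarr_comp1 g f) X"])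
      (use r f g c X in \<open>simp_all add: Cmp_extend[OF u]\<close>)
qed

text \<open>
  The action of \<open>g\<close> turns the homomorphism \<open>\<rho> X\<close> into a homomorphism from the left-hand side to
  the structure belonging to \<open>V X\<close>. Being invertible, it determines the structure on its source.
\<close>

lemma ehat_obj_u1Alg:
  assumes f: "uarr_1cell f" and g: "uarr_1cell g" and c: "u1s g = u1t f" and X: "X \<in> Obj (uX (u1s f))"
  shows "ehat_obj (Phi_1 g) (u1Alg f X) = u1Alg (uarr_comp1 g f) X"
proof (rule ealgebra_eqI[of "Phi_0 (u1t g)"])
  have gf: "uarr_1cell (uarr_comp1 g f)" using f g c by simp
  let ?C = "uC (u1t g)" and ?j = "FArr (u1J g) (NCmp (u1rho f) X)" and ?j' = "FArr (u1J g) (u1rho' f X)"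
  have VX: "FObj (u1V f) X \<in> Obj (uX (u1s g))" using f g c X by simp
  have al: "ealgebra (e1s (Phi_1 g)) (u1Alg f X)" using f X c by simp
  show al': "ealgebra (Phi_0 (u1t g)) (ehat_obj (Phi_1 g) (u1Alg f X))"
    using ealgebra_ehat_obj[OF emonad_1cell_Phi_1[OF g] al] by simp
  show "ealgebra (Phi_0 (u1t g)) (u1Alg (uarr_comp1 g f) X)"
    using ealgebra_u1Alg[OF gf, of X] X by simp
  show "fst (ehat_obj (Phi_1 g) (u1Alg f X)) = fst (u1Alg (uarr_comp1 g f) X)" using f g X c by simp
  have "ealg_hom (Phi_0 (u1t g)) (ehat_obj (Phi_1 g) (u1Alg f X)) ?j (ehat_obj (Phi_1 g) (cmp_alg (u1s g) (FObj (u1V f) X)))"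
    using ehat_obj_hom[OF emonad_1cell_Phi_1[OF g] al, of "cmp_alg (u1s g) (FObj (u1V f) X)" "NCmp (u1rho f) X"] u1rho_hom[OF f X] f g c X VX
    by simp
  then have h: "ealg_hom (Phi_0 (u1t g)) (ehat_obj (Phi_1 g) (u1Alg f X)) ?j (u1Alg g (FObj (u1V f) X))"
    by (simp add: ehat_obj_cmp_alg[OF g VX])
  have u: "?j' \<cdot>\<^bsub>?C\<^esub> ?j = Ide ?C (FObj (u1J g) (FObj (u1J f) (FObj (uR (u1s f)) X)))"
    using FArr_equation[OF u1rho'_simps(5)[OF f X], of "u1J g" ?C] f g c X by simp
  fix q assume "q \<in> Arr (eC (Phi_0 (u1t g)))" "Cod (eC (Phi_0 (u1t g))) q = fst (u1Alg (uarr_comp1 g f) X)"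
  then have q: "q \<in> Arr ?C" "Cod ?C q = FObj (u1J g) (FObj (u1J f) (FObj (uR (u1s f)) X))" using f X by simp_all
  define z where "z = snd (ehat_obj (Phi_1 g) (u1Alg f X)) q"
  have z: "z \<in> Arr ?C" "Cod ?C z = FObj (u1J g) (FObj (u1J f) (FObj (uR (u1s f)) X))"
    using ealgebra_simps(2,4)[OF _ al', of q] q f g X unfolding z_def by simp_all
  have "?j \<cdot>\<^bsub>?C\<^esub> z = snd (u1Alg g (FObj (u1V f) X)) (?j \<cdot>\<^bsub>?C\<^esub> q)"
    using ealg_hom_simps(4)[OF h, of q] q f g c X by (simp add: z_def)
  then have "?j' \<cdot>\<^bsub>?C\<^esub> ?j \<cdot>\<^bsub>?C\<^esub> z = ?j' \<cdot>\<^bsub>?C\<^esub> snd (u1Alg g (FObj (u1V f) X)) (?j \<cdot>\<^bsub>?C\<^esub> q)" by simp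
  then have "z = ?j' \<cdot>\<^bsub>?C\<^esub> snd (u1Alg g (FObj (u1V f) X)) (?j \<cdot>\<^bsub>?C\<^esub> q)"
    using z f g c X by (simp add: Cmp_extend[OF u] del: u1Alg_simps(2))
  also have "\<dots> = snd (u1Alg (uarr_comp1 g f) X) q"
    using q f g c X by (simp add: u1rho'_comp1[OF f g c X, unfolded uarr_comp1_simps])
  finally show "snd (ehat_obj (Phi_1 g) (u1Alg f X)) q = snd (u1Alg (uarr_comp1 g f) X) q" by (simp add: z_def)
qed

lemma Phi_1_comp1:
  assumes f: "uarr_1cell f" and g: "uarr_1cell g" and c: "u1s g = u1t f"
  shows "Phi_1 (uarr_comp1 g f) = emonad_comp1 (Phi_1 g) (Phi_1 f)"
proof (rule emonad1_eqI)
  show "e1Ext (Phi_1 (uarr_comp1 g f)) A = e1Ext (emonad_comp1 (Phi_1 g) (Phi_1 f)) A"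
    if "A \<in> Obj (eC (e1s (emonad_comp1 (Phi_1 g) (Phi_1 f))))" for A
    using that f g c e1Ext_comp1[of "Phi_1 f" "Phi_1 g" A] e1Alg_Phi_1[of A f] ehat_obj_u1Alg[OF f g c, of "uL (u1s f) A"]
    by simp
qed (use f g c in simp_all)

lemma Phi_1_one:
  assumes U: "universal_arrow U"
  shows "Phi_1 (uarr_one U) = emonad_one (Phi_0 U)"
proof (rule emonad1_eqI)
  fix A assume "A \<in> Obj (eC (e1s (emonad_one (Phi_0 U))))"
  then have A: "A \<in> Obj (uC U)" by simp
  have "u1Alg (uarr_one U) (uL U A) = eFree (Phi_0 U) A"
    by (rule ealgebra_eqI[of "Phi_0 U"])
      (use U A ealgebra_u1Alg[OF uarr_1cell_one[OF U], of "uL U A"] in \<open>simp_all add: nat_inv_id\<close>)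
  then show "e1Ext (Phi_1 (uarr_one U)) A = e1Ext (emonad_one (Phi_0 U)) A" using A by simp
qed (use U in simp_all)

lemma Phi_simps [simp]:
  "F0 Phi = Phi_0" "F1 Phi = Phi_1" "e2s (F2 Phi \<theta>) = Phi_1 (u2s \<theta>)" "e2t (F2 Phi \<theta>) = Phi_1 (u2t \<theta>)"
  "e2a (F2 Phi \<theta>) = u2a \<theta>"
  by (simp_all add: Phi_def)

text \<open>
  By the equation \<open>R\<^sup>\<dagger> \<beta> \<cdot> \<rho> = \<rho> \<cdot> \<alpha> R\<close>, the components of \<open>\<alpha> R\<close> are the homomorphisms \<open>R\<^sup>\<dagger> \<beta>\<close>,
  transported along \<open>\<rho>\<close>.
\<close>

lemma emonad_2cell_Phi:
  assumes t: "uarr_2cell \<theta>"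
  shows "emonad_2cell (F2 Phi \<theta>)"
proof (rule emonad_2cellI)
  let ?f = "u2s \<theta>" and ?g = "u2t \<theta>" and ?U = "u1s (u2s \<theta>)" and ?T = "u1t (u2s \<theta>)"
  note S = t uarr_2cell_simps[OF t] uarr_1cell_simps[OF uarr_2cell_simps(2)[OF t]]
  fix A assume "A \<in> Obj (eC (e1s (e2s (F2 Phi \<theta>))))"
  then have A: "A \<in> Obj (uC ?U)" by simp
  let ?X = "uL ?U A"
  have X: "?X \<in> Obj (uX ?U)" "?X \<in> Obj (uX (u1s ?g))" using S A by simp_all
  note G = u1rho'_simps[OF uarr_2cell_simps(2)[OF t] X(2)] u1rho'_extend[OF uarr_2cell_simps(2)[OF t] X(2)]
  note e = uarr_2cell_rho[OF t X(1), symmetric]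
  have "NCmp (u2a \<theta>) (FObj (uR ?U) ?X) \<cdot>\<^bsub>uC ?T\<^esub> u1rho' ?f ?X =
      u1rho' ?g ?X \<cdot>\<^bsub>uC ?T\<^esub> NCmp (u1rho ?g) ?X \<cdot>\<^bsub>uC ?T\<^esub> NCmp (u2a \<theta>) (FObj (uR ?U) ?X) \<cdot>\<^bsub>uC ?T\<^esub> u1rho' ?f ?X"
    using S X G by simp
  also have "\<dots> = u1rho' ?g ?X \<cdot>\<^bsub>uC ?T\<^esub> FArr (uR ?T) (NCmp (u2b \<theta>) ?X)"
    using S X G by (simp add: Cmp_extend[OF e])
  finally have e': "u1rho' ?g ?X \<cdot>\<^bsub>uC ?T\<^esub> FArr (uR ?T) (NCmp (u2b \<theta>) ?X) = NCmp (u2a \<theta>) (FObj (uR ?U) ?X) \<cdot>\<^bsub>uC ?T\<^esub> u1rho' ?f ?X" by simp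
  have "ealg_hom (Phi_0 ?T) (u1Alg ?f ?X) (NCmp (u2a \<theta>) (FObj (uR ?U) ?X)) (u1Alg ?g ?X)"
    by (rule ealg_homI) (use S X G in \<open>simp_all add: Cmp_extend[OF e] Cmp_extend[OF e']\<close>)
  then show "ealg_hom (e1t (e2s (F2 Phi \<theta>))) (e1Alg (e2s (F2 Phi \<theta>)) A)
      (NCmp (e2a (F2 Phi \<theta>)) (eS (e1s (e2s (F2 Phi \<theta>))) A)) (e1Alg (e2t (F2 Phi \<theta>)) A)"
    using A S e1Alg_Phi_1[of A ?f] e1Alg_Phi_1[of A ?g] by simp
qed (use t uarr_2cell_simps[OF t] in simp_all)

lemma two_functor_Phi: "two_functor UArr EMnd Phi"
proof (rule two_functorI[OF two_category_UArr two_category_EMnd])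
  show "F2 Phi (\<kappa> \<cdot>\<^bsub>Vert UArr\<^esub> \<theta>) = F2 Phi \<kappa> \<cdot>\<^bsub>Vert EMnd\<^esub> F2 Phi \<theta>"
    if "\<theta> \<in> Cell2 UArr" "\<kappa> \<in> Cell2 UArr" "Dom (Vert UArr) \<kappa> = Cod (Vert UArr) \<theta>" for \<theta> \<kappa> :: "('o, 'm, 'x, 'y) uarr2"
    using that emonad_2cell_Phi[of \<theta>] emonad_2cell_Phi[of \<kappa>] by (auto intro!: emonad2.equality)
qed (auto simp: emonad_2cell_Phi Phi_1_one Phi_1_comp1 intro!: emonad2.equality)

section \<open>The monad of an adjunction\<close>

lemma H_0_Phi_0:
  assumes U: "universal_arrow U"
  shows "H_0 (Phi_0 U) = PhiE_0 (F_0 U)"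
proof -
  note A = adjunction_F_0[OF U]
  note P = classical_monad_H_0[OF extensive_monad_Phi_0[OF U]]
  have S: "mS (H_0 (Phi_0 U)) = uR U \<circ>\<^sub>F aL (F_0 U)"
    by (rule functor_eqI) (use U P classical_monad_simps(1)[OF P] in simp_all)
  have "mEta (H_0 (Phi_0 U)) = aEta (F_0 U)"
    by (rule ntrans.equality) (use U S in simp_all)
  moreover have "mMu (H_0 (Phi_0 U)) = uR U \<star>\<^sub>l (aEps (F_0 U) \<star>\<^sub>r aL (F_0 U))"
    by (rule ntrans_eqI) (use U A S P adjunction_simps[OF A] classical_monad_simps(6)[OF P] in simp_all)
  ultimately show ?thesis using S by (intro cmonad.equality) (simp_all add: PhiE_0_def)
qed

lemma H_1_Phi_1:
  assumes f: "uarr_1cell f"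
  shows "H_1 (Phi_1 f) = PhiE_1 (F_1 f)"
proof (rule cmonad1.equality)
  note i = nat_inv_simps(1-3)[OF u1rho_iso[OF f]]
  note A = adjn_1cell_simps[OF adjn_1cell_F_1[OF f]]
  note P = classical_monad_simps(1)[OF classical_monad_H_0[OF extensive_monad_Phi_0]]
  have U: "universal_arrow (u1s f)" "universal_arrow (u1t f)" using f by simp_all
  have n: "nat_trans (m1phi (H_1 (Phi_1 f)))" using f by (intro cmonad_1cell_simps) simp
  have S: "mS (H_0 (Phi_0 (u1s f))) = uR (u1s f) \<circ>\<^sub>F aL (F_0 (u1s f))" "mS (H_0 (Phi_0 (u1t f))) = uR (u1t f) \<circ>\<^sub>F aL (F_0 (u1t f))"
    using H_0_Phi_0[OF U(1)] H_0_Phi_0[OF U(2)] by (simp_all add: PhiE_0_def)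
  show "m1phi (H_1 (Phi_1 f)) = m1phi (PhiE_1 (F_1 f))"
    by (rule ntrans_eqI) (use f i A(13) n U in \<open>simp_all add: PhiE_1_def S\<close>)
qed (use f in \<open>simp_all add: PhiE_1_def H_0_Phi_0\<close>)

lemma PhiE_simps [simp]:
  "F0 PhiE = PhiE_0" "F1 PhiE = PhiE_1" "m2s (F2 PhiE \<theta>) = PhiE_1 (a2s \<theta>)" "m2t (F2 PhiE \<theta>) = PhiE_1 (a2t \<theta>)"
  "m2a (F2 PhiE \<theta>) = a2a \<theta>"
  by (simp_all add: PhiE_def)

lemma HPhi_eq_PhiEF: "two_functor_eq UArr (H_2f \<circ>\<^sub>2 Phi) (PhiE \<circ>\<^sub>2 F_2f)"
  by (auto simp: two_functor_eq_def H_0_Phi_0 H_1_Phi_1 intro!: cmonad2.equality)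

section \<open>The universal arrow of algebras\<close>

lemma eForget_simps [simp]:
  "FDom (eForget S) = EAlg S" "FCod (eForget S) = eC S" "ealgebra S N \<Longrightarrow> FObj (eForget S) N = fst N"
  "m \<in> Arr (EAlg S) \<Longrightarrow> FArr (eForget S) m = fst (snd m)"
  by (simp_all add: eForget_def)

lemma cat_functor_eForget [simp]:
  assumes S: "extensive_monad S"
  shows "cat_functor (eForget S)"
proof -
  have c: "category (eC S)" using S by simp
  note H = ealg_hom_simps(1-3)[OF _ c]
  show ?thesis
  proof (rule cat_functorI)
    fix f g assume a: "f \<in> Arr (FDom (eForget S))" "g \<in> Arr (FDom (eForget S))"
      "Dom (FDom (eForget S)) g = Cod (FDom (eForget S)) f"
    have "g \<cdot>\<^bsub>EAlg S\<^esub> f \<in> Arr (EAlg S)" using a S by (intro Cmp_simps) simp_all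
    then show "FArr (eForget S) (g \<cdot>\<^bsub>FDom (eForget S)\<^esub> f) = FArr (eForget S) g \<cdot>\<^bsub>FCod (eForget S)\<^esub> FArr (eForget S) f"
      using a by (simp del: EAlg_simps(2))
  next
    fix A assume A: "A \<in> Obj (FDom (eForget S))"
    have "Ide (EAlg S) A \<in> Arr (EAlg S)" using A S by (intro Ide_simps) simp_all
    then show "FArr (eForget S) (Ide (FDom (eForget S)) A) = Ide (FCod (eForget S)) (FObj (eForget S) A)"
      using A by (simp del: EAlg_simps(2))
  qed (use S H in \<open>auto simp: eForget_def\<close>)
qed

lemma EAlg_arr_eqI:
  assumes "m \<in> Arr (EAlg S)" "m' \<in> Arr (EAlg S)" "Dom (EAlg S) m = Dom (EAlg S) m'" "Cod (EAlg S) m = Cod (EAlg S) m'"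
    "fst (snd m) = fst (snd m')"
  shows "m = m'"
  using assms by (auto simp del: EAlg_simps(2) intro!: prod_eqI)

lemma Psi_0_simps [simp]:
  "uR (Psi_0 S) = eForget S" "uL (Psi_0 S) = eFree S" "uEta (Psi_0 S) = eEta S"
  "ealgebra S N \<Longrightarrow> v \<in> Arr (eC S) \<Longrightarrow> Cod (eC S) v = fst N \<Longrightarrow>
    uZeta (Psi_0 S) N v = (eFree S (Dom (eC S) v), snd N v, N)"
  by (simp_all add: Psi_0_def)

text \<open>
  A homomorphism \<open>w\<close> out of \<open>F A\<close> is determined by \<open>v = w \<cdot> \<eta>\<close>, because
  \<open>v\<^sup>N = (w \<cdot> \<eta>)\<^sup>N = w \<cdot> \<eta>\<^sup>S = w\<close>.
\<close>

lemma universal_arrow_Psi_0 [simp]: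
  assumes S: "extensive_monad S"
  shows "universal_arrow (Psi_0 S)"
proof (rule universal_arrowI)
  have c: "category (eC S)" using S by simp
  show "uL (Psi_0 S) \<in> extensional (Obj (uC (Psi_0 S)))" by (simp add: eFree_def)
  show "uEta (Psi_0 S) \<in> extensional (Obj (uC (Psi_0 S)))" using extensive_monad_ext(2)[OF S] by simp
  show "uZeta (Psi_0 S) \<in> extensional (Obj (uX (Psi_0 S)))" by (simp add: Psi_0_def)
  show "uZeta (Psi_0 S) X \<in> extensional (Into (uC (Psi_0 S)) (FObj (uR (Psi_0 S)) X))" if "X \<in> Obj (uX (Psi_0 S))" for X
    using that by (simp add: Psi_0_def)
  fix X v assume X: "X \<in> Obj (uX (Psi_0 S))" and v: "v \<in> Arr (uC (Psi_0 S))" "Cod (uC (Psi_0 S)) v = FObj (uR (Psi_0 S)) X"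
  have z: "uZeta (Psi_0 S) X v = (eFree S (Dom (eC S) v), snd X v, X)" using X v by simp
  have m: "(eFree S (Dom (eC S) v), snd X v, X) \<in> Arr (EAlg S)" using S X v ealg_hom_free[OF S, of X v] by simp
  show "uZeta (Psi_0 S) X v \<in> Hom (uX (Psi_0 S)) (uL (Psi_0 S) (Dom (uC (Psi_0 S)) v)) X"
    unfolding z using m by (simp del: EAlg_simps(2))
  show "FArr (uR (Psi_0 S)) (uZeta (Psi_0 S) X v) \<cdot>\<^bsub>uC (Psi_0 S)\<^esub> uEta (Psi_0 S) (Dom (uC (Psi_0 S)) v) = v"
    unfolding z using m X v S by (simp del: EAlg_simps(2))
next
  fix A w assume A: "A \<in> Obj (uC (Psi_0 S))" and w: "w \<in> Arr (uX (Psi_0 S))" "Dom (uX (Psi_0 S)) w = uL (Psi_0 S) A"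
  have c: "category (eC S)" using S by simp
  obtain q N where wq: "w = (eFree S A, q, N)" using w by (cases w) (simp del: EAlg_simps(2))
  have q: "ealgebra S N" "ealg_hom S (eFree S A) q N" using w wq by auto
  note Q = ealg_hom_simps[OF q(2) c]
  have "snd N (q \<cdot>\<^bsub>eC S\<^esub> eEta S A) = q" using Q(1-3) Q(4)[of "eEta S A"] S A q(1) by simp
  moreover have "w \<in> Arr (EAlg S)" using w by simp
  ultimately show "w = uZeta (Psi_0 S) (Cod (uX (Psi_0 S)) w) (FArr (uR (Psi_0 S)) w \<cdot>\<^bsub>uC (Psi_0 S)\<^esub> uEta (Psi_0 S) A)"
    using Q(1-3) S A q(1) wq by (simp del: EAlg_simps(2))
qed (use S in simp_all)

lemma ehat_simps [simp]:
  "FDom (ehat f) = EAlg (e1s f)" "FCod (ehat f) = EAlg (e1t f)"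
  "ealgebra (e1s f) N \<Longrightarrow> FObj (ehat f) N = ehat_obj f N"
  "m \<in> Arr (EAlg (e1s f)) \<Longrightarrow> FArr (ehat f) m = (ehat_obj f (fst m), FArr (e1P f) (fst (snd m)), ehat_obj f (snd (snd m)))"
  by (simp_all add: ehat_def case_prod_beta)

lemma EAlg_arrD:
  assumes "m \<in> Arr (EAlg S)"
  shows "ealgebra S (fst m)" "ealgebra S (snd (snd m))" "ealg_hom S (fst m) (fst (snd m)) (snd (snd m))"
  using assms by auto

lemma cat_functor_ehat [simp]:
  assumes f: "emonad_1cell f"
  shows "cat_functor (ehat f)"
proof (rule cat_functorI)
  have c: "category (eC (e1s f))" using f by simp
  have m: "FArr (ehat f) m \<in> Arr (EAlg (e1t f))" if "m \<in> Arr (EAlg (e1s f))" for m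
    using EAlg_arrD[OF that] that f ehat_obj_hom[OF f EAlg_arrD[OF that]] by simp
  then show "FArr (ehat f) m \<in> Arr (FCod (ehat f))" "Dom (FCod (ehat f)) (FArr (ehat f) m) = FObj (ehat f) (Dom (FDom (ehat f)) m)"
    "Cod (FCod (ehat f)) (FArr (ehat f) m) = FObj (ehat f) (Cod (FDom (ehat f)) m)"
    if "m \<in> Arr (FDom (ehat f))" for m
    using that m[of m] EAlg_arrD[of m "e1s f"] by (simp_all del: EAlg_simps(2))
  show "FObj (ehat f) \<in> extensional (Obj (FDom (ehat f)))" "FArr (ehat f) \<in> extensional (Arr (FDom (ehat f)))"
    by (simp_all add: ehat_def)
  show "FArr (ehat f) (Ide (FDom (ehat f)) A) = Ide (FCod (ehat f)) (FObj (ehat f) A)" if "A \<in> Obj (FDom (ehat f))" for A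
  proof -
    have "Ide (EAlg (e1s f)) A \<in> Arr (EAlg (e1s f))" using that f by (intro Ide_simps) simp_all
    then show ?thesis using that f by (simp del: EAlg_simps(2))
  qed
  show "FArr (ehat f) (l \<cdot>\<^bsub>FDom (ehat f)\<^esub> m) = FArr (ehat f) l \<cdot>\<^bsub>FCod (ehat f)\<^esub> FArr (ehat f) m"
    if a: "m \<in> Arr (FDom (ehat f))" "l \<in> Arr (FDom (ehat f))" "Dom (FDom (ehat f)) l = Cod (FDom (ehat f)) m" for l m
  proof -
    have "l \<cdot>\<^bsub>EAlg (e1s f)\<^esub> m \<in> Arr (EAlg (e1s f))" using a f by (intro Cmp_simps) simp_all
    moreover have lm: "m \<in> Arr (EAlg (e1s f))" "l \<in> Arr (EAlg (e1s f))" "fst l = snd (snd m)" using a by simp_all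
    note H = ealg_hom_simps(1-3)[OF EAlg_arrD(3)[OF lm(1)] c] ealg_hom_simps(1-3)[OF EAlg_arrD(3)[OF lm(2)] c]
    ultimately show ?thesis using lm m[OF lm(1)] m[OF lm(2)] H f by (simp del: EAlg_simps(2))
  qed
  show "category (FDom (ehat f))" "category (FCod (ehat f))" using f by simp_all
  show "FObj (ehat f) A \<in> Obj (FCod (ehat f))" if "A \<in> Obj (FDom (ehat f))" for A using that f by simp
qed

lemma eForget_ehat: "emonad_1cell f \<Longrightarrow> eForget (e1t f) \<circ>\<^sub>F ehat f = e1P f \<circ>\<^sub>F eForget (e1s f)"
proof (rule functor_eqI)
  assume f: "emonad_1cell f"
  fix m assume "m \<in> Arr (FDom (e1P f \<circ>\<^sub>F eForget (e1s f)))"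
  then have m: "m \<in> Arr (EAlg (e1s f))" by simp
  have "FArr (ehat f) m \<in> Arr (EAlg (e1t f))" using m f by (intro FArr_simps) simp_all
  then show "FArr (eForget (e1t f) \<circ>\<^sub>F ehat f) m = FArr (e1P f \<circ>\<^sub>F eForget (e1s f)) m"
    using m by (simp del: EAlg_simps(2))
qed simp_all

lemma Psi_1_simps [simp]:
  "u1s (Psi_1 f) = Psi_0 (e1s f)" "u1t (Psi_1 f) = Psi_0 (e1t f)" "u1J (Psi_1 f) = e1P f" "u1V (Psi_1 f) = ehat f"
  "u1rho (Psi_1 f) = id_nat (e1P f \<circ>\<^sub>F eForget (e1s f))"
  by (simp_all add: Psi_1_def)

lemma uarr_1cell_Psi_1 [simp]:
  assumes f: "emonad_1cell f"
  shows "uarr_1cell (Psi_1 f)"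
  by (rule uarr_1cellI) (use f nat_iso_id[of "e1P f \<circ>\<^sub>F eForget (e1s f)"] in \<open>simp_all add: eForget_ehat\<close>)

lemma ehat_comp1:
  assumes f: "emonad_1cell f" and g: "emonad_1cell g" and c: "e1s g = e1t f"
  shows "ehat (emonad_comp1 g f) = ehat g \<circ>\<^sub>F ehat f"
proof (rule functor_eqI)
  have gf: "emonad_1cell (emonad_comp1 g f)" using f g c by simp
  show "cat_functor (ehat (emonad_comp1 g f))" "cat_functor (ehat g \<circ>\<^sub>F ehat f)" using f g c gf by simp_all
  show "FObj (ehat (emonad_comp1 g f)) A = FObj (ehat g \<circ>\<^sub>F ehat f) A" if "A \<in> Obj (FDom (ehat g \<circ>\<^sub>F ehat f))" for A
    using that f g c by (simp add: ehat_obj_comp1)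
  fix m assume "m \<in> Arr (FDom (ehat g \<circ>\<^sub>F ehat f))"
  then have m: "m \<in> Arr (EAlg (e1s f))" by simp
  have m': "FArr (ehat f) m \<in> Arr (EAlg (e1s g))" using m f c by (intro FArr_simps) simp_all
  have p: "fst (snd m) \<in> Arr (eC (e1s f))" using ealg_hom_simps(1)[OF EAlg_arrD(3)[OF m]] f by simp
  show "FArr (ehat (emonad_comp1 g f)) m = FArr (ehat g \<circ>\<^sub>F ehat f) m"
    using m m' p EAlg_arrD[OF m] f g c by (simp add: ehat_obj_comp1 del: EAlg_simps(2))
qed simp_all

lemma ehat_one:
  assumes S: "extensive_monad S"
  shows "ehat (emonad_one S) = id_functor (EAlg S)"
proof (rule functor_eqI)
  fix m assume "m \<in> Arr (FDom (id_functor (EAlg S)))"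
  then have m: "m \<in> Arr (EAlg S)" by simp
  have p: "fst (snd m) \<in> Arr (eC S)" using ealg_hom_simps(1)[OF EAlg_arrD(3)[OF m]] S by simp
  show "FArr (ehat (emonad_one S)) m = FArr (id_functor (EAlg S)) m"
    using m p EAlg_arrD[OF m] S by (simp add: ehat_obj_one del: EAlg_simps(2))
qed (use S in \<open>simp_all add: ehat_obj_one\<close>)

lemma Psi_2_simps [simp]:
  "u2s (Psi_2 \<theta>) = Psi_1 (e2s \<theta>)" "u2t (Psi_2 \<theta>) = Psi_1 (e2t \<theta>)" "u2a (Psi_2 \<theta>) = e2a \<theta>"
  "NSrc (u2b (Psi_2 \<theta>)) = ehat (e2s \<theta>)" "NTrg (u2b (Psi_2 \<theta>)) = ehat (e2t \<theta>)"
  "ealgebra (e1s (e2s \<theta>)) N \<Longrightarrow> NCmp (u2b (Psi_2 \<theta>)) N = (ehat_obj (e2s \<theta>) N, NCmp (e2a \<theta>) (fst N), ehat_obj (e2t \<theta>) N)"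
  by (simp_all add: Psi_2_def)

lemma uarr_2cell_Psi_2 [simp]:
  assumes t: "emonad_2cell \<theta>"
  shows "uarr_2cell (Psi_2 \<theta>)"
proof (rule uarr_2cellI)
  let ?f = "e2s \<theta>" and ?g = "e2t \<theta>" and ?S = "e1s (e2s \<theta>)" and ?T = "e1t (e2s \<theta>)"
  note E = emonad_2cell_simps[OF t]
  note S = t E emonad_1cell_simps[OF E(1)] emonad_1cell_simps[OF E(2)]
  have c: "category (eC ?S)" "category (EAlg ?T)" "category (eC ?T)" using S by simp_all
  have n: "(ehat_obj ?f N, NCmp (e2a \<theta>) (fst N), ehat_obj ?g N) \<in> Arr (EAlg ?T)" if "ealgebra ?S N" for N
    using ehat_obj_2cell[OF t that] ealgebra_ehat_obj[OF E(1) that] ealgebra_ehat_obj[OF E(2), of N] S that by simp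
  show "nat_trans (u2b (Psi_2 \<theta>))"
  proof (rule nat_transI)
    show "NCmp (u2b (Psi_2 \<theta>)) \<in> extensional (Obj (FDom (NSrc (u2b (Psi_2 \<theta>)))))" by (simp add: Psi_2_def)
    fix m assume "m \<in> Arr (FDom (NSrc (u2b (Psi_2 \<theta>))))"
    then have m: "m \<in> Arr (EAlg ?S)" by simp
    have mg: "m \<in> Arr (EAlg (e1s ?g))" using m S by simp
    note A = EAlg_arrD[OF m]
    have p: "fst (snd m) \<in> Arr (eC ?S)" "Dom (eC ?S) (fst (snd m)) = fst (fst m)" "Cod (eC ?S) (fst (snd m)) = fst (snd (snd m))"
      using ealg_hom_simps(1-3)[OF A(3) c(1)] by simp_all
    have F: "FArr (ehat ?f) m \<in> Arr (EAlg ?T)" "FArr (ehat ?g) m \<in> Arr (EAlg ?T)"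
      using FArr_simps(1)[of "ehat ?f" "EAlg ?T" m] FArr_simps(1)[of "ehat ?g" "EAlg ?T" m] m S by (simp_all del: EAlg_simps(2) ehat_simps(4))
    have nat: "NCmp (e2a \<theta>) (fst (snd (snd m))) \<cdot>\<^bsub>eC ?T\<^esub> FArr (e1P ?f) (fst (snd m)) = FArr (e1P ?g) (fst (snd m)) \<cdot>\<^bsub>eC ?T\<^esub> NCmp (e2a \<theta>) (fst (fst m))"
      using naturality[of "e2a \<theta>" "eC ?T" "fst (snd m)"] p S by simp
    show "NCmp (u2b (Psi_2 \<theta>)) (Cod (FDom (NSrc (u2b (Psi_2 \<theta>)))) m) \<cdot>\<^bsub>FCod (NSrc (u2b (Psi_2 \<theta>)))\<^esub> FArr (NSrc (u2b (Psi_2 \<theta>))) m =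
        FArr (NTrg (u2b (Psi_2 \<theta>))) m \<cdot>\<^bsub>FCod (NSrc (u2b (Psi_2 \<theta>)))\<^esub> NCmp (u2b (Psi_2 \<theta>)) (Dom (FDom (NSrc (u2b (Psi_2 \<theta>)))) m)"
      using m mg A F n[OF A(1)] n[OF A(2)] nat by (simp del: EAlg_simps(2))
  next
    fix N assume "N \<in> Obj (FDom (NSrc (u2b (Psi_2 \<theta>))))"
    then have N: "ealgebra ?S N" by simp
    then have N': "ealgebra (e1s ?g) N" using S by simp
    show "NCmp (u2b (Psi_2 \<theta>)) N \<in> Arr (FCod (NSrc (u2b (Psi_2 \<theta>))))"
      "Dom (FCod (NSrc (u2b (Psi_2 \<theta>)))) (NCmp (u2b (Psi_2 \<theta>)) N) = FObj (NSrc (u2b (Psi_2 \<theta>))) N"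
      "Cod (FCod (NSrc (u2b (Psi_2 \<theta>)))) (NCmp (u2b (Psi_2 \<theta>)) N) = FObj (NTrg (u2b (Psi_2 \<theta>))) N"
      using n[OF N] N N' by (simp_all del: EAlg_simps(2))
  qed (use S in simp_all)
  fix N assume "N \<in> Obj (uX (u1s (u2s (Psi_2 \<theta>))))"
  then have N: "ealgebra ?S N" by simp
  show "FArr (uR (u1t (u2s (Psi_2 \<theta>)))) (NCmp (u2b (Psi_2 \<theta>)) N) \<cdot>\<^bsub>uC (u1t (u2s (Psi_2 \<theta>)))\<^esub> NCmp (u1rho (u2s (Psi_2 \<theta>))) N =
    NCmp (u1rho (u2t (Psi_2 \<theta>))) N \<cdot>\<^bsub>uC (u1t (u2s (Psi_2 \<theta>)))\<^esub> NCmp (u2a (Psi_2 \<theta>)) (FObj (uR (u1s (u2s (Psi_2 \<theta>)))) N)"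
    using N n[OF N] S by (simp del: EAlg_simps(2))
qed (use t emonad_2cell_simps[OF t] in simp_all)

section \<open>Renaming the domain of a universal arrow\<close>

definition coding :: "('a \<Rightarrow> 'x) \<Rightarrow> ('b \<Rightarrow> 'y) \<Rightarrow> ('a, 'b) category \<Rightarrow> bool" where
  "coding i j C \<longleftrightarrow> category C \<and> inj_on i (Obj C) \<and> inj_on j (Arr C)"

lemma rename_simps:
  "Obj (rename i j C) = i ` Obj C" "Arr (rename i j C) = j ` Arr C"
  "coding i j C \<Longrightarrow> f \<in> Arr C \<Longrightarrow> Dom (rename i j C) (j f) = i (Dom C f)"
  "coding i j C \<Longrightarrow> f \<in> Arr C \<Longrightarrow> Cod (rename i j C) (j f) = i (Cod C f)"
  "coding i j C \<Longrightarrow> A \<in> Obj C \<Longrightarrow> Ide (rename i j C) (i A) = j (Ide C A)"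
  "coding i j C \<Longrightarrow> f \<in> Arr C \<Longrightarrow> g \<in> Arr C \<Longrightarrow> Dom C g = Cod C f \<Longrightarrow> j g \<cdot>\<^bsub>rename i j C\<^esub> j f = j (g \<cdot>\<^bsub>C\<^esub> f)"
  by (simp_all add: rename_def Let_def coding_def)

lemma category_rename [simp]:
  assumes c: "coding i j C"
  shows "category (rename i j C)"
proof -
  have C: "category C" and ij: "inj_on i (Obj C)" "inj_on j (Arr C)" using c by (simp_all add: coding_def)
  show ?thesis
    unfolding rename_def Let_def
    by (rule category_mk_category)
      (use C ij in \<open>auto simp: inj_on_eq_iff[OF ij(1)]\<close>)
qed

lemma enc_dec_simps [simp]:
  "FDom (enc i j C) = C" "FCod (enc i j C) = rename i j C" "FDom (dec i j C) = rename i j C" "FCod (dec i j C) = C"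
  "coding i j C \<Longrightarrow> A \<in> Obj C \<Longrightarrow> FObj (dec i j C) (FObj (enc i j C) A) = A"
  "coding i j C \<Longrightarrow> f \<in> Arr C \<Longrightarrow> FArr (dec i j C) (FArr (enc i j C) f) = f"
  "coding i j C \<Longrightarrow> X \<in> Obj (rename i j C) \<Longrightarrow> FObj (enc i j C) (FObj (dec i j C) X) = X"
  "coding i j C \<Longrightarrow> w \<in> Arr (rename i j C) \<Longrightarrow> FArr (enc i j C) (FArr (dec i j C) w) = w"
  by (auto simp: enc_def dec_def coding_def rename_simps(1,2))

lemma enc_eq: "A \<in> Obj C \<Longrightarrow> FObj (enc i j C) A = i A" "f \<in> Arr C \<Longrightarrow> FArr (enc i j C) f = j f"
  by (simp_all add: enc_def)

lemma cat_functor_enc [simp]: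
  assumes c: "coding i j C"
  shows "cat_functor (enc i j C)"
proof -
  have C: "category C" using c by (simp add: coding_def)
  show ?thesis
    by (rule cat_functorI) (use C c in \<open>simp_all add: enc_def rename_simps\<close>)
qed

lemma cat_functor_dec [simp]:
  assumes c: "coding i j C"
  shows "cat_functor (dec i j C)"
proof -
  have C: "category C" and ij: "inj_on i (Obj C)" "inj_on j (Arr C)" using c by (simp_all add: coding_def)
  show ?thesis
  proof (rule cat_functorI)
    fix f g assume fg: "f \<in> Arr (FDom (dec i j C))" "g \<in> Arr (FDom (dec i j C))" "Dom (FDom (dec i j C)) g = Cod (FDom (dec i j C)) f"
    then obtain f' g' where "f' \<in> Arr C" "g' \<in> Arr C" "f = j f'" "g = j g'" by (auto simp: rename_simps)
    moreover from this fg(3) have "Dom C g' = Cod C f'" using c C by (simp add: rename_simps inj_on_eq_iff[OF ij(1)])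
    ultimately show "FArr (dec i j C) (g \<cdot>\<^bsub>FDom (dec i j C)\<^esub> f) = FArr (dec i j C) g \<cdot>\<^bsub>FCod (dec i j C)\<^esub> FArr (dec i j C) f"
      using c C ij by (simp add: rename_simps) (simp add: dec_def)
  qed (use C c ij in \<open>auto simp: dec_def rename_simps inj_on_eq_iff[OF ij(1)] inj_on_eq_iff[OF ij(2)]\<close>)
qed

lemma dec_enc_id [simp]:
  assumes c: "coding i j C"
  shows "dec i j C \<circ>\<^sub>F enc i j C = id_functor C" "enc i j C \<circ>\<^sub>F dec i j C = id_functor (rename i j C)"
proof -
  have C: "category C" using c by (simp add: coding_def)
  show "dec i j C \<circ>\<^sub>F enc i j C = id_functor C" by (rule functor_eqI) (use c C in simp_all)
  show "enc i j C \<circ>\<^sub>F dec i j C = id_functor (rename i j C)" by (rule functor_eqI) (use c in simp_all)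
qed

lemma dec_enc_comp [simp]:
  "coding i j C \<Longrightarrow> cat_functor F \<Longrightarrow> FCod F = C \<Longrightarrow> dec i j C \<circ>\<^sub>F enc i j C \<circ>\<^sub>F F = F"
  using comp_functor_extend[OF dec_enc_id(1), of i j C F] by simp

abbreviation ucoding :: "('a \<Rightarrow> 'x) \<Rightarrow> ('b \<Rightarrow> 'y) \<Rightarrow> ('o, 'm, 'a, 'b) uarr \<Rightarrow> bool" where
  "ucoding i j U \<equiv> coding i j (uX U)"

lemma rename_uarr_simps [simp]:
  "uR (rename_uarr i j U) = uR U \<circ>\<^sub>F dec i j (uX U)" "uEta (rename_uarr i j U) = uEta U"
  "universal_arrow U \<Longrightarrow> A \<in> Obj (uC U) \<Longrightarrow> uL (rename_uarr i j U) A = FObj (enc i j (uX U)) (uL U A)"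
  "universal_arrow U \<Longrightarrow> ucoding i j U \<Longrightarrow> X \<in> Obj (rename i j (uX U)) \<Longrightarrow> v \<in> Arr (uC U) \<Longrightarrow>
    Cod (uC U) v = FObj (uR U) (FObj (dec i j (uX U)) X) \<Longrightarrow>
    uZeta (rename_uarr i j U) X v = FArr (enc i j (uX U)) (uZeta U (FObj (dec i j (uX U)) X) v)"
proof -
  show "uR (rename_uarr i j U) = uR U \<circ>\<^sub>F dec i j (uX U)" "uEta (rename_uarr i j U) = uEta U"
    by (simp_all add: rename_uarr_def Let_def)
  show "universal_arrow U \<Longrightarrow> A \<in> Obj (uC U) \<Longrightarrow> uL (rename_uarr i j U) A = FObj (enc i j (uX U)) (uL U A)"
    by (simp add: rename_uarr_def Let_def enc_eq)
  assume a: "universal_arrow U" "ucoding i j U" "X \<in> Obj (rename i j (uX U))" "v \<in> Arr (uC U)"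
    "Cod (uC U) v = FObj (uR U) (FObj (dec i j (uX U)) X)"
  have "FObj (dec i j (uX U)) X \<in> Obj (uX U)" using a by simp
  then have "uZeta U (FObj (dec i j (uX U)) X) v \<in> Arr (uX U)" using a by simp
  moreover have "X \<in> i ` Obj (uX U)" using a(3) by (simp add: rename_simps)
  ultimately show "uZeta (rename_uarr i j U) X v = FArr (enc i j (uX U)) (uZeta U (FObj (dec i j (uX U)) X) v)"
    using a(4,5) by (simp add: rename_uarr_def Let_def enc_eq)
qed

lemma universal_arrow_rename [simp]:
  assumes U: "universal_arrow U" and c: "ucoding i j U"
  shows "universal_arrow (rename_uarr i j U)"
proof (rule universal_arrowI)
  let ?D = "dec i j (uX U)" and ?E = "enc i j (uX U)"
  show "uL (rename_uarr i j U) \<in> extensional (Obj (uC (rename_uarr i j U)))" by (simp add: rename_uarr_def Let_def)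
  show "uEta (rename_uarr i j U) \<in> extensional (Obj (uC (rename_uarr i j U)))" using universal_arrow_ext(2)[OF U] by simp
  show "uZeta (rename_uarr i j U) \<in> extensional (Obj (uX (rename_uarr i j U)))"
    by (simp add: rename_uarr_def Let_def rename_simps)
  show "uZeta (rename_uarr i j U) X \<in> extensional (Into (uC (rename_uarr i j U)) (FObj (uR (rename_uarr i j U)) X))"
    if "X \<in> Obj (uX (rename_uarr i j U))" for X
  proof -
    have "X \<in> Obj (rename i j (uX U))" using that by simp
    moreover from this have "X \<in> i ` Obj (uX U)" by (simp add: rename_simps)
    ultimately show ?thesis by (simp add: rename_uarr_def Let_def)
  qed
  fix A w assume A: "A \<in> Obj (uC (rename_uarr i j U))" and w: "w \<in> Arr (uX (rename_uarr i j U))" "Dom (uX (rename_uarr i j U)) w = uL (rename_uarr i j U) A"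
  have A: "A \<in> Obj (uC U)" and w: "w \<in> Arr (rename i j (uX U))" "Dom (rename i j (uX U)) w = FObj ?E (uL U A)"
    using A w U by simp_all
  have x: "FArr ?D w \<in> Arr (uX U)" "Dom (uX U) (FArr ?D w) = uL U A"
    "Cod (uX U) (FArr ?D w) = FObj ?D (Cod (rename i j (uX U)) w)"
    using A w c U by simp_all
  then show "w = uZeta (rename_uarr i j U) (Cod (uX (rename_uarr i j U)) w) (FArr (uR (rename_uarr i j U)) w \<cdot>\<^bsub>uC (rename_uarr i j U)\<^esub> uEta (rename_uarr i j U) A)"
    using A w c U by simp
qed (use U c in simp_all)

definition rename_uarr1 ::
  "('a \<Rightarrow> 'x) \<Rightarrow> ('b \<Rightarrow> 'y) \<Rightarrow> ('a \<Rightarrow> 'x) \<Rightarrow> ('b \<Rightarrow> 'y) \<Rightarrow> ('o, 'm, 'a, 'b) uarr1 \<Rightarrow> ('o, 'm, 'x, 'y) uarr1" where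
  "rename_uarr1 i j i' j' f = \<lparr>u1s = rename_uarr i j (u1s f), u1t = rename_uarr i' j' (u1t f), u1J = u1J f,
    u1V = enc i' j' (uX (u1t f)) \<circ>\<^sub>F u1V f \<circ>\<^sub>F dec i j (uX (u1s f)), u1rho = u1rho f \<star>\<^sub>r dec i j (uX (u1s f))\<rparr>"

lemma rename_uarr1_simps [simp]:
  "u1s (rename_uarr1 i j i' j' f) = rename_uarr i j (u1s f)" "u1t (rename_uarr1 i j i' j' f) = rename_uarr i' j' (u1t f)"
  "u1J (rename_uarr1 i j i' j' f) = u1J f"
  "u1V (rename_uarr1 i j i' j' f) = enc i' j' (uX (u1t f)) \<circ>\<^sub>F u1V f \<circ>\<^sub>F dec i j (uX (u1s f))"
  "u1rho (rename_uarr1 i j i' j' f) = u1rho f \<star>\<^sub>r dec i j (uX (u1s f))"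
  by (simp_all add: rename_uarr1_def)

lemma uarr_1cell_rename [simp]:
  assumes f: "uarr_1cell f" and c: "ucoding i j (u1s f)" "ucoding i' j' (u1t f)"
  shows "uarr_1cell (rename_uarr1 i j i' j' f)"
proof (rule uarr_1cellI)
  show "nat_iso_from_to (u1rho (rename_uarr1 i j i' j' f))
      (u1J (rename_uarr1 i j i' j' f) \<circ>\<^sub>F uR (u1s (rename_uarr1 i j i' j' f)))
      (uR (u1t (rename_uarr1 i j i' j' f)) \<circ>\<^sub>F u1V (rename_uarr1 i j i' j' f))"
    by (rule nat_iso_from_toI[where s = "\<lambda>X. u1rho' f (FObj (dec i j (uX (u1s f))) X)"])
      (use f c in \<open>simp_all add: nat_from_to_def\<close>)
qed (use f c in simp_all)

lemma rename_uarr1_one: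
  assumes U: "universal_arrow U" and c: "ucoding i j U"
  shows "rename_uarr1 i j i j (uarr_one U) = uarr_one (rename_uarr i j U)"
proof (rule uarr1.equality)
  show "u1rho (rename_uarr1 i j i j (uarr_one U)) = u1rho (uarr_one (rename_uarr i j U))"
    by (rule ntrans_eqI) (use U c in simp_all)
qed (use U c in simp_all)

lemma rename_uarr1_comp1:
  assumes f: "uarr_1cell f" and g: "uarr_1cell g" and m: "u1s g = u1t f"
    and c: "ucoding i j (u1s f)" "ucoding i' j' (u1t f)" "ucoding i'' j'' (u1t g)"
  shows "rename_uarr1 i j i'' j'' (uarr_comp1 g f) = uarr_comp1 (rename_uarr1 i' j' i'' j'' g) (rename_uarr1 i j i' j' f)"
proof (rule uarr1.equality)
  show "u1rho (rename_uarr1 i j i'' j'' (uarr_comp1 g f)) = u1rho (uarr_comp1 (rename_uarr1 i' j' i'' j'' g) (rename_uarr1 i j i' j' f))"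
    by (rule ntrans_eqI) (use f g m c in simp_all)
qed (use f g m c in simp_all)

definition rename_uarr2 ::
  "('a \<Rightarrow> 'x) \<Rightarrow> ('b \<Rightarrow> 'y) \<Rightarrow> ('a \<Rightarrow> 'x) \<Rightarrow> ('b \<Rightarrow> 'y) \<Rightarrow> ('o, 'm, 'a, 'b) uarr2 \<Rightarrow> ('o, 'm, 'x, 'y) uarr2" where
  "rename_uarr2 i j i' j' \<theta> = \<lparr>u2s = rename_uarr1 i j i' j' (u2s \<theta>), u2t = rename_uarr1 i j i' j' (u2t \<theta>), u2a = u2a \<theta>,
    u2b = enc i' j' (uX (u1t (u2s \<theta>))) \<star>\<^sub>l (u2b \<theta> \<star>\<^sub>r dec i j (uX (u1s (u2s \<theta>))))\<rparr>"

lemma rename_uarr2_simps [simp]: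
  "u2s (rename_uarr2 i j i' j' \<theta>) = rename_uarr1 i j i' j' (u2s \<theta>)" "u2t (rename_uarr2 i j i' j' \<theta>) = rename_uarr1 i j i' j' (u2t \<theta>)"
  "u2a (rename_uarr2 i j i' j' \<theta>) = u2a \<theta>"
  "u2b (rename_uarr2 i j i' j' \<theta>) = enc i' j' (uX (u1t (u2s \<theta>))) \<star>\<^sub>l (u2b \<theta> \<star>\<^sub>r dec i j (uX (u1s (u2s \<theta>))))"
  by (simp_all add: rename_uarr2_def)

lemma uarr_2cell_rename [simp]:
  assumes t: "uarr_2cell \<theta>" and c: "ucoding i j (u1s (u2s \<theta>))" "ucoding i' j' (u1t (u2s \<theta>))"
  shows "uarr_2cell (rename_uarr2 i j i' j' \<theta>)"
proof (rule uarr_2cellI)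
  note S = t c uarr_2cell_simps[OF t] uarr_1cell_simps[OF uarr_2cell_simps(2)[OF t]]
  fix X assume "X \<in> Obj (uX (u1s (u2s (rename_uarr2 i j i' j' \<theta>))))"
  then have X: "X \<in> Obj (rename i j (uX (u1s (u2s \<theta>))))" by simp
  then have "FObj (dec i j (uX (u1s (u2s \<theta>)))) X \<in> Obj (uX (u1s (u2s \<theta>)))" using S by simp
  note e = uarr_2cell_rho[OF t this]
  show "FArr (uR (u1t (u2s (rename_uarr2 i j i' j' \<theta>)))) (NCmp (u2b (rename_uarr2 i j i' j' \<theta>)) X)
      \<cdot>\<^bsub>uC (u1t (u2s (rename_uarr2 i j i' j' \<theta>)))\<^esub> NCmp (u1rho (u2s (rename_uarr2 i j i' j' \<theta>))) X =
    NCmp (u1rho (u2t (rename_uarr2 i j i' j' \<theta>))) X \<cdot>\<^bsub>uC (u1t (u2s (rename_uarr2 i j i' j' \<theta>)))\<^esub>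
      NCmp (u2a (rename_uarr2 i j i' j' \<theta>)) (FObj (uR (u1s (u2s (rename_uarr2 i j i' j' \<theta>)))) X)"
    using X S e by simp
qed (use t c uarr_2cell_simps[OF t] in simp_all)

lemma rename_uarr2_ide:
  assumes f: "uarr_1cell f" and c: "ucoding i j (u1s f)" "ucoding i' j' (u1t f)"
  shows "rename_uarr2 i j i' j' \<lparr>u2s = f, u2t = f, u2a = id_nat (u1J f), u2b = id_nat (u1V f)\<rparr> =
    \<lparr>u2s = rename_uarr1 i j i' j' f, u2t = rename_uarr1 i j i' j' f, u2a = id_nat (u1J (rename_uarr1 i j i' j' f)),
     u2b = id_nat (u1V (rename_uarr1 i j i' j' f))\<rparr>"
proof -
  have "enc i' j' (uX (u1t f)) \<star>\<^sub>l (id_nat (u1V f) \<star>\<^sub>r dec i j (uX (u1s f))) = id_nat (u1V (rename_uarr1 i j i' j' f))"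
    by (rule ntrans_eqI) (use f c in simp_all)
  then show ?thesis by (simp add: rename_uarr2_def)
qed

lemma rename_uarr2_vcomp:
  assumes t: "uarr_2cell \<theta>" and k: "uarr_2cell \<kappa>" and m: "u2s \<kappa> = u2t \<theta>"
    and c: "ucoding i j (u1s (u2s \<theta>))" "ucoding i' j' (u1t (u2s \<theta>))"
  shows "rename_uarr2 i j i' j' (\<kappa> \<cdot>\<^bsub>Vert UArr\<^esub> \<theta>) = rename_uarr2 i j i' j' \<kappa> \<cdot>\<^bsub>Vert UArr\<^esub> rename_uarr2 i j i' j' \<theta>"
proof -
  note T = uarr_2cell_simps[OF t] and K = uarr_2cell_simps[OF k]
  have s: "u1s (u2s \<kappa>) = u1s (u2s \<theta>)" "u1t (u2s \<kappa>) = u1t (u2s \<theta>)" using m t by simp_all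
  note S = t k m c T K(5-10) s uarr_1cell_simps[OF T(1)] uarr_1cell_simps[OF T(2)] uarr_1cell_simps(6-8)[OF K(2)] K(2-4)
  have e: "enc i' j' (uX (u1t (u2s \<theta>))) \<star>\<^sub>l ((u2b \<kappa> \<circ>\<^sub>V u2b \<theta>) \<star>\<^sub>r dec i j (uX (u1s (u2s \<theta>)))) =
      u2b (rename_uarr2 i j i' j' \<kappa>) \<circ>\<^sub>V u2b (rename_uarr2 i j i' j' \<theta>)"
    by (rule ntrans_eqI) (use S in simp_all)
  have "uarr_2cell (rename_uarr2 i j i' j' \<theta>)" "uarr_2cell (rename_uarr2 i j i' j' \<kappa>)"
    using t k c s by simp_all
  then show ?thesis using t k m e by (intro uarr2.equality) simp_all
qed

lemma rename_uarr2_hcomp: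
  assumes t: "uarr_2cell \<theta>" and k: "uarr_2cell \<kappa>" and m: "u1s (u2s \<kappa>) = u1t (u2s \<theta>)"
    and c: "ucoding i j (u1s (u2s \<theta>))" "ucoding i' j' (u1t (u2s \<theta>))" "ucoding i'' j'' (u1t (u2s \<kappa>))"
  shows "rename_uarr2 i j i'' j'' (\<kappa> \<diamondop>\<^bsub>UArr\<^esub> \<theta>) = rename_uarr2 i' j' i'' j'' \<kappa> \<diamondop>\<^bsub>UArr\<^esub> rename_uarr2 i j i' j' \<theta>"
proof -
  note T = uarr_2cell_simps[OF t] and K = uarr_2cell_simps[OF k]
  note S = t k m c T K uarr_1cell_simps[OF T(1)] uarr_1cell_simps[OF T(2)] uarr_1cell_simps[OF K(1)] uarr_1cell_simps[OF K(2)]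
  have e: "enc i'' j'' (uX (u1t (u2s \<kappa>))) \<star>\<^sub>l ((u2b \<kappa> \<star>\<^sub>h u2b \<theta>) \<star>\<^sub>r dec i j (uX (u1s (u2s \<theta>)))) =
      u2b (rename_uarr2 i' j' i'' j'' \<kappa>) \<star>\<^sub>h u2b (rename_uarr2 i j i' j' \<theta>)"
    by (rule ntrans_eqI) (use S in simp_all)
  have "rename_uarr1 i j i'' j'' (uarr_comp1 (u2s \<kappa>) (u2s \<theta>)) = uarr_comp1 (rename_uarr1 i' j' i'' j'' (u2s \<kappa>)) (rename_uarr1 i j i' j' (u2s \<theta>))"
    "rename_uarr1 i j i'' j'' (uarr_comp1 (u2t \<kappa>) (u2t \<theta>)) = uarr_comp1 (rename_uarr1 i' j' i'' j'' (u2t \<kappa>)) (rename_uarr1 i j i' j' (u2t \<theta>))"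
    by (rule rename_uarr1_comp1; use S in simp)+
  then show ?thesis using e by (intro uarr2.equality) simp_all
qed

subsection \<open>The 2-functor to universal arrows\<close>

lemma Psi_enc1_rename: "Psi_enc1 i j f = rename_uarr1 (i (e1s f)) (j (e1s f)) (i (e1t f)) (j (e1t f)) (Psi_1 f)"
  by (simp add: Psi_enc1_def rename_uarr1_def Let_def)

lemma Psi_simps [simp]:
  "F0 (Psi i j) S = rename_uarr (i S) (j S) (Psi_0 S)"
  "F1 (Psi i j) f = rename_uarr1 (i (e1s f)) (j (e1s f)) (i (e1t f)) (j (e1t f)) (Psi_1 f)"
  by (simp_all add: Psi_def Psi_enc1_rename)

lemma F2_Psi [simp]:
  assumes "emonad_2cell \<theta>" "e1s (e2s \<theta>) = S" "e1t (e2s \<theta>) = T"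
  shows "F2 (Psi i j) \<theta> = rename_uarr2 (i S) (j S) (i T) (j T) (Psi_2 \<theta>)"
  using assms emonad_2cell_simps(3,4)[OF assms(1)] by (simp add: Psi_def rename_uarr2_def Psi_enc1_rename Let_def)

abbreviation ealg_coding where
  "ealg_coding i j \<equiv> \<forall>S \<in> Cell0 EMnd. inj_on (i S) (Obj (EAlg S)) \<and> inj_on (j S) (Arr (EAlg S))"

lemma coding_EAlg: "ealg_coding i j \<Longrightarrow> extensive_monad S \<Longrightarrow> coding (i S) (j S) (EAlg S)"
  by (simp add: coding_def)

lemma Psi_1_comp1:
  assumes f: "emonad_1cell f" and g: "emonad_1cell g" and c: "e1s g = e1t f"
  shows "Psi_1 (emonad_comp1 g f) = uarr_comp1 (Psi_1 g) (Psi_1 f)"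
proof (rule uarr1.equality)
  have P: "uarr_1cell (uarr_comp1 (Psi_1 g) (Psi_1 f))" using f g c by simp
  have e: "eForget (e1s g) \<circ>\<^sub>F ehat f = e1P f \<circ>\<^sub>F eForget (e1s f)" using eForget_ehat[OF f] c by simp
  have e': "fst (ehat_obj f N) = FObj (e1P f) (fst N)" if "ealgebra (e1s f) N" for N by simp
  show "u1rho (Psi_1 (emonad_comp1 g f)) = u1rho (uarr_comp1 (Psi_1 g) (Psi_1 f))"
    by (rule ntrans_eqI) (use f g c e e' in simp_all)
qed (use f g c in \<open>simp_all add: ehat_comp1\<close>)

lemma Psi_1_one: "extensive_monad S \<Longrightarrow> Psi_1 (emonad_one S) = uarr_one (Psi_0 S)"
  by (rule uarr1.equality) (simp_all add: ehat_one)

lemma Psi_2_ide: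
  assumes f: "emonad_1cell f"
  shows "Psi_2 \<lparr>e2s = f, e2t = f, e2a = id_nat (e1P f)\<rparr> =
    \<lparr>u2s = Psi_1 f, u2t = Psi_1 f, u2a = id_nat (u1J (Psi_1 f)), u2b = id_nat (u1V (Psi_1 f))\<rparr>"
proof (rule uarr2.equality)
  have t: "uarr_2cell (Psi_2 \<lparr>e2s = f, e2t = f, e2a = id_nat (e1P f)\<rparr>)" using f by simp
  show "u2b (Psi_2 \<lparr>e2s = f, e2t = f, e2a = id_nat (e1P f)\<rparr>) =
      u2b \<lparr>u2s = Psi_1 f, u2t = Psi_1 f, u2a = id_nat (u1J (Psi_1 f)), u2b = id_nat (u1V (Psi_1 f))\<rparr>"
    by (rule ntrans_eqI) (use f uarr_2cell_simps(8)[OF t] in simp_all)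
qed simp_all

lemma Psi_2_vcomp:
  assumes t: "emonad_2cell \<theta>" and k: "emonad_2cell \<kappa>" and m: "e2s \<kappa> = e2t \<theta>"
  shows "Psi_2 (\<kappa> \<cdot>\<^bsub>Vert EMnd\<^esub> \<theta>) = Psi_2 \<kappa> \<cdot>\<^bsub>Vert UArr\<^esub> Psi_2 \<theta>"
proof -
  note T = emonad_2cell_simps[OF t] and K = emonad_2cell_simps[OF k]
  note S = t k m T K(5-7) emonad_1cell_simps[OF T(1)] emonad_1cell_simps[OF T(2)]
  have v: "emonad_2cell (\<kappa> \<cdot>\<^bsub>Vert EMnd\<^esub> \<theta>)" using emonad_2cell_vcomp[OF t k m] t k m by simp
  note N = uarr_2cell_simps(8)[OF uarr_2cell_Psi_2[OF v]] uarr_2cell_simps(8)[OF uarr_2cell_Psi_2[OF t]]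
    uarr_2cell_simps(8)[OF uarr_2cell_Psi_2[OF k]]
  have e: "u2b (Psi_2 (\<kappa> \<cdot>\<^bsub>Vert EMnd\<^esub> \<theta>)) = u2b (Psi_2 \<kappa>) \<circ>\<^sub>V u2b (Psi_2 \<theta>)"
  proof (rule ntrans_eqI)
    fix X assume "X \<in> Obj (FDom (NSrc (u2b (Psi_2 \<kappa>) \<circ>\<^sub>V u2b (Psi_2 \<theta>))))"
    then have X: "ealgebra (e1s (e2s \<theta>)) X" by simp
    then have X': "ealgebra (e1s (e2s \<kappa>)) X" using S by simp
    have "NCmp (u2b (Psi_2 \<theta>)) X \<in> Arr (EAlg (e1t (e2s \<theta>)))" "NCmp (u2b (Psi_2 \<kappa>)) X \<in> Arr (EAlg (e1t (e2s \<theta>)))"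
      using N(2,3) X X' S NCmp_simps(1)[OF N(2), of _ X] NCmp_simps(1)[OF N(3), of _ X] by (simp_all del: EAlg_simps(2) Psi_2_simps(6))
    then show "NCmp (u2b (Psi_2 (\<kappa> \<cdot>\<^bsub>Vert EMnd\<^esub> \<theta>))) X = NCmp (u2b (Psi_2 \<kappa>) \<circ>\<^sub>V u2b (Psi_2 \<theta>)) X"
      using X X' S by (simp del: EAlg_simps(2))
  qed (use N S in simp_all)
  then show ?thesis using t k m by (intro uarr2.equality) simp_all
qed

lemma Psi_2_hcomp:
  assumes t: "emonad_2cell \<theta>" and k: "emonad_2cell \<kappa>" and m: "e1s (e2s \<kappa>) = e1t (e2s \<theta>)"
  shows "Psi_2 (\<kappa> \<diamondop>\<^bsub>EMnd\<^esub> \<theta>) = Psi_2 \<kappa> \<diamondop>\<^bsub>UArr\<^esub> Psi_2 \<theta>"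
proof -
  note T = emonad_2cell_simps[OF t] and K = emonad_2cell_simps[OF k]
  note S = t k m T K emonad_1cell_simps[OF T(1)] emonad_1cell_simps[OF T(2)] emonad_1cell_simps[OF K(1)] emonad_1cell_simps[OF K(2)]
  have v: "emonad_2cell (\<kappa> \<diamondop>\<^bsub>EMnd\<^esub> \<theta>)" using emonad_2cell_hcomp[OF t k m] .
  note N = uarr_2cell_simps(8)[OF uarr_2cell_Psi_2[OF v]] uarr_2cell_simps(8)[OF uarr_2cell_Psi_2[OF t]]
    uarr_2cell_simps(8)[OF uarr_2cell_Psi_2[OF k]]
  have e: "u2b (Psi_2 (\<kappa> \<diamondop>\<^bsub>EMnd\<^esub> \<theta>)) = u2b (Psi_2 \<kappa>) \<star>\<^sub>h u2b (Psi_2 \<theta>)"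
  proof (rule ntrans_eqI)
    show "nat_trans (u2b (Psi_2 (\<kappa> \<diamondop>\<^bsub>EMnd\<^esub> \<theta>)))" by (rule N(1))
    show "nat_trans (u2b (Psi_2 \<kappa>) \<star>\<^sub>h u2b (Psi_2 \<theta>))" using N S by simp
    show "NSrc (u2b (Psi_2 (\<kappa> \<diamondop>\<^bsub>EMnd\<^esub> \<theta>))) = NSrc (u2b (Psi_2 \<kappa>) \<star>\<^sub>h u2b (Psi_2 \<theta>))"
      "NTrg (u2b (Psi_2 (\<kappa> \<diamondop>\<^bsub>EMnd\<^esub> \<theta>))) = NTrg (u2b (Psi_2 \<kappa>) \<star>\<^sub>h u2b (Psi_2 \<theta>))"
      using S by (simp_all add: ehat_comp1)
    fix X assume "X \<in> Obj (FDom (NSrc (u2b (Psi_2 \<kappa>) \<star>\<^sub>h u2b (Psi_2 \<theta>))))"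
    then have X: "ealgebra (e1s (e2s \<theta>)) X" by simp
    then have Y: "ealgebra (e1s (e2s \<kappa>)) (ehat_obj (e2t \<theta>) X)"
      using S ealgebra_ehat_obj[of "e2t \<theta>" X] by simp
    have 1: "NCmp (u2b (Psi_2 \<theta>)) X \<in> Arr (EAlg (e1s (e2s \<kappa>)))"
      using X S NCmp_simps(1)[OF N(2), of _ X] by (simp del: EAlg_simps(2) Psi_2_simps(6))
    have 2: "NCmp (u2b (Psi_2 \<kappa>)) (ehat_obj (e2t \<theta>) X) \<in> Arr (EAlg (e1t (e2s \<kappa>)))"
      using Y S NCmp_simps(1)[OF N(3), of _ "ehat_obj (e2t \<theta>) X"] by (simp del: EAlg_simps(2) Psi_2_simps(6))
    have 3: "FArr (ehat (e2s \<kappa>)) (NCmp (u2b (Psi_2 \<theta>)) X) \<in> Arr (EAlg (e1t (e2s \<kappa>)))"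
      using 1 S by (intro FArr_simps) (simp_all del: EAlg_simps(2) Psi_2_simps(6))
    show "NCmp (u2b (Psi_2 (\<kappa> \<diamondop>\<^bsub>EMnd\<^esub> \<theta>))) X = NCmp (u2b (Psi_2 \<kappa>) \<star>\<^sub>h u2b (Psi_2 \<theta>)) X"
      using X Y 1 2 3 N S by (simp add: ehat_obj_comp1 del: EAlg_simps(2))
  qed
  then show ?thesis using t k m by (intro uarr2.equality) (simp_all add: Psi_1_comp1)
qed

text \<open>
  \<open>\<Psi>\<close> takes values in categories of algebras and then renames these. Both steps preserve all
  compositions and identities.
\<close>

lemma two_functor_Psi:
  assumes c: "ealg_coding i j"
  shows "two_functor EMnd UArr (Psi i j)"
proof (rule two_functorI[OF two_category_EMnd two_category_UArr])
  note C = coding_EAlg[OF c]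
  show "F1 (Psi i j) f \<in> Cell1 UArr" if "f \<in> Cell1 EMnd" for f using that C by simp
  show "F2 (Psi i j) \<theta> \<in> Cell2 UArr" "Dom (Vert UArr) (F2 (Psi i j) \<theta>) = F1 (Psi i j) (Dom (Vert EMnd) \<theta>)"
    "Cod (Vert UArr) (F2 (Psi i j) \<theta>) = F1 (Psi i j) (Cod (Vert EMnd) \<theta>)" if "\<theta> \<in> Cell2 EMnd" for \<theta>
    using that C by simp_all
  show "F2 (Psi i j) (Ide (Vert EMnd) f) = Ide (Vert UArr) (F1 (Psi i j) f)" if "f \<in> Cell1 EMnd" for f
    using that C rename_uarr2_ide[of "Psi_1 f" "i (e1s f)" "j (e1s f)" "i (e1t f)" "j (e1t f)"]
    by (simp add: Psi_2_ide)
  show "F2 (Psi i j) (\<kappa> \<cdot>\<^bsub>Vert EMnd\<^esub> \<theta>) = F2 (Psi i j) \<kappa> \<cdot>\<^bsub>Vert UArr\<^esub> F2 (Psi i j) \<theta>"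
    if h: "\<theta> \<in> Cell2 EMnd" "\<kappa> \<in> Cell2 EMnd" "Dom (Vert EMnd) \<kappa> = Cod (Vert EMnd) \<theta>" for \<theta> \<kappa>
  proof -
    have t: "emonad_2cell \<theta>" "emonad_2cell \<kappa>" "e2s \<kappa> = e2t \<theta>" using h by simp_all
    have v: "emonad_2cell (\<kappa> \<cdot>\<^bsub>Vert EMnd\<^esub> \<theta>)" using emonad_2cell_vcomp[OF t] t by simp
    let ?S = "e1s (e2s \<theta>)" and ?T = "e1t (e2s \<theta>)"
    have s: "e1s (e2s (\<kappa> \<cdot>\<^bsub>Vert EMnd\<^esub> \<theta>)) = ?S" "e1t (e2s (\<kappa> \<cdot>\<^bsub>Vert EMnd\<^esub> \<theta>)) = ?T"
      "e1s (e2s \<kappa>) = ?S" "e1t (e2s \<kappa>) = ?T" using t by simp_all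
    have k: "ucoding (i ?S) (j ?S) (u1s (u2s (Psi_2 \<theta>)))" "ucoding (i ?T) (j ?T) (u1t (u2s (Psi_2 \<theta>)))"
      using C t(1) by simp_all
    show ?thesis
      unfolding F2_Psi[OF v s(1,2)] F2_Psi[OF t(1) refl refl] F2_Psi[OF t(2) s(3,4)] Psi_2_vcomp[OF t]
      by (rule rename_uarr2_vcomp[OF _ _ _ k]) (use t in simp_all)
  qed
  show "F2 (Psi i j) (\<kappa> \<diamondop>\<^bsub>EMnd\<^esub> \<theta>) = F2 (Psi i j) \<kappa> \<diamondop>\<^bsub>UArr\<^esub> F2 (Psi i j) \<theta>"
    if h: "\<theta> \<in> Cell2 EMnd" "\<kappa> \<in> Cell2 EMnd" "src2 EMnd \<kappa> = trg2 EMnd \<theta>" for \<theta> \<kappa>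
  proof -
    have t: "emonad_2cell \<theta>" "emonad_2cell \<kappa>" "e1s (e2s \<kappa>) = e1t (e2s \<theta>)" using h by simp_all
    have v: "emonad_2cell (\<kappa> \<diamondop>\<^bsub>EMnd\<^esub> \<theta>)" using emonad_2cell_hcomp[OF t] .
    let ?S = "e1s (e2s \<theta>)" and ?T = "e1t (e2s \<theta>)" and ?W = "e1t (e2s \<kappa>)"
    have s: "e1s (e2s (\<kappa> \<diamondop>\<^bsub>EMnd\<^esub> \<theta>)) = ?S" "e1t (e2s (\<kappa> \<diamondop>\<^bsub>EMnd\<^esub> \<theta>)) = ?W" by simp_all
    have k: "ucoding (i ?S) (j ?S) (u1s (u2s (Psi_2 \<theta>)))" "ucoding (i ?T) (j ?T) (u1t (u2s (Psi_2 \<theta>)))"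
      "ucoding (i ?W) (j ?W) (u1t (u2s (Psi_2 \<kappa>)))"
      using C t(1,2) by simp_all
    show ?thesis
      unfolding F2_Psi[OF v s] F2_Psi[OF t(1) refl refl] F2_Psi[OF t(2) t(3) refl] Psi_2_hcomp[OF t]
      by (rule rename_uarr2_hcomp[OF _ _ _ k]) (use t in simp_all)
  qed
  show "F1 (Psi i j) (one EMnd A) = one UArr (F0 (Psi i j) A)" if "A \<in> Cell0 EMnd" for A
    using that C by (simp add: Psi_1_one rename_uarr1_one)
  show "F1 (Psi i j) (g \<odot>\<^bsub>EMnd\<^esub> f) = F1 (Psi i j) g \<odot>\<^bsub>UArr\<^esub> F1 (Psi i j) f"
    if "f \<in> Cell1 EMnd" "g \<in> Cell1 EMnd" "src EMnd g = trg EMnd f" for f g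
  proof -
    have t: "emonad_1cell f" "emonad_1cell g" "e1s g = e1t f" using that by simp_all
    have k: "ucoding (i (e1s f)) (j (e1s f)) (u1s (Psi_1 f))" "ucoding (i (e1t f)) (j (e1t f)) (u1t (Psi_1 f))"
      "ucoding (i (e1t g)) (j (e1t g)) (u1t (Psi_1 g))"
      using C t(1,2) by simp_all
    show ?thesis using rename_uarr1_comp1[OF _ _ _ k] t by (simp add: Psi_1_comp1)
  qed
qed (use coding_EAlg[OF c] in simp_all)

section \<open>Independence of the codes\<close>

text \<open>The identity of \<open>U\<close>, read between two renamings of \<open>U\<close>.\<close>

definition recode ::
  "('a \<Rightarrow> 'x) \<Rightarrow> ('b \<Rightarrow> 'y) \<Rightarrow> ('a \<Rightarrow> 'x) \<Rightarrow> ('b \<Rightarrow> 'y) \<Rightarrow> ('o, 'm, 'a, 'b) uarr \<Rightarrow> ('o, 'm, 'x, 'y) uarr1" where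
  "recode i j i' j' U = \<lparr>u1s = rename_uarr i j U, u1t = rename_uarr i' j' U, u1J = id_functor (uC U),
    u1V = enc i' j' (uX U) \<circ>\<^sub>F dec i j (uX U), u1rho = id_nat (uR U \<circ>\<^sub>F dec i j (uX U))\<rparr>"

lemma recode_simps [simp]:
  "u1s (recode i j i' j' U) = rename_uarr i j U" "u1t (recode i j i' j' U) = rename_uarr i' j' U"
  "u1J (recode i j i' j' U) = id_functor (uC U)" "u1V (recode i j i' j' U) = enc i' j' (uX U) \<circ>\<^sub>F dec i j (uX U)"
  "u1rho (recode i j i' j' U) = id_nat (uR U \<circ>\<^sub>F dec i j (uX U))"
  by (simp_all add: recode_def)

lemma uarr_1cell_recode [simp]:
  assumes U: "universal_arrow U" and c: "ucoding i j U" "ucoding i' j' U"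
  shows "uarr_1cell (recode i j i' j' U)"
  by (rule uarr_1cellI) (use U c nat_iso_id[of "uR U \<circ>\<^sub>F dec i j (uX U)"] in simp_all)

lemma recode_inverse:
  assumes U: "universal_arrow U" and c: "ucoding i j U" "ucoding i' j' U"
  shows "uarr_comp1 (recode i' j' i j U) (recode i j i' j' U) = uarr_one (rename_uarr i j U)"
proof (rule uarr1.equality)
  show "u1rho (uarr_comp1 (recode i' j' i j U) (recode i j i' j' U)) = u1rho (uarr_one (rename_uarr i j U))"
    by (rule ntrans_eqI) (use U c in simp_all)
qed (use U c in simp_all)

lemma recode_natural:
  assumes f: "uarr_1cell f"
    and c: "ucoding i j (u1s f)" "ucoding i' j' (u1s f)" "ucoding k l (u1t f)" "ucoding k' l' (u1t f)"
  shows "uarr_comp1 (rename_uarr1 i' j' k' l' f) (recode i j i' j' (u1s f)) =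
    uarr_comp1 (recode k l k' l' (u1t f)) (rename_uarr1 i j k l f)"
proof (rule uarr1.equality)
  show "u1rho (uarr_comp1 (rename_uarr1 i' j' k' l' f) (recode i j i' j' (u1s f))) =
      u1rho (uarr_comp1 (recode k l k' l' (u1t f)) (rename_uarr1 i j k l f))"
    by (rule ntrans_eqI) (use f c in simp_all)
qed (use f c in simp_all)

lemma recode_natural2:
  assumes t: "uarr_2cell \<theta>"
    and c: "ucoding i j (u1s (u2s \<theta>))" "ucoding i' j' (u1s (u2s \<theta>))" "ucoding k l (u1t (u2s \<theta>))" "ucoding k' l' (u1t (u2s \<theta>))"
  shows "rename_uarr2 i' j' k' l' \<theta> \<diamondop>\<^bsub>UArr\<^esub> Ide (Vert UArr) (recode i j i' j' (u1s (u2s \<theta>))) =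
    Ide (Vert UArr) (recode k l k' l' (u1t (u2s \<theta>))) \<diamondop>\<^bsub>UArr\<^esub> rename_uarr2 i j k l \<theta>"
proof -
  note T = uarr_2cell_simps[OF t]
  note S = t c T uarr_1cell_simps(3-8)[OF T(1)] uarr_1cell_simps(3-8)[OF T(2)]
  have b: "u2b (rename_uarr2 i' j' k' l' \<theta>) \<star>\<^sub>h id_nat (enc i' j' (uX (u1s (u2s \<theta>))) \<circ>\<^sub>F dec i j (uX (u1s (u2s \<theta>)))) =
      id_nat (enc k' l' (uX (u1t (u2s \<theta>))) \<circ>\<^sub>F dec k l (uX (u1t (u2s \<theta>)))) \<star>\<^sub>h u2b (rename_uarr2 i j k l \<theta>)"
    by (rule ntrans_eqI) (use S in simp_all)
  have a: "uarr_comp1 (rename_uarr1 i' j' k' l' (u2s \<theta>)) (recode i j i' j' (u1s (u2s \<theta>))) =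
      uarr_comp1 (recode k l k' l' (u1t (u2s \<theta>))) (rename_uarr1 i j k l (u2s \<theta>))"
    "uarr_comp1 (rename_uarr1 i' j' k' l' (u2t \<theta>)) (recode i j i' j' (u1s (u2s \<theta>))) =
      uarr_comp1 (recode k l k' l' (u1t (u2s \<theta>))) (rename_uarr1 i j k l (u2t \<theta>))"
    by (rule recode_natural[OF T(1) c]) (rule recode_natural[OF T(2), unfolded T(3,4), OF c])
  have I: "Ide (Vert UArr) (recode i j i' j' (u1s (u2s \<theta>))) = \<lparr>u2s = recode i j i' j' (u1s (u2s \<theta>)), u2t = recode i j i' j' (u1s (u2s \<theta>)),
      u2a = id_nat (id_functor (uC (u1s (u2s \<theta>)))), u2b = id_nat (enc i' j' (uX (u1s (u2s \<theta>))) \<circ>\<^sub>F dec i j (uX (u1s (u2s \<theta>))))\<rparr>"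
    "Ide (Vert UArr) (recode k l k' l' (u1t (u2s \<theta>))) = \<lparr>u2s = recode k l k' l' (u1t (u2s \<theta>)), u2t = recode k l k' l' (u1t (u2s \<theta>)),
      u2a = id_nat (id_functor (uC (u1t (u2s \<theta>)))), u2b = id_nat (enc k' l' (uX (u1t (u2s \<theta>))) \<circ>\<^sub>F dec k l (uX (u1t (u2s \<theta>))))\<rparr>"
    using t c by simp_all
  show ?thesis
    unfolding I UArr_simps(6)
    by (rule uarr2.equality) (use t in \<open>simp_all add: a b del: rename_uarr2_simps(4)\<close>)
qed

text \<open>Up to renaming the recodings are identities, hence they are natural and invert each other.\<close>

lemma Psi_recode:
  assumes c: "ealg_coding i j" "ealg_coding i' j'"
  shows "two_natural_iso EMnd UArr (Psi i j) (Psi i' j') (\<lambda>S. recode (i S) (j S) (i' S) (j' S) (Psi_0 S))"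
proof -
  note C = coding_EAlg[OF c(1)] coding_EAlg[OF c(2)]
  have "two_natural EMnd UArr (Psi i j) (Psi i' j') (\<lambda>S. recode (i S) (j S) (i' S) (j' S) (Psi_0 S))"
  proof (rule two_naturalI[OF two_functor_Psi[OF c(1)] two_functor_Psi[OF c(2)]])
    show "F1 (Psi i' j') f \<odot>\<^bsub>UArr\<^esub> recode (i (src EMnd f)) (j (src EMnd f)) (i' (src EMnd f)) (j' (src EMnd f)) (Psi_0 (src EMnd f)) =
        recode (i (trg EMnd f)) (j (trg EMnd f)) (i' (trg EMnd f)) (j' (trg EMnd f)) (Psi_0 (trg EMnd f)) \<odot>\<^bsub>UArr\<^esub> F1 (Psi i j) f"
      if "f \<in> Cell1 EMnd" for f
    proof -
      have f: "emonad_1cell f" using that by simp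
      have k: "ucoding (i (e1s f)) (j (e1s f)) (u1s (Psi_1 f))" "ucoding (i' (e1s f)) (j' (e1s f)) (u1s (Psi_1 f))"
        "ucoding (i (e1t f)) (j (e1t f)) (u1t (Psi_1 f))" "ucoding (i' (e1t f)) (j' (e1t f)) (u1t (Psi_1 f))"
        using f C by simp_all
      show ?thesis using recode_natural[OF uarr_1cell_Psi_1[OF f] k] by simp
    qed
    show "F2 (Psi i' j') \<theta> \<diamondop>\<^bsub>UArr\<^esub> Ide (Vert UArr) (recode (i (src2 EMnd \<theta>)) (j (src2 EMnd \<theta>)) (i' (src2 EMnd \<theta>)) (j' (src2 EMnd \<theta>)) (Psi_0 (src2 EMnd \<theta>))) =
        Ide (Vert UArr) (recode (i (trg2 EMnd \<theta>)) (j (trg2 EMnd \<theta>)) (i' (trg2 EMnd \<theta>)) (j' (trg2 EMnd \<theta>)) (Psi_0 (trg2 EMnd \<theta>))) \<diamondop>\<^bsub>UArr\<^esub> F2 (Psi i j) \<theta>"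
      if "\<theta> \<in> Cell2 EMnd" for \<theta>
    proof -
      have t: "emonad_2cell \<theta>" using that by simp
      have s: "src2 EMnd \<theta> = e1s (e2s \<theta>)" "trg2 EMnd \<theta> = e1t (e2s \<theta>)" using t by simp_all
      show ?thesis
        unfolding F2_Psi[OF t refl refl] s
        by (rule recode_natural2[OF uarr_2cell_Psi_2[OF t], unfolded Psi_2_simps(1) Psi_1_simps(1,2)])
          (use t C in simp_all)
    qed
  qed (use C in simp_all)
  moreover have "invertible1 UArr (recode (i S) (j S) (i' S) (j' S) (Psi_0 S))" if "S \<in> Cell0 EMnd" for S
    unfolding invertible1_def
    by (intro conjI bexI[of _ "recode (i' S) (j' S) (i S) (j S) (Psi_0 S)"]) (use that C in \<open>simp_all add: recode_inverse\<close>)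
  ultimately show ?thesis by (simp add: two_natural_iso_def)
qed

section \<open>The 2-adjunction between universal arrows and extensive monads\<close>

definition cmp_functor :: "('o, 'm, 'x, 'y) uarr \<Rightarrow> ('x, 'y, ('o, 'm) ealg, ('o, 'm) ealg_arr) fctr" where
  "cmp_functor U = \<lparr>FDom = uX U, FCod = EAlg (Phi_0 U), FObj = restrict (cmp_alg U) (Obj (uX U)),
    FArr = (\<lambda>w\<in>Arr (uX U). (cmp_alg U (Dom (uX U) w), FArr (uR U) w, cmp_alg U (Cod (uX U) w)))\<rparr>"

lemma cmp_functor_simps [simp]:
  "FDom (cmp_functor U) = uX U" "FCod (cmp_functor U) = EAlg (Phi_0 U)"
  "X \<in> Obj (uX U) \<Longrightarrow> FObj (cmp_functor U) X = cmp_alg U X"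
  "w \<in> Arr (uX U) \<Longrightarrow> FArr (cmp_functor U) w = (cmp_alg U (Dom (uX U) w), FArr (uR U) w, cmp_alg U (Cod (uX U) w))"
  by (simp_all add: cmp_functor_def)

lemma cmp_functor_arr:
  "universal_arrow U \<Longrightarrow> w \<in> Arr (uX U) \<Longrightarrow>
    (cmp_alg U (Dom (uX U) w), FArr (uR U) w, cmp_alg U (Cod (uX U) w)) \<in> Arr (EAlg (Phi_0 U))"
  by (simp add: cmp_alg_hom)

lemma cat_functor_cmp_functor [simp]:
  assumes U: "universal_arrow U"
  shows "cat_functor (cmp_functor U)"
proof (rule cat_functorI)
  note a = cmp_functor_arr[OF U]
  show "FObj (cmp_functor U) \<in> extensional (Obj (FDom (cmp_functor U)))"
    "FArr (cmp_functor U) \<in> extensional (Arr (FDom (cmp_functor U)))" by (simp_all add: cmp_functor_def)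
  show "FArr (cmp_functor U) f \<in> Arr (FCod (cmp_functor U))"
    "Dom (FCod (cmp_functor U)) (FArr (cmp_functor U) f) = FObj (cmp_functor U) (Dom (FDom (cmp_functor U)) f)"
    "Cod (FCod (cmp_functor U)) (FArr (cmp_functor U) f) = FObj (cmp_functor U) (Cod (FDom (cmp_functor U)) f)"
    if "f \<in> Arr (FDom (cmp_functor U))" for f
    using that a[of f] U by (simp_all del: EAlg_simps(2))
  show "FArr (cmp_functor U) (g \<cdot>\<^bsub>FDom (cmp_functor U)\<^esub> f) = FArr (cmp_functor U) g \<cdot>\<^bsub>FCod (cmp_functor U)\<^esub> FArr (cmp_functor U) f"
    if "f \<in> Arr (FDom (cmp_functor U))" "g \<in> Arr (FDom (cmp_functor U))" "Dom (FDom (cmp_functor U)) g = Cod (FDom (cmp_functor U)) f" for f g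
    using that a[of f] a[of g] U by (simp del: EAlg_simps(2))
qed (use U in simp_all)

lemma eForget_cmp_functor [simp]:
  assumes U: "universal_arrow U"
  shows "eForget (Phi_0 U) \<circ>\<^sub>F cmp_functor U = uR U"
proof (rule functor_eqI)
  show "FArr (eForget (Phi_0 U) \<circ>\<^sub>F cmp_functor U) w = FArr (uR U) w" if "w \<in> Arr (FDom (uR U))" for w
    using that cmp_functor_arr[OF U that] U by (simp del: EAlg_simps(2))
qed (use U in simp_all)

lemma UArr_id_simps [simp]:
  "Cell0 UArr_id = {U. universal_arrow U}" "src UArr_id = u1s" "trg UArr_id = u1t" "one UArr_id = uarr_one"
  "comp1 UArr_id = uarr_comp1" "\<kappa> \<diamondop>\<^bsub>UArr_id\<^esub> \<theta> = \<kappa> \<diamondop>\<^bsub>UArr\<^esub> \<theta>"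
  "f \<in> Cell1 UArr_id \<longleftrightarrow> uarr_1cell f \<and> u1rho f = id_nat (u1J f \<circ>\<^sub>F uR (u1s f))"
  "\<theta> \<in> Cell2 UArr_id \<Longrightarrow> Dom (Vert UArr_id) \<theta> = u2s \<theta>" "\<theta> \<in> Cell2 UArr_id \<Longrightarrow> Cod (Vert UArr_id) \<theta> = u2t \<theta>"
  "f \<in> Cell1 UArr_id \<Longrightarrow> Ide (Vert UArr_id) f = \<lparr>u2s = f, u2t = f, u2a = id_nat (u1J f), u2b = id_nat (u1V f)\<rparr>"
  by (auto simp: UArr_id_def)

lemma UArr_id_Cell2:
  "\<theta> \<in> Cell2 UArr_id \<longleftrightarrow> uarr_2cell \<theta> \<and> u2s \<theta> \<in> Cell1 UArr_id \<and> u2t \<theta> \<in> Cell1 UArr_id"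
  by (auto simp: UArr_id_def)

lemma UArr_id_eqI:
  assumes "f \<in> Cell1 UArr_id" "g \<in> Cell1 UArr_id" "u1s f = u1s g" "u1t f = u1t g" "u1J f = u1J g" "u1V f = u1V g"
  shows "f = g"
  using assms by (intro uarr1.equality) simp_all

lemma UArr_id_comp1:
  "f \<in> Cell1 UArr_id \<Longrightarrow> g \<in> Cell1 UArr_id \<Longrightarrow> u1s g = u1t f \<Longrightarrow> uarr_comp1 g f \<in> Cell1 UArr_id"
  using two_categoryD(9)[OF two_category_UArr_id, of f g] by simp

lemma UArr_id_square_functor:
  assumes "f \<in> Cell1 UArr_id"
  shows "u1J f \<circ>\<^sub>F uR (u1s f) = uR (u1t f) \<circ>\<^sub>F u1V f"
proof -
  have f: "uarr_1cell f" "u1rho f = id_nat (u1J f \<circ>\<^sub>F uR (u1s f))" using assms by simp_all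
  have "NTrg (u1rho f) = u1J f \<circ>\<^sub>F uR (u1s f)" by (simp only: f(2) id_nat_simps)
  then show ?thesis by (simp only: uarr_1cell_simps(11)[OF f(1)])
qed

lemma UArr_id_square:
  assumes "f \<in> Cell1 UArr_id" "X \<in> Obj (uX (u1s f))"
  shows "FObj (uR (u1t f)) (FObj (u1V f) X) = FObj (u1J f) (FObj (uR (u1s f)) X)"
proof -
  have "u1J f \<circ>\<^sub>F uR (u1s f) = uR (u1t f) \<circ>\<^sub>F u1V f"
    by (rule UArr_id_square_functor[OF assms(1)])
  from arg_cong[OF this, of "\<lambda>F. FObj F X"] show ?thesis using assms by simp
qed

lemma UArr_id_square_arr:
  assumes "f \<in> Cell1 UArr_id" "w \<in> Arr (uX (u1s f))"
  shows "FArr (uR (u1t f)) (FArr (u1V f) w) = FArr (u1J f) (FArr (uR (u1s f)) w)"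
proof -
  have "u1J f \<circ>\<^sub>F uR (u1s f) = uR (u1t f) \<circ>\<^sub>F u1V f"
    by (rule UArr_id_square_functor[OF assms(1)])
  from arg_cong[OF this, of "\<lambda>F. FArr F w"] show ?thesis using assms by simp
qed

lemma UArr_id_2cell:
  assumes t: "\<theta> \<in> Cell2 UArr_id" and X: "X \<in> Obj (uX (u1s (u2s \<theta>)))"
  shows "FArr (uR (u1t (u2s \<theta>))) (NCmp (u2b \<theta>) X) = NCmp (u2a \<theta>) (FObj (uR (u1s (u2s \<theta>))) X)"
proof -
  have t': "uarr_2cell \<theta>" "u2s \<theta> \<in> Cell1 UArr_id" "u2t \<theta> \<in> Cell1 UArr_id" using t by (simp_all add: UArr_id_Cell2)
  note T = uarr_2cell_simps[OF t'(1)]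
  let ?C = "uC (u1t (u2s \<theta>))"
  have f: "u1rho (u2s \<theta>) = id_nat (u1J (u2s \<theta>) \<circ>\<^sub>F uR (u1s (u2s \<theta>)))"
    and g: "u1rho (u2t \<theta>) = id_nat (u1J (u2t \<theta>) \<circ>\<^sub>F uR (u1s (u2t \<theta>)))"
    using t'(2,3) by simp_all
  note sq = UArr_id_square[OF t'(2) X]
  have "NCmp (u1rho (u2s \<theta>)) X = Ide ?C (FObj (uR (u1t (u2s \<theta>))) (FObj (u1V (u2s \<theta>)) X))"
    unfolding f sq using T(1) X by simp
  moreover have "NCmp (u1rho (u2t \<theta>)) X = Ide ?C (FObj (u1J (u2t \<theta>)) (FObj (uR (u1s (u2s \<theta>))) X))"
    unfolding g T(3) using T(1-4) uarr_1cell_simps(4,5)[OF T(2)] X by simp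
  ultimately show ?thesis
    using uarr_2cell_rho[OF t'(1) X] T(1,5-10) X uarr_1cell_simps(3-5)[OF T(2)] T(3,4) by simp
qed

lemma u1Alg_strict:
  assumes f: "f \<in> Cell1 UArr_id" and X: "X \<in> Obj (uX (u1s f))"
  shows "u1Alg f X = cmp_alg (u1t f) (FObj (u1V f) X)"
proof (rule ealgebra_eqI[of "Phi_0 (u1t f)"])
  have f': "uarr_1cell f" "u1rho f = id_nat (u1J f \<circ>\<^sub>F uR (u1s f))" using f by simp_all
  have i: "u1rho' f X = Ide (uC (u1t f)) (FObj (u1J f) (FObj (uR (u1s f)) X))"
    using f' X by (simp add: nat_inv_id)
  have r: "NCmp (u1rho f) X = Ide (uC (u1t f)) (FObj (u1J f) (FObj (uR (u1s f)) X))" using f' X by simp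
  show "ealgebra (Phi_0 (u1t f)) (u1Alg f X)" using f' X by simp
  show "ealgebra (Phi_0 (u1t f)) (cmp_alg (u1t f) (FObj (u1V f) X))" using f' X by simp
  show "fst (u1Alg f X) = fst (cmp_alg (u1t f) (FObj (u1V f) X))" using UArr_id_square[OF f X] by simp
  show "snd (u1Alg f X) a = snd (cmp_alg (u1t f) (FObj (u1V f) X)) a"
    if "a \<in> Arr (eC (Phi_0 (u1t f)))" "Cod (eC (Phi_0 (u1t f))) a = fst (cmp_alg (u1t f) (FObj (u1V f) X))" for a
    using that f'(1) X UArr_id_square[OF f X] by (simp add: i r)
qed

lemma ealgebra_dec [simp]:
  "coding i j (EAlg S) \<Longrightarrow> X \<in> Obj (rename i j (EAlg S)) \<Longrightarrow> ealgebra S (FObj (dec i j (EAlg S)) X)"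
  using FObj_Obj[of "dec i j (EAlg S)" "EAlg S" X] by simp

lemma Psi_strict:
  assumes f: "emonad_1cell f" and c: "ealg_coding i j"
  shows "F1 (Psi i j) f \<in> Cell1 UArr_id"
proof -
  note C = coding_EAlg[OF c]
  have "u1rho (F1 (Psi i j) f) = id_nat (u1J (F1 (Psi i j) f) \<circ>\<^sub>F uR (u1s (F1 (Psi i j) f)))"
    by (rule ntrans_eqI) (use f C in simp_all)
  then show ?thesis using f C by simp
qed

lemma two_functor_Psi_id:
  assumes c: "ealg_coding i j"
  shows "two_functor EMnd UArr_id (Psi i j)"
  unfolding UArr_id_def
proof (rule two_functor_restrict_target[OF two_functor_Psi[OF c] two_category_UArr_id[unfolded UArr_id_def]])
  fix f :: "('a, 'b) emonad1" assume "f \<in> Cell1 EMnd"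
  then show "u1rho (F1 (Psi i j) f) = id_nat (u1J (F1 (Psi i j) f) \<circ>\<^sub>F uR (u1s (F1 (Psi i j) f)))"
    using Psi_strict[OF _ c, of f] by (simp del: Psi_simps)
qed

lemma two_functor_Phi_id: "two_functor UArr_id EMnd Phi"
  unfolding UArr_id_def by (rule two_functor_restrict_source[OF two_functor_Phi two_category_UArr_id[unfolded UArr_id_def]])

text \<open>
  The unit of the 2-adjunction: the comparison functor from the domain of \<open>R\<close> to the renamed
  category of algebras.
\<close>

definition unit_cmp ::
  "(('o, 'm) emonad \<Rightarrow> ('o, 'm) ealg \<Rightarrow> 'x) \<Rightarrow> (('o, 'm) emonad \<Rightarrow> ('o, 'm) ealg_arr \<Rightarrow> 'y)
    \<Rightarrow> ('o, 'm, 'x, 'y) uarr \<Rightarrow> ('o, 'm, 'x, 'y) uarr1" where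
  "unit_cmp i j U = (let S = Phi_0 U in \<lparr>u1s = U, u1t = rename_uarr (i S) (j S) (Psi_0 S), u1J = id_functor (uC U),
    u1V = enc (i S) (j S) (EAlg S) \<circ>\<^sub>F cmp_functor U, u1rho = id_nat (uR U)\<rparr>)"

lemma unit_cmp_simps [simp]:
  "u1s (unit_cmp i j U) = U" "u1t (unit_cmp i j U) = rename_uarr (i (Phi_0 U)) (j (Phi_0 U)) (Psi_0 (Phi_0 U))"
  "u1J (unit_cmp i j U) = id_functor (uC U)"
  "u1V (unit_cmp i j U) = enc (i (Phi_0 U)) (j (Phi_0 U)) (EAlg (Phi_0 U)) \<circ>\<^sub>F cmp_functor U"
  "u1rho (unit_cmp i j U) = id_nat (uR U)"
  by (simp_all add: unit_cmp_def Let_def)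

lemma unit_cmp_Cell1:
  assumes U: "universal_arrow U" and c: "ealg_coding i j"
  shows "unit_cmp i j U \<in> Cell1 UArr_id"
proof -
  note C = coding_EAlg[OF c]
  have "uarr_1cell (unit_cmp i j U)"
    by (rule uarr_1cellI) (use U C nat_iso_id[of "uR U"] in simp_all)
  then show ?thesis using U by simp
qed

lemma unit_cmp_natural:
  assumes f: "f \<in> Cell1 UArr_id" and c: "ealg_coding i j"
  shows "uarr_comp1 (F1 (Psi i j) (Phi_1 f)) (unit_cmp i j (u1s f)) = uarr_comp1 (unit_cmp i j (u1t f)) f"
proof (rule UArr_id_eqI)
  have f': "uarr_1cell f" using f by simp
  note C = coding_EAlg[OF c]
  have P: "F1 (Psi i j) (Phi_1 f) \<in> Cell1 UArr_id" using Psi_strict[OF _ c] f' by (simp del: Psi_simps UArr_id_simps)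
  show "uarr_comp1 (F1 (Psi i j) (Phi_1 f)) (unit_cmp i j (u1s f)) \<in> Cell1 UArr_id"
    by (rule UArr_id_comp1[OF unit_cmp_Cell1[OF _ c] P]) (use f' in simp_all)
  show "uarr_comp1 (unit_cmp i j (u1t f)) f \<in> Cell1 UArr_id"
    by (rule UArr_id_comp1[OF f unit_cmp_Cell1[OF _ c]]) (use f' in simp_all)
  have "ehat (Phi_1 f) \<circ>\<^sub>F cmp_functor (u1s f) = cmp_functor (u1t f) \<circ>\<^sub>F u1V f"
  proof (rule functor_eqI)
    show "FObj (ehat (Phi_1 f) \<circ>\<^sub>F cmp_functor (u1s f)) X = FObj (cmp_functor (u1t f) \<circ>\<^sub>F u1V f) X"
      if "X \<in> Obj (FDom (cmp_functor (u1t f) \<circ>\<^sub>F u1V f))" for X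
      using that f' by (simp add: ehat_obj_cmp_alg u1Alg_strict[OF f])
    show "FArr (ehat (Phi_1 f) \<circ>\<^sub>F cmp_functor (u1s f)) w = FArr (cmp_functor (u1t f) \<circ>\<^sub>F u1V f) w"
      if "w \<in> Arr (FDom (cmp_functor (u1t f) \<circ>\<^sub>F u1V f))" for w
      using that f' cmp_functor_arr[of "u1s f" w]
      by (simp add: ehat_obj_cmp_alg u1Alg_strict[OF f] UArr_id_square_arr[OF f] del: EAlg_simps(2))
  qed (use f' in simp_all)
  then show "u1V (uarr_comp1 (F1 (Psi i j) (Phi_1 f)) (unit_cmp i j (u1s f))) = u1V (uarr_comp1 (unit_cmp i j (u1t f)) f)"
    using f' C by simp
qed (use f in simp_all)

lemma unit_cmp_natural2:
  assumes t: "\<theta> \<in> Cell2 UArr_id" and c: "ealg_coding i j"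
  shows "F2 (Psi i j) (F2 Phi \<theta>) \<diamondop>\<^bsub>UArr\<^esub> Ide (Vert UArr_id) (unit_cmp i j (u1s (u2s \<theta>))) =
    Ide (Vert UArr_id) (unit_cmp i j (u1t (u2s \<theta>))) \<diamondop>\<^bsub>UArr\<^esub> \<theta>"
proof -
  note C = coding_EAlg[OF c]
  have t': "uarr_2cell \<theta>" "u2s \<theta> \<in> Cell1 UArr_id" "u2t \<theta> \<in> Cell1 UArr_id" using t by (simp_all add: UArr_id_Cell2)
  note T = uarr_2cell_simps[OF t'(1)]
  let ?U = "u1s (u2s \<theta>)" and ?T = "u1t (u2s \<theta>)" and ?f = "u2s \<theta>" and ?g = "u2t \<theta>"
  have U: "universal_arrow ?U" "universal_arrow ?T" using T by simp_all
  have P: "emonad_2cell (F2 Phi \<theta>)" using emonad_2cell_Phi[OF t'(1)] .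
  have F2: "F2 (Psi i j) (F2 Phi \<theta>) = rename_uarr2 (i (Phi_0 ?U)) (j (Phi_0 ?U)) (i (Phi_0 ?T)) (j (Phi_0 ?T)) (Psi_2 (F2 Phi \<theta>))"
    by (rule F2_Psi[OF P]) simp_all
  have P2: "uarr_2cell (Psi_2 (F2 Phi \<theta>))" using P by simp
  have I: "Ide (Vert UArr_id) (unit_cmp i j W) = \<lparr>u2s = unit_cmp i j W, u2t = unit_cmp i j W, u2a = id_nat (id_functor (uC W)),
      u2b = id_nat (u1V (unit_cmp i j W))\<rparr>" if "universal_arrow W" for W
    using UArr_id_simps(10)[OF unit_cmp_Cell1[OF that c]] by simp
  have n: "nat_trans (u2b (F2 (Psi i j) (F2 Phi \<theta>)))" "NSrc (u2b (F2 (Psi i j) (F2 Phi \<theta>))) = u1V (F1 (Psi i j) (Phi_1 ?f))"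
      "NTrg (u2b (F2 (Psi i j) (F2 Phi \<theta>))) = u1V (F1 (Psi i j) (Phi_1 ?g))"
    unfolding F2 using uarr_2cell_simps(8-10)[OF P2] T U C by simp_all
  have V: "u1V (uarr_comp1 (F1 (Psi i j) (Phi_1 h)) (unit_cmp i j ?U)) = u1V (uarr_comp1 (unit_cmp i j ?T) h)"
    if "h \<in> Cell1 UArr_id" "u1s h = ?U" "u1t h = ?T" for h
    using unit_cmp_natural[OF that(1) c] that(2,3) by simp
  have b: "u2b (F2 (Psi i j) (F2 Phi \<theta>)) \<star>\<^sub>h id_nat (u1V (unit_cmp i j ?U)) = id_nat (u1V (unit_cmp i j ?T)) \<star>\<^sub>h u2b \<theta>"
  proof (rule ntrans_eqI)
    show "nat_trans (u2b (F2 (Psi i j) (F2 Phi \<theta>)) \<star>\<^sub>h id_nat (u1V (unit_cmp i j ?U)))"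
      using n U C T by simp
    show "nat_trans (id_nat (u1V (unit_cmp i j ?T)) \<star>\<^sub>h u2b \<theta>)" using U C T by simp
    show "NSrc (u2b (F2 (Psi i j) (F2 Phi \<theta>)) \<star>\<^sub>h id_nat (u1V (unit_cmp i j ?U))) = NSrc (id_nat (u1V (unit_cmp i j ?T)) \<star>\<^sub>h u2b \<theta>)"
      using V[OF t'(2)] n T by (simp del: Psi_simps unit_cmp_simps(4))
    show "NTrg (u2b (F2 (Psi i j) (F2 Phi \<theta>)) \<star>\<^sub>h id_nat (u1V (unit_cmp i j ?U))) = NTrg (id_nat (u1V (unit_cmp i j ?T)) \<star>\<^sub>h u2b \<theta>)"
      using V[OF t'(3)] n T by (simp del: Psi_simps unit_cmp_simps(4))
    fix X assume "X \<in> Obj (FDom (NSrc (id_nat (u1V (unit_cmp i j ?T)) \<star>\<^sub>h u2b \<theta>)))"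
    then have X: "X \<in> Obj (uX ?U)" using T by simp
    have X': "X \<in> Obj (uX (u1s ?g))" using X T by simp
    have al: "ealgebra (Phi_0 ?U) (cmp_alg ?U X)" using X U by simp
    let ?B = "NCmp (u2b \<theta>) X"
    have B: "?B \<in> Arr (uX ?T)" "Dom (uX ?T) ?B = FObj (u1V ?f) X" "Cod (uX ?T) ?B = FObj (u1V ?g) X" using X T by simp_all
    have e: "NCmp (u2b (Psi_2 (F2 Phi \<theta>))) (cmp_alg ?U X) = FArr (cmp_functor ?T) ?B"
      using al X X' T B ehat_obj_cmp_alg[OF T(1), of X] ehat_obj_cmp_alg[OF T(2), of X]
        u1Alg_strict[OF t'(2) X] u1Alg_strict[OF t'(3) X'] UArr_id_2cell[OF t X] by simp
    have eh: "ehat_obj (Phi_1 ?f) (cmp_alg ?U X) = cmp_alg ?T (FObj (u1V ?f) X)"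
      using ehat_obj_cmp_alg[OF T(1) X] u1Alg_strict[OF t'(2) X] by simp
    have F: "FArr (cmp_functor ?T) ?B \<in> Arr (EAlg (Phi_0 ?T))" using B U by (intro FArr_simps) simp_all
    show "NCmp (u2b (F2 (Psi i j) (F2 Phi \<theta>)) \<star>\<^sub>h id_nat (u1V (unit_cmp i j ?U))) X = NCmp (id_nat (u1V (unit_cmp i j ?T)) \<star>\<^sub>h u2b \<theta>) X"
      using X T U C al n B F unfolding F2
      by (simp add: e eh del: Psi_2_simps(6) cmp_functor_simps(4) EAlg_simps(2-4))
  qed
  have a: "uarr_comp1 (F1 (Psi i j) (Phi_1 ?f)) (unit_cmp i j ?U) = uarr_comp1 (unit_cmp i j ?T) ?f"
    "uarr_comp1 (F1 (Psi i j) (Phi_1 ?g)) (unit_cmp i j ?U) = uarr_comp1 (unit_cmp i j ?T) ?g"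
    using unit_cmp_natural[OF t'(2) c] unit_cmp_natural[OF t'(3) c] T by simp_all
  have s: "u2s (F2 (Psi i j) (F2 Phi \<theta>)) = F1 (Psi i j) (Phi_1 ?f)" "u2t (F2 (Psi i j) (F2 Phi \<theta>)) = F1 (Psi i j) (Phi_1 ?g)"
    "u2a (F2 (Psi i j) (F2 Phi \<theta>)) = u2a \<theta>"
    unfolding F2 using T by simp_all
  show ?thesis
    unfolding I[OF U(1)] I[OF U(2)]
    by (rule uarr2.equality) (use a b s T in \<open>simp_all del: Psi_simps unit_cmp_simps F2_Psi\<close>)
qed

lemma Phi_Psi_0:
  assumes S: "extensive_monad S" and c: "ealg_coding i j"
  shows "Phi_0 (F0 (Psi i j) S) = S"
proof -
  note C = coding_EAlg[OF c S]
  have U: "universal_arrow (F0 (Psi i j) S)" using S C by simp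
  note P = extensive_monad_Phi_0[OF U]
  have e: "eS (Phi_0 (F0 (Psi i j) S)) = eS S"
  proof (rule extensionalityI[OF _ extensive_monad_ext(1)[OF S]])
    show "eS (Phi_0 (F0 (Psi i j) S)) \<in> extensional (Obj (eC S))" using extensive_monad_ext(1)[OF P] by simp
  qed (use S C in simp)
  have "eExt (Phi_0 (F0 (Psi i j) S)) = eExt S"
  proof (rule extensionalityI[OF _ extensive_monad_ext(3)[OF S]])
    show "eExt (Phi_0 (F0 (Psi i j) S)) \<in> extensional (Obj (eC S))" by (simp add: Phi_0_def)
    show "eExt (Phi_0 (F0 (Psi i j) S)) B = eExt S B" if B: "B \<in> Obj (eC S)" for B
    proof (rule extensionalityI[OF _ extensive_monad_ext(4)[OF S B]])
      show "eExt (Phi_0 (F0 (Psi i j) S)) B \<in> extensional (Into (eC S) (eS S B))"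
        using extensive_monad_ext(4)[OF P, of B] B unfolding e by simp
      fix h assume h: "h \<in> Into (eC S) (eS S B)"
      have m: "(eFree S (Dom (eC S) h), snd (eFree S B) h, eFree S B) \<in> Arr (EAlg S)"
        using ealg_hom_free[OF S ealgebra_eFree[OF S B], of h] h B S by simp
      show "eExt (Phi_0 (F0 (Psi i j) S)) B h = eExt S B h"
        using h B S C m by (simp del: EAlg_simps(2))
    qed
  qed
  with e show ?thesis by (intro emonad.equality) simp_all
qed

lemma cmp_alg_Psi:
  assumes S: "extensive_monad S" and c: "ealg_coding i j" and X: "X \<in> Obj (rename (i S) (j S) (EAlg S))"
  shows "cmp_alg (F0 (Psi i j) S) X = FObj (dec (i S) (j S) (EAlg S)) X"
proof -
  note C = coding_EAlg[OF c S]
  let ?N = "FObj (dec (i S) (j S) (EAlg S)) X"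
  have "?N \<in> Obj (EAlg S)" using X C by (intro FObj_Obj) simp_all
  then have N: "ealgebra S ?N" by simp
  have U: "universal_arrow (F0 (Psi i j) S)" using S C by simp
  have "ealgebra (Phi_0 (F0 (Psi i j) S)) (cmp_alg (F0 (Psi i j) S) X)"
    by (rule ealgebra_cmp_alg[OF U]) (use X in simp)
  then have "ealgebra S (cmp_alg (F0 (Psi i j) S) X)" unfolding Phi_Psi_0[OF S c] .
  then show ?thesis
  proof (rule ealgebra_eqI[OF _ N])
    show "fst (cmp_alg (F0 (Psi i j) S) X) = fst ?N" using X C N by simp
    fix a assume a: "a \<in> Arr (eC S)" "Cod (eC S) a = fst ?N"
    have m: "(eFree S (Dom (eC S) a), snd ?N a, ?N) \<in> Arr (EAlg S)"
      using ealg_hom_free[OF S N a] a S N by simp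
    show "snd (cmp_alg (F0 (Psi i j) S) X) a = snd ?N a"
      using a X C N S m by (simp del: EAlg_simps(2))
  qed
qed

lemma Phi_Psi_1:
  assumes f: "emonad_1cell f" and c: "ealg_coding i j"
  shows "Phi_1 (F1 (Psi i j) f) = f"
proof (rule emonad1_eqI)
  note C = coding_EAlg[OF c]
  let ?f = "F1 (Psi i j) f"
  have P: "?f \<in> Cell1 UArr_id" using Psi_strict[OF f c] .
  then show "emonad_1cell (Phi_1 ?f)" by simp
  have s: "u1s ?f = F0 (Psi i j) (e1s f)" "u1t ?f = F0 (Psi i j) (e1t f)" by simp_all
  show S: "e1s (Phi_1 ?f) = e1s f" "e1t (Phi_1 ?f) = e1t f"
    using Phi_Psi_0[OF _ c] f s by (simp_all del: Psi_simps)
  fix A assume A: "A \<in> Obj (eC (e1s f))"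
  let ?X = "FObj (enc (i (e1s f)) (j (e1s f)) (EAlg (e1s f))) (eFree (e1s f) A)"
  have X: "?X \<in> Obj (rename (i (e1s f)) (j (e1s f)) (EAlg (e1s f)))" using f A C by (intro FObj_Obj) simp_all
  have L: "uL (u1s ?f) A = ?X" using f A by simp
  have VX: "FObj (u1V ?f) ?X = FObj (enc (i (e1t f)) (j (e1t f)) (EAlg (e1t f))) (e1Alg f A)"
    using f A X C ehat_obj_eFree[OF f A] by simp
  have VX': "FObj (u1V ?f) ?X \<in> Obj (rename (i (e1t f)) (j (e1t f)) (EAlg (e1t f)))"
    unfolding VX using f A C by (intro FObj_Obj) simp_all
  have "u1Alg ?f ?X = cmp_alg (F0 (Psi i j) (e1t f)) (FObj (u1V ?f) ?X)"
    using u1Alg_strict[OF P, of ?X] X s f by simp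
  also have "\<dots> = FObj (dec (i (e1t f)) (j (e1t f)) (EAlg (e1t f))) (FObj (u1V ?f) ?X)"
    by (rule cmp_alg_Psi[OF _ c VX']) (use f in simp)
  also have "\<dots> = e1Alg f A" unfolding VX using f A C by simp
  finally have "snd (u1Alg ?f (uL (u1s ?f) A)) = e1Ext f A" unfolding L by simp
  moreover have "A \<in> Obj (uC (u1s ?f))" using A by simp
  ultimately show "e1Ext (Phi_1 ?f) A = e1Ext f A" using Phi_1_simps(4)[of A ?f] by simp
qed (use f in simp_all)

lemma Phi_Psi_eq:
  assumes c: "ealg_coding i j"
  shows "two_functor_eq EMnd (Phi \<circ>\<^sub>2 Psi i j) two_id"
proof -
  have "F2 Phi (F2 (Psi i j) \<theta>) = \<theta>" if t: "emonad_2cell \<theta>" for \<theta>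
  proof (rule emonad2.equality)
    have s: "u2s (F2 (Psi i j) \<theta>) = F1 (Psi i j) (e2s \<theta>)" "u2t (F2 (Psi i j) \<theta>) = F1 (Psi i j) (e2t \<theta>)"
      "u2a (F2 (Psi i j) \<theta>) = e2a \<theta>"
      using t by simp_all
    then show "e2s (F2 Phi (F2 (Psi i j) \<theta>)) = e2s \<theta>" "e2t (F2 Phi (F2 (Psi i j) \<theta>)) = e2t \<theta>" "e2a (F2 Phi (F2 (Psi i j) \<theta>)) = e2a \<theta>"
      using t Phi_Psi_1[OF _ c] by (simp_all del: Psi_simps F2_Psi)
  qed simp
  then show ?thesis using Phi_Psi_0[OF _ c] Phi_Psi_1[OF _ c] by (simp add: two_functor_eq_def del: Psi_simps)
qed

lemma two_natural_id:
  assumes K: "two_category K"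
  shows "two_natural K K two_id two_id (one K)"
proof -
  interpret K: two_category K by (fact K)
  note D = two_categoryD[OF K]
  show ?thesis
    by (rule two_naturalI[OF two_functor_id[OF K] two_functor_id[OF K]])
      (simp_all add: D K.comp1_one_left K.comp1_one_right K.comp2_one_left K.comp2_one_right)
qed

lemma Phi_1_unit_cmp:
  assumes U: "universal_arrow U" and c: "ealg_coding i j"
  shows "Phi_1 (unit_cmp i j U) = emonad_one (Phi_0 U)"
proof (rule emonad1_eqI)
  let ?f = "unit_cmp i j U" and ?S = "Phi_0 U"
  have S: "extensive_monad ?S" using U by simp
  note C = coding_EAlg[OF c S]
  have P: "?f \<in> Cell1 UArr_id" using unit_cmp_Cell1[OF U c] .
  have t: "u1t ?f = F0 (Psi i j) ?S" by simp
  show "emonad_1cell (Phi_1 ?f)" using P by simp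
  show "e1t (Phi_1 ?f) = e1t (emonad_one ?S)" using t Phi_Psi_0[OF S c] by (simp del: Psi_simps unit_cmp_simps(2))
  fix A assume "A \<in> Obj (eC (e1s (emonad_one ?S)))"
  then have A: "A \<in> Obj (uC U)" by simp
  have L: "uL U A \<in> Obj (uX U)" using A U by simp
  have V: "FObj (u1V ?f) (uL U A) = FObj (enc (i ?S) (j ?S) (EAlg ?S)) (cmp_alg U (uL U A))" using L by simp
  have V': "FObj (u1V ?f) (uL U A) \<in> Obj (rename (i ?S) (j ?S) (EAlg ?S))"
    unfolding V using L U C by (intro FObj_Obj) simp_all
  have "u1Alg ?f (uL U A) = cmp_alg (F0 (Psi i j) ?S) (FObj (u1V ?f) (uL U A))"
    using u1Alg_strict[OF P, of "uL U A"] L t by simp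
  also have "\<dots> = eFree ?S A"
    unfolding cmp_alg_Psi[OF S c V'] unfolding V using L U C A by (simp add: cmp_alg_free)
  finally show "e1Ext (Phi_1 ?f) A = e1Ext (emonad_one ?S) A" using A by (simp del: unit_cmp_simps(2-))
qed (use U in simp_all)

lemma unit_cmp_Psi:
  assumes S: "extensive_monad S" and c: "ealg_coding i j"
  shows "unit_cmp i j (F0 (Psi i j) S) = uarr_one (F0 (Psi i j) S)"
proof (rule UArr_id_eqI)
  let ?U = "F0 (Psi i j) S"
  note C = coding_EAlg[OF c S]
  have U: "universal_arrow ?U" using S C by simp
  note P = Phi_Psi_0[OF S c]
  show "unit_cmp i j ?U \<in> Cell1 UArr_id" using unit_cmp_Cell1[OF U c] .
  show "uarr_one ?U \<in> Cell1 UArr_id" using two_categoryD(6)[OF two_category_UArr_id, of ?U] U by simp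
  show "u1t (unit_cmp i j ?U) = u1t (uarr_one ?U)" using P by simp
  let ?E = "enc (i S) (j S) (EAlg S)" and ?D = "dec (i S) (j S) (EAlg S)"
  have R: "uR ?U = eForget S \<circ>\<^sub>F ?D" by simp
  have "cmp_functor ?U = ?D"
  proof (rule functor_eqI)
    show "cat_functor (cmp_functor ?U)" using U by (rule cat_functor_cmp_functor)
    show "cat_functor ?D" using C by simp
    show "FDom (cmp_functor ?U) = FDom ?D" by simp
    show "FCod (cmp_functor ?U) = FCod ?D" using P by simp
    show "FObj (cmp_functor ?U) X = FObj ?D X" if "X \<in> Obj (FDom ?D)" for X
      using that cmp_alg_Psi[OF S c, of X] by simp
    fix w assume "w \<in> Arr (FDom ?D)"
    then have w: "w \<in> Arr (rename (i S) (j S) (EAlg S))" by simp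
    have D: "FArr ?D w \<in> Arr (EAlg S)" "Dom (EAlg S) (FArr ?D w) = FObj ?D (Dom (rename (i S) (j S) (EAlg S)) w)"
      "Cod (EAlg S) (FArr ?D w) = FObj ?D (Cod (rename (i S) (j S) (EAlg S)) w)"
      using FArr_simps[of ?D "EAlg S" w] C w by simp_all
    have "fst (FArr ?D w) = FObj ?D (Dom (rename (i S) (j S) (EAlg S)) w)"
      "snd (snd (FArr ?D w)) = FObj ?D (Cod (rename (i S) (j S) (EAlg S)) w)"
      using D(2,3) EAlg_simps(3,4)[OF D(1)] by simp_all
    then have m: "FArr ?D w = (FObj ?D (Dom (rename (i S) (j S) (EAlg S)) w), fst (snd (FArr ?D w)), FObj ?D (Cod (rename (i S) (j S) (EAlg S)) w))"
      by (metis prod.collapse)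
    have r: "FArr (uR ?U) w = fst (snd (FArr ?D w))" using w D(1) by (simp del: EAlg_simps(2))
    have DC: "Dom (rename (i S) (j S) (EAlg S)) w \<in> Obj (rename (i S) (j S) (EAlg S))"
      "Cod (rename (i S) (j S) (EAlg S)) w \<in> Obj (rename (i S) (j S) (EAlg S))" using w C by simp_all
    have "FArr (cmp_functor ?U) w = (cmp_alg ?U (Dom (rename (i S) (j S) (EAlg S)) w), FArr (uR ?U) w, cmp_alg ?U (Cod (rename (i S) (j S) (EAlg S)) w))"
      using w by simp
    then show "FArr (cmp_functor ?U) w = FArr ?D w"
      unfolding r cmp_alg_Psi[OF S c DC(1)] cmp_alg_Psi[OF S c DC(2)] using m by simp
  qed
  then show "u1V (unit_cmp i j ?U) = u1V (uarr_one ?U)" using P C by (simp del: Psi_simps) simp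
qed simp_all

text \<open>
  \<open>\<Phi> \<Psi>\<close> is the identity, so the counit is an identity; the unit compares a universal arrow with
  the algebras of its monad. Its naturality at a 1-cell \<open>(J, V, \<rho>)\<close> uses \<open>\<rho> = 1\<close>, for which the
  structure transported along \<open>\<rho>\<close> is that of \<open>V X\<close> itself.
\<close>

lemma two_adjunction_Phi_Psi:
  assumes c: "ealg_coding i j"
  shows "two_adjunction UArr_id EMnd Phi (Psi i j)"
proof -
  note G = two_functor_Psi_id[OF c] and F = two_functor_Phi_id
  have "two_natural UArr_id UArr_id two_id (Psi i j \<circ>\<^sub>2 Phi) (unit_cmp i j)"
  proof (rule two_naturalI[OF two_functor_id[OF two_category_UArr_id] two_functor_comp[OF F G]])
    show "unit_cmp i j A \<in> Cell1 UArr_id" if "A \<in> Cell0 UArr_id" for A using unit_cmp_Cell1[OF _ c] that by simp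
    show "F1 (Psi i j \<circ>\<^sub>2 Phi) f \<odot>\<^bsub>UArr_id\<^esub> unit_cmp i j (src UArr_id f) = unit_cmp i j (trg UArr_id f) \<odot>\<^bsub>UArr_id\<^esub> F1 two_id f"
      if "f \<in> Cell1 UArr_id" for f
      using unit_cmp_natural[OF that c] by simp
    show "F2 (Psi i j \<circ>\<^sub>2 Phi) \<theta> \<diamondop>\<^bsub>UArr_id\<^esub> Ide (Vert UArr_id) (unit_cmp i j (src2 UArr_id \<theta>)) =
        Ide (Vert UArr_id) (unit_cmp i j (trg2 UArr_id \<theta>)) \<diamondop>\<^bsub>UArr_id\<^esub> F2 two_id \<theta>"
      if t: "\<theta> \<in> Cell2 UArr_id" for \<theta>
      using unit_cmp_natural2[OF t c] t UArr_id_simps(8)[OF t] by (simp del: UArr_simps UArr_id_simps(10))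
  qed simp_all
  moreover have "two_natural EMnd EMnd (Phi \<circ>\<^sub>2 Psi i j) two_id emonad_one"
    by (rule two_natural_cong[OF two_natural_id[OF two_category_EMnd] two_functor_eq_sym[OF Phi_Psi_eq[OF c]]])
      (simp_all add: two_functor_eq_def)
  moreover have "emonad_one (F0 Phi A) \<odot>\<^bsub>EMnd\<^esub> F1 Phi (unit_cmp i j A) = one EMnd (F0 Phi A)" if "A \<in> Cell0 UArr_id" for A
    using that by (simp add: Phi_1_unit_cmp[OF _ c] emonad_comp1_one)
  moreover have "F1 (Psi i j) (emonad_one B) \<odot>\<^bsub>UArr_id\<^esub> unit_cmp i j (F0 (Psi i j) B) = one UArr_id (F0 (Psi i j) B)"
    if "B \<in> Cell0 EMnd" for B
  proof -
    have B: "extensive_monad B" using that by simp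
    have "universal_arrow (F0 (Psi i j) B)" using B coding_EAlg[OF c B] by simp
    then show ?thesis
      using unit_cmp_Psi[OF B c] two_functorD(12)[OF two_functor_Psi[OF c] that]
      by (simp add: uarr_comp1_one del: Psi_simps)
  qed
  ultimately show ?thesis unfolding two_adjunction_def using F G by blast
qed

section \<open>Extensive algebras are classical algebras\<close>

lemma calgebra_simps [simp]:
  assumes "calgebra M N"
  shows "fst N \<in> Obj (mC M)" "snd N \<in> Arr (mC M)" "Dom (mC M) (snd N) = FObj (mS M) (fst N)" "Cod (mC M) (snd N) = fst N"
    "snd N \<cdot>\<^bsub>mC M\<^esub> NCmp (mEta M) (fst N) = Ide (mC M) (fst N)"
  using assms by (auto simp: calgebra_def)

lemma calgebra_mu:
  "calgebra M N \<Longrightarrow> snd N \<cdot>\<^bsub>mC M\<^esub> FArr (mS M) (snd N) = snd N \<cdot>\<^bsub>mC M\<^esub> NCmp (mMu M) (fst N)"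
  by (auto simp: calgebra_def)

lemma calg_homD:
  assumes "calg_hom M A q B"
  shows "q \<in> Arr (mC M)" "Dom (mC M) q = fst A" "Cod (mC M) q = fst B" "q \<cdot>\<^bsub>mC M\<^esub> snd A = snd B \<cdot>\<^bsub>mC M\<^esub> FArr (mS M) q"
  using assms by (auto simp: calg_hom_def)

lemma CAlg_simps [simp]:
  "Obj (CAlg M) = {N. calgebra M N}" "Arr (CAlg M) = {(A, q, B). calgebra M A \<and> calgebra M B \<and> calg_hom M A q B}"
  "m \<in> Arr (CAlg M) \<Longrightarrow> Dom (CAlg M) m = fst m" "m \<in> Arr (CAlg M) \<Longrightarrow> Cod (CAlg M) m = snd (snd m)"
  "calgebra M N \<Longrightarrow> Ide (CAlg M) N = (N, Ide (mC M) (fst N), N)"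
  "l \<in> Arr (CAlg M) \<Longrightarrow> m \<in> Arr (CAlg M) \<Longrightarrow> fst l = snd (snd m) \<Longrightarrow>
    l \<cdot>\<^bsub>CAlg M\<^esub> m = (fst m, fst (snd l) \<cdot>\<^bsub>mC M\<^esub> fst (snd m), snd (snd l))"
  unfolding CAlg_def by simp_all

lemma calg_hom_comp:
  assumes M: "classical_monad M" and A: "calgebra M A" "calgebra M B" "calgebra M D"
    and p: "calg_hom M A p B" and q: "calg_hom M B q D"
  shows "calg_hom M A (q \<cdot>\<^bsub>mC M\<^esub> p) D"
proof -
  have c: "category (mC M)" using M by simp
  note P = calg_homD[OF p] and Q = calg_homD[OF q]
  show ?thesis
    using M A c P(1-3) Q(1-3) by (simp add: calg_hom_def P(4) Cmp_extend[OF Q(4)])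
qed

lemma category_CAlg [simp]:
  assumes M: "classical_monad M"
  shows "category (CAlg M)"
proof -
  have c: "category (mC M)" using M by simp
  have i: "calg_hom M N (Ide (mC M) (fst N)) N" if "calgebra M N" for N
    using that M c by (simp add: calg_hom_def)
  note H = calg_homD(1-3)
  show ?thesis
    unfolding CAlg_def
    by (rule category_mk_category) (use M c in \<open>auto simp: i H intro: calg_hom_comp\<close>)
qed

text \<open>
  The associativity law for \<open>b = 1\<^sup>N \<cdot> (\<eta> \<cdot> b)\<close>. It recovers the operation of an extensive algebra
  from its value at the identity.
\<close>

lemma ealgebra_structure:
  assumes S: "extensive_monad S" and N: "ealgebra S N" and b: "b \<in> Arr (eC S)" "Cod (eC S) b = fst N"
  shows "snd N (Ide (eC S) (fst N)) \<cdot>\<^bsub>eC S\<^esub> eExt S (fst N) (eEta S (fst N) \<cdot>\<^bsub>eC S\<^esub> b) = snd N b"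
proof -
  have "snd N (Ide (eC S) (fst N)) \<cdot>\<^bsub>eC S\<^esub> eExt S (fst N) (eEta S (fst N) \<cdot>\<^bsub>eC S\<^esub> b) =
      snd N (snd N (Ide (eC S) (fst N)) \<cdot>\<^bsub>eC S\<^esub> eEta S (fst N) \<cdot>\<^bsub>eC S\<^esub> b)"
    using S N b ealgebra_simps(6)[OF S N, of "Ide (eC S) (fst N)" "eEta S (fst N) \<cdot>\<^bsub>eC S\<^esub> b"]
    by (simp del: ealgebra_simps(6) ealgebra_eta_extend)
  then show ?thesis using S N b by simp
qed

abbreviation alg_val :: "('o, 'm) emonad \<Rightarrow> ('o, 'm) ealg \<Rightarrow> ('o, 'm) calg" where
  "alg_val S N \<equiv> (fst N, snd N (Ide (eC S) (fst N)))"

lemma calgebra_alg_val [simp]: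
  assumes S: "extensive_monad S" and N: "ealgebra S N"
  shows "calgebra (H_0 S) (alg_val S N)"
proof -
  let ?a = "snd N (Ide (eC S) (fst N))"
  have a: "?a \<in> Arr (eC S)" "Cod (eC S) ?a = fst N" "Dom (eC S) ?a = eS S (fst N)" using S N by simp_all
  have "?a \<cdot>\<^bsub>eC S\<^esub> eExt S (fst N) (Ide (eC S) (eS S (fst N))) = snd N (?a \<cdot>\<^bsub>eC S\<^esub> Ide (eC S) (eS S (fst N)))"
    using S N ealgebra_simps(6)[OF S N, of "Ide (eC S) (fst N)" "Ide (eC S) (eS S (fst N))"] by (simp del: ealgebra_simps(6))
  then have "?a \<cdot>\<^bsub>eC S\<^esub> eExt S (fst N) (Ide (eC S) (eS S (fst N))) = snd N ?a" using S N by simp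
  then show ?thesis
    using S N a ealgebra_structure[OF S N a(1,2)] by (simp add: calgebra_def)
qed

lemma alg_val_hom_iff:
  assumes S: "extensive_monad S" and M: "ealgebra S M" and N: "ealgebra S N"
  shows "calg_hom (H_0 S) (alg_val S M) q (alg_val S N) \<longleftrightarrow> ealg_hom S M q N"
proof
  have c: "category (eC S)" using S by simp
  let ?a = "snd M (Ide (eC S) (fst M))" and ?b = "snd N (Ide (eC S) (fst N))"
  assume q: "calg_hom (H_0 S) (alg_val S M) q (alg_val S N)"
  then have q': "q \<in> Arr (eC S)" "Dom (eC S) q = fst M" "Cod (eC S) q = fst N"
    and e: "?b \<cdot>\<^bsub>eC S\<^esub> eExt S (fst N) (eEta S (fst N) \<cdot>\<^bsub>eC S\<^esub> q) = q \<cdot>\<^bsub>eC S\<^esub> ?a"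
    using calg_homD[OF q] by simp_all
  show "ealg_hom S M q N"
  proof (rule ealg_homI[OF q'])
    fix x assume x: "x \<in> Arr (eC S)" "Cod (eC S) x = fst M"
    have "snd N (q \<cdot>\<^bsub>eC S\<^esub> x) = ?b \<cdot>\<^bsub>eC S\<^esub> eExt S (fst N) (eEta S (fst N) \<cdot>\<^bsub>eC S\<^esub> q \<cdot>\<^bsub>eC S\<^esub> x)"
      using ealgebra_structure[OF S N, of "q \<cdot>\<^bsub>eC S\<^esub> x"] q' x c by simp
    also have "\<dots> = ?b \<cdot>\<^bsub>eC S\<^esub> eExt S (fst N) (eEta S (fst N) \<cdot>\<^bsub>eC S\<^esub> q) \<cdot>\<^bsub>eC S\<^esub> eExt S (fst M) (eEta S (fst M) \<cdot>\<^bsub>eC S\<^esub> x)"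
      using S M N q' x by (simp add: eExt_fuse del: eExt_eExt)
    also have "\<dots> = q \<cdot>\<^bsub>eC S\<^esub> ?a \<cdot>\<^bsub>eC S\<^esub> eExt S (fst M) (eEta S (fst M) \<cdot>\<^bsub>eC S\<^esub> x)"
      using S M N q' x by (simp add: Cmp_extend[OF e])
    also have "\<dots> = q \<cdot>\<^bsub>eC S\<^esub> snd M x" using ealgebra_structure[OF S M x] by simp
    finally show "snd N (q \<cdot>\<^bsub>eC S\<^esub> x) = q \<cdot>\<^bsub>eC S\<^esub> snd M x" .
  qed
next
  assume q: "ealg_hom S M q N"
  have c: "category (eC S)" using S by simp
  show "calg_hom (H_0 S) (alg_val S M) q (alg_val S N)"
    using ealg_hom_simps(1-3)[OF q c] ealg_hom_structure[OF S M N q] by (simp add: calg_hom_def)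
qed

lemma alg_val_inj:
  assumes S: "extensive_monad S" and "ealgebra S M" "ealgebra S N" and e: "alg_val S M = alg_val S N"
  shows "M = N"
proof (rule ealgebra_eqI[OF assms(2,3)])
  show f: "fst M = fst N" using e by simp
  have v: "snd M (Ide (eC S) (fst N)) = snd N (Ide (eC S) (fst N))" using e unfolding f by simp
  fix a assume a: "a \<in> Arr (eC S)" "Cod (eC S) a = fst N"
  show "snd M a = snd N a"
    using ealgebra_structure[OF S assms(3) a] ealgebra_structure[OF S assms(2), of a] a unfolding f v by simp
qed

text \<open>For a classical algebra \<open>a\<close> the operation must be \<open>q \<mapsto> a \<cdot> S q\<close>.\<close>

lemma alg_val_surj:
  assumes S: "extensive_monad S" and A: "calgebra (H_0 S) A"
  shows "\<exists>N. ealgebra S N \<and> A = alg_val S N"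
proof -
  let ?M = "H_0 S"
  have M: "classical_monad ?M" using S by simp
  have c: "category (mC ?M)" using S by simp
  define N where "N = (fst A, \<lambda>q\<in>Into (mC ?M) (fst A). snd A \<cdot>\<^bsub>mC ?M\<^esub> FArr (mS ?M) q)"
  have n: "fst N = fst A" "\<And>q. q \<in> Arr (mC ?M) \<Longrightarrow> Cod (mC ?M) q = fst A \<Longrightarrow> snd N q = snd A \<cdot>\<^bsub>mC ?M\<^esub> FArr (mS ?M) q"
    by (simp_all add: N_def)
  note a = calgebra_simps[OF A]
  note laws = classical_monad_natural[OF M]
  have "ealgebra (K_0 ?M) N"
  proof (rule ealgebraI)
    show "snd N \<in> extensional (Into (eC (K_0 ?M)) (fst N))" by (simp add: N_def)
    fix b assume "b \<in> Arr (eC (K_0 ?M))" "Cod (eC (K_0 ?M)) b = fst N"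
    then have b: "b \<in> Arr (mC ?M)" "Cod (mC ?M) b = fst A" by (simp_all add: n)
    show "snd N b \<in> Hom (eC (K_0 ?M)) (eS (K_0 ?M) (Dom (eC (K_0 ?M)) b)) (fst N)"
      using b a M c by (simp add: n del: H_0_simps)
    show "snd N b \<cdot>\<^bsub>eC (K_0 ?M)\<^esub> eEta (K_0 ?M) (Dom (eC (K_0 ?M)) b) = b"
      using b a M c laws(2)[OF b(1) refl b(2), symmetric] by (simp add: n Cmp_extend[OF a(5)] del: H_0_simps)
    fix h assume "h \<in> Arr (eC (K_0 ?M))" "Cod (eC (K_0 ?M)) h = eS (K_0 ?M) (Dom (eC (K_0 ?M)) b)"
    then have h: "h \<in> Arr (mC ?M)" "Cod (mC ?M) h = FObj (mS ?M) (Dom (mC ?M) b)" by (simp_all add: n)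
    show "snd N (snd N b \<cdot>\<^bsub>eC (K_0 ?M)\<^esub> h) = snd N b \<cdot>\<^bsub>eC (K_0 ?M)\<^esub> eExt (K_0 ?M) (Dom (eC (K_0 ?M)) b) h"
      using b h a M c by (simp add: n Cmp_extend[OF calgebra_mu[OF A]] Cmp_extend[OF laws(1)[OF b(1) refl b(2)]] del: H_0_simps K_0_H_0)
  qed (use a in \<open>simp_all add: n del: H_0_simps\<close>)
  moreover have "snd N (Ide (eC S) (fst N)) = snd A" "fst N = fst A" using a M n(2)[of "Ide (eC S) (fst N)"] n(1) c S by simp_all
  ultimately show ?thesis using S by (intro exI[of _ N]) simp
qed

lemma alg_iso_simps [simp]:
  "FDom (alg_iso S) = EAlg S" "FCod (alg_iso S) = CAlg (H_0 S)"
  "ealgebra S N \<Longrightarrow> FObj (alg_iso S) N = alg_val S N"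
  "m \<in> Arr (EAlg S) \<Longrightarrow> FArr (alg_iso S) m = (alg_val S (fst m), fst (snd m), alg_val S (snd (snd m)))"
  by (simp_all add: alg_iso_def Let_def case_prod_beta)

lemma alg_iso_arr:
  assumes S: "extensive_monad S" and m: "m \<in> Arr (EAlg S)"
  shows "(alg_val S (fst m), fst (snd m), alg_val S (snd (snd m))) \<in> Arr (CAlg (H_0 S))"
  using EAlg_arrD[OF m] S by (simp add: alg_val_hom_iff)

lemma cat_functor_alg_iso [simp]:
  assumes S: "extensive_monad S"
  shows "cat_functor (alg_iso S)"
proof (rule cat_functorI)
  have M: "classical_monad (H_0 S)" using S by simp
  note arr = alg_iso_arr[OF S]
  show "category (FDom (alg_iso S))" "category (FCod (alg_iso S))" using S by simp_all
  show "FObj (alg_iso S) \<in> extensional (Obj (FDom (alg_iso S)))" "FArr (alg_iso S) \<in> extensional (Arr (FDom (alg_iso S)))"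
    by (simp_all add: alg_iso_def Let_def)
  show "FArr (alg_iso S) f \<in> Arr (FCod (alg_iso S))" "Dom (FCod (alg_iso S)) (FArr (alg_iso S) f) = FObj (alg_iso S) (Dom (FDom (alg_iso S)) f)"
    "Cod (FCod (alg_iso S)) (FArr (alg_iso S) f) = FObj (alg_iso S) (Cod (FDom (alg_iso S)) f)" if "f \<in> Arr (FDom (alg_iso S))" for f
    using that arr[of f] EAlg_arrD[of f S] by (simp_all del: EAlg_simps(2) CAlg_simps(2))
  show "FArr (alg_iso S) (Ide (FDom (alg_iso S)) A) = Ide (FCod (alg_iso S)) (FObj (alg_iso S) A)" if "A \<in> Obj (FDom (alg_iso S))" for A
  proof -
    have "Ide (EAlg S) A \<in> Arr (EAlg S)" using that S by (intro Ide_simps) simp_all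
    then show ?thesis using that S by (simp del: EAlg_simps(2))
  qed
  show "FArr (alg_iso S) (g \<cdot>\<^bsub>FDom (alg_iso S)\<^esub> f) = FArr (alg_iso S) g \<cdot>\<^bsub>FCod (alg_iso S)\<^esub> FArr (alg_iso S) f"
    if "f \<in> Arr (FDom (alg_iso S))" "g \<in> Arr (FDom (alg_iso S))" "Dom (FDom (alg_iso S)) g = Cod (FDom (alg_iso S)) f" for f g
  proof -
    have fg: "f \<in> Arr (EAlg S)" "g \<in> Arr (EAlg S)" "fst g = snd (snd f)" using that by simp_all
    have "g \<cdot>\<^bsub>EAlg S\<^esub> f \<in> Arr (EAlg S)" using that S by (intro Cmp_simps) simp_all
    then show ?thesis using fg arr[OF fg(1)] arr[OF fg(2)] by (simp del: EAlg_simps(2) CAlg_simps(2))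
  qed
qed (use S in simp)

lemma alg_iso_bij:
  assumes S: "extensive_monad S"
  shows "bij_betw (FObj (alg_iso S)) (Obj (EAlg S)) (Obj (CAlg (H_0 S)))"
    "bij_betw (FArr (alg_iso S)) (Arr (EAlg S)) (Arr (CAlg (H_0 S)))"
proof -
  show "bij_betw (FObj (alg_iso S)) (Obj (EAlg S)) (Obj (CAlg (H_0 S)))"
    unfolding bij_betw_def
  proof (intro conjI inj_onI equalityI subsetI)
    show "x = y" if "x \<in> Obj (EAlg S)" "y \<in> Obj (EAlg S)" "FObj (alg_iso S) x = FObj (alg_iso S) y" for x y
      by (rule alg_val_inj[OF S]) (use that in \<open>simp_all only: alg_iso_simps EAlg_simps mem_Collect_eq\<close>)
    show "x \<in> Obj (CAlg (H_0 S))" if hx: "x \<in> FObj (alg_iso S) ` Obj (EAlg S)" for x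
    proof -
      obtain N where "ealgebra S N" "x = FObj (alg_iso S) N" using hx unfolding EAlg_simps(1) by blast
      then show ?thesis using S by simp
    qed
    show "x \<in> FObj (alg_iso S) ` Obj (EAlg S)" if "x \<in> Obj (CAlg (H_0 S))" for x
      using that alg_val_surj[OF S, of x] by force
  qed
  show "bij_betw (FArr (alg_iso S)) (Arr (EAlg S)) (Arr (CAlg (H_0 S)))"
    unfolding bij_betw_def
  proof (intro conjI inj_onI equalityI subsetI)
    show "x = y" if h: "x \<in> Arr (EAlg S)" "y \<in> Arr (EAlg S)" "FArr (alg_iso S) x = FArr (alg_iso S) y" for x y
    proof (rule EAlg_arr_eqI[OF h(1,2)])
      note x = EAlg_arrD[OF h(1)] and y = EAlg_arrD[OF h(2)]
      note e = h(3)[unfolded alg_iso_simps(4)[OF h(1)] alg_iso_simps(4)[OF h(2)]]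
      have "alg_val S (fst x) = alg_val S (fst y)" "alg_val S (snd (snd x)) = alg_val S (snd (snd y))"
        using arg_cong[OF e, of fst] arg_cong[OF e, of "\<lambda>t. snd (snd t)"] by (simp_all only: fst_conv snd_conv)
      then have "fst x = fst y" "snd (snd x) = snd (snd y)"
        using alg_val_inj[OF S x(1) y(1)] alg_val_inj[OF S x(2) y(2)] by blast+
      then show "Dom (EAlg S) x = Dom (EAlg S) y" "Cod (EAlg S) x = Cod (EAlg S) y"
        using h by (simp_all del: EAlg_simps(2))
      show "fst (snd x) = fst (snd y)" using h by (simp del: EAlg_simps(2))
    qed
    show "x \<in> Arr (CAlg (H_0 S))" if "x \<in> FArr (alg_iso S) ` Arr (EAlg S)" for x
      using that alg_iso_arr[OF S] by (auto simp del: EAlg_simps(2) CAlg_simps(2))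
    show "x \<in> FArr (alg_iso S) ` Arr (EAlg S)" if hx: "x \<in> Arr (CAlg (H_0 S))" for x
    proof -
      obtain A q B where x: "x = (A, q, B)" "calgebra (H_0 S) A" "calgebra (H_0 S) B" "calg_hom (H_0 S) A q B"
        using hx unfolding CAlg_simps(2) by blast
      obtain M N where m: "ealgebra S M" "ealgebra S N" "A = alg_val S M" "B = alg_val S N"
        using alg_val_surj[OF S x(2)] alg_val_surj[OF S x(3)] by blast
      have "(M, q, N) \<in> Arr (EAlg S)" using x m S alg_val_hom_iff[OF S m(1,2)] by simp
      moreover from this have "x = FArr (alg_iso S) (M, q, N)" using x m by (simp del: EAlg_simps(2))
      ultimately show ?thesis by blast
    qed
  qed
qed

section \<open>Matching codes\<close>

lemma category_eqI:
  fixes C D :: "('a, 'b) category"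
  assumes C: "category C" and D: "category D" and "Obj C = Obj D" "Arr C = Arr D"
    and "\<And>f. f \<in> Arr D \<Longrightarrow> Dom C f = Dom D f" "\<And>f. f \<in> Arr D \<Longrightarrow> Cod C f = Cod D f"
    and "\<And>A. A \<in> Obj D \<Longrightarrow> Ide C A = Ide D A"
    and "\<And>f g. f \<in> Arr D \<Longrightarrow> g \<in> Arr D \<Longrightarrow> Dom D g = Cod D f \<Longrightarrow> g \<cdot>\<^bsub>C\<^esub> f = g \<cdot>\<^bsub>D\<^esub> f"
  shows "C = D"
proof (rule category.equality)
  have e: "Dom C \<in> extensional (Arr C)" "Cod C \<in> extensional (Arr C)" "Ide C \<in> extensional (Obj C)"
    "Dom D \<in> extensional (Arr D)" "Cod D \<in> extensional (Arr D)" "Ide D \<in> extensional (Obj D)"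
    using category.Dom_closed[OF C] category.Cod_closed[OF C] category.Ide_ext[OF C]
      category.Dom_closed[OF D] category.Cod_closed[OF D] category.Ide_ext[OF D] by (auto simp: PiE_def)
  show "Dom C = Dom D" "Cod C = Cod D" "Ide C = Ide D"
    using e assms(3-7) by (auto intro: extensionalityI)
  show "Cmp C = Cmp D"
  proof (intro ext)
    fix g f
    show "g \<cdot>\<^bsub>C\<^esub> f = g \<cdot>\<^bsub>D\<^esub> f"
    proof (cases "f \<in> Arr D \<and> g \<in> Arr D \<and> Dom D g = Cod D f")
      case True
      then show ?thesis using assms(8) by blast
    next
      case False
      then have "\<not> (f \<in> Arr C \<and> g \<in> Arr C \<and> Dom C g = Cod C f)" using assms(4-6) by metis
      then show ?thesis using category.Cmp_ext[OF C] category.Cmp_ext[OF D] False by metis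
    qed
  qed
qed (use assms in simp_all)

text \<open>
  The codes of \<open>C\<close> are those of \<open>D\<close>, read through the isomorphism \<open>I\<close>. Hence the two renamed
  categories have the same objects and arrows, and since \<open>I\<close> preserves their structure they are
  equal.
\<close>

lemma rename_iso:
  assumes I: "cat_functor I" "FDom I = C" "FCod I = D"
    and b: "bij_betw (FObj I) (Obj C) (Obj D)" "bij_betw (FArr I) (Arr C) (Arr D)"
    and c: "coding k l D"
    and ij: "\<And>A. A \<in> Obj C \<Longrightarrow> i A = k (FObj I A)" "\<And>f. f \<in> Arr C \<Longrightarrow> j f = l (FArr I f)"
  shows "coding i j C" "rename i j C = rename k l D" "enc i j C = enc k l D \<circ>\<^sub>F I" "I \<circ>\<^sub>F dec i j C = dec k l D"
proof -
  have D: "inj_on k (Obj D)" "inj_on l (Arr D)" "category D" using c by (simp_all add: coding_def)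
  have C: "category C" using I by auto
  show cc: "coding i j C"
    unfolding coding_def
  proof (intro conjI inj_onI C)
    show "x = y" if "x \<in> Obj C" "y \<in> Obj C" "i x = i y" for x y
      using that ij(1) I inj_onD[OF bij_betw_imp_inj_on[OF b(1)], of x y] inj_onD[OF D(1), of "FObj I x" "FObj I y"] by simp
    show "x = y" if "x \<in> Arr C" "y \<in> Arr C" "j x = j y" for x y
      using that ij(2) I inj_onD[OF bij_betw_imp_inj_on[OF b(2)], of x y] inj_onD[OF D(2), of "FArr I x" "FArr I y"] by simp
  qed
  show r: "rename i j C = rename k l D"
  proof (rule category_eqI)
    have o: "i ` Obj C = k ` Obj D" "j ` Arr C = l ` Arr D"
      using ij b[unfolded bij_betw_def] by (auto simp: image_iff) (metis imageE)+
    then show "Obj (rename i j C) = Obj (rename k l D)" "Arr (rename i j C) = Arr (rename k l D)"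
      by (simp_all add: rename_simps)
    have p: "\<exists>f \<in> Arr C. x = j f \<and> x = l (FArr I f)" if "x \<in> Arr (rename k l D)" for x
      using that ij(2) unfolding rename_simps o(2)[symmetric] by auto
    have p0: "\<exists>A \<in> Obj C. x = i A \<and> x = k (FObj I A)" if "x \<in> Obj (rename k l D)" for x
      using that ij(1) unfolding rename_simps o(1)[symmetric] by auto
    show "Dom (rename i j C) x = Dom (rename k l D) x" "Cod (rename i j C) x = Cod (rename k l D) x" if hx: "x \<in> Arr (rename k l D)" for x
    proof -
      obtain f where f: "f \<in> Arr C" "x = j f" "x = l (FArr I f)" using p[OF hx] by blast
      have "Dom (rename i j C) x = i (Dom C f)" "Cod (rename i j C) x = i (Cod C f)"
        unfolding f(2) using f(1) cc by (simp_all add: rename_simps)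
      moreover have "Dom (rename k l D) x = k (Dom D (FArr I f))" "Cod (rename k l D) x = k (Cod D (FArr I f))"
        unfolding f(3) using f(1) c I by (simp_all add: rename_simps)
      ultimately show "Dom (rename i j C) x = Dom (rename k l D) x" "Cod (rename i j C) x = Cod (rename k l D) x"
        using f(1) C I ij(1) by simp_all
    qed
    show "Ide (rename i j C) x = Ide (rename k l D) x" if hx: "x \<in> Obj (rename k l D)" for x
    proof -
      obtain A where A: "A \<in> Obj C" "x = i A" "x = k (FObj I A)" using p0[OF hx] by blast
      have "Ide (rename i j C) x = j (Ide C A)" unfolding A(2) using A(1) cc by (simp add: rename_simps)
      moreover have "Ide (rename k l D) x = l (Ide D (FObj I A))" unfolding A(3) using A(1) c I by (simp add: rename_simps)
      ultimately show ?thesis using A(1) C I ij(2) by simp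
    qed
    show "y \<cdot>\<^bsub>rename i j C\<^esub> x = y \<cdot>\<^bsub>rename k l D\<^esub> x"
      if h: "x \<in> Arr (rename k l D)" "y \<in> Arr (rename k l D)" "Dom (rename k l D) y = Cod (rename k l D) x" for x y
    proof -
      obtain f where f: "f \<in> Arr C" "x = j f" "x = l (FArr I f)" using p[OF h(1)] by blast
      obtain g where g: "g \<in> Arr C" "y = j g" "y = l (FArr I g)" using p[OF h(2)] by blast
      have "k (FObj I (Dom C g)) = k (FObj I (Cod C f))"
        using h(3) f(1) g(1) c I unfolding f(3) g(3) by (simp add: rename_simps)
      then have m: "Dom C g = Cod C f"
        using f(1) g(1) C I inj_onD[OF D(1), of "FObj I (Dom C g)" "FObj I (Cod C f)"]
          inj_onD[OF bij_betw_imp_inj_on[OF b(1)], of "Dom C g" "Cod C f"] by simp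
      have "y \<cdot>\<^bsub>rename i j C\<^esub> x = j (g \<cdot>\<^bsub>C\<^esub> f)" unfolding f(2) g(2) using f(1) g(1) cc m by (simp add: rename_simps)
      moreover have "y \<cdot>\<^bsub>rename k l D\<^esub> x = l (FArr I g \<cdot>\<^bsub>D\<^esub> FArr I f)" unfolding f(3) g(3) using f(1) g(1) c I m by (simp add: rename_simps)
      ultimately show ?thesis using f(1) g(1) m C I ij(2) by simp
    qed
  qed (use cc c in simp_all)
  show e: "enc i j C = enc k l D \<circ>\<^sub>F I"
    by (rule functor_eqI) (use cc c I C r ij in \<open>simp_all add: enc_eq\<close>)
  have "dec k l D \<circ>\<^sub>F (enc k l D \<circ>\<^sub>F I) \<circ>\<^sub>F dec i j C = dec k l D \<circ>\<^sub>F enc i j C \<circ>\<^sub>F dec i j C" by (simp add: e)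
  then show "I \<circ>\<^sub>F dec i j C = dec k l D" using cc c I C r by simp
qed

abbreviation calg_coding where
  "calg_coding k l \<equiv> \<forall>M \<in> Cell0 MndE. inj_on (k M) (Obj (CAlg M)) \<and> inj_on (l M) (Arr (CAlg M))"

lemma coding_CAlg: "calg_coding k l \<Longrightarrow> classical_monad M \<Longrightarrow> coding (k M) (l M) (CAlg M)"
  by (simp add: coding_def)

abbreviation matching where
  "matching i j k l \<equiv> \<forall>S \<in> Cell0 EMnd.
    (\<forall>N \<in> Obj (EAlg S). i S N = k (H_0 S) (FObj (alg_iso S) N)) \<and>
    (\<forall>m \<in> Arr (EAlg S). j S m = l (H_0 S) (FArr (alg_iso S) m))"

lemma matching_iso:
  assumes S: "extensive_monad S" and k: "calg_coding k l" and m: "matching i j k l"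
  shows "coding (i S) (j S) (EAlg S)"
    "rename (i S) (j S) (EAlg S) = rename (k (H_0 S)) (l (H_0 S)) (CAlg (H_0 S))"
    "enc (i S) (j S) (EAlg S) = enc (k (H_0 S)) (l (H_0 S)) (CAlg (H_0 S)) \<circ>\<^sub>F alg_iso S"
    "alg_iso S \<circ>\<^sub>F dec (i S) (j S) (EAlg S) = dec (k (H_0 S)) (l (H_0 S)) (CAlg (H_0 S))"
proof -
  have c: "coding (k (H_0 S)) (l (H_0 S)) (CAlg (H_0 S))" using coding_CAlg[OF k] S by simp
  have m': "\<And>N. N \<in> Obj (EAlg S) \<Longrightarrow> i S N = k (H_0 S) (FObj (alg_iso S) N)"
    "\<And>f. f \<in> Arr (EAlg S) \<Longrightarrow> j S f = l (H_0 S) (FArr (alg_iso S) f)"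
    using m S unfolding EMnd_simps by blast+
  note r = rename_iso[where i = "i S" and j = "j S", OF cat_functor_alg_iso[OF S] alg_iso_simps(1,2) alg_iso_bij[OF S] c m']
  show "coding (i S) (j S) (EAlg S)"
    "rename (i S) (j S) (EAlg S) = rename (k (H_0 S)) (l (H_0 S)) (CAlg (H_0 S))"
    "enc (i S) (j S) (EAlg S) = enc (k (H_0 S)) (l (H_0 S)) (CAlg (H_0 S)) \<circ>\<^sub>F alg_iso S"
    "alg_iso S \<circ>\<^sub>F dec (i S) (j S) (EAlg S) = dec (k (H_0 S)) (l (H_0 S)) (CAlg (H_0 S))"
    by (rule r; assumption)+
qed

section \<open>The Eilenberg-Moore adjunction\<close>

lemma cForget_simps [simp]:
  "FDom (cForget M) = CAlg M" "FCod (cForget M) = mC M" "calgebra M N \<Longrightarrow> FObj (cForget M) N = fst N"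
  "m \<in> Arr (CAlg M) \<Longrightarrow> FArr (cForget M) m = fst (snd m)"
  by (simp_all add: cForget_def)

lemma cFree_simps [simp]:
  "FDom (cFree M) = mC M" "FCod (cFree M) = CAlg M"
  "A \<in> Obj (mC M) \<Longrightarrow> FObj (cFree M) A = (FObj (mS M) A, NCmp (mMu M) A)"
  "f \<in> Arr (mC M) \<Longrightarrow> FArr (cFree M) f = ((FObj (mS M) (Dom (mC M) f), NCmp (mMu M) (Dom (mC M) f)), FArr (mS M) f,
    (FObj (mS M) (Cod (mC M) f), NCmp (mMu M) (Cod (mC M) f)))"
  by (simp_all add: cFree_def Let_def)

lemma cbar_simps [simp]:
  "FDom (cbar f) = CAlg (m1s f)" "FCod (cbar f) = CAlg (m1t f)"
  "calgebra (m1s f) N \<Longrightarrow> FObj (cbar f) N = cbar_obj f N"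
  "m \<in> Arr (CAlg (m1s f)) \<Longrightarrow> FArr (cbar f) m = (cbar_obj f (fst m), FArr (m1P f) (fst (snd m)), cbar_obj f (snd (snd m)))"
  by (simp_all add: cbar_def case_prod_beta)

lemma EAlg_functors_ext [simp]:
  "FObj (eForget S) \<in> extensional (Obj (EAlg S))" "FArr (eForget S) \<in> extensional (Arr (EAlg S))"
  "mC M = C \<Longrightarrow> FObj (cFree M) \<in> extensional (Obj C)" "mC M = C \<Longrightarrow> FArr (cFree M) \<in> extensional (Arr C)"
  by (auto simp: eForget_def cFree_def Let_def simp del: EAlg_simps)

text \<open>
  The isomorphism from extensive to classical algebras carries one free-forgetful adjunction to
  the other: here for the right adjoints, in \<open>cFree_eq\<close> and \<open>cEps_alg_iso\<close> for the left adjoints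
  and the counits.
\<close>

lemma cForget_alg_iso:
  assumes S: "extensive_monad S"
  shows "eForget S = cForget (H_0 S) \<circ>\<^sub>F alg_iso S"
proof (rule fctr_eqI)
  show "FArr (eForget S) m = FArr (cForget (H_0 S) \<circ>\<^sub>F alg_iso S) m" if "m \<in> Arr (FDom (cForget (H_0 S) \<circ>\<^sub>F alg_iso S))" for m
    using that alg_iso_arr[OF S, of m] by (simp del: EAlg_simps(2) CAlg_simps(2))
  show "FObj (eForget S) N = FObj (cForget (H_0 S) \<circ>\<^sub>F alg_iso S) N" if "N \<in> Obj (FDom (cForget (H_0 S) \<circ>\<^sub>F alg_iso S))" for N
    using that S by simp
qed (simp_all del: EAlg_simps(1,2))

lemma cFree_alg_iso:
  assumes S: "extensive_monad S"
  shows "A \<in> Obj (eC S) \<Longrightarrow> FObj (cFree (H_0 S)) A = FObj (alg_iso S) (eFree S A)"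
    "v \<in> Arr (eC S) \<Longrightarrow> Cod (eC S) v = B \<Longrightarrow>
      FArr (cFree (H_0 S)) v = FArr (alg_iso S) (eFree S (Dom (eC S) v), eExt S B (eEta S B \<cdot>\<^bsub>eC S\<^esub> v), eFree S B)"
proof -
  show "A \<in> Obj (eC S) \<Longrightarrow> FObj (cFree (H_0 S)) A = FObj (alg_iso S) (eFree S A)" using S by simp
  assume v: "v \<in> Arr (eC S)" "Cod (eC S) v = B"
  have c: "category (eC S)" using S by simp
  have B: "B \<in> Obj (eC S)" "Dom (eC S) v \<in> Obj (eC S)" using c v by auto
  have "(eFree S (Dom (eC S) v), eExt S B (eEta S B \<cdot>\<^bsub>eC S\<^esub> v), eFree S B) \<in> Arr (EAlg S)"
    using ealg_hom_free[OF S ealgebra_eFree[OF S B(1)], of "eEta S B \<cdot>\<^bsub>eC S\<^esub> v"] S v B by simp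
  then show "FArr (cFree (H_0 S)) v = FArr (alg_iso S) (eFree S (Dom (eC S) v), eExt S B (eEta S B \<cdot>\<^bsub>eC S\<^esub> v), eFree S B)"
    using S v B by (simp del: EAlg_simps(2))
qed

lemma cbar_obj_alg_val:
  assumes f: "emonad_1cell f" and N: "ealgebra (e1s f) N"
  shows "cbar_obj (H_1 f) (alg_val (e1s f) N) = alg_val (e1t f) (ehat_obj f N)"
  using f N by (simp add: cbar_obj_def)

text \<open>The isomorphism with classical algebras intertwines the actions of a 1-cell on the two kinds of algebras.\<close>

lemma cbar_alg_iso:
  assumes f: "emonad_1cell f"
  shows "alg_iso (e1t f) \<circ>\<^sub>F ehat f = cbar (H_1 f) \<circ>\<^sub>F alg_iso (e1s f)"
proof (rule fctr_eqI)
  have S: "extensive_monad (e1s f)" "extensive_monad (e1t f)" using f by simp_all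
  show "FObj (alg_iso (e1t f) \<circ>\<^sub>F ehat f) N = FObj (cbar (H_1 f) \<circ>\<^sub>F alg_iso (e1s f)) N"
    if "N \<in> Obj (FDom (cbar (H_1 f) \<circ>\<^sub>F alg_iso (e1s f)))" for N
    using that f S cbar_obj_alg_val[OF f, of N] by simp
  show "FArr (alg_iso (e1t f) \<circ>\<^sub>F ehat f) m = FArr (cbar (H_1 f) \<circ>\<^sub>F alg_iso (e1s f)) m"
    if "m \<in> Arr (FDom (cbar (H_1 f) \<circ>\<^sub>F alg_iso (e1s f)))" for m
  proof -
    have m: "m \<in> Arr (EAlg (e1s f))" using that by (simp del: EAlg_simps(2))
    have "FArr (ehat f) m \<in> Arr (EAlg (e1t f))" using m f by (intro FArr_simps) simp_all
    then show ?thesis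
      using m alg_iso_arr[OF S(1) m] cbar_obj_alg_val[OF f EAlg_arrD(1)[OF m]] cbar_obj_alg_val[OF f EAlg_arrD(2)[OF m]]
      by (simp del: EAlg_simps(2) CAlg_simps(2))
  qed
qed (use f in \<open>simp_all del: EAlg_simps(1,2)\<close>)

lemma cFree_eq:
  assumes S: "extensive_monad S"
  shows "cFree (H_0 S) = alg_iso S \<circ>\<^sub>F aL (F_0 (Psi_0 S))"
proof (rule fctr_eqI)
  show "FArr (cFree (H_0 S)) v = FArr (alg_iso S \<circ>\<^sub>F aL (F_0 (Psi_0 S))) v"
    if "v \<in> Arr (FDom (alg_iso S \<circ>\<^sub>F aL (F_0 (Psi_0 S))))" for v
    using that cFree_alg_iso(2)[OF S, of v] S by (simp del: cFree_simps alg_iso_simps(4))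
qed (use S in \<open>simp_all add: cFree_alg_iso(1) del: cFree_simps(3) alg_iso_simps(3)\<close>)

lemma cEps_alg_iso:
  assumes S: "extensive_monad S" and N: "ealgebra S N"
  shows "NCmp (aEps (PsiE_0 (H_0 S))) (FObj (alg_iso S) N) = FArr (alg_iso S) (NCmp (aEps (F_0 (Psi_0 S))) N)"
proof -
  have h: "NCmp (aEps (F_0 (Psi_0 S))) N \<in> Arr (EAlg S)"
    using S N nat_trans_functors(1)[of "aEps (F_0 (Psi_0 S))"] by (intro NCmp_simps) simp_all
  then show ?thesis
    using S N by (simp add: PsiE_0_def del: EAlg_simps(2))
qed

section \<open>Serial commutativity\<close>

lemma aL_F_0_rename:
  assumes U: "universal_arrow U" and c: "ucoding i j U"
  shows "aL (F_0 (rename_uarr i j U)) = enc i j (uX U) \<circ>\<^sub>F aL (F_0 U)"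
  by (rule functor_eqI) (use U c in simp_all)

lemma F_0_rename:
  assumes U: "universal_arrow U" and c: "ucoding i j U"
  shows "F_0 (rename_uarr i j U) = rename_adjn i j (F_0 U)"
proof (rule adjn.equality)
  note L = aL_F_0_rename[OF U c]
  show "aL (F_0 (rename_uarr i j U)) = aL (rename_adjn i j (F_0 U))" by (simp add: L rename_adjn_def Let_def)
  show "aR (F_0 (rename_uarr i j U)) = aR (rename_adjn i j (F_0 U))" by (simp add: rename_adjn_def Let_def)
  show "aEta (F_0 (rename_uarr i j U)) = aEta (rename_adjn i j (F_0 U))"
    by (rule ntrans.equality) (simp_all add: L rename_adjn_def Let_def)
  show "aEps (F_0 (rename_uarr i j U)) = aEps (rename_adjn i j (F_0 U))"
  proof (rule ntrans_eqI')
    show "NCmp (aEps (F_0 (rename_uarr i j U))) \<in> extensional (i ` Obj (uX U))"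
      using NCmp_ext[of "aEps (F_0 (rename_uarr i j U))"] U c by (simp add: rename_simps(1))
    show "NCmp (aEps (F_0 (rename_uarr i j U))) X = NCmp (aEps (rename_adjn i j (F_0 U))) X" if "X \<in> i ` Obj (uX U)" for X
    proof -
      have X: "X \<in> Obj (rename i j (uX U))" using that by (simp add: rename_simps)
      then show ?thesis using U c that by (simp add: rename_adjn_def Let_def enc_eq)
    qed
  qed (simp_all add: L rename_adjn_def Let_def)
qed simp

text \<open>
  An isomorphism \<open>I\<close> between the adjunctions \<open>A\<close> and \<open>B\<close> is absorbed by codes which agree along
  \<open>I\<close>.
\<close>

lemma rename_adjn_cong:
  assumes A: "adjunction A" and I: "cat_functor I" "FDom I = aX A" "FCod I = aX B"
    and c: "coding i j (aX A)" "rename i j (aX A) = rename k l (aX B)" "enc i j (aX A) = enc k l (aX B) \<circ>\<^sub>F I"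
      "I \<circ>\<^sub>F dec i j (aX A) = dec k l (aX B)"
    and R: "aR A = aR B \<circ>\<^sub>F I" and L: "aL B = I \<circ>\<^sub>F aL A" and eta: "NCmp (aEta B) = NCmp (aEta A)"
    and eps: "\<And>X. X \<in> Obj (aX A) \<Longrightarrow> NCmp (aEps B) (FObj I X) = FArr I (NCmp (aEps A) X)"
  shows "rename_adjn i j A = rename_adjn k l B"
proof (rule adjn.equality)
  have C: "aC B = aC A" by (simp add: R)
  have l: "enc i j (aX A) \<circ>\<^sub>F aL A = enc k l (aX B) \<circ>\<^sub>F aL B"
    unfolding c(3) L using A I(2) by (intro comp_functor_assoc) simp_all
  have r: "aR A \<circ>\<^sub>F dec i j (aX A) = aR B \<circ>\<^sub>F dec k l (aX B)"
    unfolding c(4)[symmetric] by (subst R, rule comp_functor_assoc) (use c(1) I in simp_all)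
  show "aL (rename_adjn i j A) = aL (rename_adjn k l B)" "aR (rename_adjn i j A) = aR (rename_adjn k l B)"
    "aEta (rename_adjn i j A) = aEta (rename_adjn k l B)"
    by (simp_all add: rename_adjn_def Let_def l r C eta)
  have o: "i ` Obj (aX A) = k ` Obj (aX B)" using arg_cong[OF c(2), of Obj] by (simp add: rename_simps)
  have e: "j (NCmp (aEps A) (FObj (dec i j (aX A)) X)) = l (NCmp (aEps B) (FObj (dec k l (aX B)) X))"
    if "X \<in> i ` Obj (aX A)" for X
  proof -
    have X: "X \<in> Obj (rename i j (aX A))" using that by (simp add: rename_simps)
    let ?Y = "FObj (dec i j (aX A)) X"
    have Y: "?Y \<in> Obj (aX A)" using X c(1) by simp
    have d: "FObj (dec k l (aX B)) X = FObj I ?Y" using X by (simp flip: c(4))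
    have m: "NCmp (aEps A) ?Y \<in> Arr (aX A)" using A Y by simp
    have "j (NCmp (aEps A) ?Y) = FArr (enc i j (aX A)) (NCmp (aEps A) ?Y)" using m by (simp add: enc_eq)
    also have "\<dots> = l (FArr I (NCmp (aEps A) ?Y))" using m I by (simp add: c(3) enc_eq)
    also have "\<dots> = l (NCmp (aEps B) (FObj (dec k l (aX B)) X))" unfolding d eps[OF Y] ..
    finally show ?thesis .
  qed
  show "aEps (rename_adjn i j A) = aEps (rename_adjn k l B)"
    by (simp add: rename_adjn_def Let_def l r c(2) o[symmetric] e cong: restrict_cong)
qed simp

lemma PsiE_0_simps [simp]:
  "aL (PsiE_0 M) = cFree M" "aR (PsiE_0 M) = cForget M" "NCmp (aEta (PsiE_0 M)) = NCmp (mEta M)"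
  by (simp_all add: PsiE_0_def)

lemma F_0_Psi:
  assumes S: "extensive_monad S" and k: "calg_coding k l" and m: "matching i j k l"
  shows "F_0 (F0 (Psi i j) S) = F0 (PsiE k l) (H_0 S)"
proof -
  note mi = matching_iso[OF S k m]
  have "rename_adjn (i S) (j S) (F_0 (Psi_0 S)) = rename_adjn (k (H_0 S)) (l (H_0 S)) (PsiE_0 (H_0 S))"
    by (rule rename_adjn_cong[where I = "alg_iso S"])
      (use S mi in \<open>simp_all add: cForget_alg_iso cFree_eq cEps_alg_iso del: alg_iso_simps(3) F_0_simps(11)\<close>)
  then show ?thesis using S mi(1) by (simp add: F_0_rename PsiE_def)
qed

lemma a1lam_F_1_rename:
  assumes f: "uarr_1cell f" and c: "ucoding i j (u1s f)" "ucoding i' j' (u1t f)"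
  shows "a1lam (F_1 (rename_uarr1 i j i' j' f)) = enc i' j' (uX (u1t f)) \<star>\<^sub>l a1lam (F_1 f)"
proof (rule ntrans_eqI)
  note L = aL_F_0_rename[OF _ c(1)] aL_F_0_rename[OF _ c(2)]
  show "nat_trans (a1lam (F_1 (rename_uarr1 i j i' j' f)))" using f c by simp
  show "nat_trans (enc i' j' (uX (u1t f)) \<star>\<^sub>l a1lam (F_1 f))"
    using f c adjn_1cell_simps(13)[of "F_1 f"] by (intro nat_trans_whisker_left) simp_all
qed (use f c in \<open>simp_all add: aL_F_0_rename\<close>)

text \<open>Because \<open>\<zeta>(v) = \<epsilon> \<cdot> L v\<close>, the transpose of \<open>\<rho> \<cdot> J \<eta>\<close> is the mate of \<open>\<rho>\<close>.\<close>

lemma mate_F_1: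
  assumes f: "uarr_1cell f" and A: "A \<in> Obj (uC (u1s f))"
  shows "NCmp (aEps (F_0 (u1t f))) (FObj (u1V f) (uL (u1s f) A)) \<cdot>\<^bsub>uX (u1t f)\<^esub>
      FArr (aL (F_0 (u1t f))) (NCmp (u1rho f) (uL (u1s f) A)) \<cdot>\<^bsub>uX (u1t f)\<^esub>
      FArr (aL (F_0 (u1t f))) (FArr (u1J f) (uEta (u1s f) A)) = NCmp (a1lam (F_1 f)) A"
proof -
  let ?W = "u1t f" and ?X = "FObj (u1V f) (uL (u1s f) A)"
  let ?v = "NCmp (u1rho f) (uL (u1s f) A) \<cdot>\<^bsub>uC (u1t f)\<^esub> FArr (u1J f) (uEta (u1s f) A)"
  have "uZeta (G_0 (F_0 ?W)) ?X ?v = NCmp (aEps (F_0 ?W)) ?X \<cdot>\<^bsub>uX ?W\<^esub> FArr (aL (F_0 ?W)) ?v"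
    using f A by (subst G_0_simps(4)) simp_all
  then have "uZeta ?W ?X ?v = NCmp (aEps (F_0 ?W)) ?X \<cdot>\<^bsub>uX ?W\<^esub> FArr (aL (F_0 ?W)) ?v"
    using f by (simp del: F_0_simps G_0_simps)
  moreover have "FArr (aL (F_0 ?W)) ?v = FArr (aL (F_0 ?W)) (NCmp (u1rho f) (uL (u1s f) A)) \<cdot>\<^bsub>uX ?W\<^esub>
      FArr (aL (F_0 ?W)) (FArr (u1J f) (uEta (u1s f) A))"
    using f A by (subst FArr_Cmp) (simp_all del: F_0_simps(5))
  ultimately show ?thesis using A by simp
qed

text \<open>
  Unit, counit and free functor of the Eilenberg-Moore adjunction are the images of those for
  extensive algebras, hence so is the mate of the identity.
\<close>

lemma mate_PsiE:
  assumes f: "emonad_1cell f"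
  shows "a1lam (PsiE_1 (H_1 f)) = alg_iso (e1t f) \<star>\<^sub>l a1lam (F_1 (Psi_1 f))"
proof (rule ntrans_eqI'[where A = "Obj (eC (e1s f))"])
  let ?S = "e1s f" and ?T = "e1t f"
  have S: "extensive_monad ?S" "extensive_monad ?T" using f by simp_all
  have U: "uarr_1cell (Psi_1 f)" using f by simp
  let ?L = "aL (F_0 (Psi_0 ?S))" and ?L' = "aL (F_0 (Psi_0 ?T))" and ?I = "alg_iso ?T"
  have V: "cbar (H_1 f) \<circ>\<^sub>F alg_iso ?S \<circ>\<^sub>F ?L = ?I \<circ>\<^sub>F ehat f \<circ>\<^sub>F ?L"
    using comp_functor_extend[OF cbar_alg_iso[OF f], of ?L] S by simp
  have e: "NSrc (aEta (PsiE_0 M)) = id_functor (mC M)" "NTrg (aEps (PsiE_0 M)) = id_functor (CAlg M)" for M :: "('a, 'b) cmonad"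
    by (simp_all add: PsiE_0_def)
  show "NSrc (a1lam (PsiE_1 (H_1 f))) = NSrc (?I \<star>\<^sub>l a1lam (F_1 (Psi_1 f)))"
    using f S by (simp add: PsiE_1_def mate_def e cFree_eq)
  show "NTrg (a1lam (PsiE_1 (H_1 f))) = NTrg (?I \<star>\<^sub>l a1lam (F_1 (Psi_1 f)))"
    using f S by (simp add: PsiE_1_def mate_def e cFree_eq V)
  show "NCmp (a1lam (PsiE_1 (H_1 f))) \<in> extensional (Obj (eC ?S))"
    using f S by (simp add: PsiE_1_def mate_def e vcomp_def whisker_left_def)
  show "NCmp (?I \<star>\<^sub>l a1lam (F_1 (Psi_1 f))) \<in> extensional (Obj (eC ?S))"
    using f S by (simp add: whisker_left_def)
  fix A assume A: "A \<in> Obj (eC ?S)"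
  have A': "A \<in> Obj (uC (u1s (Psi_1 f)))" using A by simp
  let ?N = "ehat_obj f (eFree ?S A)"
  have N: "ealgebra ?T ?N" using f S A by simp
  let ?e = "NCmp (aEps (F_0 (Psi_0 ?T))) ?N" and ?p = "FArr (e1P f) (eEta ?S A)" and ?i = "Ide (eC ?T) (fst ?N)"
  have a: "?e \<in> Arr (EAlg ?T)" "Dom (EAlg ?T) ?e = FObj ?L' (fst ?N)"
    using N S adjunction_simps(8)[OF adjunction_F_0, of "Psi_0 ?T"] by (simp_all del: F_0_simps(4,11) EAlg_simps(2-4))
  have b: "?p \<in> Arr (eC ?T)" "Cod (eC ?T) ?p = fst ?N" "?i \<in> Arr (eC ?T)" "Dom (eC ?T) ?i = fst ?N" "Cod (eC ?T) ?i = fst ?N"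
    using f S A by simp_all
  have g: "NCmp (id_nat (e1P f \<circ>\<^sub>F cForget (H_0 ?S))) (FObj (cFree (H_0 ?S)) A) = ?i"
    using calgebra_alg_val[OF S(1), of "eFree ?S A"] S f A by simp
  have "NCmp (a1lam (PsiE_1 (H_1 f))) A =
      NCmp (aEps (PsiE_0 (H_0 ?T))) (FObj (cbar (H_1 f)) (FObj (cFree (H_0 ?S)) A)) \<cdot>\<^bsub>CAlg (H_0 ?T)\<^esub>
      FArr (cFree (H_0 ?T)) ?i \<cdot>\<^bsub>CAlg (H_0 ?T)\<^esub> FArr (cFree (H_0 ?T)) ?p"
    using f S A by (simp add: PsiE_1_def mate_def e g del: cFree_simps(3,4) cbar_simps(3))
  also have "FObj (cbar (H_1 f)) (FObj (cFree (H_0 ?S)) A) = FObj ?I ?N"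
    using cbar_obj_alg_val[OF f, of "eFree ?S A"] calgebra_alg_val[OF S(1), of "eFree ?S A"] f S A by (simp add: cFree_alg_iso(1) del: cFree_simps(3))
  also have "NCmp (aEps (PsiE_0 (H_0 ?T))) (FObj ?I ?N) = FArr ?I ?e" by (rule cEps_alg_iso[OF S(2) N])
  also have "FArr ?I ?e \<cdot>\<^bsub>CAlg (H_0 ?T)\<^esub> FArr (cFree (H_0 ?T)) ?i \<cdot>\<^bsub>CAlg (H_0 ?T)\<^esub> FArr (cFree (H_0 ?T)) ?p =
      FArr ?I (?e \<cdot>\<^bsub>EAlg ?T\<^esub> FArr ?L' ?i \<cdot>\<^bsub>EAlg ?T\<^esub> FArr ?L' ?p)"
    using S a b by (simp add: cFree_eq del: F_0_simps(4,5,11) EAlg_simps(2-6) alg_iso_simps(4))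
  also have "?e \<cdot>\<^bsub>EAlg ?T\<^esub> FArr ?L' ?i \<cdot>\<^bsub>EAlg ?T\<^esub> FArr ?L' ?p = NCmp (a1lam (F_1 (Psi_1 f))) A"
    using mate_F_1[OF U A'] f S A by (simp del: F_0_simps(4,5,11) EAlg_simps(2-6) F_1_simps(8))
  also have "FArr ?I (NCmp (a1lam (F_1 (Psi_1 f))) A) = NCmp (?I \<star>\<^sub>l a1lam (F_1 (Psi_1 f))) A"
    using f S A by simp
  finally show "NCmp (a1lam (PsiE_1 (H_1 f))) A = NCmp (?I \<star>\<^sub>l a1lam (F_1 (Psi_1 f))) A" .
qed

lemma F_1_Psi:
  assumes f: "emonad_1cell f" and k: "calg_coding k l" and m: "matching i j k l"
  shows "F_1 (F1 (Psi i j) f) = F1 (PsiE k l) (H_1 f)"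
proof (rule adjn1.equality)
  have S: "extensive_monad (e1s f)" "extensive_monad (e1t f)" using f by simp_all
  note s = matching_iso[OF S(1) k m] and t = matching_iso[OF S(2) k m]
  have c: "ucoding (i (e1s f)) (j (e1s f)) (u1s (Psi_1 f))" "ucoding (i (e1t f)) (j (e1t f)) (u1t (Psi_1 f))"
    using s(1) t(1) by simp_all
  show "a1s (F_1 (F1 (Psi i j) f)) = a1s (F1 (PsiE k l) (H_1 f))" "a1t (F_1 (F1 (Psi i j) f)) = a1t (F1 (PsiE k l) (H_1 f))"
    using F_0_Psi[OF S(1) k m] F_0_Psi[OF S(2) k m] by (simp_all add: PsiE_def PsiE_enc1_def PsiE_1_def Let_def)
  show "a1J (F_1 (F1 (Psi i j) f)) = a1J (F1 (PsiE k l) (H_1 f))"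
    by (simp add: PsiE_def PsiE_enc1_def PsiE_1_def Let_def)
  let ?D = "dec (i (e1s f)) (j (e1s f)) (EAlg (e1s f))" and ?E' = "enc (k (H_0 (e1t f))) (l (H_0 (e1t f))) (CAlg (H_0 (e1t f)))"
  have V: "alg_iso (e1t f) \<circ>\<^sub>F ehat f \<circ>\<^sub>F ?D = cbar (H_1 f) \<circ>\<^sub>F alg_iso (e1s f) \<circ>\<^sub>F ?D"
    using comp_functor_extend[OF cbar_alg_iso[OF f], of ?D] S s(1) by simp
  show "a1V (F_1 (F1 (Psi i j) f)) = a1V (F1 (PsiE k l) (H_1 f))"
    using f S s(1) t(1) by (simp add: PsiE_def PsiE_enc1_def PsiE_1_def Let_def t(3) s(4)[symmetric] V)
  show "a1rho (F_1 (F1 (Psi i j) f)) = a1rho (F1 (PsiE k l) (H_1 f))"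
  proof -
    have "id_nat (e1P f \<circ>\<^sub>F eForget (e1s f)) \<star>\<^sub>r ?D = id_nat (e1P f \<circ>\<^sub>F cForget (H_0 (e1s f))) \<star>\<^sub>r (alg_iso (e1s f) \<circ>\<^sub>F ?D)"
      by (rule ntrans_eqI'[where A = "Obj (FDom ?D)"])
        (use f S s(1) in \<open>simp_all add: cForget_alg_iso whisker_right_def\<close>)
    then show ?thesis using S s(1) by (simp add: PsiE_def PsiE_enc1_def PsiE_1_def Let_def s(4)[symmetric])
  qed
  show "a1lam (F_1 (F1 (Psi i j) f)) = a1lam (F1 (PsiE k l) (H_1 f))"
  proof -
    have "(?E' \<circ>\<^sub>F alg_iso (e1t f)) \<star>\<^sub>l a1lam (F_1 (Psi_1 f)) = ?E' \<star>\<^sub>l (alg_iso (e1t f) \<star>\<^sub>l a1lam (F_1 (Psi_1 f)))"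
      using f S adjn_1cell_simps(13)[OF adjn_1cell_F_1, of "Psi_1 f"] by (intro whisker_left_comp) simp_all
    then show ?thesis
      using a1lam_F_1_rename[OF uarr_1cell_Psi_1[OF f] c] mate_PsiE[OF f]
      by (simp add: PsiE_def PsiE_enc1_def PsiE_1_def Let_def t(3))
  qed
qed simp

text \<open>
  With matching codes the isomorphism between extensive and classical algebras becomes an
  identity of renamed categories, and the square commutes on the nose.
\<close>

lemma FPsi_eq_PsiEH:
  fixes k :: "('o, 'm) cmonad \<Rightarrow> ('o, 'm) calg \<Rightarrow> 'x" and l :: "('o, 'm) cmonad \<Rightarrow> ('o, 'm) calg_arr \<Rightarrow> 'y"
  assumes k: "calg_coding k l" and m: "matching i j k l"
  shows "two_functor_eq EMnd (F_2f \<circ>\<^sub>2 Psi i j) (PsiE k l \<circ>\<^sub>2 H_2f)"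
  unfolding two_functor_eq_def
proof (intro conjI ballI)
  show "F0 (F_2f \<circ>\<^sub>2 Psi i j) S = F0 (PsiE k l \<circ>\<^sub>2 H_2f) S" if "S \<in> Cell0 EMnd" for S
    using F_0_Psi[OF _ k m, of S] that by (simp del: Psi_simps)
  show "F1 (F_2f \<circ>\<^sub>2 Psi i j) f = F1 (PsiE k l \<circ>\<^sub>2 H_2f) f" if "f \<in> Cell1 EMnd" for f
    using F_1_Psi[OF _ k m, of f] that by (simp del: Psi_simps)
  fix \<theta> :: "('o, 'm) emonad2" assume "\<theta> \<in> Cell2 EMnd"
  then have t: "emonad_2cell \<theta>" by simp
  let ?f = "e2s \<theta>" and ?g = "e2t \<theta>"
  let ?S = "e1s ?f" and ?T = "e1t ?f"
  have fg: "emonad_1cell ?f" "emonad_1cell ?g" "e1s ?g = ?S" "e1t ?g = ?T" using t by simp_all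
  have S: "extensive_monad ?S" "extensive_monad ?T" using fg by simp_all
  note s = matching_iso[OF S(1) k m] and tt = matching_iso[OF S(2) k m]
  note F = F_1_Psi[OF fg(1) k m] F_1_Psi[OF fg(2) k m]
  let ?D = "dec (i ?S) (j ?S) (EAlg ?S)" and ?E' = "enc (k (H_0 ?T)) (l (H_0 ?T)) (CAlg (H_0 ?T))"
  have U: "uarr_2cell (Psi_2 \<theta>)" using t by simp
  have V: "?E' \<circ>\<^sub>F cbar (H_1 h) \<circ>\<^sub>F alg_iso ?S \<circ>\<^sub>F ?D = ?E' \<circ>\<^sub>F alg_iso ?T \<circ>\<^sub>F ehat h \<circ>\<^sub>F ?D"
    if h: "emonad_1cell h" "e1s h = ?S" "e1t h = ?T" for h
    using comp_functor_extend[OF cbar_alg_iso[OF h(1)], of ?D] S s(1) h by simp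
  have "a2b (F2 (F_2f \<circ>\<^sub>2 Psi i j) \<theta>) = a2b (F2 (PsiE k l \<circ>\<^sub>2 H_2f) \<theta>)"
  proof (rule ntrans_eqI'[where A = "Obj (FDom ?D)"])
    show "NSrc (a2b (F2 (F_2f \<circ>\<^sub>2 Psi i j) \<theta>)) = NSrc (a2b (F2 (PsiE k l \<circ>\<^sub>2 H_2f) \<theta>))"
      using t fg S s(1) tt(1) V[OF fg(1)]
      by (simp add: F2_Psi[OF t refl refl] PsiE_def PsiE_2_def Let_def tt(3) s(4)[symmetric])
    show "NTrg (a2b (F2 (F_2f \<circ>\<^sub>2 Psi i j) \<theta>)) = NTrg (a2b (F2 (PsiE k l \<circ>\<^sub>2 H_2f) \<theta>))"
      using t fg S s(1) tt(1) V[OF fg(2-4)]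
      by (simp add: F2_Psi[OF t refl refl] PsiE_def PsiE_2_def Let_def tt(3) s(4)[symmetric])
    show "NCmp (a2b (F2 (F_2f \<circ>\<^sub>2 Psi i j) \<theta>)) \<in> extensional (Obj (FDom ?D))"
      "NCmp (a2b (F2 (PsiE k l \<circ>\<^sub>2 H_2f) \<theta>)) \<in> extensional (Obj (FDom ?D))"
      using t fg by (simp_all add: F2_Psi[OF t refl refl] PsiE_def PsiE_2_def Let_def whisker_left_def s(2))
    fix X assume X: "X \<in> Obj (FDom ?D)"
    let ?N = "FObj ?D X"
    have N: "ealgebra ?S ?N" using X s(1) by simp
    have h: "NCmp (u2b (Psi_2 \<theta>)) ?N \<in> Arr (EAlg ?T)"
      using U N fg by (intro NCmp_simps) (simp_all del: Psi_2_simps(6))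
    have "NCmp (a2b (F2 (F_2f \<circ>\<^sub>2 Psi i j) \<theta>)) X = FArr ?E' (FArr (alg_iso ?T) (NCmp (u2b (Psi_2 \<theta>)) ?N))"
      using t fg X N h s(1) tt(1) by (simp add: F2_Psi[OF t refl refl] tt(3) del: EAlg_simps(2) alg_iso_simps(4) Psi_2_simps(6))
    also have "FArr (alg_iso ?T) (NCmp (u2b (Psi_2 \<theta>)) ?N) =
        (cbar_obj (H_1 ?f) (alg_val ?S ?N), NCmp (e2a \<theta>) (fst ?N), cbar_obj (H_1 ?g) (alg_val ?S ?N))"
      using h N fg cbar_obj_alg_val[OF fg(1) N] cbar_obj_alg_val[OF fg(2), of ?N] by (simp del: EAlg_simps(2))
    also have "FArr ?E' \<dots> = NCmp (a2b (F2 (PsiE k l \<circ>\<^sub>2 H_2f) \<theta>)) X"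
      using calgebra_alg_val[OF S(1) N] fg X N S s(1) by (simp add: PsiE_def PsiE_2_def Let_def s(4)[symmetric])
    finally show "NCmp (a2b (F2 (F_2f \<circ>\<^sub>2 Psi i j) \<theta>)) X = NCmp (a2b (F2 (PsiE k l \<circ>\<^sub>2 H_2f) \<theta>)) X" .
  qed
  then show "F2 (F_2f \<circ>\<^sub>2 Psi i j) \<theta> = F2 (PsiE k l \<circ>\<^sub>2 H_2f) \<theta>"
    using F fg by (intro adjn2.equality) (simp_all add: F2_Psi[OF t refl refl] PsiE_def PsiE_2_def Let_def)
qed

text \<open>Given codes of classical algebras are pulled back to matching codes of extensive algebras.\<close>

abbreviation match_obj where "match_obj i \<equiv> \<lambda>S N. i (H_0 S) (FObj (alg_iso S) N)"
abbreviation match_arr where "match_arr j \<equiv> \<lambda>S m. j (H_0 S) (FArr (alg_iso S) m)"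

lemma ealg_coding_match: "calg_coding k l \<Longrightarrow> ealg_coding (match_obj k) (match_arr l)"
  using matching_iso(1)[of _ k l "match_obj k" "match_arr l"] by (simp add: coding_def)

text \<open>
  By the choice of matching codes, recoding to them amounts to passing to classical algebras and
  using their codes. This realises the comparison 1-cells as images of recodings.
\<close>

lemma adjn_comparison_recode:
  fixes iX :: "('o, 'm) emonad \<Rightarrow> ('o, 'm) ealg \<Rightarrow> 'x" and iE :: "('o, 'm) cmonad \<Rightarrow> ('o, 'm) calg \<Rightarrow> 'x"
  assumes S: "extensive_monad S" and x: "ealg_coding iX jX" and k: "calg_coding iE jE"
    and m: "matching i j iE jE"
  shows "F_1 (recode (iX S) (jX S) (i S) (j S) (Psi_0 S)) = adjn_comparison iX jX iE jE S"
proof (rule adjn1.equality)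
  note mi = matching_iso[OF S k m]
  have c: "coding (iX S) (jX S) (EAlg S)" by (rule coding_EAlg[OF x S])
  let ?r = "recode (iX S) (jX S) (i S) (j S) (Psi_0 S)"
  have U: "uarr_1cell ?r" using S c mi(1) by simp
  have B: "F_0 (rename_uarr (i S) (j S) (Psi_0 S)) = F0 (PsiE iE jE) (H_0 S)" using F_0_Psi[OF S k m] by simp
  show "a1s (F_1 ?r) = a1s (adjn_comparison iX jX iE jE S)" "a1t (F_1 ?r) = a1t (adjn_comparison iX jX iE jE S)"
    "a1J (F_1 ?r) = a1J (adjn_comparison iX jX iE jE S)" "a1rho (F_1 ?r) = a1rho (adjn_comparison iX jX iE jE S)"
    using S B by (simp_all add: adjn_comparison_def Let_def)
  show "a1V (F_1 ?r) = a1V (adjn_comparison iX jX iE jE S)"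
    using S c by (simp add: adjn_comparison_def Let_def alg_iso_enc_def mi(3))
  have L: "aL (F_0 (rename_uarr (iX S) (jX S) (Psi_0 S))) = enc (iX S) (jX S) (EAlg S) \<circ>\<^sub>F aL (F_0 (Psi_0 S))"
    "aL (F_0 (rename_uarr (i S) (j S) (Psi_0 S))) = enc (i S) (j S) (EAlg S) \<circ>\<^sub>F aL (F_0 (Psi_0 S))"
    using S c mi(1) by (simp_all add: aL_F_0_rename)
  have "a1lam (F_1 ?r) = id_nat (aL (F_0 (rename_uarr (i S) (j S) (Psi_0 S))))"
  proof (rule ntrans_eqI)
    show "nat_trans (a1lam (F_1 ?r))" using U by simp
    let ?d = "id_nat (aL (F_0 (rename_uarr (i S) (j S) (Psi_0 S))))"
    show "NCmp (a1lam (F_1 ?r)) A = NCmp ?d A" if "A \<in> Obj (FDom (NSrc ?d))" for A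
      using that S c mi(1) FArr_Ide[of "enc (i S) (j S) (EAlg S)" "EAlg S" "eFree S A"] by (simp add: L)
  qed (use S c mi(1) in \<open>simp_all add: L\<close>)
  then show "a1lam (F_1 ?r) = a1lam (adjn_comparison iX jX iE jE S)" by (simp add: adjn_comparison_def Let_def B)
qed simp

lemma uarr_comparison_recode:
  fixes iX :: "('o, 'm) emonad \<Rightarrow> ('o, 'm) ealg \<Rightarrow> 'x" and iE :: "('o, 'm) cmonad \<Rightarrow> ('o, 'm) calg \<Rightarrow> 'x"
  assumes M: "classical_monad M" and x: "ealg_coding iX jX" and k: "calg_coding iE jE"
    and m: "matching i j iE jE"
  shows "recode (iX (K_0 M)) (jX (K_0 M)) (i (K_0 M)) (j (K_0 M)) (Psi_0 (K_0 M)) = uarr_comparison iX jX iE jE M"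
proof (rule uarr1.equality)
  have S: "extensive_monad (K_0 M)" using M by simp
  note mi = matching_iso[OF S k m]
  have c: "coding (iX (K_0 M)) (jX (K_0 M)) (EAlg (K_0 M))" by (rule coding_EAlg[OF x S])
  let ?U = "rename_uarr (i (K_0 M)) (j (K_0 M)) (Psi_0 (K_0 M))"
  have "G_0 (F_0 ?U) = G_0 (F0 (PsiE iE jE) M)" using F_0_Psi[OF S k m] M by simp
  then have B: "?U = G_0 (F0 (PsiE iE jE) M)" using S mi(1) by simp
  let ?r = "recode (iX (K_0 M)) (jX (K_0 M)) (i (K_0 M)) (j (K_0 M)) (Psi_0 (K_0 M))"
  show "u1s ?r = u1s (uarr_comparison iX jX iE jE M)" "u1t ?r = u1t (uarr_comparison iX jX iE jE M)"
    "u1J ?r = u1J (uarr_comparison iX jX iE jE M)" "u1rho ?r = u1rho (uarr_comparison iX jX iE jE M)"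
    using B by (simp_all add: uarr_comparison_def Let_def)
  show "u1V ?r = u1V (uarr_comparison iX jX iE jE M)"
    using S c by (simp add: uarr_comparison_def Let_def alg_iso_enc_def mi(3))
qed simp

theorem theorem7p2p2:
  fixes iX :: "('o, 'm) emonad \<Rightarrow> ('o, 'm) ealg \<Rightarrow> 'x"
    and jX :: "('o, 'm) emonad \<Rightarrow> ('o, 'm) ealg_arr \<Rightarrow> 'y"
    and iE :: "('o, 'm) cmonad \<Rightarrow> ('o, 'm) calg \<Rightarrow> 'x"
    and jE :: "('o, 'm) cmonad \<Rightarrow> ('o, 'm) calg_arr \<Rightarrow> 'y"
  assumes inj_ext: "\<forall>S \<in> Cell0 EMnd. inj_on (iX S) (Obj (EAlg S)) \<and> inj_on (jX S) (Arr (EAlg S))"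
    and inj_cl: "\<forall>M \<in> Cell0 MndE. inj_on (iE M) (Obj (CAlg M)) \<and> inj_on (jE M) (Arr (CAlg M))"
  shows
    \<comment> \<open>the horizontal sides\<close>
    "mutually_inverse (UArr :: (('o, 'm, 'x, 'y) uarr, _, _) two_category) AdjR F_2f G_2f \<and>
     mutually_inverse (EMnd :: (('o, 'm) emonad, _, _) two_category) MndE H_2f K_2f \<and>
     \<comment> \<open>the vertical sides\<close>
     two_functor (UArr :: (('o, 'm, 'x, 'y) uarr, _, _) two_category) EMnd Phi \<and>
     two_functor EMnd UArr (Psi iX jX) \<and>
     two_functor (AdjR :: (('o, 'm, 'x, 'y) adjn, _, _) two_category) MndE PhiE \<and>
     two_functor MndE AdjR (PsiE iE jE) \<and>
     two_adjunction UArr_id EMnd Phi (Psi iX jX) \<and>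
     two_adjunction AdjR_id MndE PhiE (PsiE iE jE) \<and>
     \<comment> \<open>serial commutativity\<close>
     two_functor_eq (UArr :: (('o, 'm, 'x, 'y) uarr, _, _) two_category)
       (H_2f \<circ>\<^sub>2 Phi) (PhiE \<circ>\<^sub>2 F_2f) \<and>
     two_functor_eq (AdjR :: (('o, 'm, 'x, 'y) adjn, _, _) two_category)
       (Phi \<circ>\<^sub>2 G_2f) (K_2f \<circ>\<^sub>2 PhiE) \<and>
     two_natural_iso EMnd AdjR (F_2f \<circ>\<^sub>2 Psi iX jX) (PsiE iE jE \<circ>\<^sub>2 H_2f)
       (adjn_comparison iX jX iE jE) \<and>
     two_natural_iso MndE UArr (Psi iX jX \<circ>\<^sub>2 K_2f) (G_2f \<circ>\<^sub>2 PsiE iE jE)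
       (uarr_comparison iX jX iE jE) \<and>
     \<comment> \<open>equality when corresponding algebras are identified\<close>
     ((\<forall>S \<in> Cell0 EMnd.
         (\<forall>N \<in> Obj (EAlg S). iX S N = iE (H_0 S) (FObj (alg_iso S) N)) \<and>
         (\<forall>m \<in> Arr (EAlg S). jX S m = jE (H_0 S) (FArr (alg_iso S) m))) \<longrightarrow>
       two_functor_eq EMnd (F_2f \<circ>\<^sub>2 Psi iX jX) (PsiE iE jE \<circ>\<^sub>2 H_2f) \<and>
       two_functor_eq MndE (Psi iX jX \<circ>\<^sub>2 K_2f) (G_2f \<circ>\<^sub>2 PsiE iE jE))"
proof -
  \<comment> \<open>auxiliary codes of extensive algebras, for which the square of right-hand 2-functors commutes strictly\<close>
  let ?i = "match_obj iE" and ?j = "match_arr jE"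
  have m: "matching ?i ?j iE jE" by simp
  have c: "ealg_coding ?i ?j" by (rule ealg_coding_match[OF inj_cl])
  note FG = UArr_AdjR_inverse[where ?'a = 'o and ?'b = 'm and ?'c = 'x and ?'d = 'y] and HK = EMnd_MndE_inverse[where ?'a = 'o and ?'b = 'm]
  note Phi = square_conjugate[OF FG HK two_functor_Phi HPhi_eq_PhiEF]
  note Psi = square_conjugate[OF HK FG two_functor_Psi FPsi_eq_PsiEH[OF inj_cl]]
  note Psi' = Psi[OF c m]
  \<comment> \<open>\<open>\<Phi>\<^sub>E = H \<Phi> G\<close> and \<open>\<Psi>\<^sub>E = F \<Psi> K\<close>, with \<open>\<Psi>\<close> formed by the matching codes\<close>
  have adj: "two_adjunction AdjR_id MndE PhiE (PsiE iE jE)"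
    by (rule two_adjunction_cong[OF two_adjunction_transport[OF two_adjunction_Phi_Psi[OF c] UArr_AdjR_id_inverse HK]])
      (use two_functor_eq_restrict[OF Phi(1)] Psi'(1) in \<open>simp_all add: AdjR_id_def\<close>)
  note FGD = FG[unfolded mutually_inverse_def] and HKD = HK[unfolded mutually_inverse_def]
  have refl: "two_functor_eq K T T" for K :: "('a, 'b, 'c) two_category" and T :: "('a, 'b, 'c, 'd, 'e, 'f) two_fctr"
    by (simp add: two_functor_eq_def)
  note rc = Psi_recode[OF inj_ext c]
  have n1: "two_natural_iso EMnd AdjR (F_2f \<circ>\<^sub>2 Psi iX jX) (PsiE iE jE \<circ>\<^sub>2 H_2f) (adjn_comparison iX jX iE jE)"
  proof (rule two_natural_iso_cong[OF two_natural_iso_whisker_left[OF rc]])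
    show "F1 F_2f (recode (iX S) (jX S) (?i S) (?j S) (Psi_0 S)) = adjn_comparison iX jX iE jE S"
      if "S \<in> Cell0 EMnd" for S
      using adjn_comparison_recode[OF _ inj_ext inj_cl m, of S] that by simp
  qed (use FGD FPsi_eq_PsiEH[OF inj_cl m] refl in blast)+
  have n2: "two_natural_iso MndE UArr (Psi iX jX \<circ>\<^sub>2 K_2f) (G_2f \<circ>\<^sub>2 PsiE iE jE) (uarr_comparison iX jX iE jE)"
  proof (rule two_natural_iso_cong[OF two_natural_iso_whisker_right[OF rc]])
    show "recode (iX (F0 K_2f M)) (jX (F0 K_2f M)) (?i (F0 K_2f M)) (?j (F0 K_2f M)) (Psi_0 (F0 K_2f M)) = uarr_comparison iX jX iE jE M"
      if "M \<in> Cell0 MndE" for M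
      using uarr_comparison_recode[OF _ inj_ext inj_cl m, of M] that by simp
  qed (use HKD Psi'(2) refl in blast)+
  show ?thesis
    using FG HK two_functor_Phi two_functor_Psi[OF inj_ext] Phi(3) Psi'(3) two_adjunction_Phi_Psi[OF inj_ext] adj
      HPhi_eq_PhiEF Phi(2) n1 n2 FPsi_eq_PsiEH[OF inj_cl] Psi(2)[OF inj_ext]
    by blast
qed

end
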